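(* Let $X$ be a smooth irreducible projective curve of genus $g>1$ over an algebraically closed field $k$, let $f:X\to\mathbb{P}^1$ be a surjective morphism over $k$ of degree $n$, and let $\mathcal{L}$ be a line bundle on $X$. (1) If $n$ is odd, then $s(\mathcal{L},f)\leq\frac{2g-5/2}{n}+\frac{5}{2}$, and in particular $s(\mathcal{L},f)\leq\frac{2}{3}g+\frac{5}{3}$. (2) If $n$ is even, then $s(\mathcal{L},f)\leq\frac{2g-2}{n}+\frac{5}{2}$. For $n=2$ this gives $s(\mathcal{L},f)\leq g+1$, and for $n$ even with $n\neq2$ it gives $s(\mathcal{L},f)\leq\frac{1}{2}g+2$. (3) Consequently, if $X$ is not hyperelliptic, or if $f$ is not the hyperelliptic map $X\to\mathbb{P}^1$ of degree $2$, then $s(\mathcal{L},f)\leq\frac{2}{3}g+\frac{5}{3}$ holds for all $n$.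
   Context: By Grothendieck's splitting theorem, the rank $n$ vector bundle $f_*\mathcal{L}$ on $\mathbb{P}^1$ decomposes as $f_*\mathcal{L}\cong\bigoplus_{j=1}^n\mathcal{O}(n_j)$ with integers $n_j$ unique up to permutation, where $\mathcal{O}(m)$ is the line bundle of degree $m$ on $\mathbb{P}^1$. Define $s(\mathcal{L},f)=\max_{1\leq j,j'\leq n}|n_j-n_{j'}|$. A curve $X$ of genus $g>1$ is hyperelliptic if it admits a degree $2$ morphism to $\mathbb{P}^1$; such a morphism is called a hyperelliptic map. *)

theory Defs
  imports
    "HOL-Analysis.Abstract_Topology"
    "HOL-Library.Poly_Mapping"
    "HOL-Library.Numeral_Type"
    "HOL-Library.Extended_Nat"
    "HOL-Computational_Algebra.Polynomial"
    "HOL-Algebra.Module"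
    "HOL-Algebra.QuotRing"
    "HOL-Algebra.Ideal_Product"
    "HOL-Algebra.Embedded_Algebras"
begin

section \<open>Projective space and the Zariski topology\<close>

text \<open>
  A point of the projective space with homogeneous coordinates indexed by the finite type
  \<open>'n\<close> (hence of dimension \<open>CARD('n) - 1\<close>) is the set of all its coordinate vectors, i.e. a line
  through the origin without the origin. In particular, for a set \<open>U\<close> of points, \<open>\<Union>U\<close> is
  the (punctured) affine cone over \<open>U\<close>. Varieties over the algebraically closed field \<open>'k\<close> are
  identified with their sets of \<open>'k\<close>-points.
\<close>

type_synonym ('n, 'k) vec = "'n \<Rightarrow> 'k"
type_synonym ('n, 'k) pt = "('n \<Rightarrow> 'k) set"
type_synonym ('n, 'k) mpoly = "('n \<Rightarrow>\<^sub>0 nat) \<Rightarrow>\<^sub>0 'k"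

definition proj_point :: "('n, 'k::field) vec \<Rightarrow> ('n, 'k) pt" where
  "proj_point x = {(\<lambda>i. c * x i) | c. c \<noteq> 0}"

definition proj_space :: "('n, 'k::field) pt set" where
  "proj_space = {proj_point x | x. x \<noteq> (\<lambda>_. 0)}"

abbreviation proj_line :: "(2, 'k::field) pt set" where
  "proj_line \<equiv> proj_space"

definition poly_eval :: "('n::finite, 'k::field) mpoly \<Rightarrow> ('n, 'k) vec \<Rightarrow> 'k" where
  "poly_eval F x =
     (\<Sum>m\<in>Poly_Mapping.keys F. Poly_Mapping.lookup F m * (\<Prod>i\<in>UNIV. x i ^ Poly_Mapping.lookup m i))"

definition homogeneous :: "nat \<Rightarrow> ('n::finite, 'k::field) mpoly \<Rightarrow> bool" where
  "homogeneous e F \<longleftrightarrow>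
     (\<forall>m\<in>Poly_Mapping.keys F. (\<Sum>i\<in>UNIV. Poly_Mapping.lookup m i) = e)"

text \<open>The coarsest topology in which the zero loci of homogeneous polynomials are closed.\<close>

definition zariski :: "('n::finite, 'k::field) pt topology" where
  "zariski = topology_generated_by
     {{p \<in> proj_space. \<forall>x\<in>p. poly_eval F x \<noteq> 0} | F e. homogeneous e F}"

abbreviation zar :: "('n::finite, 'k::field) pt set \<Rightarrow> ('n, 'k) pt topology" where
  "zar X \<equiv> subtopology zariski X"

definition irreducible_space :: "'a topology \<Rightarrow> bool" where
  "irreducible_space T \<longleftrightarrow> topspace T \<noteq> {} \<and>
     (\<forall>A B. closedin T A \<and> closedin T B \<and> topspace T = A \<union> B \<longrightarrow> topspace T = A \<or> topspace T = B)"

definition krull_dim :: "'a topology \<Rightarrow> enat" where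
  "krull_dim T = Sup {enat r | r. \<exists>Z :: nat \<Rightarrow> 'a set.
     (\<forall>i\<le>r. closedin T (Z i) \<and> irreducible_space (subtopology T (Z i))) \<and>
     (\<forall>i<r. Z i \<subset> Z (Suc i))}"


section \<open>Regular functions, germs, local rings and the function field\<close>

text \<open>
  Functions on an open subset \<open>U\<close> are represented by total functions vanishing outside \<open>U\<close>.
\<close>

definition restr_fun :: "'p set \<Rightarrow> ('p \<Rightarrow> 'k::zero) \<Rightarrow> 'p \<Rightarrow> 'k" where
  "restr_fun U \<phi> = (\<lambda>p. if p \<in> U then \<phi> p else 0)"

definition regular ::
    "('n::finite, 'k::field) pt set \<Rightarrow> ('n, 'k) pt set \<Rightarrow> (('n, 'k) pt \<Rightarrow> 'k) set" where
  "regular X U = {\<phi>. (\<forall>p. p \<notin> U \<longrightarrow> \<phi> p = 0) \<and>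
     (\<forall>p\<in>U. \<exists>V e G H. openin (zar X) V \<and> p \<in> V \<and> V \<subseteq> U \<and> homogeneous e G \<and> homogeneous e H \<and>
        (\<forall>q\<in>V. \<forall>x\<in>q. poly_eval H x \<noteq> 0 \<and> \<phi> q = poly_eval G x / poly_eval H x))}"

text \<open>
  The direct limit of the rings \<open>regular X U\<close> over the sets \<open>U\<close> of a family \<open>B\<close> of open sets that is
  closed under intersection.
\<close>

definition germ ::
    "('n::finite, 'k::field) pt set \<Rightarrow> ('n, 'k) pt set set \<Rightarrow> ('n, 'k) pt set \<Rightarrow> (('n, 'k) pt \<Rightarrow> 'k)
     \<Rightarrow> (('n, 'k) pt set \<times> (('n, 'k) pt \<Rightarrow> 'k)) set" where
  "germ X B U \<phi> = {(V, \<psi>). V \<in> B \<and> \<psi> \<in> regular X V \<and>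
     (\<exists>W\<in>B. W \<subseteq> U \<inter> V \<and> (\<forall>p\<in>W. \<phi> p = \<psi> p))}"

definition germ_ring ::
    "('n::finite, 'k::field) pt set \<Rightarrow> ('n, 'k) pt set set
     \<Rightarrow> (('n, 'k) pt set \<times> (('n, 'k) pt \<Rightarrow> 'k)) set ring" where
  "germ_ring X B =
     \<lparr> carrier = {germ X B U \<phi> | U \<phi>. U \<in> B \<and> \<phi> \<in> regular X U},
       mult = (\<lambda>a b. \<Union>(U, \<phi>)\<in>a. \<Union>(V, \<psi>)\<in>b. germ X B (U \<inter> V) (\<lambda>p. \<phi> p * \<psi> p)),
       one = germ X B X (restr_fun X (\<lambda>_. 1)),
       zero = germ X B X (\<lambda>_. 0),
       add = (\<lambda>a b. \<Union>(U, \<phi>)\<in>a. \<Union>(V, \<psi>)\<in>b. germ X B (U \<inter> V) (restr_fun (U \<inter> V) (\<lambda>p. \<phi> p + \<psi> p))) \<rparr>"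

definition const_germs ::
    "('n::finite, 'k::field) pt set \<Rightarrow> ('n, 'k) pt set set
     \<Rightarrow> (('n, 'k) pt set \<times> (('n, 'k) pt \<Rightarrow> 'k)) set set" where
  "const_germs X B = {germ X B X (restr_fun X (\<lambda>_. c)) | c. True}"

definition nbhds_of :: "('n::finite, 'k::field) pt set \<Rightarrow> ('n, 'k) pt \<Rightarrow> ('n, 'k) pt set set" where
  "nbhds_of X P = {U. openin (zar X) U \<and> P \<in> U}"

abbreviation local_ring where
  "local_ring X P \<equiv> germ_ring X (nbhds_of X P)"

definition max_ideal ::
    "('n::finite, 'k::field) pt set \<Rightarrow> ('n, 'k) pt
     \<Rightarrow> (('n, 'k) pt set \<times> (('n, 'k) pt \<Rightarrow> 'k)) set set" where
  "max_ideal X P =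
     {germ X (nbhds_of X P) U \<phi> | U \<phi>. U \<in> nbhds_of X P \<and> \<phi> \<in> regular X U \<and> \<phi> P = 0}"

text \<open>
  \<open>cotangent_dim X P e\<close>: the Zariski cotangent space \<open>m / m\<^sup>2\<close>, formed inside the \<open>k\<close>-algebra
  \<open>O\<^sub>P / m\<^sup>2\<close>, has dimension \<open>e\<close> over \<open>k\<close>.
\<close>

definition cotangent_dim ::
    "('n::finite, 'k::field) pt set \<Rightarrow> ('n, 'k) pt \<Rightarrow> nat \<Rightarrow> bool" where
  "cotangent_dim X P e \<longleftrightarrow>
     (let R = local_ring X P;
          m = max_ideal X P;
          m2 = ideal_prod R m m
      in ring.dimension (R Quot m2) e
           ((\<lambda>a. a_r_coset R m2 a) ` const_germs X (nbhds_of X P))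
           ((\<lambda>a. a_r_coset R m2 a) ` m))"

definition smooth :: "('n::finite, 'k::field) pt set \<Rightarrow> bool" where
  "smooth X \<longleftrightarrow> (\<forall>P\<in>X. \<exists>e. krull_dim (zar X) = enat e \<and> cotangent_dim X P e)"

definition smooth_projective_curve :: "('n::finite, 'k::alg_closed_field) pt set \<Rightarrow> bool" where
  "smooth_projective_curve X \<longleftrightarrow>
     closedin zariski X \<and> irreducible_space (zar X) \<and> krull_dim (zar X) = 1 \<and> smooth X"

definition nonempty_opens :: "('n::finite, 'k::field) pt set \<Rightarrow> ('n, 'k) pt set set" where
  "nonempty_opens X = {U. openin (zar X) U \<and> U \<noteq> {}}"

abbreviation function_field where
  "function_field X \<equiv> germ_ring X (nonempty_opens X)"


section \<open>The genus\<close>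

text \<open>
  The genus is the dimension of the Cech cohomology \<open>H\<^sup>1(X, O\<^sub>X)\<close>, the direct limit over
  all open covers. It suffices to use covers \<open>(C P)\<close> indexed by the points with \<open>P \<in> C P\<close>,
  which are cofinal, and refinements \<open>D P \<subseteq> C P\<close>.
\<close>

definition point_cover ::
    "('n::finite, 'k::field) pt set \<Rightarrow> (('n, 'k) pt \<Rightarrow> ('n, 'k) pt set) \<Rightarrow> bool" where
  "point_cover X C \<longleftrightarrow> (\<forall>P\<in>X. openin (zar X) (C P) \<and> P \<in> C P)"

definition cech_cocycle ::
    "('n::finite, 'k::field) pt set \<Rightarrow> (('n, 'k) pt \<Rightarrow> ('n, 'k) pt set)
     \<Rightarrow> (('n, 'k) pt \<Rightarrow> ('n, 'k) pt \<Rightarrow> ('n, 'k) pt \<Rightarrow> 'k) \<Rightarrow> bool" where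
  "cech_cocycle X C c \<longleftrightarrow>
     (\<forall>P\<in>X. \<forall>Q\<in>X. c P Q \<in> regular X (C P \<inter> C Q)) \<and>
     (\<forall>P\<in>X. \<forall>Q\<in>X. \<forall>R\<in>X. \<forall>p \<in> C P \<inter> C Q \<inter> C R. c P Q p + c Q R p = c P R p)"

definition cech_trivial ::
    "('n::finite, 'k::field) pt set \<Rightarrow> (('n, 'k) pt \<Rightarrow> ('n, 'k) pt set)
     \<Rightarrow> (('n, 'k) pt \<Rightarrow> ('n, 'k) pt \<Rightarrow> ('n, 'k) pt \<Rightarrow> 'k) \<Rightarrow> bool" where
  "cech_trivial X C c \<longleftrightarrow>
     (\<exists>D h. point_cover X D \<and> (\<forall>P\<in>X. D P \<subseteq> C P \<and> h P \<in> regular X (D P)) \<and>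
        (\<forall>P\<in>X. \<forall>Q\<in>X. \<forall>p \<in> D P \<inter> D Q. c P Q p = h Q p - h P p))"

text \<open>
  Finitely many classes in the direct limit are represented by cocycles on a common cover.
\<close>

definition h1_independent_classes :: "('n::finite, 'k::field) pt set \<Rightarrow> nat \<Rightarrow> bool" where
  "h1_independent_classes X r \<longleftrightarrow>
     (\<exists>C c. point_cover X C \<and> (\<forall>i<r. cech_cocycle X C (c i)) \<and>
        (\<forall>a :: nat \<Rightarrow> 'k. cech_trivial X C (\<lambda>P Q p. \<Sum>i<r. a i * c i P Q p) \<longrightarrow> (\<forall>i<r. a i = 0)))"

definition has_genus :: "('n::finite, 'k::field) pt set \<Rightarrow> nat \<Rightarrow> bool" where
  "has_genus X g \<longleftrightarrow> h1_independent_classes X g \<and> \<not> h1_independent_classes X (Suc g)"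


section \<open>Morphisms\<close>

definition pullback_fun ::
    "('n, 'k) pt set \<Rightarrow> (('n, 'k) pt \<Rightarrow> ('m, 'k) pt) \<Rightarrow> ('m, 'k) pt set
     \<Rightarrow> (('m, 'k) pt \<Rightarrow> 'k) \<Rightarrow> ('n, 'k::field) pt \<Rightarrow> 'k" where
  "pullback_fun X f V \<phi> = restr_fun (X \<inter> f -` V) (\<lambda>p. \<phi> (f p))"

definition is_morphism ::
    "('n::finite, 'k::field) pt set \<Rightarrow> ('m::finite, 'k) pt set \<Rightarrow> (('n, 'k) pt \<Rightarrow> ('m, 'k) pt) \<Rightarrow> bool"
  where
  "is_morphism X Y f \<longleftrightarrow> continuous_map (zar X) (zar Y) f \<and>
     (\<forall>V. openin (zar Y) V \<longrightarrow>
        (\<forall>\<phi>\<in>regular Y V. pullback_fun X f V \<phi> \<in> regular X (X \<inter> f -` V)))"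

definition surjective_morphism ::
    "('n::finite, 'k::field) pt set \<Rightarrow> ('m::finite, 'k) pt set \<Rightarrow> (('n, 'k) pt \<Rightarrow> ('m, 'k) pt) \<Rightarrow> bool"
  where
  "surjective_morphism X Y f \<longleftrightarrow> is_morphism X Y f \<and> f ` X = Y"

definition pullback_field ::
    "('n::finite, 'k::field) pt set \<Rightarrow> ('m::finite, 'k) pt set \<Rightarrow> (('n, 'k) pt \<Rightarrow> ('m, 'k) pt)
     \<Rightarrow> (('n, 'k) pt set \<times> (('n, 'k) pt \<Rightarrow> 'k)) set set" where
  "pullback_field X Y f =
     {germ X (nonempty_opens X) (X \<inter> f -` V) (pullback_fun X f V \<phi>) | V \<phi>.
        V \<in> nonempty_opens Y \<and> \<phi> \<in> regular Y V}"

definition has_degree ::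
    "('n::finite, 'k::field) pt set \<Rightarrow> ('m::finite, 'k) pt set \<Rightarrow> (('n, 'k) pt \<Rightarrow> ('m, 'k) pt)
     \<Rightarrow> nat \<Rightarrow> bool" where
  "has_degree X Y f n \<longleftrightarrow>
     ring.dimension (function_field X) n (pullback_field X Y f) (carrier (function_field X))"

definition hyperelliptic_map ::
    "('n::finite, 'k::field) pt set \<Rightarrow> (('n, 'k) pt \<Rightarrow> (2, 'k) pt) \<Rightarrow> bool" where
  "hyperelliptic_map X f \<longleftrightarrow>
     surjective_morphism X proj_line f \<and> has_degree X proj_line f 2"

definition hyperelliptic :: "('n::finite, 'k::field) pt set \<Rightarrow> bool" where
  "hyperelliptic X \<longleftrightarrow> (\<exists>f. hyperelliptic_map X f)"


section \<open>Sheaves of modules and line bundles\<close>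

definition regular_ring ::
    "('n::finite, 'k::field) pt set \<Rightarrow> ('n, 'k) pt set \<Rightarrow> (('n, 'k) pt \<Rightarrow> 'k) ring" where
  "regular_ring X U =
     \<lparr> carrier = regular X U, mult = (\<lambda>\<phi> \<psi> p. \<phi> p * \<psi> p), one = restr_fun U (\<lambda>_. 1),
       zero = (\<lambda>_. 0), add = (\<lambda>\<phi> \<psi> p. \<phi> p + \<psi> p) \<rparr>"

text \<open>
  Only the additive structure and \<open>smult\<close> of the records \<open>sections F U\<close> are relevant (see the
  locale \<open>module\<close>); the fields \<open>mult\<close> and \<open>one\<close> are inherited from \<open>ring\<close> and carry no meaning.
\<close>

record ('p, 'a, 's) mod_sheaf =
  sections :: "'p set \<Rightarrow> ('a, 's) module"
  restr :: "'p set \<Rightarrow> 'p set \<Rightarrow> 's \<Rightarrow> 's"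

type_synonym ('n, 'k, 's) sheaf = "(('n, 'k) pt, ('n, 'k) pt \<Rightarrow> 'k, 's) mod_sheaf"

definition sheaf_of_modules ::
    "('n::finite, 'k::field) pt set \<Rightarrow> ('n, 'k, 's) sheaf \<Rightarrow> bool" where
  "sheaf_of_modules X F \<longleftrightarrow>
     (\<forall>U. openin (zar X) U \<longrightarrow> Module.module (regular_ring X U) (sections F U)) \<and>
     (\<forall>U V. openin (zar X) U \<and> openin (zar X) V \<and> V \<subseteq> U \<longrightarrow>
        (\<forall>s\<in>carrier (sections F U). restr F U V s \<in> carrier (sections F V)) \<and>
        (\<forall>s\<in>carrier (sections F U). \<forall>t\<in>carrier (sections F U).
           restr F U V (s \<oplus>\<^bsub>sections F U\<^esub> t) = restr F U V s \<oplus>\<^bsub>sections F V\<^esub> restr F U V t) \<and>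
        (\<forall>a\<in>regular X U. \<forall>s\<in>carrier (sections F U).
           restr F U V (a \<odot>\<^bsub>sections F U\<^esub> s) = restr_fun V a \<odot>\<^bsub>sections F V\<^esub> restr F U V s)) \<and>
     (\<forall>U. openin (zar X) U \<longrightarrow> (\<forall>s\<in>carrier (sections F U). restr F U U s = s)) \<and>
     (\<forall>U V W. openin (zar X) U \<and> openin (zar X) V \<and> openin (zar X) W \<and> W \<subseteq> V \<and> V \<subseteq> U \<longrightarrow>
        (\<forall>s\<in>carrier (sections F U). restr F V W (restr F U V s) = restr F U W s)) \<and>
     (\<forall>\<U> s. (\<forall>V\<in>\<U>. openin (zar X) V \<and> s V \<in> carrier (sections F V)) \<and>
        (\<forall>V\<in>\<U>. \<forall>W\<in>\<U>. restr F V (V \<inter> W) (s V) = restr F W (V \<inter> W) (s W)) \<longrightarrow>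
        (\<exists>!t. t \<in> carrier (sections F (\<Union>\<U>)) \<and> (\<forall>V\<in>\<U>. restr F (\<Union>\<U>) V t = s V)))"

text \<open>Isomorphism of the restrictions of two sheaves of modules to the open subset \<open>W\<close>.\<close>

definition sheaf_iso_on ::
    "('n::finite, 'k::field) pt set \<Rightarrow> ('n, 'k) pt set \<Rightarrow> ('n, 'k, 's) sheaf \<Rightarrow> ('n, 'k, 't) sheaf
     \<Rightarrow> bool" where
  "sheaf_iso_on X W F G \<longleftrightarrow> (\<exists>\<theta> :: ('n, 'k) pt set \<Rightarrow> 's \<Rightarrow> 't.
     \<forall>U. openin (zar X) U \<and> U \<subseteq> W \<longrightarrow>
       bij_betw (\<theta> U) (carrier (sections F U)) (carrier (sections G U)) \<and>
       (\<forall>s\<in>carrier (sections F U). \<forall>t\<in>carrier (sections F U).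
          \<theta> U (s \<oplus>\<^bsub>sections F U\<^esub> t) = \<theta> U s \<oplus>\<^bsub>sections G U\<^esub> \<theta> U t) \<and>
       (\<forall>a\<in>regular X U. \<forall>s\<in>carrier (sections F U).
          \<theta> U (a \<odot>\<^bsub>sections F U\<^esub> s) = a \<odot>\<^bsub>sections G U\<^esub> \<theta> U s) \<and>
       (\<forall>V. openin (zar X) V \<and> V \<subseteq> U \<longrightarrow>
          (\<forall>s\<in>carrier (sections F U). \<theta> V (restr F U V s) = restr G U V (\<theta> U s))))"

definition sheaf_iso ::
    "('n::finite, 'k::field) pt set \<Rightarrow> ('n, 'k, 's) sheaf \<Rightarrow> ('n, 'k, 't) sheaf \<Rightarrow> bool" where
  "sheaf_iso X F G \<longleftrightarrow> sheaf_iso_on X X F G"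

definition structure_sheaf ::
    "('n::finite, 'k::field) pt set \<Rightarrow> ('n, 'k, ('n, 'k) pt \<Rightarrow> 'k) sheaf" where
  "structure_sheaf X =
     \<lparr> sections = (\<lambda>U. \<lparr> carrier = regular X U, mult = (\<lambda>\<phi> \<psi> p. \<phi> p * \<psi> p),
         one = restr_fun U (\<lambda>_. 1), zero = (\<lambda>_. 0), add = (\<lambda>\<phi> \<psi> p. \<phi> p + \<psi> p),
         smult = (\<lambda>\<phi> \<psi> p. \<phi> p * \<psi> p) \<rparr>),
       restr = (\<lambda>U V. restr_fun V) \<rparr>"

definition line_bundle :: "('n::finite, 'k::field) pt set \<Rightarrow> ('n, 'k, 's) sheaf \<Rightarrow> bool" where
  "line_bundle X F \<longleftrightarrow> sheaf_of_modules X F \<and>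
     (\<forall>P\<in>X. \<exists>W. openin (zar X) W \<and> P \<in> W \<and> sheaf_iso_on X W F (structure_sheaf X))"

definition direct_image ::
    "('n, 'k::field) pt set \<Rightarrow> (('n, 'k) pt \<Rightarrow> ('m, 'k) pt) \<Rightarrow> ('n, 'k, 's) sheaf
     \<Rightarrow> ('m, 'k, 's) sheaf" where
  "direct_image X f F =
     \<lparr> sections = (\<lambda>V. let M = sections F (X \<inter> f -` V) in
         \<lparr> carrier = carrier M, mult = mult M, one = one M, zero = zero M, add = add M,
           smult = (\<lambda>a s. pullback_fun X f V a \<odot>\<^bsub>M\<^esub> s) \<rparr>),
       restr = (\<lambda>U V. restr F (X \<inter> f -` U) (X \<inter> f -` V)) \<rparr>"

definition direct_sum :: "nat \<Rightarrow> (nat \<Rightarrow> ('p, 'a, 's) mod_sheaf) \<Rightarrow> ('p, 'a, nat \<Rightarrow> 's) mod_sheaf"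
  where
  "direct_sum n F =
     \<lparr> sections = (\<lambda>U. \<lparr> carrier = (\<Pi>\<^sub>E j\<in>{..<n}. carrier (sections (F j) U)),
         mult = (\<lambda>s t. \<lambda>j\<in>{..<n}. s j \<otimes>\<^bsub>sections (F j) U\<^esub> t j),
         one = (\<lambda>j\<in>{..<n}. \<one>\<^bsub>sections (F j) U\<^esub>),
         zero = (\<lambda>j\<in>{..<n}. \<zero>\<^bsub>sections (F j) U\<^esub>),
         add = (\<lambda>s t. \<lambda>j\<in>{..<n}. s j \<oplus>\<^bsub>sections (F j) U\<^esub> t j),
         smult = (\<lambda>a s. \<lambda>j\<in>{..<n}. a \<odot>\<^bsub>sections (F j) U\<^esub> s j) \<rparr>),
       restr = (\<lambda>U V s. \<lambda>j\<in>{..<n}. restr (F j) U V (s j)) \<rparr>"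

text \<open>
  The twisting sheaf \<open>O(d)\<close>: its sections over \<open>U\<close> are the functions on the cone over \<open>U\<close> that
  locally are quotients of homogeneous polynomials with degree difference \<open>d\<close>.
\<close>

definition twisted_sections ::
    "('n::finite, 'k::field) pt set \<Rightarrow> int \<Rightarrow> ('n, 'k) pt set \<Rightarrow> (('n, 'k) vec \<Rightarrow> 'k) set" where
  "twisted_sections X d U = {s. (\<forall>x. x \<notin> \<Union>U \<longrightarrow> s x = 0) \<and>
     (\<forall>p\<in>U. \<exists>V e e' G H. openin (zar X) V \<and> p \<in> V \<and> V \<subseteq> U \<and>
        homogeneous e G \<and> homogeneous e' H \<and> int e - int e' = d \<and>
        (\<forall>x\<in>\<Union>V. poly_eval H x \<noteq> 0 \<and> s x = poly_eval G x / poly_eval H x))}"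

definition twisting_sheaf ::
    "('n::finite, 'k::field) pt set \<Rightarrow> int \<Rightarrow> ('n, 'k, ('n, 'k) vec \<Rightarrow> 'k) sheaf" where
  "twisting_sheaf X d =
     \<lparr> sections = (\<lambda>U. \<lparr> carrier = twisted_sections X d U, mult = (\<lambda>s t x. s x * t x),
         one = restr_fun (\<Union>U) (\<lambda>_. 1), zero = (\<lambda>_. 0), add = (\<lambda>s t x. s x + t x),
         smult = (\<lambda>a s x. a (proj_point x) * s x) \<rparr>),
       restr = (\<lambda>U V. restr_fun (\<Union>V)) \<rparr>"


section \<open>The splitting type of the direct image\<close>

definition splitting_type ::
    "('n::finite, 'k::field) pt set \<Rightarrow> (('n, 'k) pt \<Rightarrow> (2, 'k) pt) \<Rightarrow> ('n, 'k, 's) sheaf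
     \<Rightarrow> nat \<Rightarrow> (nat \<Rightarrow> int) \<Rightarrow> bool" where
  "splitting_type X f L n d \<longleftrightarrow>
     sheaf_iso proj_line (direct_image X f L) (direct_sum n (\<lambda>j. twisting_sheaf proj_line (d j)))"

text \<open>
  The invariant \<open>s(L, f)\<close>, where \<open>n\<close> is the degree of \<open>f\<close>, i.e. the rank of the direct image.
  A splitting type exists by Grothendieck's theorem and is unique up to permutation, so the
  value does not depend on the choice made by \<open>SOME\<close>.
\<close>

definition s_invariant ::
    "('n::finite, 'k::field) pt set \<Rightarrow> (('n, 'k) pt \<Rightarrow> (2, 'k) pt) \<Rightarrow> ('n, 'k, 's) sheaf
     \<Rightarrow> nat \<Rightarrow> int" where
  "s_invariant X f L n =
     (let d = (SOME d. splitting_type X f L n d) in Max {\<bar>d i - d j\<bar> | i j. i < n \<and> j < n})"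

end

(* Let t be the coordinate on the line and O(d_1) + ... + O(d_n) the direct image of L. A splitting
   is the same as a basis s_1, ..., s_n of the rational sections of L over k(t) that generates L on
   every fibre of f, where t^(d_j) s_j is used over infinity; choosing sections of minimal degree
   greedily produces one. Take such a basis x_1, ..., x_n with degrees e_j for the structure sheaf
   as well. The matrix of the coefficients of x_a x_b s_i at s_j is nonsingular, so some permutation
   sigma only meets nonzero entries, which forces e_a + e_(sigma a) <= d_j - d_i. Summing over a and
   using sum_j (- e_j) <= g + n - 1, which follows from dim H^1(X, O) = g, one gets
   n (d_i - d_j) <= 2 g - 2 + 2 n. This gives all the inequalities; for n = 1 the spread is 0. *)
theory Submission
  imports Defs "Jordan_Normal_Form.Determinant"
begin

hide_const (open) up_ring.coeff up_ring.monom

section \<open>Curves over a line\<close>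

text \<open>Since \<open>s_invariant\<close> is defined through a choice, the correspondence between
  splittings and bases is needed in both directions: a basis shows that a splitting exists, and
  every splitting gives a basis, so that the bound reaches the chosen one. The two sides are
  compared through rational functions, taken as total functions modulo equality on a nonempty open
  set; the local data of the line bundle become a divisor. The obstacle is to extract the finiteness
  facts of the theory of curves from the definitions. They flow from two numbers. The degree n
  bounds the number of functions independent over k(t): hence finite fibres, finitely many zeros,
  and poles that a polynomial in t can clear. The genus g bounds the number of independent classes
  in H^1: hence constant global functions, degrees of sections that are bounded below, and the
  inequality for the e_j.\<close>

definition poly_indep ::
    "'p filter \<Rightarrow> ('p \<Rightarrow> 'k::field) \<Rightarrow> (nat \<Rightarrow> 'p \<Rightarrow> 'k) \<Rightarrow> nat \<Rightarrow> bool" where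
  "poly_indep G t s m \<longleftrightarrow>
     (\<forall>q. (\<forall>\<^sub>F p in G. (\<Sum>j<m. poly (q j) (t p) * s j p) = 0) \<longrightarrow> (\<forall>j<m. q j = 0))"

lemma poly_indepD:
  assumes "poly_indep G t s m" "\<forall>\<^sub>F p in G. (\<Sum>j<m. poly (q j) (t p) * s j p) = 0" "j < m"
  shows "q j = 0"
  using assms unfolding poly_indep_def by blast

lemma poly_indep_cong:
  assumes "\<And>j. j < m \<Longrightarrow> s j = s' j" shows "poly_indep G t s m \<longleftrightarrow> poly_indep G t s' m"
proof -
  have "(\<Sum>j<m. poly (q j) (t p) * s j p) = (\<Sum>j<m. poly (q j) (t p) * s' j p)" for q p
    by (rule sum.cong) (auto simp: assms)
  then show ?thesis unfolding poly_indep_def by simp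
qed

text \<open>Up to positions this is a subfamily of the given independent family, with
  \<open>u\<close> moved down to place \<open>j\<close>. It is what makes the degrees of the greedy
  choice nondecreasing.\<close>

lemma poly_indep_drop:
  assumes "poly_indep G t (s(m := u)) (Suc m)" and j: "j \<le> m"
  shows "poly_indep G t (s(j := u)) (Suc j)"
  unfolding poly_indep_def
proof (intro allI impI)
  fix q i assume ev: "\<forall>\<^sub>F p in G. (\<Sum>i<Suc j. poly (q i) (t p) * (s(j := u)) i p) = 0" and i: "i < Suc j"
  define q' where "q' = (\<lambda>i. if i = m then q j else if i < j then q i else 0)"
  have "(\<Sum>i<Suc m. poly (q' i) (t p) * (s(m := u)) i p)
      = (\<Sum>i<Suc j. poly (q i) (t p) * (s(j := u)) i p)" for p
  proof -
    have "(\<Sum>i<m. poly (q' i) (t p) * (s(m := u)) i p) = (\<Sum>i<j. poly (q i) (t p) * s i p)"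
      by (rule sum.mono_neutral_cong_right) (use j in \<open>auto simp: q'_def\<close>)
    moreover have "(\<Sum>i<j. poly (q i) (t p) * (s(j := u)) i p) = (\<Sum>i<j. poly (q i) (t p) * s i p)"
      by (rule sum.cong) auto
    ultimately show ?thesis by (simp add: q'_def)
  qed
  then have "\<forall>\<^sub>F p in G. (\<Sum>i<Suc m. poly (q' i) (t p) * (s(m := u)) i p) = 0" using ev by simp
  then have z: "\<And>i. i < Suc m \<Longrightarrow> q' i = 0" using assms(1) poly_indepD by blast
  show "q i = 0"
  proof (cases "i = j")
    case True then show ?thesis using z[of m] by (simp add: q'_def)
  next
    case False then show ?thesis using z[of i] i j by (simp add: q'_def split: if_splits)
  qed
qed

text \<open>
  Rational functions on the curve \<open>X\<close> are total functions compared by equality along the filter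
  \<open>G\<close> of nonempty open sets; \<open>R P\<close> consists of those that are regular at \<open>P\<close> after such an
  identification, and \<open>I\<close> is the fibre over infinity. The assumption \<open>genus_bound\<close> is the bound
  on \<open>H\<^sup>1\<close> computed on the cover of \<open>X\<close> by the preimages of the standard charts
  \<open>t \<noteq> \<infinity>\<close> and \<open>t \<noteq> 0\<close>.
\<close>

locale curve_over_line =
  fixes G :: "'p filter" and X I :: "'p set"
    and K :: "('p \<Rightarrow> 'k::alg_closed_field) set" and R :: "'p \<Rightarrow> ('p \<Rightarrow> 'k) set"
    and t :: "'p \<Rightarrow> 'k" and n g :: nat
  assumes G_bot: "G \<noteq> bot"
    and I_sub: "I \<subseteq> X"
    and K_const: "(\<lambda>_. c) \<in> K"
    and K_add: "u \<in> K \<Longrightarrow> v \<in> K \<Longrightarrow> (\<lambda>p. u p + v p) \<in> K"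
    and K_mult: "u \<in> K \<Longrightarrow> v \<in> K \<Longrightarrow> (\<lambda>p. u p * v p) \<in> K"
    and K_inverse: "u \<in> K \<Longrightarrow> (\<lambda>p. inverse (u p)) \<in> K"
    and K_cong: "u \<in> K \<Longrightarrow> \<forall>\<^sub>F p in G. u p = v p \<Longrightarrow> v \<in> K"
    and K_cases: "u \<in> K \<Longrightarrow> (\<forall>\<^sub>F p in G. u p = 0) \<or> (\<forall>\<^sub>F p in G. u p \<noteq> 0)"
    and R_K: "P \<in> X \<Longrightarrow> u \<in> R P \<Longrightarrow> u \<in> K"
    and R_const: "P \<in> X \<Longrightarrow> (\<lambda>_. c) \<in> R P"
    and R_add: "P \<in> X \<Longrightarrow> u \<in> R P \<Longrightarrow> v \<in> R P \<Longrightarrow> (\<lambda>p. u p + v p) \<in> R P"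
    and R_mult: "P \<in> X \<Longrightarrow> u \<in> R P \<Longrightarrow> v \<in> R P \<Longrightarrow> (\<lambda>p. u p * v p) \<in> R P"
    and R_cong: "u \<in> R P \<Longrightarrow> \<forall>\<^sub>F p in G. u p = v p \<Longrightarrow> v \<in> R P"
    and K_R: "u \<in> K \<Longrightarrow> finite {P\<in>X. u \<notin> R P}"
    and t_K: "t \<in> K"
    and t_neq: "\<forall>\<^sub>F p in G. t p \<noteq> c"
    and t_R: "P \<in> X - I \<Longrightarrow> t \<in> R P"
    and t_inverse: "P \<in> X - I \<Longrightarrow> t P \<noteq> c \<Longrightarrow> (\<lambda>p. inverse (t p - c)) \<in> R P"
    and t_inf: "P \<in> I \<Longrightarrow> (\<lambda>p. inverse (t p)) \<in> R P"
    and t_inf_quot: "P \<in> I \<Longrightarrow> (\<lambda>p. t p * inverse (t p - c)) \<in> R P"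
    and pole_fin: "u \<in> K \<Longrightarrow> P \<in> X - I \<Longrightarrow> \<exists>q. q \<noteq> 0 \<and> (\<lambda>p. poly q (t p) * u p) \<in> R P"
    and pole_inf: "u \<in> K \<Longrightarrow> P \<in> I \<Longrightarrow> \<exists>q m. q \<noteq> 0 \<and> (\<lambda>p. inverse (t p) ^ m * poly q (t p) * u p) \<in> R P"
    and indep_le: "(\<And>j. j < m \<Longrightarrow> s j \<in> K) \<Longrightarrow> poly_indep G t s m \<Longrightarrow> m \<le> n"
    and indep_extend: "(\<And>j. j < m \<Longrightarrow> s j \<in> K) \<Longrightarrow> poly_indep G t s m \<Longrightarrow> m < n \<Longrightarrow>
          \<exists>u\<in>K. poly_indep G t (s(m := u)) (Suc m)"
    and global_const: "(\<And>P. P \<in> X \<Longrightarrow> u \<in> R P) \<Longrightarrow> \<exists>c. \<forall>\<^sub>F p in G. u p = c"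
    and genus_bound: "(\<And>i P. i < N \<Longrightarrow> P \<in> X - I \<Longrightarrow> t P \<noteq> 0 \<Longrightarrow> w i \<in> R P) \<Longrightarrow>
          (\<And>a u v. (\<And>P. P \<in> X - I \<Longrightarrow> u \<in> R P) \<Longrightarrow>
             (\<And>P. P \<in> X \<Longrightarrow> P \<in> I \<or> t P \<noteq> 0 \<Longrightarrow> v \<in> R P) \<Longrightarrow>
             \<forall>\<^sub>F p in G. (\<Sum>i<N. a i * w i p) = u p + v p \<Longrightarrow> (\<forall>i<N. a i = 0)) \<Longrightarrow> N \<le> g"
begin

subsection \<open>Closure properties\<close>

lemma I_X: "P \<in> I \<Longrightarrow> P \<in> X" using I_sub by auto

lemma K_power: "u \<in> K \<Longrightarrow> (\<lambda>p. u p ^ i) \<in> K"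
  by (induction i) (auto intro: K_const K_mult)

lemma K_powi: "u \<in> K \<Longrightarrow> (\<lambda>p. u p powi i) \<in> K"
  by (cases "i \<ge> 0") (auto simp: power_int_def intro: K_power K_inverse)

lemma K_sum: "(\<And>j. j \<in> A \<Longrightarrow> u j \<in> K) \<Longrightarrow> (\<lambda>p. \<Sum>j\<in>A. u j p) \<in> K"
  by (induction A rule: infinite_finite_induct) (auto intro: K_const K_add)

lemma K_diff: "u \<in> K \<Longrightarrow> v \<in> K \<Longrightarrow> (\<lambda>p. u p - v p) \<in> K"
  using K_add[OF _ K_mult[OF K_const[of "-1"]], of u v] by simp

lemma K_poly: "u \<in> K \<Longrightarrow> (\<lambda>p. poly q (u p)) \<in> K"
  by (induction q) (auto intro: K_const K_add K_mult)

lemmas K_intros = K_const K_add K_mult K_inverse K_power K_powi K_sum K_diff K_poly t_K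

lemma R_power: "P \<in> X \<Longrightarrow> u \<in> R P \<Longrightarrow> (\<lambda>p. u p ^ i) \<in> R P"
  by (induction i) (auto intro: R_const R_mult)

lemma R_poly: "P \<in> X \<Longrightarrow> u \<in> R P \<Longrightarrow> (\<lambda>p. poly q (u p)) \<in> R P"
  by (induction q) (auto intro: R_const R_add R_mult)

lemma t_neq_0: "\<forall>\<^sub>F p in G. t p \<noteq> 0" by (rule t_neq)

lemma poly_t_neq_0:
  assumes "q \<noteq> 0" shows "\<forall>\<^sub>F p in G. poly q (t p) \<noteq> 0"
proof -
  have "finite {x. poly q x = 0}" using assms by (rule poly_roots_finite)
  then have "\<forall>\<^sub>F p in G. \<forall>x\<in>{x. poly q x = 0}. t p \<noteq> x"
    by (rule eventually_ball_finite) (auto intro: t_neq)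
  then show ?thesis by eventually_elim auto
qed

lemma ev_False: "\<not> (\<forall>\<^sub>F p in G. False)" using G_bot by (simp add: trivial_limit_def)

text \<open>At a pole of \<open>t\<close> the function \<open>inverse t\<close> is regular, and
  \<open>t^(-M) q(t)\<close> is a polynomial in it with constant term \<open>coeff q M\<close>.
  Removing that term leaves a multiple of \<open>inverse t\<close>, so one factor \<open>t\<close>
  may be restored.\<close>

lemma inf_poly:
  assumes "P \<in> I" "degree q \<le> M"
  shows "(\<lambda>p. inverse (t p) ^ M * poly q (t p)) \<in> R P"
    and "(\<lambda>p. t p * (inverse (t p) ^ M * poly q (t p) - coeff q M)) \<in> R P"
proof -
  have P: "P \<in> X" using assms I_X by auto
  have "degree q \<le> M \<Longrightarrow> (\<lambda>p. inverse (t p) ^ M * poly q (t p)) \<in> R P \<and>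
      (\<lambda>p. t p * (inverse (t p) ^ M * poly q (t p) - coeff q M)) \<in> R P" for q
  proof (induction M arbitrary: q)
    case 0
    then obtain a where "q = [:a:]" using degree_eq_zeroE by auto
    then show ?case using R_const[OF P] by simp
  next
    case (Suc M)
    obtain a q' where q: "q = pCons a q'" by (cases q) auto
    then have d: "degree q' \<le> M" using Suc.prems by (auto split: if_splits)
    have 1: "(\<lambda>p. a * inverse (t p) ^ Suc M + inverse (t p) ^ M * poly q' (t p)) \<in> R P"
      by (intro R_add R_mult[OF P R_const R_power] conjunct1[OF Suc.IH[OF d]] P t_inf assms(1))
    have 2: "(\<lambda>p. a * inverse (t p) ^ M + t p * (inverse (t p) ^ M * poly q' (t p) - coeff q' M)) \<in> R P"
      by (intro R_add R_mult[OF P R_const R_power] conjunct2[OF Suc.IH[OF d]] P t_inf assms(1))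
    show ?case
    proof
      show "(\<lambda>p. inverse (t p) ^ Suc M * poly q (t p)) \<in> R P"
        by (rule R_cong[OF 1], rule eventually_mono[OF t_neq_0]) (simp add: q field_simps)
      show "(\<lambda>p. t p * (inverse (t p) ^ Suc M * poly q (t p) - coeff q (Suc M))) \<in> R P"
        by (rule R_cong[OF 2], rule eventually_mono[OF t_neq_0]) (simp add: q field_simps)
    qed
  qed
  then show "(\<lambda>p. inverse (t p) ^ M * poly q (t p)) \<in> R P"
    and "(\<lambda>p. t p * (inverse (t p) ^ M * poly q (t p) - coeff q M)) \<in> R P" using assms by auto
qed

subsection \<open>Clearing poles\<close>

text \<open>The product of denominators that serve the single points serves all of them: away from
  infinity the remaining factor is a polynomial in \<open>t\<close>, and over infinity it becomes
  regular once divided by \<open>t\<close> to its degree. The function may vary with the point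
  because it will contain the local equations of a divisor.\<close>

lemma clear_finite:
  assumes "finite B" "B \<subseteq> X" "\<And>P. P \<in> B \<Longrightarrow> w P \<in> K"
  shows "\<exists>q m. q \<noteq> 0 \<and> (\<forall>P\<in>B - I. (\<lambda>p. poly q (t p) * w P p) \<in> R P) \<and>
    (\<forall>P\<in>B \<inter> I. (\<lambda>p. inverse (t p) ^ m * poly q (t p) * w P p) \<in> R P)"
  using assms
proof (induction B)
  case empty show ?case by (auto intro!: exI[of _ 1])
next
  case (insert Q B)
  have "\<exists>q m. q \<noteq> 0 \<and> (\<forall>P\<in>B - I. (\<lambda>p. poly q (t p) * w P p) \<in> R P) \<and>
      (\<forall>P\<in>B \<inter> I. (\<lambda>p. inverse (t p) ^ m * poly q (t p) * w P p) \<in> R P)"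
    by (rule insert.IH) (use insert.prems in auto)
  then obtain q m where q: "q \<noteq> 0" "\<forall>P\<in>B - I. (\<lambda>p. poly q (t p) * w P p) \<in> R P"
      "\<forall>P\<in>B \<inter> I. (\<lambda>p. inverse (t p) ^ m * poly q (t p) * w P p) \<in> R P"
    by (elim exE conjE) (rule that)
  have Q: "Q \<in> X" "w Q \<in> K" using insert.prems by auto
  obtain q' m' where q': "q' \<noteq> 0" "Q \<notin> I \<Longrightarrow> (\<lambda>p. poly q' (t p) * w Q p) \<in> R Q"
    "Q \<in> I \<Longrightarrow> (\<lambda>p. inverse (t p) ^ m' * poly q' (t p) * w Q p) \<in> R Q"
    using pole_fin[OF Q(2), of Q] pole_inf[OF Q(2), of Q] Q(1) by (cases "Q \<in> I") (blast, metis DiffI)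
  show ?case
  proof (intro exI[of _ "q * q'"] exI[of _ "m + m' + degree q + degree q'"] conjI ballI)
    show "q * q' \<noteq> 0" using q q' by simp
  next
    fix P assume P: "P \<in> insert Q B - I"
    then have PX: "P \<in> X" and tP: "t \<in> R P" using insert.prems t_R by auto
    show "(\<lambda>p. poly (q * q') (t p) * w P p) \<in> R P"
    proof (cases "P = Q")
      case True
      have "(\<lambda>p. poly q (t p) * (poly q' (t p) * w P p)) \<in> R P"
        by (rule R_mult[OF PX R_poly[OF PX tP]]; use q'(2) P True in auto)
      then show ?thesis by (simp add: mult.assoc)
    next
      case False
      have "(\<lambda>p. poly q' (t p) * (poly q (t p) * w P p)) \<in> R P"
        by (rule R_mult[OF PX R_poly[OF PX tP]]; use q(2) P False in auto)
      then show ?thesis by (simp add: mult_ac)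
    qed
  next
    fix P assume P: "P \<in> insert Q B \<inter> I"
    then have PX: "P \<in> X" and PI: "P \<in> I" using I_X by auto
    show "(\<lambda>p. inverse (t p) ^ (m + m' + degree q + degree q') * poly (q * q') (t p) * w P p) \<in> R P"
    proof (cases "P = Q")
      case True
      have "(\<lambda>p. inverse (t p) ^ (m + degree q') * ((inverse (t p) ^ degree q * poly q (t p)) *
          (inverse (t p) ^ m' * poly q' (t p) * w P p))) \<in> R P"
        by (rule R_mult[OF PX R_power[OF PX t_inf[OF PI]] R_mult[OF PX inf_poly(1)[OF PI]]];
           use q'(3) P True in auto)
      then show ?thesis by (simp add: mult_ac power_add)
    next
      case False
      have "(\<lambda>p. inverse (t p) ^ (m' + degree q) * ((inverse (t p) ^ degree q' * poly q' (t p)) *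
          (inverse (t p) ^ m * poly q (t p) * w P p))) \<in> R P"
        by (rule R_mult[OF PX R_power[OF PX t_inf[OF PI]] R_mult[OF PX inf_poly(1)[OF PI]]];
           use q(3) P False in auto)
      then show ?thesis by (simp add: mult_ac power_add)
    qed
  qed
qed

text \<open>Only the finitely many bad points call for a denominator. At the others the clearing
  polynomial must do no harm, which over infinity costs the extra exponent
  \<open>degree q\<close>.\<close>

lemma clear_poles:
  assumes K: "\<And>P. P \<in> X \<Longrightarrow> w P \<in> K" and fin: "finite {P\<in>X. w P \<notin> R P}"
  shows "\<exists>q m. q \<noteq> 0 \<and> (\<forall>P\<in>X - I. (\<lambda>p. poly q (t p) * w P p) \<in> R P) \<and>
    (\<forall>P\<in>I. (\<lambda>p. inverse (t p) ^ m * poly q (t p) * w P p) \<in> R P)"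
proof -
  define B where "B = {P\<in>X. w P \<notin> R P}"
  have "\<exists>q m. q \<noteq> 0 \<and> (\<forall>P\<in>B - I. (\<lambda>p. poly q (t p) * w P p) \<in> R P) \<and>
      (\<forall>P\<in>B \<inter> I. (\<lambda>p. inverse (t p) ^ m * poly q (t p) * w P p) \<in> R P)"
    by (rule clear_finite) (use fin K in \<open>auto simp: B_def\<close>)
  then obtain q m where q: "q \<noteq> 0" "\<forall>P\<in>B - I. (\<lambda>p. poly q (t p) * w P p) \<in> R P"
      "\<forall>P\<in>B \<inter> I. (\<lambda>p. inverse (t p) ^ m * poly q (t p) * w P p) \<in> R P"
    by (elim exE conjE) (rule that)
  show ?thesis
  proof (intro exI[of _ q] exI[of _ "m + degree q"] conjI ballI)
    show "q \<noteq> 0" by fact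
  next
    fix P assume P: "P \<in> X - I"
    show "(\<lambda>p. poly q (t p) * w P p) \<in> R P"
    proof (cases "P \<in> B")
      case True then show ?thesis using q P by auto
    next
      case False then show ?thesis using P by (intro R_mult R_poly t_R) (auto simp: B_def)
    qed
  next
    fix P assume P: "P \<in> I"
    then have PX: "P \<in> X" by (rule I_X)
    show "(\<lambda>p. inverse (t p) ^ (m + degree q) * poly q (t p) * w P p) \<in> R P"
    proof (cases "P \<in> B")
      case True
      have "(\<lambda>p. inverse (t p) ^ degree q * (inverse (t p) ^ m * poly q (t p) * w P p)) \<in> R P"
        by (rule R_mult[OF PX R_power[OF PX t_inf]]; use q(3) P True in auto)
      then show ?thesis by (simp add: mult_ac power_add)
    next
      case False
      then have w: "w P \<in> R P" using PX by (simp add: B_def)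
      have "(\<lambda>p. inverse (t p) ^ m * (inverse (t p) ^ degree q * poly q (t p)) * w P p) \<in> R P"
        by (rule R_mult[OF PX R_mult[OF PX R_power[OF PX t_inf] inf_poly(1)] w]) (use P in auto)
      then show ?thesis by (simp add: mult_ac power_add)
    qed
  qed
qed

subsection \<open>Divisors and graded sections\<close>

definition divisor :: "('p \<Rightarrow> 'p \<Rightarrow> 'k) \<Rightarrow> bool" where
  "divisor gd \<longleftrightarrow> (\<forall>P\<in>X. gd P \<in> K \<and> (\<forall>\<^sub>F p in G. gd P p \<noteq> 0)) \<and>
     finite {P\<in>X. \<not> (\<forall>\<^sub>F p in G. gd P p = 1)}"

text \<open>
  The stalk at \<open>P\<close> of the line bundle with local equation \<open>gd P\<close>.
\<close>

definition sec :: "('p \<Rightarrow> 'p \<Rightarrow> 'k) \<Rightarrow> 'p \<Rightarrow> ('p \<Rightarrow> 'k) set" where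
  "sec gd P = {u\<in>K. (\<lambda>p. gd P p * u p) \<in> R P}"

text \<open>The global sections of the bundle twisted by \<open>e\<close> times the fibre over
  infinity, equivalently of the direct image twisted by O(e): the factor \<open>t powi (- e)\<close>
  compensates a pole of order \<open>e\<close> along that fibre.\<close>

definition graded_sec :: "('p \<Rightarrow> 'p \<Rightarrow> 'k) \<Rightarrow> int \<Rightarrow> ('p \<Rightarrow> 'k) set" where
  "graded_sec gd e = {u\<in>K. (\<forall>P\<in>X - I. u \<in> sec gd P) \<and>
     (\<forall>P\<in>I. (\<lambda>p. t p powi (- e) * u p) \<in> sec gd P)}"

lemma divisor_one: "divisor (\<lambda>_ _. 1)"
  by (simp add: divisor_def K_const)

lemma sec_one: "P \<in> X \<Longrightarrow> sec (\<lambda>_ _. 1) P = R P"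
  unfolding sec_def using R_K by auto

lemma sec_K: "u \<in> sec gd P \<Longrightarrow> u \<in> K" by (simp add: sec_def)

lemma graded_sec_K: "u \<in> graded_sec gd e \<Longrightarrow> u \<in> K" by (simp add: graded_sec_def)

lemma sec_cong:
  assumes "u \<in> sec gd P" "\<forall>\<^sub>F p in G. u p = v p" shows "v \<in> sec gd P"
proof -
  have "\<forall>\<^sub>F p in G. gd P p * u p = gd P p * v p" using assms(2) by eventually_elim simp
  then have "(\<lambda>p. gd P p * v p) \<in> R P"
    by (rule R_cong[rotated]) (use assms(1) in \<open>simp add: sec_def\<close>)
  moreover have "v \<in> K" by (rule K_cong[OF _ assms(2)]) (use assms(1) in \<open>simp add: sec_def\<close>)
  ultimately show ?thesis by (simp add: sec_def)
qed

lemma sec_zero: "P \<in> X \<Longrightarrow> (\<lambda>_. 0) \<in> sec gd P"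
  by (simp add: sec_def K_const R_const)

lemma sec_add: "P \<in> X \<Longrightarrow> u \<in> sec gd P \<Longrightarrow> v \<in> sec gd P \<Longrightarrow> (\<lambda>p. u p + v p) \<in> sec gd P"
  unfolding sec_def by (auto simp: distrib_left intro: K_add R_add)

lemma sec_smult:
  assumes "P \<in> X" "u \<in> R P" "v \<in> sec gd P" shows "(\<lambda>p. u p * v p) \<in> sec gd P"
proof -
  have "(\<lambda>p. u p * (gd P p * v p)) \<in> R P" by (rule R_mult[OF assms(1,2)]; use assms in \<open>auto simp: sec_def\<close>)
  moreover have "(\<lambda>p. u p * v p) \<in> K" using assms R_K by (intro K_mult) (auto simp: sec_def)
  ultimately show ?thesis by (simp add: sec_def mult_ac)
qed

lemma sec_sum: "P \<in> X \<Longrightarrow> (\<And>j. j \<in> A \<Longrightarrow> u j \<in> sec gd P) \<Longrightarrow> (\<lambda>p. \<Sum>j\<in>A. u j p) \<in> sec gd P"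
  by (induction A rule: infinite_finite_induct) (auto intro: sec_zero sec_add)

lemma sec_diff:
  assumes "P \<in> X" "u \<in> sec gd P" "v \<in> sec gd P" shows "(\<lambda>p. u p - v p) \<in> sec gd P"
  using sec_add[OF assms(1,2) sec_smult[OF assms(1) R_const[of _ "-1"] assms(3)]] assms(1) by simp

text \<open>The product \<open>gd P * u\<close> can fail to be regular only where
  \<open>gd P\<close> is not generically 1 or \<open>u\<close> has a pole, hence at finitely many
  points, and \<open>clear_poles\<close> applies. The exponent at infinity becomes the
  degree.\<close>

lemma graded_clear:
  assumes gd: "divisor gd" and u: "u \<in> K"
  shows "\<exists>q m. q \<noteq> 0 \<and> (\<lambda>p. poly q (t p) * u p) \<in> graded_sec gd m"
proof -
  define w where "w = (\<lambda>P p. gd P p * u p)"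
  have "finite ({P\<in>X. \<not> (\<forall>\<^sub>F p in G. gd P p = 1)} \<union> {P\<in>X. u \<notin> R P})"
    using gd K_R[OF u] by (simp add: divisor_def)
  moreover have "{P\<in>X. w P \<notin> R P} \<subseteq> {P\<in>X. \<not> (\<forall>\<^sub>F p in G. gd P p = 1)} \<union> {P\<in>X. u \<notin> R P}"
  proof clarify
    fix P assume *: "P \<in> X" "w P \<notin> R P" "u \<in> R P" "\<forall>\<^sub>F p in G. gd P p = 1"
    have "\<forall>\<^sub>F p in G. u p = w P p" using *(4) by eventually_elim (simp add: w_def)
    with *(3) have "w P \<in> R P" by (rule R_cong)
    with *(2) show False by simp
  qed
  ultimately have "finite {P\<in>X. w P \<notin> R P}" by (rule finite_subset[rotated])
  moreover have "\<And>P. P \<in> X \<Longrightarrow> w P \<in> K" using gd u by (auto simp: w_def divisor_def intro: K_mult)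
  ultimately have "\<exists>q m. q \<noteq> 0 \<and> (\<forall>P\<in>X - I. (\<lambda>p. poly q (t p) * w P p) \<in> R P) \<and>
      (\<forall>P\<in>I. (\<lambda>p. inverse (t p) ^ m * poly q (t p) * w P p) \<in> R P)"
    by (intro clear_poles)
  then obtain q m where q: "q \<noteq> 0" "\<forall>P\<in>X - I. (\<lambda>p. poly q (t p) * w P p) \<in> R P"
      "\<forall>P\<in>I. (\<lambda>p. inverse (t p) ^ m * poly q (t p) * w P p) \<in> R P"
    by (elim exE conjE) (rule that)
  have "(\<lambda>p. poly q (t p) * u p) \<in> graded_sec gd (int m)"
    unfolding graded_sec_def sec_def
    using q(2,3) u by (auto simp: w_def power_int_minus power_inverse mult_ac intro!: K_intros)
  then show ?thesis using q(1) by blast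
qed

text \<open>A denominator \<open>q\<close> for the inverse local equations turns a section
  \<open>u\<close> of sufficiently negative degree into \<open>v = q(t) u\<close> such that
  \<open>v\<close> and \<open>t v\<close> are both regular everywhere. Both are then constant, and
  since \<open>t\<close> is not generically constant, \<open>v = 0\<close>. This lower bound on
  degrees makes the greedy choice possible.\<close>

lemma graded_sec_trivial:
  assumes gd: "divisor gd"
  shows "\<exists>b0. \<forall>e<b0. \<forall>u\<in>graded_sec gd e. \<forall>\<^sub>F p in G. u p = 0"
proof -
  define w where "w = (\<lambda>P p. inverse (gd P p))"
  have "{P\<in>X. w P \<notin> R P} \<subseteq> {P\<in>X. \<not> (\<forall>\<^sub>F p in G. gd P p = 1)}"
  proof clarify
    fix P assume *: "P \<in> X" "w P \<notin> R P" "\<forall>\<^sub>F p in G. gd P p = 1"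
    have "\<forall>\<^sub>F p in G. 1 = w P p" using *(3) by eventually_elim (simp add: w_def)
    then have "w P \<in> R P" by (rule R_cong[OF R_const[OF *(1)]])
    with *(2) show False by simp
  qed
  then have "finite {P\<in>X. w P \<notin> R P}" using gd by (simp add: divisor_def finite_subset)
  moreover have "\<And>P. P \<in> X \<Longrightarrow> w P \<in> K" using gd by (auto simp: w_def divisor_def intro: K_inverse)
  ultimately have "\<exists>q m. q \<noteq> 0 \<and> (\<forall>P\<in>X - I. (\<lambda>p. poly q (t p) * w P p) \<in> R P) \<and>
      (\<forall>P\<in>I. (\<lambda>p. inverse (t p) ^ m * poly q (t p) * w P p) \<in> R P)"
    by (intro clear_poles)
  then obtain q m where q: "q \<noteq> 0" "\<forall>P\<in>X - I. (\<lambda>p. poly q (t p) * w P p) \<in> R P"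
      "\<forall>P\<in>I. (\<lambda>p. inverse (t p) ^ m * poly q (t p) * w P p) \<in> R P"
    by (elim exE conjE) (rule that)
  have "\<forall>\<^sub>F p in G. u p = 0" if e: "e < - int m" and u: "u \<in> graded_sec gd e" for e u
  proof -
    define v where "v = (\<lambda>p. poly q (t p) * u p)"
    \<comment> \<open>At least one full power of \<open>t\<close> is left after the exponent
      \<open>m\<close> is spent; it keeps \<open>t v\<close> regular over infinity.\<close>
    define k where "k = nat (- e - int m) - 1"
    have k: "- e = int m + (int k + 1)" using e by (simp add: k_def)
    have fin: "v \<in> R P" if P: "P \<in> X - I" for P
    proof -
      have "(\<lambda>p. poly q (t p) * w P p * (gd P p * u p)) \<in> R P"
        by (rule R_mult[OF _ bspec[OF q(2)]]; use P u in \<open>auto simp: graded_sec_def sec_def\<close>)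
      moreover have "\<forall>\<^sub>F p in G. poly q (t p) * w P p * (gd P p * u p) = v p"
      proof -
        have "\<forall>\<^sub>F p in G. gd P p \<noteq> 0" using gd P by (auto simp: divisor_def)
        then show ?thesis by eventually_elim (simp add: w_def v_def)
      qed
      ultimately show ?thesis by (rule R_cong)
    qed
    have inf: "(\<lambda>p. t p ^ Suc k * v p) \<in> R P" if P: "P \<in> I" for P
    proof -
      have "(\<lambda>p. inverse (t p) ^ m * poly q (t p) * w P p * (gd P p * (t p powi (- e) * u p))) \<in> R P"
        by (rule R_mult[OF _ bspec[OF q(3)]]; use P u I_X in \<open>auto simp: graded_sec_def sec_def\<close>)
      moreover have "\<forall>\<^sub>F p in G. inverse (t p) ^ m * poly q (t p) * w P p * (gd P p * (t p powi (- e) * u p))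
          = t p ^ Suc k * v p"
      proof -
        have "\<forall>\<^sub>F p in G. gd P p \<noteq> 0" using gd P I_X by (auto simp: divisor_def)
        then show ?thesis using t_neq_0
        proof eventually_elim
          case (elim p)
          have "t p powi (- e) = t p ^ m * t p ^ Suc k"
            unfolding k using elim by (simp add: power_int_add)
          then show ?case using elim by (simp add: w_def v_def field_simps)
        qed
      qed
      ultimately show ?thesis by (rule R_cong)
    qed
    have inf': "(\<lambda>p. t p * v p) \<in> R P" "v \<in> R P" if P: "P \<in> I" for P
    proof -
      have PX: "P \<in> X" using I_X P by auto
      have "(\<lambda>p. inverse (t p) ^ k * (t p ^ Suc k * v p)) \<in> R P"
        by (rule R_mult[OF PX R_power[OF PX t_inf[OF P]] inf[OF P]])
      then show tv: "(\<lambda>p. t p * v p) \<in> R P"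
        by (rule R_cong) (rule eventually_mono[OF t_neq_0], simp add: field_simps)
      have "(\<lambda>p. inverse (t p) * (t p * v p)) \<in> R P"
        by (rule R_mult[OF PX t_inf[OF P] tv])
      then show "v \<in> R P"
        by (rule R_cong) (rule eventually_mono[OF t_neq_0], simp add: field_simps)
    qed
    obtain \<alpha> where a: "\<forall>\<^sub>F p in G. v p = \<alpha>" using global_const[of v] fin inf' by blast
    have "\<exists>c. \<forall>\<^sub>F p in G. t p * v p = c"
    proof (rule global_const)
      fix P assume "P \<in> X"
      then show "(\<lambda>p. t p * v p) \<in> R P"
        using inf' fin t_R R_mult by (cases "P \<in> I") auto
    qed
    then obtain \<beta> where b: "\<forall>\<^sub>F p in G. t p * v p = \<beta>" by blast
    have "\<alpha> = 0"
    proof (rule ccontr)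
      assume "\<alpha> \<noteq> 0"
      have "\<forall>\<^sub>F p in G. False" using a b t_neq[of "\<beta> / \<alpha>"]
        by eventually_elim (use \<open>\<alpha> \<noteq> 0\<close> in \<open>auto simp: field_simps\<close>)
      then show False using ev_False by blast
    qed
    show ?thesis using a poly_t_neq_0[OF q(1)] by eventually_elim (auto simp: v_def \<open>\<alpha> = 0\<close>)
  qed
  then show ?thesis by blast
qed

end

lemma poly_indep_scale:
  assumes "poly_indep G t (s(m := u)) (Suc m)" "q0 \<noteq> 0"
  shows "poly_indep G t (s(m := (\<lambda>p. poly q0 (t p) * u p))) (Suc m)"
  unfolding poly_indep_def
proof (intro allI impI)
  fix q i assume ev: "\<forall>\<^sub>F p in G. (\<Sum>i<Suc m. poly (q i) (t p) * (s(m := \<lambda>p. poly q0 (t p) * u p)) i p) = 0"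
    and i: "i < Suc m"
  define q' where "q' = q(m := q m * q0)"
  have "(\<Sum>i<Suc m. poly (q' i) (t p) * (s(m := u)) i p)
      = (\<Sum>i<Suc m. poly (q i) (t p) * (s(m := \<lambda>p. poly q0 (t p) * u p)) i p)" for p
    by (simp add: q'_def mult_ac)
  then have "\<forall>\<^sub>F p in G. (\<Sum>i<Suc m. poly (q' i) (t p) * (s(m := u)) i p) = 0" using ev by simp
  then have "q' i = 0" using assms(1) i poly_indepD by blast
  then show "q i = 0" using assms(2) by (auto simp: q'_def split: if_splits)
qed

context curve_over_line
begin

subsection \<open>Bases that are independent in every fibre\<close>

text \<open>
  The last two conditions say that no nontrivial linear combination vanishes on a fibre: it would
  be divisible by \<open>t - c\<close>, respectively by \<open>1 / t\<close> over infinity.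
\<close>

definition sbasis :: "('p \<Rightarrow> 'p \<Rightarrow> 'k) \<Rightarrow> (nat \<Rightarrow> 'p \<Rightarrow> 'k) \<Rightarrow> (nat \<Rightarrow> int) \<Rightarrow> bool" where
  "sbasis gd s d \<longleftrightarrow> (\<forall>j<n. s j \<in> graded_sec gd (- d j)) \<and>
     (\<forall>c b. (\<forall>P\<in>X - I. t P = c \<longrightarrow> (\<lambda>p. inverse (t p - c) * (\<Sum>j<n. b j * s j p)) \<in> sec gd P) \<longrightarrow>
        (\<forall>j<n. b j = 0)) \<and>
     (\<forall>b. (\<forall>P\<in>I. (\<lambda>p. t p * (\<Sum>j<n. b j * (t p powi d j * s j p))) \<in> sec gd P) \<longrightarrow>
        (\<forall>j<n. b j = 0))"

lemma sbasis_fin: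
  assumes "sbasis gd s d"
    "\<And>P. P \<in> X - I \<Longrightarrow> t P = c \<Longrightarrow> (\<lambda>p. inverse (t p - c) * (\<Sum>j<n. b j * s j p)) \<in> sec gd P"
    "j < n"
  shows "b j = 0"
proof -
  have "\<forall>P\<in>X - I. t P = c \<longrightarrow> (\<lambda>p. inverse (t p - c) * (\<Sum>j<n. b j * s j p)) \<in> sec gd P"
    using assms(2) by auto
  with assms(1,3) show ?thesis unfolding sbasis_def by simp
qed

lemma sbasis_inf:
  assumes "sbasis gd s d"
    "\<And>P. P \<in> I \<Longrightarrow> (\<lambda>p. t p * (\<Sum>j<n. b j * (t p powi d j * s j p))) \<in> sec gd P"
    "j < n"
  shows "b j = 0"
proof -
  have "\<forall>P\<in>I. (\<lambda>p. t p * (\<Sum>j<n. b j * (t p powi d j * s j p))) \<in> sec gd P"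
    using assms(2) by auto
  with assms(1,3) show ?thesis unfolding sbasis_def by simp
qed

lemma not_indep_zero:
  assumes "\<forall>\<^sub>F p in G. u p = 0" shows "\<not> poly_indep G t (s(m := u)) (Suc m)"
proof
  assume "poly_indep G t (s(m := u)) (Suc m)"
  moreover have "\<forall>\<^sub>F p in G. (\<Sum>i<Suc m. poly (if i = m then 1 else 0) (t p) * (s(m := u)) i p) = 0"
    using assms by eventually_elim simp
  ultimately have "(if m = m then 1 else 0 :: 'k poly) = 0" by (rule poly_indepD) simp
  then show False by simp
qed

text \<open>Induction on \<open>m\<close>: among all degrees in which some section extends the
  family independently, the least one is taken. Such degrees exist by \<open>graded_clear\<close>
  and are bounded below by \<open>graded_sec_trivial\<close>.\<close>

lemma minimal_family:
  assumes gd: "divisor gd" and "m \<le> n"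
  shows "\<exists>s a. (\<forall>j<m. s j \<in> graded_sec gd (a j)) \<and> poly_indep G t s m \<and>
     (\<forall>i j. i \<le> j \<longrightarrow> j < m \<longrightarrow> a i \<le> a j) \<and>
     (\<forall>j<m. \<forall>e<a j. \<forall>u\<in>graded_sec gd e. \<not> poly_indep G t (s(j := u)) (Suc j))"
  using assms(2)
proof (induction m)
  case 0 show ?case by (auto simp: poly_indep_def)
next
  case (Suc m)
  have "\<exists>s a. (\<forall>j<m. s j \<in> graded_sec gd (a j)) \<and> poly_indep G t s m \<and>
     (\<forall>i j. i \<le> j \<longrightarrow> j < m \<longrightarrow> a i \<le> a j) \<and>
     (\<forall>j<m. \<forall>e<a j. \<forall>u\<in>graded_sec gd e. \<not> poly_indep G t (s(j := u)) (Suc j))"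
    by (rule Suc.IH) (use Suc.prems in simp)
  then obtain s a where sec: "\<forall>j<m. s j \<in> graded_sec gd (a j)" and ind: "poly_indep G t s m"
    and mono: "\<forall>i j. i \<le> j \<longrightarrow> j < m \<longrightarrow> a i \<le> a j"
    and min: "\<forall>j<m. \<forall>e<a j. \<forall>u\<in>graded_sec gd e. \<not> poly_indep G t (s(j := u)) (Suc j)"
    by (elim exE conjE) (rule that)
  define S where "S = {e. \<exists>u\<in>graded_sec gd e. poly_indep G t (s(m := u)) (Suc m)}"
  have "\<exists>u\<in>K. poly_indep G t (s(m := u)) (Suc m)"
    by (rule indep_extend) (use sec ind Suc.prems graded_sec_K in auto)
  then obtain u where u: "u \<in> K" "poly_indep G t (s(m := u)) (Suc m)" by auto
  obtain q e where q: "q \<noteq> 0" "(\<lambda>p. poly q (t p) * u p) \<in> graded_sec gd e"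
    using graded_clear[OF gd u(1)] by auto
  have eS: "e \<in> S" unfolding S_def using poly_indep_scale[OF u(2) q(1)] q(2) by auto
  obtain b0 where b0: "\<forall>e<b0. \<forall>u\<in>graded_sec gd e. \<forall>\<^sub>F p in G. u p = 0"
    using graded_sec_trivial[OF gd] by auto
  have S_ge: "b0 \<le> e" if "e \<in> S" for e
  proof (rule ccontr)
    assume "\<not> b0 \<le> e"
    then have e: "e < b0" by simp
    have "\<exists>u\<in>graded_sec gd e. poly_indep G t (s(m := u)) (Suc m)" using that by (simp add: S_def)
    then obtain u where u: "u \<in> graded_sec gd e" "poly_indep G t (s(m := u)) (Suc m)" by (rule bexE)
    have "\<forall>\<^sub>F p in G. u p = 0" using b0[rule_format, OF e u(1)] .
    then show False using not_indep_zero u(2) by simp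
  qed
  \<comment> \<open>Degrees are integers; counting from the lower bound \<open>b0\<close> turns the
    minimum into one over the naturals.\<close>
  define k where "k = (LEAST k. b0 + int k \<in> S)"
  have "b0 + int (nat (e - b0)) \<in> S" using S_ge[OF eS] eS by simp
  then have kS: "b0 + int k \<in> S" unfolding k_def by (rule LeastI)
  define e0 where "e0 = b0 + int k"
  have e0_min: "e0 \<le> e" if "e \<in> S" for e
  proof -
    have "b0 + int (nat (e - b0)) \<in> S" using S_ge[OF that] that by simp
    then have "k \<le> nat (e - b0)" unfolding k_def by (rule Least_le)
    then show ?thesis using S_ge[OF that] by (simp add: e0_def)
  qed
  obtain u0 where u0: "u0 \<in> graded_sec gd e0" "poly_indep G t (s(m := u0)) (Suc m)"
    using kS by (auto simp: S_def e0_def)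
  define s' a' where "s' = s(m := u0)" and "a' = a(m := e0)"
  have upd: "poly_indep G t (s'(j := u)) (Suc j) \<longleftrightarrow> poly_indep G t (s(j := u)) (Suc j)" if "j \<le> m" for j u
    by (rule poly_indep_cong) (use that in \<open>auto simp: s'_def\<close>)
  show ?case
  proof (intro exI[of _ s'] exI[of _ a'] conjI allI impI ballI)
    fix j assume "j < Suc m" then show "s' j \<in> graded_sec gd (a' j)"
      using sec u0(1) by (auto simp: s'_def a'_def less_Suc_eq)
  next
    show "poly_indep G t s' (Suc m)" using u0(2) by (simp add: s'_def)
  next
    fix i j assume ij: "i \<le> j" "j < Suc m"
    show "a' i \<le> a' j"
    proof (cases "j = m")
      case True
      \<comment> \<open>Otherwise the new section, put at place \<open>i\<close>, would have been
        available there with a smaller degree.\<close>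
      have "a i \<le> e0" if "i < m"
      proof (rule ccontr)
        assume "\<not> a i \<le> e0"
        then have "e0 < a i" by simp
        then have "\<not> poly_indep G t (s(i := u0)) (Suc i)" using min[rule_format, OF that _ u0(1)] by simp
        then show False using poly_indep_drop[OF u0(2)] that by auto
      qed
      then show ?thesis using ij True by (auto simp: a'_def)
    next
      case False then show ?thesis using ij mono by (auto simp: a'_def)
    qed
  next
    fix j e u assume j: "j < Suc m" and e: "e < a' j" and u: "u \<in> graded_sec gd e"
    show "\<not> poly_indep G t (s'(j := u)) (Suc j)"
    proof (cases "j = m")
      case True
      then have "e \<notin> S" using e0_min[of e] e by (auto simp: a'_def)
      then show ?thesis using u True upd[of m] by (auto simp: S_def)
    next
      case False
      then have "j < m" "e < a j" using j e by (auto simp: a'_def)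
      then show ?thesis using min[rule_format, of j e u] u upd[of j] by simp
    qed
  qed
qed

text \<open>Over k(t) the function \<open>w\<close> is a combination of the \<open>s j\<close> with
  nonzero coefficient at \<open>m\<close>, so it may be exchanged for \<open>s m\<close>. Applied to
  a \<open>w\<close> of smaller degree, this contradicts the minimal choice.\<close>

lemma minimal_dependent:
  assumes ind: "poly_indep G t s (Suc m)"
    and b: "b m \<noteq> 0" and w: "\<forall>\<^sub>F p in G. poly r (t p) * w p = (\<Sum>j<Suc m. poly (b j) (t p) * s j p)"
    and r: "r \<noteq> 0"
  shows "poly_indep G t (s(m := w)) (Suc m)"
  unfolding poly_indep_def
proof (intro allI impI)
  fix q i assume ev: "\<forall>\<^sub>F p in G. (\<Sum>i<Suc m. poly (q i) (t p) * (s(m := w)) i p) = 0" and i: "i < Suc m"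
  \<comment> \<open>Coefficients obtained by multiplying the relation by \<open>r\<close> and
    substituting for \<open>r w\<close>.\<close>
  define q' where "q' = (\<lambda>j. q m * b j + (if j < m then r * q j else 0))"
  have "\<forall>\<^sub>F p in G. (\<Sum>i<Suc m. poly (q' i) (t p) * s i p) = 0"
    using ev w
  proof eventually_elim
    case (elim p)
    have 1: "(\<Sum>i<m. poly (q i) (t p) * s i p) + poly (q m) (t p) * w p = 0"
      using elim(1) by simp
    have "(\<Sum>i<Suc m. poly (q' i) (t p) * s i p) =
        poly (q m) (t p) * (\<Sum>i<Suc m. poly (b i) (t p) * s i p) + poly r (t p) * (\<Sum>i<m. poly (q i) (t p) * s i p)"
      by (simp add: q'_def sum.distrib sum_distrib_left algebra_simps)
    also have "\<dots> = poly r (t p) * ((\<Sum>i<m. poly (q i) (t p) * s i p) + poly (q m) (t p) * w p)"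
      unfolding elim(2)[symmetric] by (simp add: algebra_simps)
    finally show ?case using 1 by simp
  qed
  then have z: "q' j = 0" if "j < Suc m" for j using ind that poly_indepD by blast
  have qm: "q m = 0" using z[of m] b by (simp add: q'_def)
  show "q i = 0" using z[OF i] i qm r by (cases "i = m") (auto simp: q'_def)
qed

lemma inverse_powi_diff:
  fixes x :: 'k
  assumes "x \<noteq> 0" "a \<le> b"
  shows "x powi (- b) = inverse x ^ nat (b - a) * x powi (- a)"
proof -
  have "x powi (- b) = x powi (- int (nat (b - a)) + - a)" using assms by simp
  also have "\<dots> = x powi (- int (nat (b - a))) * x powi (- a)" using assms by (intro power_int_add) auto
  also have "x powi (- int (nat (b - a))) = inverse x ^ nat (b - a)"
    by (simp add: power_int_minus power_inverse del: int_nat_eq)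
  finally show ?thesis .
qed

text \<open>A minimal family is independent in every fibre. If a combination vanished on a fibre,
  let \<open>m\<close> be the last index with nonzero coefficient; dividing by the equation of the
  fibre gives a section of degree \<open>a m - 1\<close> that could replace \<open>s m\<close>,
  against minimality. The degrees of the splitting are the negatives of the
  \<open>a j\<close>.\<close>

theorem sbasis_exists:
  assumes gd: "divisor gd"
  shows "\<exists>s d. sbasis gd s d"
proof -
  from minimal_family[OF gd order_refl]
  obtain s a where sec: "\<forall>j<n. s j \<in> graded_sec gd (a j)" and ind: "poly_indep G t s n"
    and mono: "\<forall>i j. i \<le> j \<longrightarrow> j < n \<longrightarrow> a i \<le> a j"
    and min: "\<forall>j<n. \<forall>e<a j. \<forall>u\<in>graded_sec gd e. \<not> poly_indep G t (s(j := u)) (Suc j)"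
    by (elim exE conjE) (rule that)
  have ind': "poly_indep G t s (Suc m)" if "m < n" for m
  proof -
    have "poly_indep G t (s(n - 1 := s (n - 1))) (Suc (n - 1))" using ind that by simp
    then have "poly_indep G t ((s(n - 1 := s (n - 1)))(m := s m)) (Suc m)" 
    proof -
      show ?thesis unfolding poly_indep_def
      proof (intro allI impI)
        fix q i assume ev: "\<forall>\<^sub>F p in G. (\<Sum>i<Suc m. poly (q i) (t p) * ((s(n - 1 := s (n - 1)))(m := s m)) i p) = 0"
          and i: "i < Suc m"
        have "(\<Sum>i<n. poly (if i < Suc m then q i else 0) (t p) * s i p) = (\<Sum>i<Suc m. poly (q i) (t p) * s i p)" for p
          by (rule sum.mono_neutral_cong_right) (use that in auto)
        then have "\<forall>\<^sub>F p in G. (\<Sum>i<n. poly (if i < Suc m then q i else 0) (t p) * s i p) = 0" using ev by simp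
        then have "(if i < Suc m then q i else 0) = 0" by (rule poly_indepD[OF ind]) (use i that in auto)
        then show "q i = 0" using i by simp
      qed
    qed
    then show ?thesis by simp
  qed
  \<comment> \<open>It is enough to refute a last nonzero coefficient.\<close>
  have zero: "\<forall>j<n. b j = 0"
    if key: "\<And>m. m < n \<Longrightarrow> b m \<noteq> 0 \<Longrightarrow> (\<And>j. m < j \<Longrightarrow> j < n \<Longrightarrow> b j = 0) \<Longrightarrow> False" for b :: "nat \<Rightarrow> 'k"
  proof (rule ccontr)
    assume "\<not> (\<forall>j<n. b j = 0)"
    then have ne: "{j. j < n \<and> b j \<noteq> 0} \<noteq> {}" by auto
    define m where "m = Max {j. j < n \<and> b j \<noteq> 0}"
    have fin: "finite {j. j < n \<and> b j \<noteq> 0}" by simp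
    have "m \<in> {j. j < n \<and> b j \<noteq> 0}" unfolding m_def using fin ne by (rule Max_in)
    moreover have "b j = 0" if "m < j" "j < n" for j
      using Max_ge[OF fin, of j] that unfolding m_def[symmetric] by force
    ultimately show False using key[of m] by auto
  qed
  have trunc: "(\<Sum>j<n. b j * v j) = (\<Sum>j<Suc m. b j * v j)"
    if "m < n" "\<And>j. m < j \<Longrightarrow> j < n \<Longrightarrow> b j = 0" for b v :: "nat \<Rightarrow> 'k" and m
    by (rule sum.mono_neutral_right) (use that in auto)
  have s_fin: "s j \<in> sec gd P" if "j < n" "P \<in> X - I" for j P
    using sec that by (auto simp: graded_sec_def)
  have s_inf: "(\<lambda>p. t p powi (- a j) * s j p) \<in> sec gd P" if "j < n" "P \<in> I" for j P
    using sec that by (auto simp: graded_sec_def)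
  have s_K: "s j \<in> K" if "j < n" for j using sec that graded_sec_K by auto
  \<comment> \<open>As \<open>a\<close> is nondecreasing, every \<open>s j\<close> with
    \<open>j \<le> m\<close> is also a section of degree \<open>a m\<close>.\<close>
  have inf_sum: "(\<lambda>p. t p powi (- a m) * (\<Sum>j<Suc m. b j * s j p)) \<in> sec gd P"
    if "m < n" "P \<in> I" for b m P
  proof -
    have PX: "P \<in> X" using that I_X by auto
    have "(\<lambda>p. \<Sum>j<Suc m. b j * (inverse (t p) ^ nat (a m - a j) * (t p powi (- a j) * s j p))) \<in> sec gd P"
      by (intro sec_sum sec_smult PX s_inf R_const R_power t_inf that) (use that in auto)
    moreover have "\<forall>\<^sub>F p in G. (\<Sum>j<Suc m. b j * (inverse (t p) ^ nat (a m - a j) * (t p powi (- a j) * s j p)))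
        = t p powi (- a m) * (\<Sum>j<Suc m. b j * s j p)"
      using t_neq_0
    proof eventually_elim
      case (elim p)
      have "t p powi (- a m) = inverse (t p) ^ nat (a m - a j) * t p powi (- a j)" if "j < Suc m" for j
        using inverse_powi_diff[OF elim] mono \<open>m < n\<close> that by auto
      then show ?case
        unfolding sum_distrib_left by (intro sum.cong) auto
    qed
    ultimately show ?thesis by (rule sec_cong)
  qed
  have "sbasis gd s (\<lambda>j. - a j)"
    unfolding sbasis_def
  proof (intro conjI allI)
    show "j < n \<longrightarrow> s j \<in> graded_sec gd (- (- a j))" for j using sec by simp
  next
    fix c b
    show "(\<forall>P\<in>X - I. t P = c \<longrightarrow> (\<lambda>p. inverse (t p - c) * (\<Sum>j<n. b j * s j p)) \<in> sec gd P) \<longrightarrow>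
        (\<forall>j<n. b j = 0)"
    proof (intro impI zero)
      fix m assume H: "\<forall>P\<in>X - I. t P = c \<longrightarrow> (\<lambda>p. inverse (t p - c) * (\<Sum>j<n. b j * s j p)) \<in> sec gd P"
        and m: "m < n" "b m \<noteq> 0" "\<And>j. m < j \<Longrightarrow> j < n \<Longrightarrow> b j = 0"
      define w where "w = (\<lambda>p. inverse (t p - c) * (\<Sum>j<Suc m. b j * s j p))"
      have wn: "w = (\<lambda>p. inverse (t p - c) * (\<Sum>j<n. b j * s j p))"
        unfolding w_def using trunc[OF m(1,3)] by simp
      have wK: "w \<in> K" unfolding w_def
        by (intro K_mult K_inverse K_diff K_sum K_const t_K s_K) (use m in auto)
      \<comment> \<open>Division by \<open>t - c\<close> lowers the degree by one, because
        \<open>t / (t - c)\<close> is regular over infinity.\<close>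
      have "w \<in> graded_sec gd (a m - 1)"
        unfolding graded_sec_def
      proof (intro CollectI conjI wK ballI)
        fix P assume P: "P \<in> X - I"
        show "w \<in> sec gd P"
        proof (cases "t P = c")
          case True then show ?thesis using H P by (simp add: wn)
        next
          case False
          show ?thesis unfolding w_def
            by (intro sec_smult sec_sum t_inverse P False R_const s_fin) (use P m in auto)
        qed
      next
        fix P assume P: "P \<in> I"
        have "(\<lambda>p. t p * inverse (t p - c) * (t p powi (- a m) * (\<Sum>j<Suc m. b j * s j p))) \<in> sec gd P"
          by (intro sec_smult t_inf_quot inf_sum P m I_X[OF P])
        moreover have "\<forall>\<^sub>F p in G. t p * inverse (t p - c) * (t p powi (- a m) * (\<Sum>j<Suc m. b j * s j p))
            = t p powi (- (a m - 1)) * w p"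
          using t_neq_0
        proof eventually_elim
          case (elim p)
          have "t p powi (- (a m - 1)) = t p * t p powi (- a m)"
            using power_int_add[of "t p" 1 "- a m"] elim by simp
          then show ?case by (simp add: w_def mult_ac)
        qed
        ultimately show "(\<lambda>p. t p powi (- (a m - 1)) * w p) \<in> sec gd P" by (rule sec_cong)
      qed
      then have "\<not> poly_indep G t (s(m := w)) (Suc m)"
        using min[rule_format, OF m(1), of "a m - 1" w] by simp
      moreover have "poly_indep G t (s(m := w)) (Suc m)"
      proof (rule minimal_dependent[OF ind'[OF m(1)], of "\<lambda>j. [:b j:]" "[:-c, 1:]"])
        show "\<forall>\<^sub>F p in G. poly [:- c, 1:] (t p) * w p = (\<Sum>j<Suc m. poly [:b j:] (t p) * s j p)"
          using t_neq[of c] by eventually_elim (simp add: w_def)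
      qed (use m in auto)
      ultimately show False by simp
    qed
  next
    fix b
    show "(\<forall>P\<in>I. (\<lambda>p. t p * (\<Sum>j<n. b j * (t p powi (- a j) * s j p))) \<in> sec gd P) \<longrightarrow>
        (\<forall>j<n. b j = 0)"
    proof (intro impI zero)
      fix m assume H: "\<forall>P\<in>I. (\<lambda>p. t p * (\<Sum>j<n. b j * (t p powi (- a j) * s j p))) \<in> sec gd P"
        and m: "m < n" "b m \<noteq> 0" "\<And>j. m < j \<Longrightarrow> j < n \<Longrightarrow> b j = 0"
      \<comment> \<open>The powers of \<open>t\<close> raise all terms to the common degree
        \<open>a m\<close>; by assumption the result vanishes along the fibre over infinity, which
        lowers the degree by one.\<close>
      define w where "w = (\<lambda>p. \<Sum>j<Suc m. poly (monom (b j) (nat (a m - a j))) (t p) * s j p)"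
      have mono': "a j \<le> a m" if "j < Suc m" for j using mono m that by auto
      have wK: "w \<in> K" unfolding w_def
        by (intro K_sum K_mult K_poly t_K s_K) (use m in auto)
      have "w \<in> graded_sec gd (a m - 1)"
        unfolding graded_sec_def
      proof (intro CollectI conjI wK ballI)
        fix P assume P: "P \<in> X - I"
        show "w \<in> sec gd P" unfolding w_def
          by (intro sec_sum sec_smult R_poly t_R P s_fin) (use P m in auto)
      next
        fix P assume P: "P \<in> I"
        then have "(\<lambda>p. t p * (\<Sum>j<n. b j * (t p powi (- a j) * s j p))) \<in> sec gd P" using H by simp
        moreover have "\<forall>\<^sub>F p in G. t p * (\<Sum>j<n. b j * (t p powi (- a j) * s j p))
            = t p powi (- (a m - 1)) * w p"
          using t_neq_0
        proof eventually_elim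
          case (elim p)
          have "t p powi (- (a m - 1)) * w p =
            (\<Sum>j<Suc m. t p powi (- (a m - 1)) * (b j * t p ^ nat (a m - a j) * s j p))"
            unfolding w_def sum_distrib_left by (simp add: poly_monom)
          also have "\<dots> = (\<Sum>j<Suc m. t p * (b j * (t p powi (- a j) * s j p)))"
          proof (rule sum.cong[OF refl])
            fix j assume j: "j \<in> {..<Suc m}"
            have "t p powi (- a j + 1) = t p powi (- (a m - 1) + int (nat (a m - a j)))"
              using mono'[of j] j by (simp add: algebra_simps)
            also have "\<dots> = t p powi (- (a m - 1)) * t p ^ nat (a m - a j)"
              using power_int_add[of "t p" "- (a m - 1)" "int (nat (a m - a j))"] elim
              by (simp del: int_nat_eq)
            finally have "t p powi (- a j + 1) = t p powi (- (a m - 1)) * t p ^ nat (a m - a j)" .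
            moreover have "t p powi (- a j + 1) = t p powi (- a j) * t p"
              using elim by (subst power_int_add) auto
            ultimately show "t p powi (- (a m - 1)) * (b j * t p ^ nat (a m - a j) * s j p)
                = t p * (b j * (t p powi (- a j) * s j p))"
              by (simp add: mult_ac)
          qed
          also have "\<dots> = t p * (\<Sum>j<n. b j * (t p powi (- a j) * s j p))"
            by (simp only: trunc[OF m(1,3)] sum_distrib_left)
          finally show ?case by simp
        qed
        ultimately show "(\<lambda>p. t p powi (- (a m - 1)) * w p) \<in> sec gd P" by (rule sec_cong)
      qed
      then have "\<not> poly_indep G t (s(m := w)) (Suc m)"
        using min[rule_format, OF m(1), of "a m - 1" w] by simp
      moreover have "poly_indep G t (s(m := w)) (Suc m)"
        by (rule minimal_dependent[OF ind'[OF m(1)], of "\<lambda>j. monom (b j) (nat (a m - a j))" 1])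
          (use m in \<open>auto simp: w_def\<close>)
      ultimately show False by simp
    qed
  qed
  then show ?thesis by blast
qed

end

text \<open>The determinant is nonzero, so by the Leibniz formula some permutation contributes a
  nonzero product.\<close>

lemma nonsingular_imp_permutation:
  fixes B :: "nat \<Rightarrow> nat \<Rightarrow> 'a::idom"
  assumes "\<And>v. (\<And>i. i < n \<Longrightarrow> (\<Sum>j<n. B i j * v j) = 0) \<Longrightarrow> (\<forall>j<n. v j = 0)"
  shows "\<exists>\<pi>. \<pi> permutes {..<n} \<and> (\<forall>i<n. B i (\<pi> i) \<noteq> 0)"
proof -
  define A where "A = mat n n (\<lambda>(i, j). B i j)"
  have A: "A \<in> carrier_mat n n" by (simp add: A_def)
  have "det A \<noteq> 0"
  proof
    assume "det A = 0"
    then obtain v where v: "v \<in> carrier_vec n" "v \<noteq> 0\<^sub>v n" "A *\<^sub>v v = 0\<^sub>v n"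
      using det_0_iff_vec_prod_zero[OF A] by auto
    have "(\<Sum>j<n. B i j * v $ j) = 0" if "i < n" for i
    proof -
      have "(A *\<^sub>v v) $ i = 0" using v(3) that by simp
      then show ?thesis using that v(1)
        by (simp add: A_def scalar_prod_def atLeast0LessThan)
    qed
    then have "\<forall>j<n. v $ j = 0" using assms[of "\<lambda>j. v $ j"] by blast
    then have "v = 0\<^sub>v n" using v(1) by (intro eq_vecI) auto
    then show False using v(2) by simp
  qed
  then obtain p where p: "p permutes {0..<n}" "(\<Prod>i = 0..<n. A $$ (i, p i)) \<noteq> 0"
    unfolding det_def'[OF A] by (metis (no_types, lifting) mem_Collect_eq mult_zero_right sum.neutral)
  have "B i (p i) \<noteq> 0" if "i < n" for i
  proof -
    have "p i < n" using p(1) that permutes_in_image[OF p(1), of i] by simp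
    moreover have "A $$ (i, p i) \<noteq> 0" using p(2) that by (simp add: prod_zero_iff)
    ultimately show ?thesis using that by (simp add: A_def)
  qed
  then show ?thesis using p(1) by (auto simp: atLeast0LessThan)
qed

lemma poly_no_root_const:
  fixes q :: "'a::alg_closed_field poly"
  assumes "\<And>c. poly q c \<noteq> 0"
  obtains c where "c \<noteq> 0" "q = [:c:]"
proof -
  have "degree q = 0" using assms alg_closed_imp_poly_has_root[of q] by fastforce
  then obtain c where "q = [:c:]" by (rule degree_eq_zeroE)
  then show ?thesis using assms[of 0] that by auto
qed

text \<open>Splitting off the full power of the variable leaves a polynomial without roots. Such
  polynomials arise as denominators of functions that are regular where
  \<open>t \<noteq> 0\<close>.\<close>

lemma poly_single_root:
  fixes q :: "'a::alg_closed_field poly"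
  assumes "q \<noteq> 0" "\<And>c. c \<noteq> 0 \<Longrightarrow> poly q c \<noteq> 0"
  obtains c m where "c \<noteq> 0" "q = monom c m"
proof -
  define k where "k = Polynomial.order 0 q"
  obtain q1 where q1: "q = [:0, 1:] ^ k * q1" "\<not> [:0, 1:] dvd q1"
    using order_decomp[OF assms(1), of 0] unfolding k_def by auto
  have "poly q1 c \<noteq> 0" for c
  proof (cases "c = 0")
    case True then show ?thesis using q1(2) by (simp add: poly_eq_0_iff_dvd)
  next
    case False
    then have "poly q c \<noteq> 0" by (rule assms(2))
    then show ?thesis unfolding q1(1) by auto
  qed
  then obtain c where c: "c \<noteq> 0" "q1 = [:c:]" by (rule poly_no_root_const)
  then have "q = monom c k" using q1(1) by (simp add: monom_altdef mult.commute)
  then show ?thesis using c that by blast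
qed

section \<open>Coordinates with respect to a fibrewise independent basis\<close>

context curve_over_line
begin

lemma sbasis_sec:
  assumes "sbasis gd s d" "j < n"
  shows "s j \<in> K" "P \<in> X - I \<Longrightarrow> s j \<in> sec gd P" "P \<in> I \<Longrightarrow> (\<lambda>p. t p powi d j * s j p) \<in> sec gd P"
  using assms unfolding sbasis_def graded_sec_def by auto

text \<open>Independence in the single fibre \<open>t = 0\<close> kills the constant terms of a
  relation. The relation can then be divided by \<open>t\<close>, and the coefficients shrink until
  nothing is left.\<close>

lemma sbasis_indep:
  assumes sb: "sbasis gd s d"
  shows "poly_indep G t s n"
  unfolding poly_indep_def
proof (intro allI impI)
  fix q :: "nat \<Rightarrow> 'k poly" and j
  assume ev: "\<forall>\<^sub>F p in G. (\<Sum>j<n. poly (q j) (t p) * s j p) = 0" and j: "j < n"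
  have *: "\<forall>j<n. q j = 0" if "\<forall>j<n. \<forall>i\<ge>N. coeff (q j) i = 0"
    "\<forall>\<^sub>F p in G. (\<Sum>j<n. poly (q j) (t p) * s j p) = 0" for N q
    using that
  proof (induction N arbitrary: q)
    case 0 then show ?case by (auto intro: poly_eqI)
  next
    case (Suc N)
    define q' where "q' = (\<lambda>j. poly_shift 1 (q j))"
    define b where "b = (\<lambda>j. coeff (q j) 0)"
    have q: "q j = pCons (b j) (q' j)" for j
      by (rule poly_eqI) (simp add: coeff_pCons b_def q'_def coeff_poly_shift split: nat.split)
    have b: "b j = 0" if "j < n" for j
    proof (rule sbasis_fin[OF sb _ that, of 0 b])
      fix P assume P: "P \<in> X - I" "t P = 0"
      have "(\<lambda>p. \<Sum>j<n. poly (- q' j) (t p) * s j p) \<in> sec gd P"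
        by (intro sec_sum sec_smult R_poly t_R P sbasis_sec[OF sb]) (use P in auto)
      moreover have "\<forall>\<^sub>F p in G. (\<Sum>j<n. poly (- q' j) (t p) * s j p) = inverse (t p - 0) * (\<Sum>j<n. b j * s j p)"
        using Suc.prems(2) t_neq_0
      proof eventually_elim
        case (elim p)
        have "(\<Sum>j<n. b j * s j p) + t p * (\<Sum>j<n. poly (q' j) (t p) * s j p) = 0"
          using elim(1) by (simp add: q ring_distribs sum.distrib sum_distrib_left mult_ac)
        then have e: "(\<Sum>j<n. b j * s j p) = - (t p * (\<Sum>j<n. poly (q' j) (t p) * s j p))"
          by (rule eq_neg_iff_add_eq_0[THEN iffD2])
        show ?case unfolding e using elim(2) by (simp add: sum_negf)
      qed
      ultimately show "(\<lambda>p. inverse (t p - 0) * (\<Sum>j<n. b j * s j p)) \<in> sec gd P" by (rule sec_cong)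
    qed
    have "\<forall>j<n. q' j = 0"
    proof (rule Suc.IH)
      show "\<forall>j<n. \<forall>i\<ge>N. coeff (q' j) i = 0" using Suc.prems(1) by (simp add: q'_def coeff_poly_shift)
      show "\<forall>\<^sub>F p in G. (\<Sum>j<n. poly (q' j) (t p) * s j p) = 0"
        using Suc.prems(2) t_neq_0
      proof eventually_elim
        case (elim p)
        have "t p * (\<Sum>j<n. poly (q' j) (t p) * s j p) = (\<Sum>j<n. poly (q j) (t p) * s j p)"
          unfolding sum_distrib_left by (rule sum.cong) (auto simp: q b)
        then show ?case using elim by simp
      qed
    qed
    then show ?case using b q by auto
  qed
  define N where "N = Suc (\<Sum>j<n. degree (q j))"
  have "coeff (q j) i = 0" if "j < n" "i \<ge> N" for j i
  proof -
    have "degree (q j) \<le> (\<Sum>j<n. degree (q j))" using that by (intro member_le_sum) auto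
    then show ?thesis using that by (intro coeff_eq_0) (auto simp: N_def)
  qed
  then show "q j = 0" using *[of N q] ev j by blast
qed

text \<open>Take a denominator \<open>q\<close> of least degree. If \<open>u\<close> is a section on
  the whole fibre \<open>t = c\<close>, a root \<open>c\<close> of \<open>q\<close> would force all
  numerators to vanish at \<open>c\<close> by fibre independence, and \<open>t - c\<close> would
  cancel. Over infinity the same independence keeps the degrees of the numerators small, since
  otherwise their top coefficients would form a relation there. So the regularity of
  \<open>u\<close> can be read off from its coordinates.\<close>

lemma sbasis_generates:
  assumes sb: "sbasis gd s d" and u: "u \<in> K"
  shows "\<exists>q r. q \<noteq> 0 \<and> (\<forall>\<^sub>F p in G. poly q (t p) * u p = (\<Sum>j<n. poly (r j) (t p) * s j p)) \<and>
    (\<forall>c. (\<forall>P\<in>X - I. t P = c \<longrightarrow> u \<in> sec gd P) \<longrightarrow> poly q c \<noteq> 0) \<and>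
    (\<forall>e. (\<forall>P\<in>I. (\<lambda>p. t p powi (- e) * u p) \<in> sec gd P) \<longrightarrow>
       (\<forall>j<n. r j \<noteq> 0 \<longrightarrow> int (degree (r j)) \<le> int (degree q) + d j + e))"
proof -
  note ind = sbasis_indep[OF sb]
  define Pr where "Pr = (\<lambda>q r. q \<noteq> 0 \<and> (\<forall>\<^sub>F p in G. poly q (t p) * u p = (\<Sum>j<n. poly (r j) (t p) * s j p)))"
  have "\<not> poly_indep G t (s(n := u)) (Suc n)"
  proof
    assume "poly_indep G t (s(n := u)) (Suc n)"
    then have "Suc n \<le> n" by (rule indep_le[rotated]) (use u sbasis_sec(1)[OF sb] in auto)
    then show False by simp
  qed
  then obtain q j where q: "\<forall>\<^sub>F p in G. (\<Sum>i<Suc n. poly (q i) (t p) * (s(n := u)) i p) = 0"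
    and j: "j < Suc n" "q j \<noteq> 0" unfolding poly_indep_def by blast
  have "q n \<noteq> 0"
  proof
    assume "q n = 0"
    then have "\<forall>\<^sub>F p in G. (\<Sum>i<n. poly (q i) (t p) * s i p) = 0" using q by simp
    then have "\<And>i. i < n \<Longrightarrow> q i = 0" using ind poly_indepD by blast
    then show False using j \<open>q n = 0\<close> by (auto simp: less_Suc_eq)
  qed
  moreover have "\<forall>\<^sub>F p in G. poly (- q n) (t p) * u p = (\<Sum>i<n. poly (q i) (t p) * s i p)"
    using q by eventually_elim (simp add: add_eq_0_iff)
  ultimately have "Pr (- q n) q" by (simp add: Pr_def)
  then have "\<exists>k q r. Pr q r \<and> degree q = k" by blast
  then have "\<exists>q r. Pr q r \<and> degree q = (LEAST k. \<exists>q r. Pr q r \<and> degree q = k)" by (rule LeastI_ex)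
  then obtain q r where Pqr: "Pr q r" and dq: "degree q = (LEAST k. \<exists>q r. Pr q r \<and> degree q = k)" by blast
  have least: "degree q \<le> degree q'" if "Pr q' r'" for q' r'
    unfolding dq by (rule Least_le) (use that in blast)
  have q0: "q \<noteq> 0" and eq: "\<forall>\<^sub>F p in G. poly q (t p) * u p = (\<Sum>j<n. poly (r j) (t p) * s j p)"
    using Pqr by (auto simp: Pr_def)
  have root: "poly q c \<noteq> 0" if c: "\<And>P. P \<in> X - I \<Longrightarrow> t P = c \<Longrightarrow> u \<in> sec gd P" for c
  proof
    assume "poly q c = 0"
    then obtain q1 where q1: "q = [:- c, 1:] * q1" by (auto simp: poly_eq_0_iff_dvd elim: dvdE)
    have "\<exists>r1. r j = [:poly (r j) c:] + [:- c, 1:] * r1" for j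
    proof -
      have "poly (r j - [:poly (r j) c:]) c = 0" by simp
      then obtain r1 where "r j - [:poly (r j) c:] = [:- c, 1:] * r1"
        unfolding poly_eq_0_iff_dvd by (elim dvdE)
      then show ?thesis by (metis diff_add_cancel add.commute)
    qed
    then obtain r1 where r1: "\<And>j. r j = [:poly (r j) c:] + [:- c, 1:] * r1 j" by metis
    define rc where "rc = (\<lambda>j. poly (r j) c)"
    have r1': "poly (r j) x = rc j + (x - c) * poly (r1 j) x" for j x
      by (subst r1) (simp add: algebra_simps rc_def)
    have z: "rc j = 0" if "j < n" for j
    proof (rule sbasis_fin[OF sb _ that, of c rc])
      fix P assume P: "P \<in> X - I" "t P = c"
      have "(\<lambda>p. poly q1 (t p) * u p - (\<Sum>j<n. poly (r1 j) (t p) * s j p)) \<in> sec gd P"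
        by (intro sec_diff sec_sum sec_smult R_poly t_R P sbasis_sec[OF sb] c) (use P in auto)
      moreover have "\<forall>\<^sub>F p in G. poly q1 (t p) * u p - (\<Sum>j<n. poly (r1 j) (t p) * s j p)
          = inverse (t p - c) * (\<Sum>j<n. rc j * s j p)"
        using eq t_neq[of c]
      proof eventually_elim
        case (elim p)
        have "(t p - c) * (poly q1 (t p) * u p) = (\<Sum>j<n. rc j * s j p) +
            (t p - c) * (\<Sum>j<n. poly (r1 j) (t p) * s j p)"
          using elim(1) unfolding q1 r1' by (simp add: sum.distrib sum_subtractf sum_distrib_left algebra_simps)
        then show ?case using elim(2) by (simp add: field_simps)
      qed
      ultimately show "(\<lambda>p. inverse (t p - c) * (\<Sum>j<n. rc j * s j p)) \<in> sec gd P" by (rule sec_cong)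
    qed
    have "Pr q1 r1" unfolding Pr_def
    proof
      show "q1 \<noteq> 0" using q0 q1 by auto
      show "\<forall>\<^sub>F p in G. poly q1 (t p) * u p = (\<Sum>j<n. poly (r1 j) (t p) * s j p)"
        using eq t_neq[of c]
      proof eventually_elim
        case (elim p)
        have "(\<Sum>j<n. poly (r j) (t p) * s j p) = (t p - c) * (\<Sum>j<n. poly (r1 j) (t p) * s j p)"
          unfolding sum_distrib_left by (rule sum.cong) (use r1' z in auto)
        then have "(t p - c) * (poly q1 (t p) * u p) = (t p - c) * (\<Sum>j<n. poly (r1 j) (t p) * s j p)"
          using elim(1) unfolding q1 by (simp add: algebra_simps)
        then show ?case using elim(2) by simp
      qed
    qed
    then have "degree q \<le> degree q1" by (rule least)
    moreover have "degree q = Suc (degree q1)" unfolding q1 using q0 q1 by (subst degree_mult_eq) auto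
    ultimately show False by simp
  qed
  have inf: "int (degree (r j)) \<le> int (degree q) + d j + e"
    if e: "\<And>P. P \<in> I \<Longrightarrow> (\<lambda>p. t p powi (- e) * u p) \<in> sec gd P" and j: "j < n" "r j \<noteq> 0" for e j
  proof (rule ccontr)
    assume big: "\<not> int (degree (r j)) \<le> int (degree q) + d j + e"
    \<comment> \<open>\<open>M\<close> is the largest weight of a numerator at infinity;
      \<open>b\<close> will collect the coefficients in that weight.\<close>
    define S where "S = {i. i < n \<and> r i \<noteq> 0}"
    define M where "M = Max ((\<lambda>i. int (degree (r i)) - d i) ` S)"
    have S: "finite S" "S \<noteq> {}" using j by (auto simp: S_def)
    have M_ge: "int (degree (r i)) - d i \<le> M" if "i < n" "r i \<noteq> 0" for i
      unfolding M_def using S that by (intro Max_ge) (auto simp: S_def)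
    have "M \<in> (\<lambda>i. int (degree (r i)) - d i) ` S" unfolding M_def using S by (intro Max_in) auto
    then obtain i0 where i0: "i0 < n" "r i0 \<noteq> 0" "M = int (degree (r i0)) - d i0" by (auto simp: S_def)
    have MD: "int (degree q) + e < M" using M_ge[OF j] big by linarith
    define b where "b = (\<lambda>i. if r i = 0 then 0 else coeff (r i) (nat (M + d i)))"
    have "b i0 = 0"
    proof (rule sbasis_inf[OF sb _ i0(1), of b])
      fix P assume P: "P \<in> I"
      then have PX: "P \<in> X" by (rule I_X)
      define v where "v = (\<lambda>i p. if r i = 0 then 0 else
         t p * (inverse (t p) ^ nat (M + d i) * poly (r i) (t p) - coeff (r i) (nat (M + d i))))"
      have v: "v i \<in> R P" if "i < n" for i
      proof (cases "r i = 0")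
        case True then show ?thesis using R_const[OF PX] by (simp add: v_def)
      next
        case False
        have "degree (r i) \<le> nat (M + d i)" using M_ge[OF that False] by linarith
        from inf_poly(2)[OF P this] show ?thesis using False by (simp add: v_def)
      qed
      \<comment> \<open>\<open>M\<close> exceeds \<open>degree q + e\<close>, so a spare power of
        \<open>inverse t\<close> can absorb the factor \<open>t\<close>; hence the
        \<open>- 1\<close>.\<close>
      define k where "k = nat (M - int (degree q) - e) - 1"
      have "(\<lambda>p. inverse (t p) ^ k * (inverse (t p) ^ degree q * poly q (t p)) * (t p powi (- e) * u p)
          - (\<Sum>i<n. v i p * (t p powi d i * s i p))) \<in> sec gd P" (is "(\<lambda>p. ?l p) \<in> _")
        by (intro sec_diff sec_sum sec_smult[OF PX R_mult[OF PX R_power[OF PX t_inf[OF P]] inf_poly(1)[OF P]]]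
           sec_smult[OF PX v] e P PX sbasis_sec(3)[OF sb]) auto
      moreover have "\<forall>\<^sub>F p in G. ?l p = t p * (\<Sum>i<n. b i * (t p powi d i * s i p))"
        using eq t_neq_0
      proof eventually_elim
        case (elim p)
        have 1: "v i p * (t p powi d i * s i p) =
            t p powi (1 - M) * (poly (r i) (t p) * s i p) - t p * (b i * (t p powi d i * s i p))"
          if "i < n" for i
        proof (cases "r i = 0")
          case True then show ?thesis by (simp add: v_def b_def)
        next
          case False
          have "M + d i \<ge> 0" using M_ge[OF that False] by linarith
          then have "inverse (t p) ^ nat (M + d i) = t p powi (- (M + d i))"
            by (simp add: power_int_minus power_inverse power_int_def add.commute)
          then have "t p * inverse (t p) ^ nat (M + d i) * t p powi d i = t p powi (1 + - (M + d i) + d i)"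
            by (simp only: power_int_add[OF disjI1[OF elim(2)]] power_int_1_right)
          also have "1 + - (M + d i) + d i = 1 - M" by simp
          finally have E: "t p * inverse (t p) ^ nat (M + d i) * t p powi d i = t p powi (1 - M)" .
          show ?thesis unfolding E[symmetric] using False by (simp add: v_def b_def algebra_simps)
        qed
        have "inverse (t p) ^ k * inverse (t p) ^ degree q = t p powi (- int k + - int (degree q))"
          using elim(2) by (subst power_int_add) (auto simp: power_int_minus power_inverse)
        then have "inverse (t p) ^ k * inverse (t p) ^ degree q * t p powi (- e) = t p powi (- int k + - int (degree q) + - e)"
          using elim(2) by (subst power_int_add) auto
        moreover have "- int k + - int (degree q) + - e = 1 - M" using MD by (simp add: k_def)
        ultimately have 2: "inverse (t p) ^ k * inverse (t p) ^ degree q * t p powi (- e) = t p powi (1 - M)" by simp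
        have 3: "(\<Sum>i<n. v i p * (t p powi d i * s i p)) =
            t p powi (1 - M) * (\<Sum>i<n. poly (r i) (t p) * s i p) - t p * (\<Sum>i<n. b i * (t p powi d i * s i p))"
          unfolding sum_distrib_left sum_subtractf[symmetric] by (rule sum.cong) (auto simp: 1)
        have "?l p = t p powi (1 - M) * (poly q (t p) * u p) - (\<Sum>i<n. v i p * (t p powi d i * s i p))"
          unfolding 2[symmetric] by (simp add: mult_ac)
        then show ?case unfolding 3 elim(1) by simp
      qed
      ultimately show "(\<lambda>p. t p * (\<Sum>i<n. b i * (t p powi d i * s i p))) \<in> sec gd P" by (rule sec_cong)
    qed
    then show False using i0 by (simp add: b_def)
  qed
  show ?thesis
    by (intro exI[of _ q] exI[of _ r] conjI allI impI q0 eq; (rule root | rule inf)) simp_all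
qed

end

section \<open>Inequalities between degrees\<close>

context curve_over_line
begin

text \<open>As \<open>u\<close> is a section in all finite fibres, its denominator has no root and
  is therefore constant over an algebraically closed field.\<close>

lemma graded_sec_expand:
  assumes sb: "sbasis gd s d" and u: "u \<in> graded_sec gd e"
  shows "\<exists>r. (\<forall>\<^sub>F p in G. u p = (\<Sum>j<n. poly (r j) (t p) * s j p)) \<and>
    (\<forall>j<n. r j \<noteq> 0 \<longrightarrow> int (degree (r j)) \<le> d j + e)"
proof -
  from sbasis_generates[OF sb graded_sec_K[OF u]]
  obtain q r where q: "q \<noteq> 0" "\<forall>\<^sub>F p in G. poly q (t p) * u p = (\<Sum>j<n. poly (r j) (t p) * s j p)"
    "\<forall>c. (\<forall>P\<in>X - I. t P = c \<longrightarrow> u \<in> sec gd P) \<longrightarrow> poly q c \<noteq> 0"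
    "\<forall>e. (\<forall>P\<in>I. (\<lambda>p. t p powi (- e) * u p) \<in> sec gd P) \<longrightarrow>
       (\<forall>j<n. r j \<noteq> 0 \<longrightarrow> int (degree (r j)) \<le> int (degree q) + d j + e)"
    by (elim exE conjE) (rule that)
  have us: "\<forall>P\<in>X - I. u \<in> sec gd P" "\<forall>P\<in>I. (\<lambda>p. t p powi (- e) * u p) \<in> sec gd P"
    using u by (auto simp: graded_sec_def)
  have "poly q c \<noteq> 0" for c using q(3) us(1) by simp
  then obtain c where c: "c \<noteq> 0" "q = [:c:]" by (rule poly_no_root_const)
  have deg: "int (degree (r j)) \<le> d j + e" if "j < n" "r j \<noteq> 0" for j
    using q(4)[rule_format, of e j] us(2) that c by simp
  show ?thesis
  proof (intro exI[of _ "\<lambda>j. Polynomial.smult (inverse c) (r j)"] conjI allI impI)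
    show "\<forall>\<^sub>F p in G. u p = (\<Sum>j<n. poly (Polynomial.smult (inverse c) (r j)) (t p) * s j p)"
      using q(2)
    proof eventually_elim
      case (elim p)
      have "u p = inverse c * (c * u p)" using c by simp
      also have "\<dots> = (\<Sum>j<n. poly (Polynomial.smult (inverse c) (r j)) (t p) * s j p)"
        using elim c by (simp add: sum_distrib_left mult_ac)
      finally show ?case .
    qed
  next
    fix j assume j: "j < n" "Polynomial.smult (inverse c) (r j) \<noteq> 0"
    then show "int (degree (Polynomial.smult (inverse c) (r j))) \<le> d j + e" using deg[of j] c by simp
  qed
qed

lemma graded_sec_mult:
  assumes u: "u \<in> graded_sec (\<lambda>_ _. 1) e" and v: "v \<in> graded_sec gd e'"
  shows "(\<lambda>p. u p * v p) \<in> graded_sec gd (e + e')"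
  unfolding graded_sec_def
proof (intro CollectI conjI ballI)
  show "(\<lambda>p. u p * v p) \<in> K" using u v by (intro K_mult graded_sec_K)
next
  fix P assume P: "P \<in> X - I"
  then show "(\<lambda>p. u p * v p) \<in> sec gd P"
    using u v by (intro sec_smult) (auto simp: graded_sec_def sec_one)
next
  fix P assume P: "P \<in> I"
  have "(\<lambda>p. (t p powi (- e) * u p) * (t p powi (- e') * v p)) \<in> sec gd P"
    by (rule sec_smult) (use P u v I_X sec_one in \<open>auto simp: graded_sec_def\<close>)
  moreover have "\<forall>\<^sub>F p in G. (t p powi (- e) * u p) * (t p powi (- e') * v p) = t p powi (- (e + e')) * (u p * v p)"
    using t_neq_0
  proof eventually_elim
    case (elim p)
    have "t p powi (- (e + e')) = t p powi (- e) * t p powi (- e')"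
      using power_int_add[of "t p" "- e" "- e'"] elim by simp
    then show ?case by (simp add: mult_ac)
  qed
  ultimately show "(\<lambda>p. t p powi (- (e + e')) * (u p * v p)) \<in> sec gd P" by (rule sec_cong)
qed

lemma sbasis_nonzero:
  assumes "sbasis gd s d" "j < n"
  shows "\<forall>\<^sub>F p in G. s j p \<noteq> 0"
proof (rule ccontr)
  assume "\<not> ?thesis"
  then have "\<forall>\<^sub>F p in G. s j p = 0" using K_cases[OF sbasis_sec(1)[OF assms]] by simp
  then have "\<forall>\<^sub>F p in G. (\<Sum>i<n. poly (if i = j then 1 else 0) (t p) * s i p) = 0"
  proof eventually_elim
    case (elim p)
    show ?case by (rule sum.neutral) (use elim in auto)
  qed
  then have "(if j = j then 1 else 0 :: 'k poly) = 0" by (rule poly_indepD[OF sbasis_indep[OF assms(1)]]) (rule assms(2))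
  then show False by simp
qed

text \<open>
  A splitting of the structure sheaf bounds the negative part of its degrees through \<open>H\<^sup>1\<close>: the
  functions \<open>t\<^sup>-\<^sup>k x\<^sub>j\<close> with \<open>0 < k < - e\<^sub>j\<close> are independent modulo functions regular
  over one of the two standard charts. The constant function \<open>1\<close> provides a nonnegative degree.
\<close>

lemma structure_degrees:
  assumes sb: "sbasis (\<lambda>_ _. 1) x e"
  shows "(\<Sum>j<n. - e j) \<le> int g + int n - 1"
proof -
  define A where "A = (SIGMA j:{..<n}. {0<..<nat (- e j)})"
  have finA: "finite A" by (simp add: A_def)
  obtain h where h: "bij_betw h {..<card A} A"
    using ex_bij_betw_nat_finite[OF finA] by (auto simp: atLeast0LessThan)
  define w where "w = (\<lambda>i p. inverse (t p) ^ snd (h i) * x (fst (h i)) p)"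
  have hA: "h i \<in> A" if "i < card A" for i using h that by (auto simp: bij_betw_def)
  note ind = sbasis_indep[OF sb]
  have "card A \<le> g"
  proof (rule genus_bound[of "card A" w])
    fix i P assume i: "i < card A" and P: "P \<in> X - I" "t P \<noteq> 0"
    have "fst (h i) < n" using hA[OF i] by (auto simp: A_def)
    then have "x (fst (h i)) \<in> R P" using sbasis_sec(2)[OF sb _ P(1)] P(1) by (simp add: sec_one)
    moreover have "(\<lambda>p. inverse (t p)) \<in> R P" using t_inverse[OF P] by simp
    ultimately show "w i \<in> R P" unfolding w_def using P by (intro R_mult R_power) auto
  next
    fix a u v
    assume u: "\<And>P. P \<in> X - I \<Longrightarrow> u \<in> R P"
      and v: "\<And>P. P \<in> X \<Longrightarrow> P \<in> I \<or> t P \<noteq> 0 \<Longrightarrow> v \<in> R P"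
      and ev: "\<forall>\<^sub>F p in G. (\<Sum>i<card A. a i * w i p) = u p + v p"
    define a' where "a' = (\<lambda>y. a (the_inv_into {..<card A} h y))"
    have a': "a' (h i) = a i" if "i < card A" for i
      using h that by (simp add: a'_def the_inv_into_f_f bij_betw_def)
    have "(\<Sum>i<card A. a i * w i p) = (\<Sum>y\<in>A. a' y * (inverse (t p) ^ snd y * x (fst y) p))" for p
      using sum.reindex_bij_betw[OF h, of "\<lambda>y. a' y * (inverse (t p) ^ snd y * x (fst y) p)", symmetric]
      by (simp add: a' w_def)
    then have sumA: "(\<Sum>i<card A. a i * w i p) = (\<Sum>j<n. \<Sum>k\<in>{0<..<nat (- e j)}. a' (j, k) * (inverse (t p) ^ k * x j p))" for p
      unfolding A_def by (simp add: sum.Sigma split_beta)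
    have wK: "(\<lambda>p. \<Sum>i<card A. a i * w i p) \<in> K"
      unfolding w_def
    proof (intro K_sum K_mult K_const K_power K_inverse t_K sbasis_sec(1)[OF sb])
      fix i assume "i \<in> {..<card A}"
      then have "h i \<in> A" by (simp add: hA)
      then show "fst (h i) < n" by (auto simp: A_def)
    qed
    \<comment> \<open>Regularity at one point shows that \<open>u\<close> or \<open>v\<close> is
      rational; the equation then gives the other.\<close>
    have "u \<in> K \<or> v \<in> K"
    proof (cases "X = {}")
      case True
      have "\<exists>c. \<forall>\<^sub>F p in G. u p = c" by (rule global_const) (use True in simp)
      then obtain c where "\<forall>\<^sub>F p in G. u p = c" by (rule exE)
      then have "\<forall>\<^sub>F p in G. c = u p" by eventually_elim simp
      then have "u \<in> K" by (rule K_cong[OF K_const])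
      then show ?thesis by (rule disjI1)
    next
      case False
      then obtain P where P: "P \<in> X" by auto
      then show ?thesis
        using R_K[OF P u] R_K[OF P v[OF P]] by (cases "P \<in> I") auto
    qed
    moreover have "v \<in> K" if "u \<in> K"
      by (rule K_cong[OF K_diff[OF wK that]]) (use ev in \<open>eventually_elim, simp\<close>)
    moreover have "u \<in> K" if "v \<in> K"
      by (rule K_cong[OF K_diff[OF wK that]]) (use ev in \<open>eventually_elim, simp\<close>)
    ultimately have uK: "u \<in> K" and vK: "v \<in> K" by blast+
    \<comment> \<open>\<open>u\<close> has poles only over infinity, so its denominator is constant;
      \<open>v\<close> may also have poles over \<open>t = 0\<close> but nowhere else, so its
      denominator is a monomial.\<close>
    from sbasis_generates[OF sb uK]
    obtain q r where q: "q \<noteq> 0" "\<forall>\<^sub>F p in G. poly q (t p) * u p = (\<Sum>j<n. poly (r j) (t p) * x j p)"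
      "\<forall>c. (\<forall>P\<in>X - I. t P = c \<longrightarrow> u \<in> sec (\<lambda>_ _. 1) P) \<longrightarrow> poly q c \<noteq> 0"
      by (elim exE conjE) (rule that)
    have "poly q c \<noteq> 0" for c using q(3) u sec_one by auto
    then obtain c where c: "c \<noteq> 0" "q = [:c:]" by (rule poly_no_root_const)
    from sbasis_generates[OF sb vK]
    obtain q' r' where q': "q' \<noteq> 0" "\<forall>\<^sub>F p in G. poly q' (t p) * v p = (\<Sum>j<n. poly (r' j) (t p) * x j p)"
      "\<forall>c. (\<forall>P\<in>X - I. t P = c \<longrightarrow> v \<in> sec (\<lambda>_ _. 1) P) \<longrightarrow> poly q' c \<noteq> 0"
      "\<forall>e'. (\<forall>P\<in>I. (\<lambda>p. t p powi (- e') * v p) \<in> sec (\<lambda>_ _. 1) P) \<longrightarrow>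
         (\<forall>j<n. r' j \<noteq> 0 \<longrightarrow> int (degree (r' j)) \<le> int (degree q') + e j + e')"
      by (elim exE conjE) (rule that)
    have "poly q' c \<noteq> 0" if "c \<noteq> 0" for c using q'(3) v sec_one that by auto
    with q'(1) obtain c' m where c': "c' \<noteq> 0" "q' = monom c' m" by (rule poly_single_root)
    have deg: "int (degree (r' j)) \<le> int m + e j" if "j < n" "r' j \<noteq> 0" for j
    proof -
      have "\<forall>P\<in>I. (\<lambda>p. t p powi (- 0) * v p) \<in> sec (\<lambda>_ _. 1) P" using v I_X sec_one by auto
      then have "int (degree (r' j)) \<le> int (degree q') + e j + 0" using q'(4) that by blast
      then show ?thesis using c' by (simp add: degree_monom_eq)
    qed
    define L where "L = (\<Sum>j<n. nat (- e j))"
    define M where "M = m + L"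
    have kL: "k \<le> L" if "j < n" "k \<in> {0<..<nat (- e j)}" for j k
    proof -
      have "nat (- e j) \<le> L" unfolding L_def using that by (intro member_le_sum) auto
      then show ?thesis using that by auto
    qed
    \<comment> \<open>The coordinate at \<open>x j\<close> of the assumed relation, multiplied by
      \<open>c * c' * t^M\<close> to clear all denominators.\<close>
    define D where "D = (\<lambda>j. (\<Sum>k\<in>{0<..<nat (- e j)}. monom (c * c' * a' (j, k)) (M - k))
        - (monom c' M * r j + monom c L * r' j))"
    have D0: "D j = 0" if "j < n" for j
    proof (rule poly_indepD[OF ind _ that])
      show "\<forall>\<^sub>F p in G. (\<Sum>j<n. poly (D j) (t p) * x j p) = 0"
        using q(2) q'(2) ev t_neq_0
      proof eventually_elim
        case (elim p)
        have 1: "(\<Sum>j<n. (\<Sum>k\<in>{0<..<nat (- e j)}. c * c' * a' (j, k) * t p ^ (M - k)) * x j p)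
            = c * c' * t p ^ M * (\<Sum>i<card A. a i * w i p)"
          unfolding sumA sum_distrib_left sum_distrib_right
        proof (intro sum.cong refl)
          fix j k assume "j \<in> {..<n}" "k \<in> {0<..<nat (- e j)}"
          then have "k \<le> M" using kL[of j k] by (simp add: M_def)
          then have "t p ^ (M - k) = t p ^ M * inverse (t p) ^ k"
            using elim(4) by (simp add: power_diff field_simps)
          then show "c * c' * a' (j, k) * t p ^ (M - k) * x j p
              = c * c' * t p ^ M * (a' (j, k) * (inverse (t p) ^ k * x j p))"
            by (simp add: mult_ac)
        qed
        have 2: "(\<Sum>j<n. poly (monom c' M * r j) (t p) * x j p) = c' * t p ^ M * (c * u p)"
          using elim(1) c(2) by (simp add: poly_monom sum_distrib_left mult_ac)
        have "(\<Sum>j<n. poly (monom c L * r' j) (t p) * x j p) = c * t p ^ L * (poly q' (t p) * v p)"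
          unfolding elim(2) by (simp add: poly_monom sum_distrib_left mult_ac)
        also have "\<dots> = c * c' * t p ^ M * v p" unfolding c'(2) M_def by (simp add: poly_monom power_add)
        finally have 3: "(\<Sum>j<n. poly (monom c L * r' j) (t p) * x j p) = c * c' * t p ^ M * v p" .
        have "(\<Sum>j<n. poly (D j) (t p) * x j p) =
           (\<Sum>j<n. (\<Sum>k\<in>{0<..<nat (- e j)}. c * c' * a' (j, k) * t p ^ (M - k)) * x j p)
           - ((\<Sum>j<n. poly (monom c' M * r j) (t p) * x j p) + (\<Sum>j<n. poly (monom c L * r' j) (t p) * x j p))"
          unfolding sum.distrib[symmetric] sum_subtractf[symmetric]
          by (rule sum.cong) (auto simp: D_def poly_sum poly_monom algebra_simps)
        also have "\<dots> = 0" unfolding 1 2 3 elim(3) by (simp add: algebra_simps)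
        finally show ?case .
      qed
    qed
    have a0: "a' (j, k) = 0" if j: "j < n" and k: "k \<in> {0<..<nat (- e j)}" for j k
    proof -
      \<comment> \<open>In degree \<open>M - k\<close> only the wanted term survives: the
        contribution of \<open>u\<close> starts in degree \<open>M\<close>, and that of
        \<open>v\<close> ends by \<open>M + e j\<close>, which is below
        \<open>M - k\<close>.\<close>
      have kM: "k \<le> L" "k \<le> M" "0 < k" using kL[OF that] k by (auto simp: M_def)
      have 1: "coeff (\<Sum>k\<in>{0<..<nat (- e j)}. monom (c * c' * a' (j, k)) (M - k)) (M - k) = c * c' * a' (j, k)"
      proof -
        have "coeff (\<Sum>k\<in>{0<..<nat (- e j)}. monom (c * c' * a' (j, k)) (M - k)) (M - k)
            = (\<Sum>k'\<in>{0<..<nat (- e j)}. if k' = k then c * c' * a' (j, k') else 0)"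
          unfolding coeff_sum
        proof (intro sum.cong refl)
          fix k' assume "k' \<in> {0<..<nat (- e j)}"
          then have "k' \<le> M" using kL[OF j, of k'] by (simp add: M_def)
          then show "coeff (monom (c * c' * a' (j, k')) (M - k')) (M - k) = (if k' = k then c * c' * a' (j, k') else 0)"
            using kM by auto
        qed
        then show ?thesis using k by simp
      qed
      have 2: "coeff (monom c' M * r j) (M - k) = 0"
        using kM by (simp add: coeff_monom_mult)
      have 3: "coeff (monom c L * r' j) (M - k) = 0"
      proof (cases "L \<le> M - k \<and> r' j \<noteq> 0")
        case True
        then have "k \<le> m" using kM unfolding M_def by linarith
        then have "int (M - k - L) = int m - int k" by (simp add: M_def)
        moreover have "int k < - e j" using k by auto
        ultimately have "degree (r' j) < M - k - L" using deg[OF j] True by linarith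
        then show ?thesis by (simp add: coeff_monom_mult coeff_eq_0)
      next
        case False then show ?thesis by (auto simp: coeff_monom_mult)
      qed
      have "coeff (D j) (M - k) = c * c' * a' (j, k)"
        unfolding D_def coeff_diff coeff_add 1 2 3 by simp
      then show ?thesis using D0[OF j] c c' by simp
    qed
    show "\<forall>i<card A. a i = 0"
    proof (intro allI impI)
      fix i assume i: "i < card A"
      obtain j k where jk: "h i = (j, k)" by (cases "h i")
      then have "j < n" "k \<in> {0<..<nat (- e j)}" using hA[OF i] by (auto simp: A_def)
      then show "a i = 0" using a0 a'[OF i] jk by simp
    qed
  qed
  moreover have "card A = (\<Sum>j<n. nat (- e j) - 1)" by (simp add: A_def)
  ultimately have bound: "(\<Sum>j<n. int (nat (- e j) - 1)) \<le> int g" by (simp flip: of_nat_sum)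
  have "(\<lambda>_. 1) \<in> graded_sec (\<lambda>_ _. 1) 0"
    by (auto simp: graded_sec_def sec_one K_const R_const I_X)
  from graded_sec_expand[OF sb this]
  obtain r where r: "\<forall>\<^sub>F p in G. 1 = (\<Sum>j<n. poly (r j) (t p) * x j p)"
    "\<forall>j<n. r j \<noteq> 0 \<longrightarrow> int (degree (r j)) \<le> e j + 0" by (elim exE conjE) (rule that)
  have "\<exists>j<n. r j \<noteq> 0"
  proof (rule ccontr)
    assume z: "\<not> (\<exists>j<n. r j \<noteq> 0)"
    have "\<forall>\<^sub>F p in G. False" using r(1) by eventually_elim (use z in simp)
    then show False using ev_False by simp
  qed
  then obtain j1 where j1: "j1 < n" "0 \<le> e j1" using r(2) by force
  \<comment> \<open>An index with \<open>e j \<ge> 0\<close> provides no class, yet its term on the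
    left is at most \<open>- 1\<close>; at \<open>j1\<close> this gains the final 1.\<close>
  have "(\<Sum>j<n. - e j - 1) \<le> (\<Sum>j<n. int (nat (- e j) - 1) - (if j = j1 then 1 else 0))"
    by (rule sum_mono) (use j1 in auto)
  also have "\<dots> = (\<Sum>j<n. int (nat (- e j) - 1)) - 1" using j1 by (simp add: sum_subtractf)
  finally have "(\<Sum>j<n. - e j) - int n \<le> int g - 1" using bound by (simp add: sum_subtractf)
  then show ?thesis by simp
qed

text \<open>
  The symmetric form sending \<open>(x, y)\<close> to the coefficient of \<open>x y s\<^sub>i\<close> at \<open>s\<^sub>j\<close> is
  nondegenerate, so some permutation only meets nonzero entries of its matrix; an entry can be
  nonzero only if \<open>e\<^sub>a + e\<^sub>b \<le> d\<^sub>j - d\<^sub>i\<close>.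
\<close>

theorem spread_bound:
  assumes gd: "divisor gd" and sb: "sbasis gd s d" and ij: "i < n" "j < n"
  shows "int n * (d i - d j) \<le> 2 * int g - 2 + 2 * int n"
proof -
  obtain x e where xb: "sbasis (\<lambda>_ _. 1) x e" using sbasis_exists[OF divisor_one] by blast
  have "\<exists>r. (\<forall>\<^sub>F p in G. x a p * (x b p * s i p) = (\<Sum>m<n. poly (r m) (t p) * s m p)) \<and>
      (\<forall>m<n. r m \<noteq> 0 \<longrightarrow> int (degree (r m)) \<le> d m + (- e a + (- e b + - d i)))"
    if "a < n" "b < n" for a b
  proof -
    have "(\<lambda>p. x a p * (x b p * s i p)) \<in> graded_sec gd (- e a + (- e b + - d i))"
      by (intro graded_sec_mult) (use xb sb that ij in \<open>auto simp: sbasis_def\<close>)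
    from graded_sec_expand[OF sb this] show ?thesis .
  qed
  then have "\<forall>a b. \<exists>r. a < n \<longrightarrow> b < n \<longrightarrow> (\<forall>\<^sub>F p in G. x a p * (x b p * s i p) = (\<Sum>m<n. poly (r m) (t p) * s m p)) \<and>
      (\<forall>m<n. r m \<noteq> 0 \<longrightarrow> int (degree (r m)) \<le> d m + (- e a + (- e b + - d i)))"
    by simp
  from this[unfolded choice_iff]
  obtain r where r0: "\<forall>a b. a < n \<longrightarrow> b < n \<longrightarrow> (\<forall>\<^sub>F p in G. x a p * (x b p * s i p) = (\<Sum>m<n. poly (r a b m) (t p) * s m p)) \<and>
      (\<forall>m<n. r a b m \<noteq> 0 \<longrightarrow> int (degree (r a b m)) \<le> d m + (- e a + (- e b + - d i)))"
    by (rule exE)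
  have r: "\<And>a b. a < n \<Longrightarrow> b < n \<Longrightarrow>
      (\<forall>\<^sub>F p in G. x a p * (x b p * s i p) = (\<Sum>m<n. poly (r a b m) (t p) * s m p))"
    "\<And>a b m. a < n \<Longrightarrow> b < n \<Longrightarrow> m < n \<Longrightarrow> r a b m \<noteq> 0 \<Longrightarrow>
        int (degree (r a b m)) \<le> d m + (- e a + (- e b + - d i))"
    using r0 by simp_all
  have "\<exists>\<pi>. \<pi> permutes {..<n} \<and> (\<forall>a<n. r a (\<pi> a) j \<noteq> 0)"
  proof (rule nonsingular_imp_permutation, rule ccontr)
    fix v :: "nat \<Rightarrow> 'k poly"
    assume v: "\<And>a. a < n \<Longrightarrow> (\<Sum>b<n. r a b j * v b) = 0" and nz: "\<not> (\<forall>b<n. v b = 0)"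
    \<comment> \<open>A nonzero kernel vector is the coordinate vector of a nonzero
      function.\<close>
    define w where "w = (\<lambda>p. \<Sum>b<n. poly (v b) (t p) * x b p)"
    have wK: "w \<in> K" unfolding w_def by (intro K_sum K_mult K_poly t_K sbasis_sec(1)[OF xb]) auto
    have w0: "\<forall>\<^sub>F p in G. w p \<noteq> 0"
    proof (rule ccontr)
      assume "\<not> ?thesis"
      then have "\<forall>\<^sub>F p in G. w p = 0" using K_cases[OF wK] by simp
      then have "\<forall>\<^sub>F p in G. (\<Sum>b<n. poly (v b) (t p) * x b p) = 0" by (simp add: w_def)
      then show False using nz poly_indepD[OF sbasis_indep[OF xb]] by blast
    qed
    \<comment> \<open>Chosen so that \<open>y * w * s i = s j\<close>: expanding \<open>y\<close> in
      the \<open>x a\<close> turns \<open>s j\<close> into a combination whose coefficient at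
      \<open>s j\<close> vanishes by the choice of \<open>v\<close>.\<close>
    define y where "y = (\<lambda>p. s j p * inverse (w p * s i p))"
    have yK: "y \<in> K" unfolding y_def by (intro K_mult K_inverse wK sbasis_sec(1)[OF sb] ij)
    from sbasis_generates[OF xb yK]
    obtain q f where q: "q \<noteq> 0" "\<forall>\<^sub>F p in G. poly q (t p) * y p = (\<Sum>a<n. poly (f a) (t p) * x a p)"
      by (elim exE conjE) (rule that)
    \<comment> \<open>Coordinates of the difference between the two expansions of
      \<open>q(t) * s j\<close>.\<close>
    define c where "c = (\<lambda>m. (\<Sum>a<n. \<Sum>b<n. f a * v b * r a b m) - (if m = j then q else 0))"
    have "c j = 0"
    proof (rule poly_indepD[OF sbasis_indep[OF sb] _ ij(2)])
      have "\<forall>\<^sub>F p in G. \<forall>a\<in>{..<n}. \<forall>b\<in>{..<n}. x a p * (x b p * s i p) = (\<Sum>m<n. poly (r a b m) (t p) * s m p)"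
        by (intro eventually_ball_finite ballI r(1)) auto
      then show "\<forall>\<^sub>F p in G. (\<Sum>m<n. poly (c m) (t p) * s m p) = 0"
        using q(2) w0 sbasis_nonzero[OF sb ij(1)]
      proof eventually_elim
        case (elim p)
        have yw: "y p * (w p * s i p) = s j p" using elim(3,4) by (simp add: y_def field_simps)
        have "poly q (t p) * s j p = poly q (t p) * y p * (w p * s i p)"
          unfolding yw[symmetric] by (simp only: mult.assoc)
        also have "\<dots> = (\<Sum>a<n. \<Sum>b<n. poly (f a) (t p) * poly (v b) (t p) * (x a p * (x b p * s i p)))"
          unfolding elim(2) w_def mult.assoc[symmetric] sum_product sum_distrib_right
          by (simp add: sum_distrib_left mult_ac)
        also have "\<dots> = (\<Sum>a<n. \<Sum>b<n. \<Sum>m<n. poly (f a * v b * r a b m) (t p) * s m p)"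
        proof (intro sum.cong refl)
          fix a b assume "a \<in> {..<n}" "b \<in> {..<n}"
          then have E: "x a p * (x b p * s i p) = (\<Sum>m<n. poly (r a b m) (t p) * s m p)"
            using elim(1) by blast
          show "poly (f a) (t p) * poly (v b) (t p) * (x a p * (x b p * s i p))
              = (\<Sum>m<n. poly (f a * v b * r a b m) (t p) * s m p)"
            unfolding E sum_distrib_left by (simp add: mult_ac)
        qed
        also have "\<dots> = (\<Sum>a<n. \<Sum>m<n. \<Sum>b<n. poly (f a * v b * r a b m) (t p) * s m p)"
          by (intro sum.cong refl sum.swap)
        also have "\<dots> = (\<Sum>m<n. \<Sum>a<n. \<Sum>b<n. poly (f a * v b * r a b m) (t p) * s m p)"
          by (rule sum.swap)
        finally have 1: "poly q (t p) * s j p = \<dots>" .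
        have "(\<Sum>m<n. poly (c m) (t p) * s m p) = (\<Sum>m<n. \<Sum>a<n. \<Sum>b<n. poly (f a * v b * r a b m) (t p) * s m p)
            - (\<Sum>m<n. if m = j then poly q (t p) * s j p else 0)"
          unfolding sum_subtractf[symmetric]
          by (rule sum.cong) (auto simp: c_def poly_sum sum_distrib_right left_diff_distrib)
        also have "\<dots> = 0" unfolding 1[symmetric] using ij by simp
        finally show ?case .
      qed
    qed
    moreover have "(\<Sum>a<n. \<Sum>b<n. f a * v b * r a b j) = 0"
    proof (rule sum.neutral, rule ballI)
      fix a assume "a \<in> {..<n}"
      then have "f a * (\<Sum>b<n. r a b j * v b) = 0" using v by simp
      then show "(\<Sum>b<n. f a * v b * r a b j) = 0" by (simp add: sum_distrib_left mult_ac)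
    qed
    ultimately show False using q(1) by (simp add: c_def)
  qed
  then obtain \<pi> where \<pi>: "\<pi> permutes {..<n}" "\<And>a. a < n \<Longrightarrow> r a (\<pi> a) j \<noteq> 0" by blast
  have "- e a + - e (\<pi> a) \<ge> d i - d j" if a: "a < n" for a
  proof -
    have "\<pi> a < n" using \<pi>(1) a permutes_in_image[OF \<pi>(1), of a] by simp
    from r(2)[OF a this ij(2) \<pi>(2)[OF a]] show ?thesis by linarith
  qed
  \<comment> \<open>The permuted degrees contribute the same sum a second time, which accounts for
    the factor 2 in the bound.\<close>
  then have "(\<Sum>a<n. d i - d j) \<le> (\<Sum>a<n. - e a + - e (\<pi> a))" by (intro sum_mono) auto
  also have "\<dots> = (\<Sum>a<n. - e a) + (\<Sum>a<n. - e (\<pi> a))" by (rule sum.distrib)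
  also have "(\<Sum>a<n. - e (\<pi> a)) = (\<Sum>a<n. - e a)" using sum.permute[OF \<pi>(1), of "\<lambda>a. - e a"] by (simp add: o_def)
  finally show ?thesis using structure_degrees[OF xb] by simp
qed

end

section \<open>Homogeneous forms\<close>

text \<open>Homogeneous polynomials are used through the functions they define, so that closure
  under sums and products needs no bookkeeping of coefficients.\<close>

definition form :: "nat \<Rightarrow> (('n::finite \<Rightarrow> 'k::field) \<Rightarrow> 'k) \<Rightarrow> bool" where
  "form e \<phi> \<longleftrightarrow> (\<exists>F. homogeneous e F \<and> \<phi> = poly_eval F)"

lemma formI: "homogeneous e F \<Longrightarrow> form e (poly_eval F)"
  by (auto simp: form_def)

definition mono_eval :: "('n::finite \<Rightarrow>\<^sub>0 nat) \<Rightarrow> ('n \<Rightarrow> 'k::field) \<Rightarrow> 'k" where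
  "mono_eval m x = (\<Prod>i\<in>UNIV. x i ^ Poly_Mapping.lookup m i)"

lemma mono_eval_add: "mono_eval (m + m') x = mono_eval m x * mono_eval m' x"
  by (simp add: mono_eval_def lookup_add power_add prod.distrib)

lemma poly_eval_mono: "poly_eval F x = (\<Sum>m\<in>Poly_Mapping.keys F. Poly_Mapping.lookup F m * mono_eval m x)"
  by (simp add: poly_eval_def mono_eval_def)

lemma poly_eval_add: "poly_eval (F + G) x = poly_eval F x + poly_eval G x"
  unfolding poly_eval_mono
  by (rule setsum_keys_plus_distrib[where f = "\<lambda>m c. c * mono_eval m x"]) (auto simp: algebra_simps)

lemma poly_eval_zero [simp]: "poly_eval 0 x = 0"
  by (simp add: poly_eval_mono)

lemma poly_eval_single: "poly_eval (Poly_Mapping.single m c) x = c * mono_eval m x"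
  by (simp add: poly_eval_mono)

lemma poly_eval_sum: "poly_eval (sum F A) x = (\<Sum>a\<in>A. poly_eval (F a) x)"
  by (induction A rule: infinite_finite_induct) (auto simp: poly_eval_add)

lemma poly_mapping_eq_sum: "F = (\<Sum>m\<in>Poly_Mapping.keys F. Poly_Mapping.single m (Poly_Mapping.lookup F m))"
proof (rule poly_mapping_eqI)
  fix k
  have "Poly_Mapping.lookup (\<Sum>m\<in>Poly_Mapping.keys F. Poly_Mapping.single m (Poly_Mapping.lookup F m)) k
     = (\<Sum>m\<in>Poly_Mapping.keys F. if m = k then Poly_Mapping.lookup F m else 0)"
    by (simp add: lookup_sum lookup_single when_def)
  also have "\<dots> = Poly_Mapping.lookup F k" by (simp add: in_keys_iff)
  finally show "Poly_Mapping.lookup F k = Poly_Mapping.lookup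
    (\<Sum>m\<in>Poly_Mapping.keys F. Poly_Mapping.single m (Poly_Mapping.lookup F m)) k" by simp
qed

lemma poly_eval_mult: "poly_eval (F * G) x = poly_eval F x * poly_eval G x"
proof -
  have "F * G = (\<Sum>m\<in>Poly_Mapping.keys F. \<Sum>m'\<in>Poly_Mapping.keys G.
      Poly_Mapping.single (m + m') (Poly_Mapping.lookup F m * Poly_Mapping.lookup G m'))"
    by (subst poly_mapping_eq_sum[of F], subst poly_mapping_eq_sum[of G]) (simp add: sum_product mult_single)
  then have "poly_eval (F * G) x = (\<Sum>m\<in>Poly_Mapping.keys F. \<Sum>m'\<in>Poly_Mapping.keys G.
      (Poly_Mapping.lookup F m * mono_eval m x) * (Poly_Mapping.lookup G m' * mono_eval m' x))"
    by (simp add: poly_eval_sum poly_eval_single mono_eval_add mult_ac)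
  also have "\<dots> = poly_eval F x * poly_eval G x" by (simp add: poly_eval_mono sum_product)
  finally show ?thesis .
qed

lemma form_add: "form e \<phi> \<Longrightarrow> form e \<psi> \<Longrightarrow> form e (\<lambda>x. \<phi> x + \<psi> x)"
  unfolding form_def
  by (elim exE conjE, rule_tac x = "F + Fa" in exI)
    (auto simp: poly_eval_add homogeneous_def dest: subsetD[OF keys_add])

lemma form_mult:
  assumes "form e \<phi>" "form e' \<psi>" shows "form (e + e') (\<lambda>x. \<phi> x * \<psi> x)"
proof -
  obtain F G where F: "homogeneous e F" "\<phi> = poly_eval F" and G: "homogeneous e' G" "\<psi> = poly_eval G"
    using assms by (auto simp: form_def)
  have "homogeneous (e + e') (F * G)"
    unfolding homogeneous_def
  proof
    fix m assume "m \<in> Poly_Mapping.keys (F * G)"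
    then obtain a b where "m = a + b" "a \<in> Poly_Mapping.keys F" "b \<in> Poly_Mapping.keys G"
      using keys_mult[of F G] by auto
    then show "(\<Sum>i\<in>UNIV. Poly_Mapping.lookup m i) = e + e'"
      using F(1) G(1) by (simp add: homogeneous_def lookup_add sum.distrib)
  qed
  then show ?thesis unfolding form_def F(2) G(2)
    by (intro exI[of _ "F * G"]) (auto simp: poly_eval_mult)
qed

lemma form_zero: "form e (\<lambda>_. 0)"
  unfolding form_def by (rule exI[of _ 0]) (auto simp: homogeneous_def)

lemma form_const: "form 0 (\<lambda>_. c)"
  unfolding form_def
  by (rule exI[of _ "Poly_Mapping.single 0 c"]) (auto simp: homogeneous_def poly_eval_single mono_eval_def fun_eq_iff)

lemma form_coord: "form 1 (\<lambda>x. x i)"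
proof -
  have "mono_eval (Poly_Mapping.single i 1) x = x i" for x :: "('a \<Rightarrow> 'b)"
    by (simp add: mono_eval_def lookup_single when_def if_distrib[of "\<lambda>k. _ ^ k"] cong: if_cong)
  then show ?thesis unfolding form_def
    by (intro exI[of _ "Poly_Mapping.single (Poly_Mapping.single i 1) 1"])
      (auto simp: homogeneous_def poly_eval_single lookup_single when_def)
qed

lemma form_smult: "form e \<phi> \<Longrightarrow> form e (\<lambda>x. c * \<phi> x)"
  using form_mult[OF form_const[of c], of e \<phi>] by simp

lemma form_sum: "(\<And>a. a \<in> A \<Longrightarrow> form e (\<phi> a)) \<Longrightarrow> form e (\<lambda>x. \<Sum>a\<in>A. \<phi> a x)"
  by (induction A rule: infinite_finite_induct) (auto intro: form_zero form_add)

lemma form_power: "form e \<phi> \<Longrightarrow> form (e * k) (\<lambda>x. \<phi> x ^ k)"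
proof (induction k)
  case 0 show ?case using form_const[of 1] by simp
next
  case (Suc k) then show ?case using form_mult[of e \<phi> "e * k" "\<lambda>x. \<phi> x ^ k"] by (simp add: mult_ac)
qed

lemma form_prod: "finite A \<Longrightarrow> (\<And>a. a \<in> A \<Longrightarrow> form 1 (\<phi> a)) \<Longrightarrow> form (card A) (\<lambda>x. \<Prod>a\<in>A. \<phi> a x)"
proof (induction A rule: finite_induct)
  case empty show ?case using form_const[of 1] by simp
next
  case (insert a A) then show ?case using form_mult[of 1 "\<phi> a" "card A"] by simp
qed

lemma form_scale:
  assumes "form e \<phi>" shows "\<phi> (\<lambda>i. c * x i) = c ^ e * \<phi> x"
proof -
  obtain F where F: "homogeneous e F" "\<phi> = poly_eval F" using assms by (auto simp: form_def)
  have "mono_eval m (\<lambda>i. c * x i) = c ^ e * mono_eval m x" if "m \<in> Poly_Mapping.keys F" for m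
  proof -
    have "(\<Sum>i\<in>UNIV. Poly_Mapping.lookup m i) = e" using F(1) that by (simp add: homogeneous_def)
    then show ?thesis by (simp add: mono_eval_def power_mult_distrib prod.distrib power_sum[symmetric])
  qed
  then show ?thesis by (simp add: F(2) poly_eval_mono sum_distrib_left mult_ac)
qed

section \<open>Points and regular functions\<close>

lemma proj_pointE:
  assumes "p \<in> proj_space"
  obtains x where "x \<noteq> (\<lambda>_. 0)" "p = proj_point x" "x \<in> p"
proof -
  obtain x where x: "x \<noteq> (\<lambda>_. 0)" "p = proj_point x" using assms by (auto simp: proj_space_def)
  moreover have "x \<in> proj_point x" unfolding proj_point_def by (auto intro!: exI[of _ 1])
  ultimately show ?thesis using that by auto
qed

lemma proj_point_mem:
  assumes "p \<in> proj_space" "x \<in> p"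
  shows "x \<noteq> (\<lambda>_. 0)" "p = proj_point x"
proof -
  obtain y where y: "y \<noteq> (\<lambda>_. 0)" "p = proj_point y" using assms by (auto elim: proj_pointE)
  then obtain c where c: "c \<noteq> 0" "x = (\<lambda>i. c * y i)" using assms by (auto simp: proj_point_def)
  show "x \<noteq> (\<lambda>_. 0)" using c y by (auto simp: fun_eq_iff)
  show "p = proj_point x"
  proof
    show "p \<subseteq> proj_point x"
    proof
      fix z assume "z \<in> p"
      then obtain b where b: "b \<noteq> 0" "z = (\<lambda>i. b * y i)" using y by (auto simp: proj_point_def)
      then have "z = (\<lambda>i. (b / c) * x i)" using c by auto
      then show "z \<in> proj_point x" using b c unfolding proj_point_def by (auto intro!: exI[of _ "b / c"])
    qed
    show "proj_point x \<subseteq> p"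
    proof
      fix z assume "z \<in> proj_point x"
      then obtain b where b: "b \<noteq> 0" "z = (\<lambda>i. b * x i)" by (auto simp: proj_point_def)
      then have "z = (\<lambda>i. (b * c) * y i)" using c by auto
      then show "z \<in> p" using b c y unfolding proj_point_def by (auto intro!: exI[of _ "b * c"])
    qed
  qed
qed

lemma proj_point_scale:
  assumes "p \<in> proj_space" "x \<in> p" "y \<in> p"
  obtains c where "c \<noteq> 0" "y = (\<lambda>i. c * x i)"
  using proj_point_mem[OF assms(1,2)] assms(3) by (auto simp: proj_point_def)

definition rep :: "('n, 'k::field) pt \<Rightarrow> ('n \<Rightarrow> 'k)" where
  "rep p = (SOME x. x \<in> p)"

lemma rep_mem: "p \<in> proj_space \<Longrightarrow> rep p \<in> p"
  unfolding rep_def by (metis proj_pointE someI_ex)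

lemma form_nonzero_iff:
  assumes "form e \<phi>" "p \<in> proj_space" "x \<in> p"
  shows "(\<forall>y\<in>p. \<phi> y \<noteq> 0) \<longleftrightarrow> \<phi> x \<noteq> 0"
proof
  assume *: "\<phi> x \<noteq> 0"
  show "\<forall>y\<in>p. \<phi> y \<noteq> 0"
  proof
    fix y assume "y \<in> p"
    then obtain c where "c \<noteq> 0" "y = (\<lambda>i. c * x i)" using proj_point_scale assms by blast
    then show "\<phi> y \<noteq> 0" using form_scale[OF assms(1), of c x] * by simp
  qed
qed (use assms in auto)

lemma form_quotient_const:
  assumes "form e \<phi>" "form e \<psi>" "p \<in> proj_space" "x \<in> p" "y \<in> p"
  shows "\<phi> x / \<psi> x = \<phi> y / \<psi> y"
proof -
  obtain c where c: "c \<noteq> 0" "y = (\<lambda>i. c * x i)" using proj_point_scale assms(3-5) by blast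
  then show ?thesis using form_scale[OF assms(1), of c x] form_scale[OF assms(2), of c x] by simp
qed

lemma topspace_zariski: "topspace (zariski :: ('n::finite, 'k::field) pt topology) = proj_space"
proof
  show "topspace (zariski :: ('n, 'k) pt topology) \<subseteq> proj_space"
    unfolding zariski_def by auto
  obtain F :: "('n, 'k) mpoly" where F: "homogeneous 0 F" "(\<lambda>_. 1) = poly_eval F"
    using form_const[of 1] by (auto simp: form_def)
  have "\<exists>e. proj_space = {p \<in> proj_space. \<forall>x\<in>p. poly_eval F x \<noteq> 0} \<and> homogeneous e F"
    using F(1) by (auto simp flip: F(2))
  then have "proj_space \<in> {{p \<in> proj_space. \<forall>x\<in>p. poly_eval (F :: ('n, 'k) mpoly) x \<noteq> 0} | F e. homogeneous e F}"
    by blast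
  then show "proj_space \<subseteq> topspace (zariski :: ('n, 'k) pt topology)"
    unfolding zariski_def by auto
qed

lemma openin_zariski_form:
  assumes "form e \<phi>" shows "openin zariski {p \<in> proj_space. \<forall>x\<in>p. \<phi> x \<noteq> 0}"
  using assms unfolding zariski_def form_def
  by (auto intro!: topology_generated_by_Basis)

lemma openin_form:
  assumes "form e \<phi>" "X \<subseteq> proj_space" shows "openin (zar X) {p \<in> X. \<forall>x\<in>p. \<phi> x \<noteq> 0}"
proof -
  have "{p \<in> X. \<forall>x\<in>p. \<phi> x \<noteq> 0} = {p \<in> proj_space. \<forall>x\<in>p. \<phi> x \<noteq> 0} \<inter> X" using assms(2) by auto
  then show ?thesis using openin_zariski_form[OF assms(1)] by (auto simp: openin_subtopology)
qed

text \<open>Forms multiply, so their nonvanishing loci are closed under intersection and the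
  generating family is already a basis.\<close>

lemma zariski_basis:
  assumes "openin zariski U" "p \<in> U"
  shows "\<exists>e \<phi>. form e \<phi> \<and> (\<forall>x\<in>p. \<phi> x \<noteq> 0) \<and> {q \<in> proj_space. \<forall>x\<in>q. \<phi> x \<noteq> 0} \<subseteq> U"
proof -
  have "generate_topology_on {{p \<in> proj_space. \<forall>x\<in>p. poly_eval F x \<noteq> 0} | F e. homogeneous e F} U"
    using assms(1) unfolding zariski_def by (simp add: openin_topology_generated_by_iff)
  then show ?thesis using assms(2)
  proof (induction arbitrary: p)
    case Empty then show ?case by simp
  next
    case (Int A B)
    obtain e \<phi> where 1: "form e \<phi>" "\<forall>x\<in>p. \<phi> x \<noteq> 0" "{q \<in> proj_space. \<forall>x\<in>q. \<phi> x \<noteq> 0} \<subseteq> A"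
      using Int.IH(1)[of p] Int.prems by auto
    obtain e' \<psi> where 2: "form e' \<psi>" "\<forall>x\<in>p. \<psi> x \<noteq> 0" "{q \<in> proj_space. \<forall>x\<in>q. \<psi> x \<noteq> 0} \<subseteq> B"
      using Int.IH(2)[of p] Int.prems by auto
    show ?case
      by (intro exI[of _ "e + e'"] exI[of _ "\<lambda>x. \<phi> x * \<psi> x"] conjI form_mult 1 2) (use 1 2 in auto)
  next
    case (UN \<A>)
    then obtain A where A: "A \<in> \<A>" "p \<in> A" by auto
    from UN.IH[OF A] obtain e \<phi> where "form e \<phi>" "\<forall>x\<in>p. \<phi> x \<noteq> 0" "{q \<in> proj_space. \<forall>x\<in>q. \<phi> x \<noteq> 0} \<subseteq> A"
      by (elim exE conjE) (rule that)
    then show ?case using A by (intro exI[of _ e] exI[of _ \<phi>]) auto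
  next
    case (Basis A)
    then obtain F e where "A = {p \<in> proj_space. \<forall>x\<in>p. poly_eval F x \<noteq> 0}" "homogeneous e F" by auto
    then show ?case using Basis.prems by (intro exI[of _ e] exI[of _ "poly_eval F"]) (auto intro: formI)
  qed
qed

lemma regular_iff:
  "\<phi> \<in> regular X U \<longleftrightarrow> (\<forall>p. p \<notin> U \<longrightarrow> \<phi> p = 0) \<and>
     (\<forall>p\<in>U. \<exists>V e g h. openin (zar X) V \<and> p \<in> V \<and> V \<subseteq> U \<and> form e g \<and> form e h \<and>
        (\<forall>q\<in>V. \<forall>x\<in>q. h x \<noteq> 0 \<and> \<phi> q = g x / h x))"
proof -
  have "(\<exists>V e G H. openin (zar X) V \<and> p \<in> V \<and> V \<subseteq> U \<and> homogeneous e G \<and> homogeneous e H \<and>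
        (\<forall>q\<in>V. \<forall>x\<in>q. poly_eval H x \<noteq> 0 \<and> \<phi> q = poly_eval G x / poly_eval H x))
      \<longleftrightarrow> (\<exists>V e g h. openin (zar X) V \<and> p \<in> V \<and> V \<subseteq> U \<and> form e g \<and> form e h \<and>
        (\<forall>q\<in>V. \<forall>x\<in>q. h x \<noteq> 0 \<and> \<phi> q = g x / h x))" (is "?A \<longleftrightarrow> ?B") for p
  proof
    assume ?A then show ?B
      by (elim exE conjE) (intro exI conjI; (assumption | rule formI))
  next
    assume ?B
    then obtain V e g h where V: "openin (zar X) V" "p \<in> V" "V \<subseteq> U" "form e g" "form e h"
      "\<forall>q\<in>V. \<forall>x\<in>q. h x \<noteq> 0 \<and> \<phi> q = g x / h x" by (elim exE conjE) (rule that)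
    obtain F F' where "homogeneous e F" "g = poly_eval F" "homogeneous e F'" "h = poly_eval F'"
      using V(4,5) by (auto simp: form_def)
    with V show ?A by (intro exI[of _ V] exI[of _ e] exI[of _ F] exI[of _ F'] conjI) auto
  qed
  then show ?thesis unfolding regular_def by simp
qed

lemma regular_zero_outside: "\<phi> \<in> regular X U \<Longrightarrow> p \<notin> U \<Longrightarrow> \<phi> p = 0"
  by (simp add: regular_def)

lemma regularD:
  assumes "\<phi> \<in> regular X U" "p \<in> U"
  shows "\<exists>V e g h. openin (zar X) V \<and> p \<in> V \<and> V \<subseteq> U \<and> form e g \<and> form e h \<and>
        (\<forall>q\<in>V. \<forall>x\<in>q. h x \<noteq> 0) \<and> (\<forall>q\<in>V. \<forall>x\<in>q. \<phi> q = g x / h x)"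
  using bspec[OF conjunct2[OF assms(1)[unfolded regular_iff]] assms(2)] by (simp only: ball_conj_distrib)

lemma regular_locally:
  assumes U: "openin (zar X) U" and z: "\<And>p. p \<notin> U \<Longrightarrow> \<phi> p = 0"
    and loc: "\<And>p. p \<in> U \<Longrightarrow> \<exists>V \<psi>. openin (zar X) V \<and> p \<in> V \<and> \<psi> \<in> regular X V \<and> (\<forall>q\<in>V \<inter> U. \<phi> q = \<psi> q)"
  shows "\<phi> \<in> regular X U"
  unfolding regular_iff
proof (intro conjI allI impI ballI z)
  fix p assume p: "p \<in> U"
  from loc[OF p] obtain V \<psi> where V: "openin (zar X) V" "p \<in> V" "\<psi> \<in> regular X V" "\<forall>q\<in>V \<inter> U. \<phi> q = \<psi> q"
    by (elim exE conjE) (rule that)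
  from regularD[OF V(3,2)]
  obtain W e g h where W: "openin (zar X) W" "p \<in> W" "W \<subseteq> V" "form e g" "form e h"
    "\<forall>q\<in>W. \<forall>x\<in>q. h x \<noteq> 0" "\<forall>q\<in>W. \<forall>x\<in>q. \<psi> q = g x / h x"
    by (elim exE conjE) (rule that)
  show "\<exists>V e g h. openin (zar X) V \<and> p \<in> V \<and> V \<subseteq> U \<and> form e g \<and> form e h \<and>
        (\<forall>q\<in>V. \<forall>x\<in>q. h x \<noteq> 0 \<and> \<phi> q = g x / h x)"
    by (rule exI[of _ "W \<inter> U"], rule exI[of _ e], rule exI[of _ g], rule exI[of _ h])
      (use W V p U in \<open>auto intro: openin_Int\<close>)
qed

lemma regular_restr:
  assumes "\<phi> \<in> regular X U" "V \<subseteq> U" "openin (zar X) V" shows "restr_fun V \<phi> \<in> regular X V"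
  unfolding regular_iff
proof (intro conjI allI impI ballI)
  fix p assume p: "p \<in> V"
  from regularD[OF assms(1) subsetD[OF assms(2) p]]
  obtain W e g h where W: "openin (zar X) W" "p \<in> W" "W \<subseteq> U" "form e g" "form e h"
    "\<forall>q\<in>W. \<forall>x\<in>q. h x \<noteq> 0" "\<forall>q\<in>W. \<forall>x\<in>q. \<phi> q = g x / h x"
    by (elim exE conjE) (rule that)
  show "\<exists>W e g h. openin (zar X) W \<and> p \<in> W \<and> W \<subseteq> V \<and> form e g \<and> form e h \<and>
        (\<forall>q\<in>W. \<forall>x\<in>q. h x \<noteq> 0 \<and> restr_fun V \<phi> q = g x / h x)"
    by (rule exI[of _ "W \<inter> V"], rule exI[of _ e], rule exI[of _ g], rule exI[of _ h])
      (use W p assms in \<open>auto intro: openin_Int simp: restr_fun_def\<close>)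
qed (simp add: restr_fun_def)

text \<open>Sums and products are treated alike: near each point both functions are quotients of
  forms, and only the algebra of these quotients differs.\<close>

lemma regular_combine:
  assumes 1: "\<phi> \<in> regular X U" "\<psi> \<in> regular X U" and U: "openin (zar X) U"
    and z: "\<And>p. p \<notin> U \<Longrightarrow> \<chi> p = 0"
    and comb: "\<And>e g h e' g' h'. form e g \<Longrightarrow> form e h \<Longrightarrow> form e' g' \<Longrightarrow> form e' h' \<Longrightarrow>
      \<exists>e'' G H. form e'' G \<and> form e'' H \<and> (\<forall>q\<in>U. \<forall>x\<in>q. h x \<noteq> 0 \<longrightarrow> h' x \<noteq> 0 \<longrightarrow>
         \<phi> q = g x / h x \<longrightarrow> \<psi> q = g' x / h' x \<longrightarrow> H x \<noteq> 0 \<and> \<chi> q = G x / H x)"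
  shows "\<chi> \<in> regular X U"
  unfolding regular_iff
proof (intro conjI allI impI ballI z)
  fix p assume p: "p \<in> U"
  from regularD[OF 1(1) p]
  obtain W e g h where W: "openin (zar X) W" "p \<in> W" "W \<subseteq> U" "form e g" "form e h"
    "\<forall>q\<in>W. \<forall>x\<in>q. h x \<noteq> 0" "\<forall>q\<in>W. \<forall>x\<in>q. \<phi> q = g x / h x"
    by (elim exE conjE) (rule that)
  from regularD[OF 1(2) p]
  obtain W' e' g' h' where W': "openin (zar X) W'" "p \<in> W'" "W' \<subseteq> U" "form e' g'" "form e' h'"
    "\<forall>q\<in>W'. \<forall>x\<in>q. h' x \<noteq> 0" "\<forall>q\<in>W'. \<forall>x\<in>q. \<psi> q = g' x / h' x"
    by (elim exE conjE) (rule that)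
  obtain e'' G H where G: "form e'' G" "form e'' H" "\<forall>q\<in>U. \<forall>x\<in>q. h x \<noteq> 0 \<longrightarrow> h' x \<noteq> 0 \<longrightarrow>
         \<phi> q = g x / h x \<longrightarrow> \<psi> q = g' x / h' x \<longrightarrow> H x \<noteq> 0 \<and> \<chi> q = G x / H x"
    using comb[OF W(4,5) W'(4,5)] by (elim exE conjE) (rule that)
  show "\<exists>W e g h. openin (zar X) W \<and> p \<in> W \<and> W \<subseteq> U \<and> form e g \<and> form e h \<and>
        (\<forall>q\<in>W. \<forall>x\<in>q. h x \<noteq> 0 \<and> \<chi> q = g x / h x)"
  proof (rule exI[of _ "W \<inter> W'"], rule exI[of _ e''], rule exI[of _ G], rule exI[of _ H], intro conjI ballI)
    fix q x assume "q \<in> W \<inter> W'" "x \<in> q"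
    then have "q \<in> U" "h x \<noteq> 0" "h' x \<noteq> 0" "\<phi> q = g x / h x" "\<psi> q = g' x / h' x" 
      using W(3) W(6,7) W'(6,7) by auto
    with G(3) \<open>x \<in> q\<close> have "H x \<noteq> 0 \<and> \<chi> q = G x / H x" by blast
    then show "H x \<noteq> 0" "\<chi> q = G x / H x" by simp_all
  qed (use W W' G in auto)
qed

lemma regular_add:
  fixes \<phi> \<psi> :: "('n::finite, 'k::field) pt \<Rightarrow> 'k"
  assumes "\<phi> \<in> regular X U" "\<psi> \<in> regular X U" "openin (zar X) U"
  shows "(\<lambda>p. \<phi> p + \<psi> p) \<in> regular X U"
proof (rule regular_combine[OF assms])
  fix p assume "p \<notin> U" then show "\<phi> p + \<psi> p = 0" using assms regular_zero_outside by (metis add.right_neutral)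
next
  fix e e' and g h g' h' :: "('n \<Rightarrow> 'k) \<Rightarrow> 'k"
  assume f: "form e g" "form e h" "form e' g'" "form e' h'"
  show "\<exists>e'' G H. form e'' G \<and> form e'' H \<and> (\<forall>q\<in>U. \<forall>x\<in>q. h x \<noteq> 0 \<longrightarrow> h' x \<noteq> 0 \<longrightarrow>
         \<phi> q = g x / h x \<longrightarrow> \<psi> q = g' x / h' x \<longrightarrow> H x \<noteq> 0 \<and> \<phi> q + \<psi> q = G x / H x)"
    by (rule exI[of _ "e + e'"], rule exI[of _ "\<lambda>x. g x * h' x + h x * g' x"], rule exI[of _ "\<lambda>x. h x * h' x"])
      (intro conjI form_add form_mult f, auto simp: field_simps)
qed

lemma regular_mult:
  fixes \<phi> \<psi> :: "('n::finite, 'k::field) pt \<Rightarrow> 'k"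
  assumes "\<phi> \<in> regular X U" "\<psi> \<in> regular X U" "openin (zar X) U"
  shows "(\<lambda>p. \<phi> p * \<psi> p) \<in> regular X U"
proof (rule regular_combine[OF assms])
  fix p assume "p \<notin> U" then show "\<phi> p * \<psi> p = 0" using assms regular_zero_outside by (metis mult_zero_right)
next
  fix e e' and g h g' h' :: "('n \<Rightarrow> 'k) \<Rightarrow> 'k"
  assume f: "form e g" "form e h" "form e' g'" "form e' h'"
  show "\<exists>e'' G H. form e'' G \<and> form e'' H \<and> (\<forall>q\<in>U. \<forall>x\<in>q. h x \<noteq> 0 \<longrightarrow> h' x \<noteq> 0 \<longrightarrow>
         \<phi> q = g x / h x \<longrightarrow> \<psi> q = g' x / h' x \<longrightarrow> H x \<noteq> 0 \<and> \<phi> q * \<psi> q = G x / H x)"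
    by (rule exI[of _ "e + e'"], rule exI[of _ "\<lambda>x. g x * g' x"], rule exI[of _ "\<lambda>x. h x * h' x"])
      (intro conjI form_mult f, auto)
qed

lemma regular_quotient:
  assumes U: "openin (zar X) U" and X: "X \<subseteq> proj_space" and f: "form e g" "form e h"
    and nz: "\<And>p x. p \<in> U \<Longrightarrow> x \<in> p \<Longrightarrow> h x \<noteq> 0"
  shows "restr_fun U (\<lambda>p. g (rep p) / h (rep p)) \<in> regular X U"
  unfolding regular_iff
proof (intro conjI allI impI ballI)
  fix p assume p: "p \<in> U"
  have UX: "U \<subseteq> proj_space" using openin_subset[OF U] X by (auto simp: topspace_subtopology)
  show "\<exists>W e g' h'. openin (zar X) W \<and> p \<in> W \<and> W \<subseteq> U \<and> form e g' \<and> form e h' \<and>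
        (\<forall>q\<in>W. \<forall>x\<in>q. h' x \<noteq> 0 \<and> restr_fun U (\<lambda>p. g (rep p) / h (rep p)) q = g' x / h' x)"
  proof (rule exI[of _ U], rule exI[of _ e], rule exI[of _ g], rule exI[of _ h], intro conjI ballI)
    fix q x assume qx: "q \<in> U" "x \<in> q"
    show "h x \<noteq> 0" using nz qx by blast
    have "g (rep q) / h (rep q) = g x / h x"
      by (rule form_quotient_const[OF f]) (use qx UX rep_mem in auto)
    then show "restr_fun U (\<lambda>p. g (rep p) / h (rep p)) q = g x / h x" using qx by (simp add: restr_fun_def)
  qed (use U f p in auto)
qed (simp add: restr_fun_def)

lemma regular_inverse:
  assumes r: "\<phi> \<in> regular X U" and nz: "\<And>p. p \<in> U \<Longrightarrow> \<phi> p \<noteq> 0"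
  shows "(\<lambda>p. inverse (\<phi> p)) \<in> regular X U"
  unfolding regular_iff
proof (intro conjI allI impI ballI)
  fix p assume p: "p \<in> U"
  from regularD[OF r p]
  obtain W e g h where W: "openin (zar X) W" "p \<in> W" "W \<subseteq> U" "form e g" "form e h"
    "\<forall>q\<in>W. \<forall>x\<in>q. h x \<noteq> 0" "\<forall>q\<in>W. \<forall>x\<in>q. \<phi> q = g x / h x"
    by (elim exE conjE) (rule that)
  show "\<exists>W e g h. openin (zar X) W \<and> p \<in> W \<and> W \<subseteq> U \<and> form e g \<and> form e h \<and>
        (\<forall>q\<in>W. \<forall>x\<in>q. h x \<noteq> 0 \<and> inverse (\<phi> q) = g x / h x)"
  proof (rule exI[of _ W], rule exI[of _ e], rule exI[of _ h], rule exI[of _ g], intro conjI ballI)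
    fix q x assume qx: "q \<in> W" "x \<in> q"
    then have "\<phi> q \<noteq> 0" using nz[of q] W(3) by blast
    moreover have "\<phi> q = g x / h x" using W(7) qx by blast
    ultimately show "g x \<noteq> 0" "inverse (\<phi> q) = h x / g x" by auto
  qed (use W in auto)
qed (use r regular_zero_outside in fastforce)

lemma openin_nonzero:
  assumes r: "\<phi> \<in> regular X U" and U: "openin (zar X) U" and X: "X \<subseteq> proj_space"
  shows "openin (zar X) {p \<in> U. \<phi> p \<noteq> 0}"
proof (subst openin_subopen, intro ballI)
  fix p assume p: "p \<in> {p \<in> U. \<phi> p \<noteq> 0}"
  have UX: "U \<subseteq> X" "U \<subseteq> proj_space" using openin_subset[OF U] X by (auto simp: topspace_subtopology)
  from regularD[OF r conjunct1[OF p[unfolded mem_Collect_eq]]]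
  obtain W e g h where W: "openin (zar X) W" "p \<in> W" "W \<subseteq> U" "form e g" "form e h"
    "\<forall>q\<in>W. \<forall>x\<in>q. h x \<noteq> 0" "\<forall>q\<in>W. \<forall>x\<in>q. \<phi> q = g x / h x"
    by (elim exE conjE) (rule that)
  define T where "T = W \<inter> {q \<in> X. \<forall>x\<in>q. g x \<noteq> 0}"
  have "openin (zar X) T" unfolding T_def using W openin_form[OF W(4) X] by (intro openin_Int)
  moreover have "p \<in> T"
  proof -
    have "g x \<noteq> 0" if "x \<in> p" for x using W(7) W(2) that p by auto
    then show ?thesis using W(2) p UX by (auto simp: T_def)
  qed
  moreover have "T \<subseteq> {p \<in> U. \<phi> p \<noteq> 0}"
  proof
    fix q assume q: "q \<in> T"
    then have "q \<in> U" using W(3) by (auto simp: T_def)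
    then have x: "rep q \<in> q" using UX rep_mem by auto
    then have "g (rep q) \<noteq> 0" "\<phi> q = g (rep q) / h (rep q)" "h (rep q) \<noteq> 0" using q W(6,7) by (auto simp: T_def)
    then show "q \<in> {p \<in> U. \<phi> p \<noteq> 0}" using \<open>q \<in> U\<close> by simp
  qed
  ultimately show "\<exists>T. openin (zar X) T \<and> p \<in> T \<and> T \<subseteq> {p \<in> U. \<phi> p \<noteq> 0}" by blast
qed

section \<open>Generic equality and local regularity\<close>

locale variety =
  fixes X :: "('n::finite, 'k::field) pt set"
  assumes X_sub: "X \<subseteq> proj_space" and irreducible: "irreducible_space (zar X)"
begin

lemma topspace_zar: "topspace (zar X) = X"
  using X_sub by (auto simp: topspace_subtopology topspace_zariski)

lemma topspace_Int [simp]: "topspace zariski \<inter> X = X"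
  using X_sub by (auto simp: topspace_zariski)

lemma openin_sub: "openin (zar X) U \<Longrightarrow> U \<subseteq> X"
  using openin_subset by fastforce

lemma X_nonempty: "X \<noteq> {}"
  using irreducible unfolding irreducible_space_def topspace_zar by simp

lemma openin_X: "openin (zar X) X"
  using openin_topspace[of "zar X"] by simp

lemma open_meet:
  assumes "openin (zar X) U" "U \<noteq> {}" "openin (zar X) V" "V \<noteq> {}" shows "U \<inter> V \<noteq> {}"
proof
  assume e: "U \<inter> V = {}"
  have "closedin (zar X) (X - U)" "closedin (zar X) (X - V)"
    using assms openin_sub by (auto simp: closedin_def topspace_zar double_diff)
  moreover have "X = (X - U) \<union> (X - V)" using e by auto
  ultimately have "X = X - U \<or> X = X - V"
    using irreducible unfolding irreducible_space_def topspace_zar by blast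
  then show False using assms openin_sub by blast
qed

lemma nonempty_opens_Int: "U \<in> nonempty_opens X \<Longrightarrow> V \<in> nonempty_opens X \<Longrightarrow> U \<inter> V \<in> nonempty_opens X"
  using open_meet by (auto simp: nonempty_opens_def)

lemma X_in_nonempty_opens: "X \<in> nonempty_opens X"
  using X_nonempty openin_X by (simp add: nonempty_opens_def)

text \<open>The generic point as a filter. Irreducibility makes nonempty open sets meet, so the
  filter is proper, and equality along it is equality in the function field.\<close>

definition gen :: "('n, 'k) pt filter" where
  "gen = (INF W\<in>nonempty_opens X. principal W)"

lemma eventually_gen: "eventually P gen \<longleftrightarrow> (\<exists>W\<in>nonempty_opens X. \<forall>p\<in>W. P p)"
  unfolding gen_def
proof (subst eventually_INF_base)
  show "nonempty_opens X \<noteq> {}" using X_in_nonempty_opens by auto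
  show "\<exists>x\<in>nonempty_opens X. principal x \<le> inf (principal a) (principal b)"
    if "a \<in> nonempty_opens X" "b \<in> nonempty_opens X" for a b
    using nonempty_opens_Int[OF that] by (intro bexI[of _ "a \<inter> b"]) auto
qed (simp add: eventually_principal)

lemma gen_neq_bot: "gen \<noteq> bot"
proof
  assume "gen = bot"
  then have "eventually (\<lambda>_. False) gen" by simp
  then show False by (auto simp: eventually_gen nonempty_opens_def)
qed

lemma eventually_genI: "openin (zar X) W \<Longrightarrow> W \<noteq> {} \<Longrightarrow> (\<And>p. p \<in> W \<Longrightarrow> P p) \<Longrightarrow> eventually P gen"
  unfolding eventually_gen by (auto simp: nonempty_opens_def)

lemma eventually_genE:
  assumes "eventually P gen" "openin (zar X) U" "U \<noteq> {}"
  obtains W where "openin (zar X) W" "W \<noteq> {}" "W \<subseteq> U" "\<forall>p\<in>W. P p"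
proof -
  obtain W where W: "W \<in> nonempty_opens X" "\<forall>p\<in>W. P p" using assms(1) by (auto simp: eventually_gen)
  have "openin (zar X) (W \<inter> U)" "W \<inter> U \<noteq> {}"
    using W assms open_meet by (auto simp: nonempty_opens_def)
  then show ?thesis using W(2) by (intro that[of "W \<inter> U"]) auto
qed

lemma eventually_open: "openin (zar X) W \<Longrightarrow> W \<noteq> {} \<Longrightarrow> \<forall>\<^sub>F p in gen. p \<in> W"
  by (rule eventually_genI)

lemma regular_const: "openin (zar X) U \<Longrightarrow> restr_fun U (\<lambda>_. c) \<in> regular X U"
  using regular_quotient[of X U 0 "\<lambda>_. c" "\<lambda>_. 1", OF _ X_sub form_const form_const] by simp

lemma regular_zero: "openin (zar X) U \<Longrightarrow> (\<lambda>_. 0) \<in> regular X U"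
  using regular_const[of U 0] by (simp add: restr_fun_def)

lemma regular_smult: "openin (zar X) U \<Longrightarrow> \<phi> \<in> regular X U \<Longrightarrow> (\<lambda>p. c * \<phi> p) \<in> regular X U"
proof -
  assume U: "openin (zar X) U" and \<phi>: "\<phi> \<in> regular X U"
  have "(\<lambda>p. restr_fun U (\<lambda>_. c) p * \<phi> p) = (\<lambda>p. c * \<phi> p)"
    using regular_zero_outside[OF \<phi>] by (auto simp: restr_fun_def)
  then show ?thesis using regular_mult[OF regular_const[OF U] \<phi> U, of c] by simp
qed

text \<open>The locus where two regular functions differ is open; if nonempty, it would meet any
  nonempty open set on which they agree.\<close>

lemma regular_identity:
  assumes U: "openin (zar X) U" and r: "\<phi> \<in> regular X U" "\<psi> \<in> regular X U"
    and ev: "\<forall>\<^sub>F p in gen. \<phi> p = \<psi> p"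
  shows "\<phi> = \<psi>"
proof (rule ccontr)
  assume "\<phi> \<noteq> \<psi>"
  define \<chi> where "\<chi> = (\<lambda>p. \<phi> p + (- 1) * \<psi> p)"
  have \<chi>: "\<chi> \<in> regular X U" unfolding \<chi>_def by (intro regular_add regular_smult r U)
  obtain p where p: "\<phi> p \<noteq> \<psi> p" using \<open>\<phi> \<noteq> \<psi>\<close> by auto
  then have "p \<in> U" using r regular_zero_outside by metis
  then have "p \<in> {p \<in> U. \<chi> p \<noteq> 0}" using p by (simp add: \<chi>_def)
  then have ne: "{p \<in> U. \<chi> p \<noteq> 0} \<noteq> {}" by auto
  obtain W where "W \<noteq> {}" "W \<subseteq> {p \<in> U. \<chi> p \<noteq> 0}" "\<forall>p\<in>W. \<phi> p = \<psi> p"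
    by (rule eventually_genE[OF ev openin_nonzero[OF \<chi> U X_sub] ne])
  then show False by (auto simp: \<chi>_def)
qed

text \<open>Elements of the function field, represented by total functions that are meaningful only
  up to generic equality. Their own values at single points carry no information.\<close>

definition rat :: "(('n, 'k) pt \<Rightarrow> 'k) set" where
  "rat = {u. \<exists>W v. openin (zar X) W \<and> W \<noteq> {} \<and> v \<in> regular X W \<and> (\<forall>\<^sub>F p in gen. u p = v p)}"

definition reg :: "('n, 'k) pt \<Rightarrow> (('n, 'k) pt \<Rightarrow> 'k) set" where
  "reg P = {u. \<exists>N v. openin (zar X) N \<and> P \<in> N \<and> v \<in> regular X N \<and> (\<forall>\<^sub>F p in gen. u p = v p)}"

lemma ratI: "openin (zar X) W \<Longrightarrow> W \<noteq> {} \<Longrightarrow> v \<in> regular X W \<Longrightarrow> \<forall>\<^sub>F p in gen. u p = v p \<Longrightarrow> u \<in> rat"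
  unfolding rat_def by blast

lemma regI: "openin (zar X) N \<Longrightarrow> P \<in> N \<Longrightarrow> v \<in> regular X N \<Longrightarrow> \<forall>\<^sub>F p in gen. u p = v p \<Longrightarrow> u \<in> reg P"
  unfolding reg_def by blast

lemma regI': "openin (zar X) N \<Longrightarrow> P \<in> N \<Longrightarrow> v \<in> regular X N \<Longrightarrow> v \<in> reg P"
  by (rule regI) auto

lemma ratD: "u \<in> rat \<Longrightarrow> \<exists>W v. openin (zar X) W \<and> W \<noteq> {} \<and> v \<in> regular X W \<and> (\<forall>\<^sub>F p in gen. u p = v p)"
  unfolding rat_def by simp

lemma regD: "u \<in> reg P \<Longrightarrow> \<exists>N v. openin (zar X) N \<and> P \<in> N \<and> v \<in> regular X N \<and> (\<forall>\<^sub>F p in gen. u p = v p)"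
  unfolding reg_def by simp

lemma reg_rat: "u \<in> reg P \<Longrightarrow> u \<in> rat"
  unfolding reg_def rat_def by blast

lemma rat_cong:
  assumes "u \<in> rat" and ev: "\<forall>\<^sub>F p in gen. u p = v p" shows "v \<in> rat"
proof -
  from ratD[OF assms(1)] obtain W w where w: "openin (zar X) W" "W \<noteq> {}" "w \<in> regular X W"
    "\<forall>\<^sub>F p in gen. u p = w p" by (elim exE conjE) (rule that)
  have "\<forall>\<^sub>F p in gen. v p = w p" using ev w(4) by eventually_elim simp
  then show ?thesis by (rule ratI[OF w(1-3)])
qed

lemma reg_cong:
  assumes "u \<in> reg P" and ev: "\<forall>\<^sub>F p in gen. u p = v p" shows "v \<in> reg P"
proof -
  from regD[OF assms(1)] obtain W w where w: "openin (zar X) W" "P \<in> W" "w \<in> regular X W"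
    "\<forall>\<^sub>F p in gen. u p = w p" by (elim exE conjE) (rule that)
  have "\<forall>\<^sub>F p in gen. v p = w p" using ev w(4) by eventually_elim simp
  then show ?thesis by (rule regI[OF w(1-3)])
qed

lemma restr_ev: "openin (zar X) U \<Longrightarrow> U \<noteq> {} \<Longrightarrow> \<forall>\<^sub>F p in gen. restr_fun U \<phi> p = \<phi> p"
  by (rule eventually_mono[OF eventually_open]) (auto simp: restr_fun_def)

lemma reg_rat_combine:
  assumes comb: "\<And>U \<phi> \<psi>. openin (zar X) U \<Longrightarrow> \<phi> \<in> regular X U \<Longrightarrow> \<psi> \<in> regular X U \<Longrightarrow>
      (\<lambda>p. f (\<phi> p) (\<psi> p)) \<in> regular X U"
  shows "u \<in> reg P \<Longrightarrow> v \<in> reg P \<Longrightarrow> (\<lambda>p. f (u p) (v p)) \<in> reg P"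
    and "u \<in> rat \<Longrightarrow> v \<in> rat \<Longrightarrow> (\<lambda>p. f (u p) (v p)) \<in> rat"
proof -
  have *: "\<exists>v'. v' \<in> regular X (U \<inter> W) \<and> (\<forall>\<^sub>F p in gen. f (u p) (v p) = v' p)"
    if U: "openin (zar X) U" "U \<noteq> {}" "\<phi> \<in> regular X U" "\<forall>\<^sub>F p in gen. u p = \<phi> p"
      and W: "openin (zar X) W" "W \<noteq> {}" "\<psi> \<in> regular X W" "\<forall>\<^sub>F p in gen. v p = \<psi> p" for U W \<phi> \<psi>
  proof -
    have UW: "openin (zar X) (U \<inter> W)" "U \<inter> W \<noteq> {}" using U W open_meet by auto
    have "(\<lambda>p. f (restr_fun (U \<inter> W) \<phi> p) (restr_fun (U \<inter> W) \<psi> p)) \<in> regular X (U \<inter> W)"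
      by (intro comb UW regular_restr[OF U(3)] regular_restr[OF W(3)]) auto
    moreover have "\<forall>\<^sub>F p in gen. f (u p) (v p) = f (restr_fun (U \<inter> W) \<phi> p) (restr_fun (U \<inter> W) \<psi> p)"
      using eventually_open[OF UW] U(4) W(4) by eventually_elim (simp add: restr_fun_def)
    ultimately show ?thesis by blast
  qed
  show "(\<lambda>p. f (u p) (v p)) \<in> reg P" if "u \<in> reg P" "v \<in> reg P"
  proof -
    from regD[OF that(1)] obtain U \<phi> where U: "openin (zar X) U" "P \<in> U" "\<phi> \<in> regular X U"
      "\<forall>\<^sub>F p in gen. u p = \<phi> p" by (elim exE conjE) (rule that)
    from regD[OF that(2)] obtain W \<psi> where W: "openin (zar X) W" "P \<in> W" "\<psi> \<in> regular X W"
      "\<forall>\<^sub>F p in gen. v p = \<psi> p" by (elim exE conjE) (rule that)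
    from *[OF U(1) _ U(3,4) W(1) _ W(3,4)] U(2) W(2)
    obtain v' where "v' \<in> regular X (U \<inter> W)" "\<forall>\<^sub>F p in gen. f (u p) (v p) = v' p" by blast
    then show ?thesis by (intro regI[OF openin_Int[OF U(1) W(1)]]) (use U W in auto)
  qed
  show "(\<lambda>p. f (u p) (v p)) \<in> rat" if "u \<in> rat" "v \<in> rat"
  proof -
    from ratD[OF that(1)] obtain U \<phi> where U: "openin (zar X) U" "U \<noteq> {}" "\<phi> \<in> regular X U"
      "\<forall>\<^sub>F p in gen. u p = \<phi> p" by (elim exE conjE) (rule that)
    from ratD[OF that(2)] obtain W \<psi> where W: "openin (zar X) W" "W \<noteq> {}" "\<psi> \<in> regular X W"
      "\<forall>\<^sub>F p in gen. v p = \<psi> p" by (elim exE conjE) (rule that)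
    from *[OF U W] obtain v' where "v' \<in> regular X (U \<inter> W)" "\<forall>\<^sub>F p in gen. f (u p) (v p) = v' p" by blast
    then show ?thesis by (intro ratI[OF openin_Int[OF U(1) W(1)] open_meet[OF U(1,2) W(1,2)]])
  qed
qed

lemma reg_add: "u \<in> reg P \<Longrightarrow> v \<in> reg P \<Longrightarrow> (\<lambda>p. u p + v p) \<in> reg P"
  by (rule reg_rat_combine(1)[where f = "(+)"]) (rule regular_add)

lemma rat_add: "u \<in> rat \<Longrightarrow> v \<in> rat \<Longrightarrow> (\<lambda>p. u p + v p) \<in> rat"
  by (rule reg_rat_combine(2)[where f = "(+)"]) (rule regular_add)

lemma reg_mult: "u \<in> reg P \<Longrightarrow> v \<in> reg P \<Longrightarrow> (\<lambda>p. u p * v p) \<in> reg P"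
  by (rule reg_rat_combine(1)[where f = "(*)"]) (rule regular_mult)

lemma rat_mult: "u \<in> rat \<Longrightarrow> v \<in> rat \<Longrightarrow> (\<lambda>p. u p * v p) \<in> rat"
  by (rule reg_rat_combine(2)[where f = "(*)"]) (rule regular_mult)

lemma reg_const: "P \<in> X \<Longrightarrow> (\<lambda>_. c) \<in> reg P"
  by (rule regI[OF openin_X _ regular_const[OF openin_X]])
    (auto intro: eventually_mono[OF eventually_open[OF openin_X X_nonempty]] simp: restr_fun_def)

lemma rat_const: "(\<lambda>_. c) \<in> rat"
  using reg_const reg_rat X_nonempty by blast

lemma rat_cases:
  assumes "u \<in> rat" shows "(\<forall>\<^sub>F p in gen. u p = 0) \<or> (\<forall>\<^sub>F p in gen. u p \<noteq> 0)"
proof -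
  from ratD[OF assms] obtain W w where w: "openin (zar X) W" "W \<noteq> {}" "w \<in> regular X W"
    "\<forall>\<^sub>F p in gen. u p = w p" by (elim exE conjE) (rule that)
  show ?thesis
  proof (cases "{p \<in> W. w p \<noteq> 0} = {}")
    case True
    have "\<forall>\<^sub>F p in gen. u p = 0" using w(4) eventually_open[OF w(1,2)] by eventually_elim (use True in auto)
    then show ?thesis by simp
  next
    case False
    have "\<forall>\<^sub>F p in gen. u p \<noteq> 0"
      using w(4) eventually_open[OF openin_nonzero[OF w(3,1) X_sub] False] by eventually_elim auto
    then show ?thesis by simp
  qed
qed

lemma reg_inverse:
  assumes P: "openin (zar X) W" "P \<in> W" "w \<in> regular X W" "w P \<noteq> 0"
  shows "(\<lambda>p. inverse (w p)) \<in> reg P"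
proof -
  define U where "U = {p \<in> W. w p \<noteq> 0}"
  have U: "openin (zar X) U" unfolding U_def by (rule openin_nonzero[OF P(3,1) X_sub])
  have PU: "P \<in> U" using P by (simp add: U_def)
  have r: "restr_fun U w \<in> regular X U" by (rule regular_restr[OF P(3) _ U]) (auto simp: U_def)
  have "(\<lambda>p. inverse (restr_fun U w p)) \<in> regular X U"
    by (rule regular_inverse[OF r]) (auto simp: U_def restr_fun_def)
  moreover have "\<forall>\<^sub>F p in gen. inverse (w p) = inverse (restr_fun U w p)"
  proof -
    have "\<forall>\<^sub>F p in gen. restr_fun U w p = w p" by (rule restr_ev[OF U]) (use PU in auto)
    then show ?thesis by eventually_elim simp
  qed
  ultimately show ?thesis by (rule regI[OF U PU])
qed

lemma rat_inverse:
  assumes "u \<in> rat" shows "(\<lambda>p. inverse (u p)) \<in> rat"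
proof -
  from ratD[OF assms] obtain W w where w: "openin (zar X) W" "W \<noteq> {}" "w \<in> regular X W"
    "\<forall>\<^sub>F p in gen. u p = w p" by (elim exE conjE) (rule that)
  show ?thesis
  proof (cases "\<exists>P\<in>W. w P \<noteq> 0")
    case True
    then obtain P where "P \<in> W" "w P \<noteq> 0" by blast
    then have "(\<lambda>p. inverse (w p)) \<in> rat" using reg_inverse[OF w(1) _ w(3)] reg_rat by blast
    moreover have "\<forall>\<^sub>F p in gen. inverse (w p) = inverse (u p)" using w(4) by eventually_elim simp
    ultimately show ?thesis by (rule rat_cong)
  next
    case False
    have "\<forall>\<^sub>F p in gen. 0 = inverse (u p)"
      using w(4) eventually_open[OF w(1,2)] by eventually_elim (use False in auto)
    then show ?thesis by (rule rat_cong[OF rat_const])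
  qed
qed

text \<open>Local representatives agree on overlaps by \<open>regular_identity\<close>, so the value
  at \<open>p\<close> may be taken from the representative at \<open>p\<close> itself.\<close>

lemma glue:
  assumes U: "openin (zar X) U" and u: "\<And>P. P \<in> U \<Longrightarrow> u \<in> reg P"
  shows "\<exists>v\<in>regular X U. U \<noteq> {} \<longrightarrow> (\<forall>\<^sub>F p in gen. u p = v p)"
proof -
  have "\<forall>P\<in>U. \<exists>Nw. openin (zar X) (fst Nw) \<and> P \<in> fst Nw \<and> snd Nw \<in> regular X (fst Nw) \<and> (\<forall>\<^sub>F p in gen. u p = snd Nw p)"
    using regD[OF u] by (auto 0 0)
  from bchoice[OF this] obtain Nw where Nw: "\<forall>P\<in>U. openin (zar X) (fst (Nw P)) \<and> P \<in> fst (Nw P) \<and>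
      snd (Nw P) \<in> regular X (fst (Nw P)) \<and> (\<forall>\<^sub>F p in gen. u p = snd (Nw P) p)" by (rule exE)
  define N w where "N = (\<lambda>P. fst (Nw P))" and "w = (\<lambda>P. snd (Nw P))"
  have N: "openin (zar X) (N P)" "P \<in> N P" "w P \<in> regular X (N P)" "\<forall>\<^sub>F p in gen. u p = w P p" if "P \<in> U" for P
    using Nw that by (auto simp: N_def w_def)
  define v where "v = restr_fun U (\<lambda>p. w p p)"
  have vw: "v q = w P q" if P: "P \<in> U" and q: "q \<in> N P \<inter> U" for P q
  proof -
    have o: "openin (zar X) (N P \<inter> N q)" using N P q by auto
    have "restr_fun (N P \<inter> N q) (w P) = restr_fun (N P \<inter> N q) (w q)"
    proof (rule regular_identity[OF o])
      show "restr_fun (N P \<inter> N q) (w P) \<in> regular X (N P \<inter> N q)" by (rule regular_restr[OF N(3)[OF P] _ o]) auto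
      show "restr_fun (N P \<inter> N q) (w q) \<in> regular X (N P \<inter> N q)" by (rule regular_restr[OF N(3) _ o]) (use q in auto)
      show "\<forall>\<^sub>F p in gen. restr_fun (N P \<inter> N q) (w P) p = restr_fun (N P \<inter> N q) (w q) p"
        using N(4)[OF P] N(4)[of q] q by (auto simp: restr_fun_def elim: eventually_elim2)
    qed
    from fun_cong[OF this, of q] q N(2)[of q] show ?thesis by (auto simp: v_def restr_fun_def)
  qed
  have v: "v \<in> regular X U"
  proof (rule regular_locally[OF U])
    fix p assume p: "p \<in> U"
    show "\<exists>V \<psi>. openin (zar X) V \<and> p \<in> V \<and> \<psi> \<in> regular X V \<and> (\<forall>q\<in>V \<inter> U. v q = \<psi> q)"
      by (rule exI[of _ "N p"], rule exI[of _ "w p"]) (use N[OF p] vw[OF p] in auto)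
  qed (simp add: v_def restr_fun_def)
  have "\<forall>\<^sub>F p in gen. u p = v p" if "U \<noteq> {}"
  proof -
    obtain P where P: "P \<in> U" using \<open>U \<noteq> {}\<close> by auto
    have o: "openin (zar X) (N P \<inter> U)" "N P \<inter> U \<noteq> {}" using N[OF P] U P by auto
    show ?thesis using N(4)[OF P] eventually_open[OF o] by eventually_elim (use vw[OF P] in auto)
  qed
  then show ?thesis using v by blast
qed

end



section \<open>Forms in two variables\<close>

definition vec2 :: "'k \<Rightarrow> 'k \<Rightarrow> (2 \<Rightarrow> 'k)" where
  "vec2 a b = (\<lambda>i. if i = 0 then a else b)"

lemma UNIV_two: "(UNIV :: 2 set) = {0, 1}"
  by (rule card_subset_eq[symmetric]) (auto simp: card_insert_if)

lemma vec2_eta: "vec2 (x 0) (x 1) = x"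
proof
  fix i :: 2
  have "i \<in> {0, 1}" unfolding UNIV_two[symmetric] by simp
  then show "vec2 (x 0) (x 1) i = x i" by (auto simp: vec2_def)
qed

lemma vec2_simps [simp]: "vec2 a b 0 = a" "vec2 a b 1 = b"
  by (simp_all add: vec2_def)

lemma vec2_zero_iff: "vec2 a b = (\<lambda>_. 0) \<longleftrightarrow> a = 0 \<and> b = 0"
proof
  assume "vec2 a b = (\<lambda>_. 0)"
  from fun_cong[OF this, of 0] fun_cong[OF this, of 1] show "a = 0 \<and> b = 0" by simp
qed (auto simp: vec2_def)

lemma vec2_scale: "(\<lambda>i. c * vec2 a b i) = vec2 (c * a) (c * b)"
  by (auto simp: vec2_def)

lemma form_dehom:
  assumes "form e (\<phi> :: (2 \<Rightarrow> 'k::field) \<Rightarrow> 'k)"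
  shows "\<exists>Q. \<forall>c. \<phi> (vec2 1 c) = poly Q c" "\<exists>Q. \<forall>c. \<phi> (vec2 c 1) = poly Q c"
proof -
  obtain F where F: "\<phi> = poly_eval F" using assms by (auto simp: form_def)
  have m: "mono_eval m x = x 0 ^ Poly_Mapping.lookup m 0 * x 1 ^ Poly_Mapping.lookup m 1"
    for m and x :: "(2 \<Rightarrow> 'k)" by (simp add: mono_eval_def UNIV_two)
  show "\<exists>Q. \<forall>c. \<phi> (vec2 1 c) = poly Q c"
    by (rule exI[of _ "\<Sum>m\<in>Poly_Mapping.keys F. monom (Poly_Mapping.lookup F m) (Poly_Mapping.lookup m 1)"])
      (simp add: F poly_eval_mono m poly_sum poly_monom)
  show "\<exists>Q. \<forall>c. \<phi> (vec2 c 1) = poly Q c"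
    by (rule exI[of _ "\<Sum>m\<in>Poly_Mapping.keys F. monom (Poly_Mapping.lookup F m) (Poly_Mapping.lookup m 0)"])
      (simp add: F poly_eval_mono m poly_sum poly_monom)
qed

text \<open>The affine coordinate is \<open>x 1 / x 0\<close>, so infinity is the point with
  \<open>x 0 = 0\<close>.\<close>

definition homogenize :: "nat \<Rightarrow> 'k::field poly \<Rightarrow> (2 \<Rightarrow> 'k) \<Rightarrow> 'k" where
  "homogenize e Q x = (\<Sum>j\<le>e. coeff Q j * (x 1 ^ j * x 0 ^ (e - j)))"

lemma form_homogenize: "form e (homogenize e Q)"
proof -
  have "form e (\<lambda>x. \<Sum>j\<le>e. coeff Q j * (x 1 ^ j * x 0 ^ (e - j)))"
  proof (intro form_sum form_smult)
    fix j assume "j \<in> {..e}"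
    then show "form e (\<lambda>x. x 1 ^ j * x 0 ^ (e - j))"
      using form_mult[OF form_power[OF form_coord, of j] form_power[OF form_coord, of "e - j"]] by simp
  qed
  then show ?thesis by (simp add: homogenize_def[abs_def])
qed

lemma homogenize_affine: "degree Q \<le> e \<Longrightarrow> homogenize e Q (vec2 1 c) = poly Q c"
  unfolding homogenize_def poly_altdef
  by (simp, rule sum.mono_neutral_right) (auto simp: coeff_eq_0)

lemma homogenize_infinity: "homogenize e Q (vec2 0 1) = coeff Q e"
proof -
  have "homogenize e Q (vec2 0 1) = (\<Sum>j\<le>e. if j = e then coeff Q j else 0)"
    unfolding homogenize_def by (rule sum.cong) (auto simp: zero_power)
  then show ?thesis by simp
qed

text \<open>Over a finite field the product of all \<open>x - a\<close>, increased by 1, would be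
  nonconstant without a root.\<close>

lemma infinite_alg_closed: "infinite (UNIV :: 'k::alg_closed_field set)"
proof
  assume fin: "finite (UNIV :: 'k set)"
  define p where "p = (\<Prod>a\<in>(UNIV :: 'k set). [:- a, 1:]) + 1"
  have p1: "poly p x = 1" for x
    using fin by (auto simp: p_def poly_prod intro: prod_zero)
  have "degree p = card (UNIV :: 'k set)"
  proof -
    have "degree (\<Prod>a\<in>(UNIV :: 'k set). [:- a, 1:]) = card (UNIV :: 'k set)"
      by (subst degree_prod_eq_sum_degree) auto
    moreover have "card (UNIV :: 'k set) > 0" using fin by (simp add: card_gt_0_iff)
    ultimately show ?thesis unfolding p_def by (subst degree_add_eq_left) auto
  qed
  then have "degree p > 0" using fin by (simp add: card_gt_0_iff)
  then show False using alg_closed_imp_poly_has_root[of p] p1 by auto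
qed

lemma poly_nonroot:
  assumes "(Q :: 'k::alg_closed_field poly) \<noteq> 0" shows "\<exists>c. poly Q c \<noteq> 0"
proof (rule ccontr)
  assume "\<not> ?thesis"
  then have "{c. poly Q c = 0} = UNIV" by auto
  then show False using poly_roots_finite[OF assms] infinite_alg_closed[where ?'k = 'k] by simp
qed

section \<open>The function field\<close>

context variety
begin

text \<open>The class in the function field, defined for an arbitrary total function, so that field
  operations become pointwise operations on representatives.\<close>

definition cls :: "(('n, 'k) pt \<Rightarrow> 'k) \<Rightarrow> (('n, 'k) pt set \<times> (('n, 'k) pt \<Rightarrow> 'k)) set" where
  "cls u = {(V, \<psi>). V \<in> nonempty_opens X \<and> \<psi> \<in> regular X V \<and> (\<forall>\<^sub>F p in gen. u p = \<psi> p)}"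

lemma germ_eq_cls:
  assumes "U \<in> nonempty_opens X" shows "germ X (nonempty_opens X) U \<phi> = cls \<phi>"
proof -
  have "(\<exists>W\<in>nonempty_opens X. W \<subseteq> U \<inter> V \<and> (\<forall>p\<in>W. \<phi> p = \<psi> p)) \<longleftrightarrow> (\<forall>\<^sub>F p in gen. \<phi> p = \<psi> p)"
    if V: "V \<in> nonempty_opens X" for V and \<psi> :: "('n, 'k) pt \<Rightarrow> 'k"
  proof
    assume "\<forall>\<^sub>F p in gen. \<phi> p = \<psi> p"
    then obtain W where "W \<in> nonempty_opens X" "\<forall>p\<in>W. \<phi> p = \<psi> p" by (auto simp: eventually_gen)
    then show "\<exists>W\<in>nonempty_opens X. W \<subseteq> U \<inter> V \<and> (\<forall>p\<in>W. \<phi> p = \<psi> p)"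
      using nonempty_opens_Int[OF nonempty_opens_Int[OF assms V], of W] by (intro bexI[of _ "U \<inter> V \<inter> W"]) auto
  qed (auto simp: eventually_gen)
  then show ?thesis by (auto simp: germ_def cls_def)
qed

lemma cls_eqI: "\<forall>\<^sub>F p in gen. u p = v p \<Longrightarrow> cls u = cls v"
  unfolding cls_def by (auto elim: eventually_elim2)

lemma cls_eq_iff: "u \<in> rat \<Longrightarrow> cls u = cls v \<longleftrightarrow> (\<forall>\<^sub>F p in gen. u p = v p)"
proof
  assume u: "u \<in> rat" and e: "cls u = cls v"
  from ratD[OF u] obtain W w where w: "openin (zar X) W" "W \<noteq> {}" "w \<in> regular X W"
    "\<forall>\<^sub>F p in gen. u p = w p" by (elim exE conjE) (rule that)
  then have "(W, w) \<in> cls u" by (simp add: cls_def nonempty_opens_def)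
  then have "\<forall>\<^sub>F p in gen. v p = w p" unfolding e by (simp add: cls_def)
  with w(4) show "\<forall>\<^sub>F p in gen. u p = v p" by eventually_elim simp
qed (rule cls_eqI)

abbreviation FF where "FF \<equiv> germ_ring X (nonempty_opens X)"

lemma FF_carrier: "carrier FF = {cls u | u. u \<in> rat}"
proof -
  have "cls u \<in> {germ X (nonempty_opens X) U \<phi> | U \<phi>. U \<in> nonempty_opens X \<and> \<phi> \<in> regular X U}" if "u \<in> rat" for u
  proof -
    from ratD[OF that] obtain W w where w: "openin (zar X) W" "W \<noteq> {}" "w \<in> regular X W"
      "\<forall>\<^sub>F p in gen. u p = w p" by (elim exE conjE) (rule that)
    then have W: "W \<in> nonempty_opens X" by (simp add: nonempty_opens_def)
    then have "cls u = germ X (nonempty_opens X) W w" using w by (simp add: germ_eq_cls cls_eqI)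
    then show ?thesis using W w by blast
  qed
  moreover have "germ X (nonempty_opens X) U \<phi> \<in> {cls u | u. u \<in> rat}"
    if "U \<in> nonempty_opens X" "\<phi> \<in> regular X U" for U \<phi>
    using that germ_eq_cls[OF that(1)] ratI[of U \<phi> \<phi>] by (auto simp: nonempty_opens_def)
  ultimately show ?thesis unfolding germ_ring_def by auto
qed

lemma cls_carrier [simp]: "u \<in> rat \<Longrightarrow> cls u \<in> carrier FF"
  by (auto simp: FF_carrier)

lemma cls_nonempty: "u \<in> rat \<Longrightarrow> cls u \<noteq> {}"
  using ratD[of u] by (auto simp: cls_def nonempty_opens_def)

lemma Union_const: "A \<noteq> {} \<Longrightarrow> (\<And>a. a \<in> A \<Longrightarrow> F a = c) \<Longrightarrow> (\<Union>a\<in>A. F a) = c"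
  by auto

text \<open>Operations on germs are unions over all pairs of representatives; they collapse because
  every pair yields the same germ.\<close>

lemma Union_const2:
  assumes "A \<noteq> {}" "B \<noteq> {}" "\<And>U \<phi> V \<psi>. (U, \<phi>) \<in> A \<Longrightarrow> (V, \<psi>) \<in> B \<Longrightarrow> F U \<phi> V \<psi> = c"
  shows "(\<Union>(U, \<phi>)\<in>A. \<Union>(V, \<psi>)\<in>B. F U \<phi> V \<psi>) = c"
  by (rule Union_const[OF assms(1)], clarify, rule Union_const[OF assms(2)]) (use assms(3) in auto)

lemma FF_mult: "u \<in> rat \<Longrightarrow> v \<in> rat \<Longrightarrow> cls u \<otimes>\<^bsub>FF\<^esub> cls v = cls (\<lambda>p. u p * v p)"
  unfolding germ_ring_def monoid.simps
proof (rule Union_const2)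
  fix U \<phi> V \<psi> assume *: "(U, \<phi>) \<in> cls u" "(V, \<psi>) \<in> cls v"
  have "\<forall>\<^sub>F p in gen. \<phi> p * \<psi> p = u p * v p"
    using * by (auto simp: cls_def elim: eventually_elim2)
  moreover have "U \<inter> V \<in> nonempty_opens X" using * by (simp add: cls_def nonempty_opens_Int)
  ultimately show "germ X (nonempty_opens X) (U \<inter> V) (\<lambda>p. \<phi> p * \<psi> p) = cls (\<lambda>p. u p * v p)"
    by (simp only: germ_eq_cls) (rule cls_eqI)
qed (auto simp: cls_nonempty)

lemma FF_add: "u \<in> rat \<Longrightarrow> v \<in> rat \<Longrightarrow> cls u \<oplus>\<^bsub>FF\<^esub> cls v = cls (\<lambda>p. u p + v p)"
  unfolding germ_ring_def ring_record_simps
proof (rule Union_const2)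
  fix U \<phi> V \<psi> assume *: "(U, \<phi>) \<in> cls u" "(V, \<psi>) \<in> cls v"
  then have UV: "U \<inter> V \<in> nonempty_opens X" by (simp add: cls_def nonempty_opens_Int)
  have "\<forall>\<^sub>F p in gen. p \<in> U \<inter> V"
    by (rule eventually_open) (use UV in \<open>auto simp: nonempty_opens_def\<close>)
  moreover have "\<forall>\<^sub>F p in gen. u p = \<phi> p" "\<forall>\<^sub>F p in gen. v p = \<psi> p" using * by (auto simp: cls_def)
  ultimately have "\<forall>\<^sub>F p in gen. restr_fun (U \<inter> V) (\<lambda>p. \<phi> p + \<psi> p) p = u p + v p"
    by eventually_elim (simp add: restr_fun_def)
  then show "germ X (nonempty_opens X) (U \<inter> V) (restr_fun (U \<inter> V) (\<lambda>p. \<phi> p + \<psi> p)) = cls (\<lambda>p. u p + v p)"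
    unfolding germ_eq_cls[OF UV] by (rule cls_eqI)
qed (auto simp: cls_nonempty)

lemma FF_zero: "\<zero>\<^bsub>FF\<^esub> = cls (\<lambda>_. 0)"
  using X_in_nonempty_opens by (simp add: germ_ring_def germ_eq_cls)

lemma FF_one: "\<one>\<^bsub>FF\<^esub> = cls (\<lambda>_. 1)"
proof -
  have "\<one>\<^bsub>FF\<^esub> = cls (restr_fun X (\<lambda>_. 1))"
    using X_in_nonempty_opens by (simp add: germ_ring_def germ_eq_cls)
  also have "\<dots> = cls (\<lambda>_. 1)" by (rule cls_eqI[OF restr_ev[OF openin_X X_nonempty]])
  finally show ?thesis .
qed

text \<open>Inverses exist by \<open>rat_cases\<close>: a rational function that is not generically
  zero is generically nonzero.\<close>

lemma FF_field: "field FF"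
proof -
  have "cring FF"
  proof (intro cringI abelian_groupI comm_monoidI; (unfold FF_carrier FF_zero FF_one)?)
    fix x assume "x \<in> {cls u |u. u \<in> rat}"
    then obtain u where u: "x = cls u" "u \<in> rat" by auto
    have m: "(\<lambda>p. - 1 * u p) \<in> rat" by (intro rat_mult rat_const u)
    show "\<exists>y\<in>{cls u |u. u \<in> rat}. y \<oplus>\<^bsub>FF\<^esub> x = cls (\<lambda>_. 0)"
      using FF_add[OF m u(2)] m u(1) by (intro bexI[of _ "cls (\<lambda>p. - 1 * u p)"]) auto
  qed (auto simp: FF_add FF_mult rat_add rat_mult rat_const algebra_simps)
  then show ?thesis
  proof (rule cring.cring_fieldI2)
    show "\<zero>\<^bsub>FF\<^esub> \<noteq> \<one>\<^bsub>FF\<^esub>" unfolding FF_zero FF_one using gen_neq_bot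
      by (simp add: cls_eq_iff[OF rat_const] trivial_limit_def)
    fix a assume a: "a \<in> carrier FF" "a \<noteq> \<zero>\<^bsub>FF\<^esub>"
    then obtain u where u: "a = cls u" "u \<in> rat" by (auto simp: FF_carrier)
    then have "\<not> (\<forall>\<^sub>F p in gen. u p = 0)" using a(2) FF_zero cls_eqI[of u "\<lambda>_. 0"] by auto
    then have nz: "\<forall>\<^sub>F p in gen. u p \<noteq> 0" using rat_cases[OF u(2)] by blast
    have "a \<otimes>\<^bsub>FF\<^esub> cls (\<lambda>p. inverse (u p)) = \<one>\<^bsub>FF\<^esub>"
      unfolding u(1) FF_mult[OF u(2) rat_inverse[OF u(2)]] FF_one
      by (rule cls_eqI) (use nz in \<open>eventually_elim, simp\<close>)
    then show "\<exists>b\<in>carrier FF. a \<otimes>\<^bsub>FF\<^esub> b = \<one>\<^bsub>FF\<^esub>"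
      using rat_inverse[OF u(2)] cls_carrier by blast
  qed
qed

lemma FF_combine:
  assumes "set rs \<subseteq> rat" "set us \<subseteq> rat" "length rs = length us"
  shows "ring.combine FF (map cls rs) (map cls us) = cls (\<lambda>p. \<Sum>i<length us. (rs ! i) p * (us ! i) p)
    \<and> (\<lambda>p. \<Sum>i<length us. (rs ! i) p * (us ! i) p) \<in> rat"
  using assms(3,1,2)
proof (induction rs us rule: list_induct2)
  case Nil
  show ?case using field.is_ring[OF FF_field] by (simp add: ring.combine.simps FF_zero rat_const)
next
  case (Cons r rs u us)
  interpret field FF by (rule FF_field)
  have S: "(\<lambda>p. \<Sum>i<length (u # us). ((r # rs) ! i) p * ((u # us) ! i) p)
      = (\<lambda>p. r p * u p + (\<Sum>i<length us. (rs ! i) p * (us ! i) p))"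
    by (simp add: sum.lessThan_Suc_shift del: sum.lessThan_Suc)
  show ?case unfolding S using Cons by (auto simp: FF_mult FF_add rat_mult rat_add)
qed

end

section \<open>A covering of the projective line\<close>

locale covering = variety X for X :: "('n::finite, 'k::alg_closed_field) pt set" +
  fixes f :: "('n, 'k) pt \<Rightarrow> (2, 'k) pt" and n :: nat
  assumes morphism: "surjective_morphism X proj_line f"
    and degree: "has_degree X proj_line f n"
begin

lemma f_mem: "p \<in> X \<Longrightarrow> f p \<in> proj_space"
  using morphism by (auto simp: surjective_morphism_def)

lemma f_surj: "q \<in> proj_space \<Longrightarrow> \<exists>p\<in>X. f p = q"
  using morphism unfolding surjective_morphism_def by (metis imageE)

lemma open_preimage: "openin (zar proj_line) V \<Longrightarrow> openin (zar X) (X \<inter> f -` V)"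
proof -
  assume V: "openin (zar proj_line) V"
  have "continuous_map (zar X) (zar proj_line) f"
    using morphism by (simp add: surjective_morphism_def is_morphism_def)
  then have "openin (zar X) {p \<in> topspace (zar X). f p \<in> V}" using V by (rule openin_continuous_map_preimage)
  moreover have "{p \<in> topspace (zar X). f p \<in> V} = X \<inter> f -` V" by (auto simp: topspace_zar)
  ultimately show ?thesis by simp
qed

lemma pullback_regular:
  "openin (zar proj_line) V \<Longrightarrow> \<phi> \<in> regular proj_line V \<Longrightarrow> pullback_fun X f V \<phi> \<in> regular X (X \<inter> f -` V)"
  using morphism by (simp add: surjective_morphism_def is_morphism_def)

definition y :: "('n, 'k) pt \<Rightarrow> 2 \<Rightarrow> 'k" where "y p = rep (f p)"

text \<open>Division by zero gives \<open>t = 0\<close> over infinity, so wherever the value at a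
  point matters, membership in \<open>inf_fibre\<close> has to be considered along with it.\<close>

definition t :: "('n, 'k) pt \<Rightarrow> 'k" where "t p = y p 1 / y p 0"

definition inf_fibre :: "('n, 'k) pt set" where "inf_fibre = {p \<in> X. y p 0 = 0}"

lemma y_mem: "p \<in> X \<Longrightarrow> y p \<in> f p"
  unfolding y_def by (rule rep_mem[OF f_mem])

lemma y_nonzero: "p \<in> X \<Longrightarrow> y p 0 \<noteq> 0 \<or> y p 1 \<noteq> 0"
  using proj_point_mem(1)[OF f_mem y_mem, of p] vec2_eta[of "y p"] vec2_zero_iff[of "y p 0" "y p 1"] by metis

lemma point_mem: "p \<in> X \<Longrightarrow> c \<noteq> 0 \<Longrightarrow> (\<lambda>i. c * y p i) \<in> f p"
  using proj_point_mem(2)[OF f_mem y_mem, of p] by (auto simp: proj_point_def)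

lemma affine_mem: "p \<in> X - inf_fibre \<Longrightarrow> vec2 1 (t p) \<in> f p"
proof -
  assume p: "p \<in> X - inf_fibre"
  then have "y p 0 \<noteq> 0" by (auto simp: inf_fibre_def)
  then have "vec2 1 (t p) = (\<lambda>i. inverse (y p 0) * y p i)"
    using vec2_scale[of "inverse (y p 0)" "y p 0" "y p 1"] vec2_eta[of "y p"] by (simp add: t_def divide_inverse mult.commute)
  then show ?thesis using point_mem[of p "inverse (y p 0)"] p \<open>y p 0 \<noteq> 0\<close> by simp
qed

lemma infinite_mem: "p \<in> inf_fibre \<Longrightarrow> vec2 0 1 \<in> f p"
proof -
  assume p: "p \<in> inf_fibre"
  then have y: "p \<in> X" "y p 0 = 0" "y p 1 \<noteq> 0" using y_nonzero by (auto simp: inf_fibre_def)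
  then have "vec2 0 1 = (\<lambda>i. inverse (y p 1) * y p i)"
    using vec2_scale[of "inverse (y p 1)" "y p 0" "y p 1"] vec2_eta[of "y p"] by simp
  then show ?thesis using point_mem[of p "inverse (y p 1)"] y by simp
qed

lemma vec2_point: "a \<noteq> 0 \<or> b \<noteq> 0 \<Longrightarrow> proj_point (vec2 a b) \<in> proj_space \<and> vec2 a b \<in> proj_point (vec2 a b)"
proof
  assume "a \<noteq> 0 \<or> b \<noteq> 0"
  then have "vec2 a b \<noteq> (\<lambda>_. 0)" by (simp add: vec2_zero_iff)
  then show "proj_point (vec2 a b) \<in> proj_space" unfolding proj_space_def by blast
  show "vec2 a b \<in> proj_point (vec2 a b)" unfolding proj_point_def by (rule CollectI, rule exI[of _ 1]) simp
qed

definition pre :: "((2 \<Rightarrow> 'k) \<Rightarrow> 'k) \<Rightarrow> ('n, 'k) pt set" where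
  "pre h = {p \<in> X. h (y p) \<noteq> 0}"

lemma pre_eq: "form e h \<Longrightarrow> pre h = X \<inter> f -` {q \<in> proj_space. \<forall>x\<in>q. h x \<noteq> 0}"
  using form_nonzero_iff[OF _ f_mem y_mem, of e h] f_mem by (auto simp: pre_def)

lemma openin_pre: "form e h \<Longrightarrow> openin (zar X) (pre h)"
  using open_preimage[OF openin_form[of e h proj_space]] by (simp add: pre_eq)

lemma pre_nonempty:
  assumes "form e h" "h (vec2 a b) \<noteq> 0" "a \<noteq> 0 \<or> b \<noteq> 0" shows "pre h \<noteq> {}"
proof -
  obtain p where p: "p \<in> X" "f p = proj_point (vec2 a b)" using f_surj vec2_point[OF assms(3)] by blast
  then have "h (y p) \<noteq> 0"
    using form_nonzero_iff[OF assms(1), of "f p" "vec2 a b"] vec2_point[OF assms(3)] y_mem assms(2) by metis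
  then show ?thesis using p by (auto simp: pre_def)
qed

lemma regular_pull:
  assumes "form e g" "form e h"
  shows "restr_fun (pre h) (\<lambda>p. g (y p) / h (y p)) \<in> regular X (pre h)"
proof -
  define V :: "(2, 'k) pt set" where "V = {q \<in> proj_space. \<forall>x\<in>q. h x \<noteq> 0}"
  have V: "openin (zar proj_line) V" unfolding V_def by (rule openin_form[OF assms(2)]) simp
  have "restr_fun V (\<lambda>p. g (rep p) / h (rep p)) \<in> regular proj_line V"
    by (rule regular_quotient[OF V _ assms]) (auto simp: V_def)
  from pullback_regular[OF V this]
  have "pullback_fun X f V (restr_fun V (\<lambda>p. g (rep p) / h (rep p))) \<in> regular X (X \<inter> f -` V)" .
  moreover have "X \<inter> f -` V = pre h" using pre_eq[OF assms(2)] by (simp add: V_def)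
  moreover have "pullback_fun X f V (restr_fun V (\<lambda>p. g (rep p) / h (rep p))) = restr_fun (pre h) (\<lambda>p. g (y p) / h (y p))"
    unfolding pullback_fun_def \<open>X \<inter> f -` V = pre h\<close> using pre_eq[OF assms(2)]
    by (auto simp: restr_fun_def y_def V_def)
  ultimately show ?thesis by simp
qed

lemma reg_pull:
  assumes "form e g" "form e h" "P \<in> pre h"
  shows "(\<lambda>p. g (y p) / h (y p)) \<in> reg P"
proof (rule regI[OF openin_pre[OF assms(2)] assms(3) regular_pull[OF assms(1,2)]])
  have "\<forall>\<^sub>F p in gen. p \<in> pre h" by (rule eventually_open[OF openin_pre[OF assms(2)]]) (use assms in auto)
  then show "\<forall>\<^sub>F p in gen. g (y p) / h (y p) = restr_fun (pre h) (\<lambda>p. g (y p) / h (y p)) p"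
    by eventually_elim (simp add: restr_fun_def)
qed

lemma form_coord_lin: "form 1 (\<lambda>x :: 2 \<Rightarrow> 'k. x 1 - c * x 0)"
proof -
  have "form 1 (\<lambda>x :: 2 \<Rightarrow> 'k. x 1 + (- c) * x 0)" by (intro form_add form_smult form_coord)
  then show ?thesis by simp
qed

lemma finite_part: "pre (\<lambda>x. x 0) = X - inf_fibre"
  by (auto simp: pre_def inf_fibre_def)

lemma openin_finite_part: "openin (zar X) (X - inf_fibre)"
  using openin_pre[OF form_coord[of 0]] by (simp add: finite_part)

lemma finite_part_nonempty: "X - inf_fibre \<noteq> {}"
  using pre_nonempty[OF form_coord[of 0], of 1 0] by (simp add: finite_part)

lemma ev_finite_part: "\<forall>\<^sub>F p in gen. p \<in> X - inf_fibre"
  by (rule eventually_open[OF openin_finite_part finite_part_nonempty])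

lemma t_neq: "\<forall>\<^sub>F p in gen. t p \<noteq> c"
proof -
  have "\<forall>\<^sub>F p in gen. p \<in> pre (\<lambda>x. x 1 - c * x 0)"
    by (rule eventually_open[OF openin_pre[OF form_coord_lin] pre_nonempty[OF form_coord_lin[of c], of 1 "c + 1"]]) auto
  then show ?thesis using ev_finite_part
    by eventually_elim (auto simp: pre_def inf_fibre_def t_def field_simps)
qed

lemma t_reg: "P \<in> X - inf_fibre \<Longrightarrow> t \<in> reg P"
  using reg_pull[OF form_coord[of 1] form_coord[of 0], of P] unfolding finite_part t_def[abs_def] by simp

lemma regular_t: "restr_fun (X - inf_fibre) t \<in> regular X (X - inf_fibre)"
  using regular_pull[OF form_coord[of 1] form_coord[of 0]] unfolding finite_part t_def[abs_def] by simp

lemma t_rat: "t \<in> rat"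
  using t_reg reg_rat finite_part_nonempty by blast

lemma pre_lin: "P \<in> X \<Longrightarrow> P \<in> inf_fibre \<or> t P \<noteq> c \<Longrightarrow> P \<in> pre (\<lambda>x. x 1 - c * x 0)"
  using y_nonzero[of P] by (auto simp: pre_def inf_fibre_def t_def field_simps)

lemma t_inverse_reg: "P \<in> X \<Longrightarrow> P \<in> inf_fibre \<or> t P \<noteq> c \<Longrightarrow> (\<lambda>p. inverse (t p - c)) \<in> reg P"
proof -
  assume P: "P \<in> X" "P \<in> inf_fibre \<or> t P \<noteq> c"
  have "\<forall>\<^sub>F p in gen. y p 0 / (y p 1 - c * y p 0) = inverse (t p - c)"
    using ev_finite_part by eventually_elim (auto simp: inf_fibre_def t_def field_simps)
  then show ?thesis by (rule reg_cong[OF reg_pull[OF form_coord form_coord_lin pre_lin[OF P]]])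
qed

lemma t_quot_reg: "P \<in> X \<Longrightarrow> P \<in> inf_fibre \<or> t P \<noteq> c \<Longrightarrow> (\<lambda>p. t p * inverse (t p - c)) \<in> reg P"
proof -
  assume P: "P \<in> X" "P \<in> inf_fibre \<or> t P \<noteq> c"
  have "\<forall>\<^sub>F p in gen. y p 1 / (y p 1 - c * y p 0) = t p * inverse (t p - c)"
    using ev_finite_part by eventually_elim (auto simp: inf_fibre_def t_def field_simps)
  then show ?thesis by (rule reg_cong[OF reg_pull[OF form_coord form_coord_lin pre_lin[OF P]]])
qed

lemma t_inverse_reg_inf: "P \<in> inf_fibre \<Longrightarrow> (\<lambda>p. inverse (t p)) \<in> reg P"
  using t_inverse_reg[of P 0] by (auto simp: inf_fibre_def)

lemma poly_rat: "u \<in> rat \<Longrightarrow> (\<lambda>p. poly q (u p)) \<in> rat"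
  by (induction q) (auto intro: rat_const rat_add rat_mult)

lemma poly_t_neq_0:
  assumes "q \<noteq> 0" shows "\<forall>\<^sub>F p in gen. poly q (t p) \<noteq> 0"
proof -
  have "finite {x. poly q x = 0}" using assms by (rule poly_roots_finite)
  then have "\<forall>\<^sub>F p in gen. \<forall>x\<in>{x. poly q x = 0}. t p \<noteq> x"
    by (rule eventually_ball_finite) (auto intro: t_neq)
  then show ?thesis by eventually_elim auto
qed

subsection \<open>Linear independence over the function field of the line\<close>

definition ratio :: "'k poly \<Rightarrow> 'k poly \<Rightarrow> ('n, 'k) pt \<Rightarrow> 'k" where
  "ratio a b p = poly a (t p) / poly b (t p)"

lemma ratio_rat: "ratio a b \<in> rat"
  unfolding ratio_def[abs_def] divide_inverse by (intro rat_mult rat_inverse poly_rat t_rat)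

text \<open>The pulled back field is k(t). Dehomogenizing a local quotient of forms gives a quotient
  of polynomials in \<open>t\<close>; conversely, homogenizing two polynomials to a common degree
  gives a regular function on the nonvanishing locus of the denominator.\<close>

lemma pullback_field_eq: "pullback_field X proj_line f = {cls (ratio a b) | a b. b \<noteq> 0}"
proof (intro equalityI subsetI)
  fix z assume "z \<in> pullback_field X proj_line f"
  then obtain V \<phi> where z: "z = germ X (nonempty_opens X) (X \<inter> f -` V) (pullback_fun X f V \<phi>)"
    and V: "V \<in> nonempty_opens proj_line" and \<phi>: "\<phi> \<in> regular proj_line V"
    unfolding pullback_field_def mem_Collect_eq by (elim exE conjE) (rule that)
  have oV: "openin (zar proj_line) V" "V \<noteq> {}" using V by (auto simp: nonempty_opens_def)
  have VP: "V \<subseteq> proj_space" using openin_subset[OF oV(1)] by (auto simp: topspace_subtopology)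
  have pre_ne: "X \<inter> f -` W \<noteq> {}" if "W \<subseteq> V" "W \<noteq> {}" for W using f_surj VP that by blast
  obtain q0 where q0: "q0 \<in> V" using oV by auto
  from regularD[OF \<phi> q0] obtain W e g h where W: "openin (zar proj_line) W" "q0 \<in> W" "W \<subseteq> V" "form e g" "form e h"
    "\<forall>q\<in>W. \<forall>x\<in>q. h x \<noteq> 0" "\<forall>q\<in>W. \<forall>x\<in>q. \<phi> q = g x / h x" by (elim exE conjE) (rule that)
  obtain a where a: "\<And>c. g (vec2 1 c) = poly a c" using form_dehom(1)[OF W(4)] by blast
  obtain b where b: "\<And>c. h (vec2 1 c) = poly b c" using form_dehom(1)[OF W(5)] by blast
  have W': "openin (zar X) (X \<inter> f -` W)" "X \<inter> f -` W \<noteq> {}" using open_preimage[OF W(1)] pre_ne W(2,3) by auto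
  have ev: "\<forall>\<^sub>F p in gen. pullback_fun X f V \<phi> p = ratio a b p \<and> poly b (t p) \<noteq> 0"
    using eventually_open[OF W'] ev_finite_part
  proof eventually_elim
    case (elim p)
    then have "\<phi> (f p) = g (vec2 1 (t p)) / h (vec2 1 (t p))" "h (vec2 1 (t p)) \<noteq> 0" using W(6,7) affine_mem by auto
    then show ?case using elim W(3) by (auto simp: pullback_fun_def restr_fun_def ratio_def a b)
  qed
  have "b \<noteq> 0"
  proof
    assume "b = 0"
    have "\<forall>\<^sub>F p in gen. False" using ev by eventually_elim (simp add: \<open>b = 0\<close>)
    then show False using gen_neq_bot by (simp add: trivial_limit_def)
  qed
  moreover have "z = cls (ratio a b)"
    unfolding z using open_preimage[OF oV(1)] pre_ne[of V] oV
    by (subst germ_eq_cls) (auto simp: nonempty_opens_def intro!: cls_eqI eventually_mono[OF ev])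
  ultimately show "z \<in> {cls (ratio a b) | a b. b \<noteq> 0}" by blast
next
  fix z assume "z \<in> {cls (ratio a b) | a b. b \<noteq> 0}"
  then obtain a b where z: "z = cls (ratio a b)" and b: "b \<noteq> 0" by blast
  define e where "e = max (degree a) (degree b)"
  define g h where "g = homogenize e a" and "h = homogenize e b"
  have fm: "form e g" "form e h" by (simp_all add: g_def h_def form_homogenize)
  have gh: "g (vec2 1 c) = poly a c" "h (vec2 1 c) = poly b c" for c
    by (simp_all add: g_def h_def e_def homogenize_affine)
  define V :: "(2, 'k) pt set" where "V = {q \<in> proj_space. \<forall>x\<in>q. h x \<noteq> 0}"
  have V: "openin (zar proj_line) V" unfolding V_def by (rule openin_form[OF fm(2)]) simp
  obtain c where c: "poly b c \<noteq> 0" using poly_nonroot[OF b] by blast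
  have "V \<noteq> {}"
    using form_nonzero_iff[OF fm(2), of "proj_point (vec2 1 c)" "vec2 1 c"] vec2_point[of 1 c] c gh(2) by (auto simp: V_def)
  with V have VN: "V \<in> nonempty_opens proj_line" by (simp add: nonempty_opens_def)
  define \<phi> where "\<phi> = restr_fun V (\<lambda>p. g (rep p) / h (rep p))"
  have \<phi>: "\<phi> \<in> regular proj_line V" unfolding \<phi>_def by (rule regular_quotient[OF V _ fm]) (auto simp: V_def)
  have pre: "X \<inter> f -` V = pre h" using pre_eq[OF fm(2)] by (simp add: V_def)
  have ne: "pre h \<noteq> {}" by (rule pre_nonempty[OF fm(2), of 1 c]) (use gh c in auto)
  have "\<forall>\<^sub>F p in gen. ratio a b p = pullback_fun X f V \<phi> p"
    using eventually_open[OF openin_pre[OF fm(2)] ne] ev_finite_part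
  proof eventually_elim
    case (elim p)
    then have "pullback_fun X f V \<phi> p = g (y p) / h (y p)"
      using pre by (auto simp: pullback_fun_def restr_fun_def \<phi>_def y_def)
    also have "\<dots> = g (vec2 1 (t p)) / h (vec2 1 (t p))"
      by (rule form_quotient_const[OF fm f_mem y_mem affine_mem]) (use elim in auto)
    finally show ?case by (simp add: gh ratio_def)
  qed
  then have "z = germ X (nonempty_opens X) (X \<inter> f -` V) (pullback_fun X f V \<phi>)"
    unfolding z pre using openin_pre[OF fm(2)] ne
    by (subst germ_eq_cls) (auto simp: nonempty_opens_def intro!: cls_eqI)
  then show "z \<in> pullback_field X proj_line f"
    unfolding pullback_field_def mem_Collect_eq using VN \<phi> by (intro exI conjI)
qed

lemma subfield_pullback: "subfield (pullback_field X proj_line f) FF"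
proof -
  interpret FF: field FF by (rule FF_field)
  show ?thesis
    unfolding pullback_field_eq
  proof (rule FF.subfieldI', rule FF.subringI)
    show "{cls (ratio a b) |a b. b \<noteq> 0} \<subseteq> carrier FF" using ratio_rat by auto
    show "\<one>\<^bsub>FF\<^esub> \<in> {cls (ratio a b) |a b. b \<noteq> 0}"
      unfolding FF_one by (intro CollectI exI[of _ 1]) (auto simp: ratio_def[abs_def])
  next
    fix h assume "h \<in> {cls (ratio a b) |a b. b \<noteq> 0}"
    then obtain a b where h: "h = cls (ratio a b)" "b \<noteq> 0" by auto
    have "cls (ratio (- a) b) \<oplus>\<^bsub>FF\<^esub> h = \<zero>\<^bsub>FF\<^esub>"
      unfolding h FF_add[OF ratio_rat ratio_rat] FF_zero by (intro cls_eqI always_eventually) (simp add: ratio_def)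
    then have "\<ominus>\<^bsub>FF\<^esub> h = cls (ratio (- a) b)"
      using ratio_rat h by (intro FF.minus_equality) auto
    then show "\<ominus>\<^bsub>FF\<^esub> h \<in> {cls (ratio a b) |a b. b \<noteq> 0}" using h by auto
  next
    fix h1 h2 assume "h1 \<in> {cls (ratio a b) |a b. b \<noteq> 0}" "h2 \<in> {cls (ratio a b) |a b. b \<noteq> 0}"
    then obtain a b a' b' where h: "h1 = cls (ratio a b)" "b \<noteq> 0" "h2 = cls (ratio a' b')" "b' \<noteq> 0" by auto
    have "h1 \<otimes>\<^bsub>FF\<^esub> h2 = cls (ratio (a * a') (b * b'))"
      unfolding h FF_mult[OF ratio_rat ratio_rat] by (intro cls_eqI always_eventually) (simp add: ratio_def)
    then show "h1 \<otimes>\<^bsub>FF\<^esub> h2 \<in> {cls (ratio a b) |a b. b \<noteq> 0}" using h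
      by (intro CollectI exI[of _ "a * a'"] exI[of _ "b * b'"]) simp
    have "h1 \<oplus>\<^bsub>FF\<^esub> h2 = cls (ratio (a * b' + b * a') (b * b'))"
      unfolding h FF_add[OF ratio_rat ratio_rat]
    proof (rule cls_eqI)
      show "\<forall>\<^sub>F p in gen. ratio a b p + ratio a' b' p = ratio (a * b' + b * a') (b * b') p"
        using poly_t_neq_0[OF h(2)] poly_t_neq_0[OF h(4)] by eventually_elim (simp add: ratio_def field_simps)
    qed
    then show "h1 \<oplus>\<^bsub>FF\<^esub> h2 \<in> {cls (ratio a b) |a b. b \<noteq> 0}" using h
      by (intro CollectI exI[of _ "a * b' + b * a'"] exI[of _ "b * b'"]) simp
  next
    fix k assume "k \<in> {cls (ratio a b) |a b. b \<noteq> 0} - {\<zero>\<^bsub>FF\<^esub>}"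
    then obtain a b where k: "k = cls (ratio a b)" "b \<noteq> 0" "k \<noteq> \<zero>\<^bsub>FF\<^esub>" by auto
    have a: "a \<noteq> 0" using k unfolding FF_zero by (auto simp: ratio_def[abs_def])
    have "k \<otimes>\<^bsub>FF\<^esub> cls (ratio b a) = \<one>\<^bsub>FF\<^esub>"
      unfolding k FF_mult[OF ratio_rat ratio_rat] FF_one
    proof (rule cls_eqI)
      show "\<forall>\<^sub>F p in gen. ratio a b p * ratio b a p = 1"
        using poly_t_neq_0[OF k(2)] poly_t_neq_0[OF a] by eventually_elim (simp add: ratio_def)
    qed
    then have "inv\<^bsub>FF\<^esub> k = cls (ratio b a)"
      using ratio_rat k by (intro FF.comm_inv_char) auto
    then show "inv\<^bsub>FF\<^esub> k \<in> {cls (ratio a b) |a b. b \<noteq> 0}" using a by auto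
  qed
qed

text \<open>Multiplying by all denominators turns coefficients in k(t) into polynomials.\<close>

lemma poly_indep_ratio:
  assumes ind: "poly_indep gen t s m" and b: "\<And>j. j < m \<Longrightarrow> b j \<noteq> 0"
    and ev: "\<forall>\<^sub>F p in gen. (\<Sum>j<m. ratio (a j) (b j) p * s j p) = 0" and j: "j < m"
  shows "a j = 0"
proof -
  define q where "q = (\<lambda>j. a j * (\<Prod>i\<in>{..<m} - {j}. b i))"
  have "\<forall>\<^sub>F p in gen. \<forall>i\<in>{..<m}. poly (b i) (t p) \<noteq> 0"
    by (intro eventually_ball_finite ballI poly_t_neq_0) (use b in auto)
  with ev have "\<forall>\<^sub>F p in gen. (\<Sum>j<m. poly (q j) (t p) * s j p) = 0"
  proof eventually_elim
    case (elim p)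
    have "poly (q j) (t p) = (\<Prod>i<m. poly (b i) (t p)) * ratio (a j) (b j) p" if "j < m" for j
    proof -
      have "(\<Prod>i<m. poly (b i) (t p)) = poly (b j) (t p) * (\<Prod>i\<in>{..<m} - {j}. poly (b i) (t p))"
        using that by (subst prod.remove[of _ j]) auto
      then show ?thesis using that elim(2) by (simp add: q_def ratio_def poly_prod)
    qed
    then have "(\<Sum>j<m. poly (q j) (t p) * s j p) = (\<Prod>i<m. poly (b i) (t p)) * (\<Sum>j<m. ratio (a j) (b j) p * s j p)"
      unfolding sum_distrib_left by (intro sum.cong) (auto simp: mult.assoc)
    then show ?case using elim(1) by simp
  qed
  from poly_indepD[OF ind this j] have "a j * (\<Prod>i\<in>{..<m} - {j}. b i) = 0" by (simp add: q_def)
  moreover have "(\<Prod>i\<in>{..<m} - {j}. b i) \<noteq> 0" using b by (auto simp: prod_zero_iff)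
  ultimately show ?thesis by simp
qed

text \<open>The bridge between dimension over the pulled back field and relations with polynomial
  coefficients; the degree of \<open>f\<close> enters the proof through it.\<close>

lemma independent_iff:
  assumes s: "\<And>j. j < m \<Longrightarrow> s j \<in> rat"
  shows "ring.independent FF (pullback_field X proj_line f) (map (\<lambda>j. cls (s j)) [0..<m]) \<longleftrightarrow> poly_indep gen t s m"
proof -
  interpret FF: field FF by (rule FF_field)
  note K = subfield_pullback
  define us where "us = map s [0..<m]"
  have us: "map cls us = map (\<lambda>j. cls (s j)) [0..<m]" "length us = m" "set us \<subseteq> rat" "set (map cls us) \<subseteq> carrier FF"
    using s by (auto simp: us_def intro!: cls_carrier)
  have comb: "FF.combine (map cls rs) (map cls us) = cls (\<lambda>p. \<Sum>i<m. (rs ! i) p * s i p)"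
      "(\<lambda>p. \<Sum>i<m. (rs ! i) p * s i p) \<in> rat"
    if "set rs \<subseteq> rat" "length rs = m" for rs
    using FF_combine[OF that(1) us(3)] that(2) us(2) by (simp_all add: us_def)
  show ?thesis unfolding us(1)[symmetric]
  proof
    assume ind: "FF.independent (pullback_field X proj_line f) (map cls us)"
    show "poly_indep gen t s m" unfolding poly_indep_def
    proof (intro allI impI)
      fix q j assume ev: "\<forall>\<^sub>F p in gen. (\<Sum>j<m. poly (q j) (t p) * s j p) = 0" and j: "j < m"
      define rs where "rs = map (\<lambda>j. ratio (q j) 1) [0..<m]"
      have "FF.combine (map cls rs) (map cls us) = \<zero>\<^bsub>FF\<^esub>"
        using ratio_rat ev by (subst comb) (auto simp: rs_def FF_zero ratio_def intro!: cls_eqI)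
      moreover have "set (map cls rs) \<subseteq> pullback_field X proj_line f"
        unfolding pullback_field_eq rs_def by force
      ultimately have "set (take (length (map cls us)) (map cls rs)) \<subseteq> {\<zero>\<^bsub>FF\<^esub>}"
        by (intro FF.independent_imp_trivial_combine[OF K ind])
      moreover have "cls (ratio (q j) 1) \<in> set (take (length (map cls us)) (map cls rs))"
        using j us(2) by (simp add: rs_def)
      ultimately have "cls (ratio (q j) 1) = cls (\<lambda>_. 0)" by (auto simp: FF_zero)
      then have z: "\<forall>\<^sub>F p in gen. ratio (q j) 1 p = 0" by (simp add: cls_eq_iff[OF ratio_rat])
      show "q j = 0"
      proof (rule ccontr)
        assume "q j \<noteq> 0"
        have "\<forall>\<^sub>F p in gen. False" using z poly_t_neq_0[OF \<open>q j \<noteq> 0\<close>] by eventually_elim (simp add: ratio_def)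
        then show False using gen_neq_bot by (simp add: trivial_limit_def)
      qed
    qed
  next
    assume ind: "poly_indep gen t s m"
    show "FF.independent (pullback_field X proj_line f) (map cls us)"
    proof (rule ccontr)
      assume dep: "FF.dependent (pullback_field X proj_line f) (map cls us)"
      from FF.dependent_imp_non_trivial_combine[OF K us(4) dep]
      obtain Ks where Ks: "length Ks = m" "FF.combine Ks (map cls us) = \<zero>\<^bsub>FF\<^esub>"
        "set Ks \<subseteq> pullback_field X proj_line f" "set Ks \<noteq> {\<zero>\<^bsub>FF\<^esub>}" using us(2) by auto
      have "\<forall>j. \<exists>ab. j < m \<longrightarrow> Ks ! j = cls (ratio (fst ab) (snd ab)) \<and> snd ab \<noteq> 0"
      proof
        fix j show "\<exists>ab. j < m \<longrightarrow> Ks ! j = cls (ratio (fst ab) (snd ab)) \<and> snd ab \<noteq> 0"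
        proof (cases "j < m")
          case True
          then have "Ks ! j \<in> pullback_field X proj_line f" using Ks(1,3) nth_mem by blast
          then obtain a b where "Ks ! j = cls (ratio a b)" "b \<noteq> 0" unfolding pullback_field_eq by blast
          then show ?thesis by (intro exI[of _ "(a, b)"]) simp
        qed simp
      qed
      from choice[OF this] obtain ab where ab: "\<And>j. j < m \<Longrightarrow> Ks ! j = cls (ratio (fst (ab j)) (snd (ab j))) \<and> snd (ab j) \<noteq> 0"
        by blast
      define rs where "rs = map (\<lambda>j. ratio (fst (ab j)) (snd (ab j))) [0..<m]"
      have "Ks = map cls rs" using ab Ks(1) by (intro nth_equalityI) (auto simp: rs_def)
      moreover have rs: "set rs \<subseteq> rat" "length rs = m" using ratio_rat by (auto simp: rs_def)
      ultimately have "cls (\<lambda>p. \<Sum>i<m. (rs ! i) p * s i p) = cls (\<lambda>_. 0)"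
        using Ks(2) comb(1) by (simp add: FF_zero)
      then have ev: "\<forall>\<^sub>F p in gen. (\<Sum>i<m. (rs ! i) p * s i p) = 0" using cls_eq_iff[OF comb(2)[OF rs]] by simp
      have "fst (ab j) = 0" if "j < m" for j
      proof (rule poly_indep_ratio[OF ind _ _ that])
        show "\<forall>\<^sub>F p in gen. (\<Sum>j<m. ratio (fst (ab j)) (snd (ab j)) p * s j p) = 0"
          using ev by (simp add: rs_def)
      qed (use ab in simp)
      then have "Ks ! j = \<zero>\<^bsub>FF\<^esub>" if "j < m" for j
        using ab[OF that] that by (simp add: FF_zero ratio_def[abs_def])
      then have "set Ks \<subseteq> {\<zero>\<^bsub>FF\<^esub>}" using Ks(1) by (auto simp: in_set_conv_nth)
      moreover have "Ks \<noteq> []" using dep us(2) Ks(1) FF.li_Nil by (cases us) auto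
      ultimately have "set Ks = {\<zero>\<^bsub>FF\<^esub>}" by (cases Ks) auto
      then show False using Ks(4) by simp
    qed
  qed
qed

lemma indep_le:
  assumes "\<And>j. j < m \<Longrightarrow> s j \<in> rat" "poly_indep gen t s m" shows "m \<le> n"
proof -
  interpret FF: field FF by (rule FF_field)
  have "FF.independent (pullback_field X proj_line f) (map (\<lambda>j. cls (s j)) [0..<m])"
    using independent_iff assms by blast
  moreover have "set (map (\<lambda>j. cls (s j)) [0..<m]) \<subseteq> carrier FF" using assms(1) by (auto intro!: cls_carrier)
  ultimately have "length (map (\<lambda>j. cls (s j)) [0..<m]) \<le> n"
    by (rule FF.independent_length_le_dimension[OF subfield_pullback degree[unfolded has_degree_def]])
  then show ?thesis by simp
qed

lemma indep_extend:
  assumes s: "\<And>j. j < m \<Longrightarrow> s j \<in> rat" and ind: "poly_indep gen t s m" and "m < n"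
  shows "\<exists>u\<in>rat. poly_indep gen t (s(m := u)) (Suc m)"
proof -
  interpret FF: field FF by (rule FF_field)
  define Us where "Us = map (\<lambda>j. cls (s j)) [0..<m]"
  have U: "FF.independent (pullback_field X proj_line f) Us" unfolding Us_def
    using independent_iff assms by blast
  have Uc: "set Us \<subseteq> carrier FF" using s by (auto simp: Us_def intro!: cls_carrier)
  have "FF.Span (pullback_field X proj_line f) Us \<noteq> carrier FF"
    using FF.independent_length_eq_dimension[OF subfield_pullback degree[unfolded has_degree_def] U Uc] \<open>m < n\<close>
    by (simp add: Us_def)
  then obtain x where x: "x \<in> carrier FF" "x \<notin> FF.Span (pullback_field X proj_line f) Us"
    using FF.Span_in_carrier[OF subfieldE(3)[OF subfield_pullback] Uc] by auto
  then have I: "FF.independent (pullback_field X proj_line f) (x # Us)" using U by (intro FF.li_Cons)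
  have "FF.independent (pullback_field X proj_line f) (Us @ [x])"
    using FF.independent_same_set[OF subfield_pullback _ _ I, of "Us @ [x]"] by simp
  moreover obtain u where u: "x = cls u" "u \<in> rat" using x(1) by (auto simp: FF_carrier)
  moreover have "Us @ [x] = map (\<lambda>j. cls ((s(m := u)) j)) [0..<Suc m]" using u by (simp add: Us_def)
  moreover have "(s(m := u)) j \<in> rat" if "j < Suc m" for j using s u that by auto
  ultimately show ?thesis using independent_iff[of "Suc m" "s(m := u)"] by auto
qed

lemma degree_pos: "n > 0"
proof -
  have "poly_indep gen t (\<lambda>_ _. 1) 1"
    unfolding poly_indep_def
  proof (intro allI impI)
    fix q :: "nat \<Rightarrow> 'k poly" and j assume ev: "\<forall>\<^sub>F p in gen. (\<Sum>j<1. poly (q j) (t p) * 1) = 0" and j: "j < (1::nat)"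
    show "q j = 0"
    proof (rule ccontr)
      assume "q j \<noteq> 0"
      have "\<forall>\<^sub>F p in gen. False" using ev poly_t_neq_0[OF \<open>q j \<noteq> 0\<close>] by eventually_elim (use j in simp)
      then show False using gen_neq_bot by (simp add: trivial_limit_def)
    qed
  qed
  then have "1 \<le> n" by (intro indep_le) (auto intro: rat_const)
  then show ?thesis by simp
qed

end

section \<open>Values of rational functions and finiteness of fibres\<close>

context variety
begin

text \<open>The value of a rational function at \<open>P\<close> is taken from a regular
  representative near \<open>P\<close>, since \<open>u P\<close> itself is arbitrary.\<close>

definition has_val :: "(('n, 'k) pt \<Rightarrow> 'k) \<Rightarrow> ('n, 'k) pt \<Rightarrow> 'k \<Rightarrow> bool" where
  "has_val u P c \<longleftrightarrow> (\<exists>N v. openin (zar X) N \<and> P \<in> N \<and> v \<in> regular X N \<and> (\<forall>\<^sub>F p in gen. u p = v p) \<and> v P = c)"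

lemma has_valI:
  "openin (zar X) N \<Longrightarrow> P \<in> N \<Longrightarrow> v \<in> regular X N \<Longrightarrow> \<forall>\<^sub>F p in gen. u p = v p \<Longrightarrow> v P = c \<Longrightarrow> has_val u P c"
  unfolding has_val_def by blast

lemma has_valD: "has_val u P c \<Longrightarrow>
    \<exists>N v. openin (zar X) N \<and> P \<in> N \<and> v \<in> regular X N \<and> (\<forall>\<^sub>F p in gen. u p = v p) \<and> v P = c"
  unfolding has_val_def .

lemma has_val_regular: "openin (zar X) N \<Longrightarrow> P \<in> N \<Longrightarrow> v \<in> regular X N \<Longrightarrow> has_val v P (v P)"
  by (rule has_valI) auto

lemma has_val_cong:
  assumes "has_val u P c" "\<forall>\<^sub>F p in gen. u p = v p" shows "has_val v P c"
proof -
  from has_valD[OF assms(1)] obtain N w where w: "openin (zar X) N" "P \<in> N" "w \<in> regular X N"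
    "\<forall>\<^sub>F p in gen. u p = w p" "w P = c" by (elim exE conjE) (rule that)
  have "\<forall>\<^sub>F p in gen. v p = w p" using assms(2) w(4) by eventually_elim simp
  then show ?thesis by (rule has_valI[OF w(1-3) _ w(5)])
qed

lemma has_val_unique:
  assumes "has_val u P c" "has_val u P c'" shows "c = c'"
proof -
  from has_valD[OF assms(1)] obtain N v where v: "openin (zar X) N" "P \<in> N" "v \<in> regular X N"
    "\<forall>\<^sub>F p in gen. u p = v p" "v P = c" by (elim exE conjE) (rule that)
  from has_valD[OF assms(2)] obtain M w where w: "openin (zar X) M" "P \<in> M" "w \<in> regular X M"
    "\<forall>\<^sub>F p in gen. u p = w p" "w P = c'" by (elim exE conjE) (rule that)
  have o: "openin (zar X) (N \<inter> M)" using v w by auto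
  have "restr_fun (N \<inter> M) v = restr_fun (N \<inter> M) w"
  proof (rule regular_identity[OF o])
    show "\<forall>\<^sub>F p in gen. restr_fun (N \<inter> M) v p = restr_fun (N \<inter> M) w p"
      using v(4) w(4) by eventually_elim (simp add: restr_fun_def)
  qed (rule regular_restr[OF v(3) _ o] regular_restr[OF w(3) _ o]; auto)+
  from fun_cong[OF this, of P] show ?thesis using v w by (simp add: restr_fun_def)
qed

lemma has_val_combine:
  assumes comb: "\<And>U \<phi> \<psi>. openin (zar X) U \<Longrightarrow> \<phi> \<in> regular X U \<Longrightarrow> \<psi> \<in> regular X U \<Longrightarrow>
      (\<lambda>p. h (\<phi> p) (\<psi> p)) \<in> regular X U"
    and "has_val u P c" "has_val v P c'"
  shows "has_val (\<lambda>p. h (u p) (v p)) P (h c c')"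
proof -
  from has_valD[OF assms(2)] obtain N a where a: "openin (zar X) N" "P \<in> N" "a \<in> regular X N"
    "\<forall>\<^sub>F p in gen. u p = a p" "a P = c" by (elim exE conjE) (rule that)
  from has_valD[OF assms(3)] obtain M b where b: "openin (zar X) M" "P \<in> M" "b \<in> regular X M"
    "\<forall>\<^sub>F p in gen. v p = b p" "b P = c'" by (elim exE conjE) (rule that)
  have o: "openin (zar X) (N \<inter> M)" "P \<in> N \<inter> M" using a b by auto
  have "(\<lambda>p. h (restr_fun (N \<inter> M) a p) (restr_fun (N \<inter> M) b p)) \<in> regular X (N \<inter> M)"
    by (intro comb o regular_restr[OF a(3)] regular_restr[OF b(3)]) auto
  moreover have "\<forall>\<^sub>F p in gen. p \<in> N \<inter> M" by (rule eventually_open[OF o(1)]) (use o(2) in auto)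
  then have "\<forall>\<^sub>F p in gen. h (u p) (v p) = h (restr_fun (N \<inter> M) a p) (restr_fun (N \<inter> M) b p)"
    using a(4) b(4) by eventually_elim (simp add: restr_fun_def)
  ultimately show ?thesis by (rule has_valI[OF o]) (use a b in \<open>simp add: restr_fun_def\<close>)
qed

lemma has_val_add: "has_val u P c \<Longrightarrow> has_val v P c' \<Longrightarrow> has_val (\<lambda>p. u p + v p) P (c + c')"
  by (rule has_val_combine[where h = "(+)"]) (rule regular_add)

lemma has_val_mult: "has_val u P c \<Longrightarrow> has_val v P c' \<Longrightarrow> has_val (\<lambda>p. u p * v p) P (c * c')"
  by (rule has_val_combine[where h = "(*)"]) (rule regular_mult)

lemma has_val_const: "P \<in> X \<Longrightarrow> has_val (\<lambda>_. c) P c"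
proof (rule has_valI[OF openin_X _ regular_const[OF openin_X]])
  show "\<forall>\<^sub>F p in gen. c = restr_fun X (\<lambda>_. c) p"
    using restr_ev[OF openin_X X_nonempty, of "\<lambda>_. c"] by eventually_elim simp
qed (auto simp: restr_fun_def)

lemma has_val_power: "P \<in> X \<Longrightarrow> has_val u P c \<Longrightarrow> has_val (\<lambda>p. u p ^ j) P (c ^ j)"
  by (induction j) (auto intro: has_val_const[of _ 1] has_val_mult)

lemma has_val_sum: "P \<in> X \<Longrightarrow> (\<And>j. j \<in> A \<Longrightarrow> has_val (u j) P (c j)) \<Longrightarrow> has_val (\<lambda>p. \<Sum>j\<in>A. u j p) P (\<Sum>j\<in>A. c j)"
  by (induction A rule: infinite_finite_induct) (auto intro: has_val_const has_val_add)

lemma has_val_poly: "P \<in> X \<Longrightarrow> has_val u P c \<Longrightarrow> has_val (\<lambda>p. poly q (u p)) P (poly q c)"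
  by (induction q) (auto intro!: has_val_const has_val_add has_val_mult)

lemma has_val_inverse:
  assumes "has_val u P c" "c \<noteq> 0" shows "(\<lambda>p. inverse (u p)) \<in> reg P"
proof -
  from has_valD[OF assms(1)] obtain N v where v: "openin (zar X) N" "P \<in> N" "v \<in> regular X N"
    "\<forall>\<^sub>F p in gen. u p = v p" "v P = c" by (elim exE conjE) (rule that)
  have "\<forall>\<^sub>F p in gen. inverse (v p) = inverse (u p)" using v(4) by eventually_elim simp
  moreover have "(\<lambda>p. inverse (v p)) \<in> reg P" by (rule reg_inverse[OF v(1-3)]) (use v(5) assms in auto)
  ultimately show ?thesis by (rule reg_cong[rotated])
qed

text \<open>Evaluating a relation at \<open>P j\<close> isolates the constant term of the
  coefficient with index \<open>j\<close>, which must vanish; dividing by \<open>\<tau>\<close> and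
  repeating removes all coefficients.\<close>

lemma fibre_indep:
  assumes P: "\<And>i. i < m \<Longrightarrow> P i \<in> X" and \<tau>: "\<And>i. i < m \<Longrightarrow> has_val \<tau> (P i) 0" "\<forall>\<^sub>F p in gen. \<tau> p \<noteq> 0"
    and u: "\<And>i j. i < m \<Longrightarrow> j < m \<Longrightarrow> has_val (u i) (P j) (if i = j then 1 else 0)"
  shows "poly_indep gen \<tau> u m"
  unfolding poly_indep_def
proof (intro allI impI)
  fix q :: "nat \<Rightarrow> 'k poly" and j
  assume ev: "\<forall>\<^sub>F p in gen. (\<Sum>j<m. poly (q j) (\<tau> p) * u j p) = 0" and j: "j < m"
  have *: "\<forall>j<m. q j = 0" if "\<forall>j<m. \<forall>i\<ge>N. coeff (q j) i = 0"
    "\<forall>\<^sub>F p in gen. (\<Sum>j<m. poly (q j) (\<tau> p) * u j p) = 0" for N q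
    using that
  proof (induction N arbitrary: q)
    case 0 then show ?case by (auto intro: poly_eqI)
  next
    case (Suc N)
    define q' where "q' = (\<lambda>j. poly_shift 1 (q j))"
    define c0 where "c0 = (\<lambda>j. coeff (q j) 0)"
    have q: "q j = pCons (c0 j) (q' j)" for j
      by (rule poly_eqI) (simp add: coeff_pCons c0_def q'_def coeff_poly_shift split: nat.split)
    have b: "c0 j = 0" if j: "j < m" for j
    proof -
      have "has_val (\<lambda>p. \<Sum>i<m. poly (q i) (\<tau> p) * u i p) (P j) (\<Sum>i<m. poly (q i) 0 * (if i = j then 1 else 0))"
        by (intro has_val_sum has_val_mult has_val_poly P \<tau> u) (use j in auto)
      moreover have "(\<Sum>i<m. poly (q i) 0 * (if i = j then 1 else 0)) = c0 j"
        using j by (simp add: c0_def poly_0_coeff_0 if_distrib cong: if_cong)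
      ultimately have 1: "has_val (\<lambda>p. \<Sum>i<m. poly (q i) (\<tau> p) * u i p) (P j) (c0 j)" by simp
      have "has_val (\<lambda>_. 0) (P j) (c0 j)" by (rule has_val_cong[OF 1 Suc.prems(2)])
      then show ?thesis using has_val_unique[OF _ has_val_const[OF P[OF j]]] by blast
    qed
    have "\<forall>j<m. q' j = 0"
    proof (rule Suc.IH)
      show "\<forall>j<m. \<forall>i\<ge>N. coeff (q' j) i = 0" using Suc.prems(1) by (simp add: q'_def coeff_poly_shift)
      show "\<forall>\<^sub>F p in gen. (\<Sum>j<m. poly (q' j) (\<tau> p) * u j p) = 0"
        using Suc.prems(2) \<tau>(2)
      proof eventually_elim
        case (elim p)
        have "poly (q j) (\<tau> p) = \<tau> p * poly (q' j) (\<tau> p)" if "j < m" for j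
          by (simp add: q b[OF that])
        then have "\<tau> p * (\<Sum>j<m. poly (q' j) (\<tau> p) * u j p) = (\<Sum>j<m. poly (q j) (\<tau> p) * u j p)"
          unfolding sum_distrib_left by (intro sum.cong) (auto simp: mult.assoc)
        then show ?case using elim by simp
      qed
    qed
    then show ?case using b q by simp
  qed
  define N where "N = Suc (\<Sum>j<m. Polynomial.degree (q j))"
  have "coeff (q j) i = 0" if "j < m" "i \<ge> N" for j i
  proof -
    have "Polynomial.degree (q j) \<le> (\<Sum>j<m. Polynomial.degree (q j))" using that by (intro member_le_sum) auto
    then show ?thesis using that by (intro coeff_eq_0) (auto simp: N_def)
  qed
  then show "q j = 0" using *[of N q] ev j by blast
qed

text \<open>Distinct points have nonproportional coordinate vectors, so some two by two minor is
  nonzero; as a linear form in the first vector it vanishes at the second.\<close>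

lemma separating_form:
  assumes "p \<in> X" "q \<in> X" "p \<noteq> q"
  shows "\<exists>\<phi>. form 1 \<phi> \<and> \<phi> (rep p) \<noteq> 0 \<and> \<phi> (rep q) = 0"
proof -
  define x z where "x = rep p" and "z = rep q"
  have pq: "p \<in> proj_space" "q \<in> proj_space" using assms X_sub by auto
  have x: "x \<noteq> (\<lambda>_. 0)" "p = proj_point x" and z: "z \<noteq> (\<lambda>_. 0)" "q = proj_point z"
    unfolding x_def z_def using proj_point_mem rep_mem pq by blast+
  obtain i where i: "z i \<noteq> 0" using z(1) by auto
  have "\<exists>j. x j * z i - x i * z j \<noteq> 0"
  proof (rule ccontr)
    assume "\<not> ?thesis"
    then have *: "x = (\<lambda>j. (x i / z i) * z j)" using i by (auto simp: field_simps)
    then have "x i \<noteq> 0" using x(1) by auto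
    then have "x \<in> proj_point z"
      unfolding proj_point_def by (intro CollectI exI[of _ "x i / z i"] conjI, rule_tac *) (use i in simp)
    then show False using assms(3) proj_point_mem(2)[OF pq(2), of x] x(2) z(2) by simp
  qed
  then obtain j where j: "x j * z i - x i * z j \<noteq> 0" by blast
  have "form 1 (\<lambda>w. z i * w j + (- z j) * w i)" by (intro form_add form_smult form_coord)
  then show ?thesis
    by (rule_tac exI, rule_tac conjI, assumption) (use j in \<open>auto simp: x_def z_def mult.commute\<close>)
qed

text \<open>As in Lagrange interpolation, \<open>g i\<close> is a product of linear forms vanishing
  at all the other points. Dividing by the sum \<open>h\<close>, which has the same degree and
  vanishes at none of the points, normalizes the values to 0 and 1.\<close>

lemma interpolation:
  fixes P :: "nat \<Rightarrow> ('n, 'k) pt"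
  assumes P: "\<And>i. i < m \<Longrightarrow> P i \<in> X" and inj: "inj_on P {..<m}"
  shows "\<exists>u. (\<forall>i<m. u i \<in> rat) \<and> (\<forall>i<m. \<forall>j<m. has_val (u i) (P j) (if i = j then 1 else 0))"
proof -
  have "\<forall>i j. \<exists>\<phi>. i < m \<and> j < m \<and> i \<noteq> j \<longrightarrow> form 1 \<phi> \<and> \<phi> (rep (P i)) \<noteq> 0 \<and> \<phi> (rep (P j)) = 0"
    using separating_form[OF P P] inj by (metis (no_types, lifting) inj_onD lessThan_iff)
  from this[unfolded choice_iff] obtain \<phi> where
    \<phi>: "\<forall>i j. i < m \<and> j < m \<and> i \<noteq> j \<longrightarrow> form 1 (\<phi> i j) \<and> \<phi> i j (rep (P i)) \<noteq> 0 \<and> \<phi> i j (rep (P j)) = 0"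
    by (rule exE)
  define g where "g = (\<lambda>i x. \<Prod>j\<in>{..<m} - {i}. \<phi> i j x)"
  define h where "h = (\<lambda>x. \<Sum>i<m. g i x)"
  have g: "form (m - 1) (g i)" if "i < m" for i
  proof -
    have "form (card ({..<m} - {i})) (g i)" unfolding g_def by (rule form_prod) (use \<phi> that in auto)
    then show ?thesis using that by simp
  qed
  have h: "form (m - 1) h" unfolding h_def by (rule form_sum) (use g in auto)
  have gP: "g i (rep (P j)) = 0 \<longleftrightarrow> i \<noteq> j" if "i < m" "j < m" for i j
    using \<phi> that by (auto simp: g_def)
  have hP: "h (rep (P j)) = g j (rep (P j))" if "j < m" for j
  proof -
    have "h (rep (P j)) = (\<Sum>i<m. if i = j then g j (rep (P j)) else 0)"
      unfolding h_def by (rule sum.cong) (use gP that in auto)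
    then show ?thesis using that by simp
  qed
  define W where "W = {p \<in> X. \<forall>x\<in>p. h x \<noteq> 0}"
  have W: "openin (zar X) W" unfolding W_def by (rule openin_form[OF h X_sub])
  have PW: "P j \<in> W" if "j < m" for j
  proof -
    have "h (rep (P j)) \<noteq> 0" using hP gP that by simp
    then show ?thesis using form_nonzero_iff[OF h, of "P j" "rep (P j)"] rep_mem P[OF that] X_sub by (auto simp: W_def)
  qed
  define u where "u = (\<lambda>i. restr_fun W (\<lambda>p. g i (rep p) / h (rep p)))"
  have u: "u i \<in> regular X W" if "i < m" for i
    unfolding u_def by (rule regular_quotient[OF W X_sub g[OF that] h]) (auto simp: W_def)
  show ?thesis
  proof (intro exI[of _ u] conjI allI impI)
    fix i assume i: "i < m"
    show "u i \<in> rat" by (rule ratI[OF W _ u[OF i]]) (use PW[OF i] in auto)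
    fix j assume j: "j < m"
    have "u i (P j) = (if i = j then 1 else 0)"
      using PW[OF j] gP[OF i j] gP[OF j j] hP[OF j] by (auto simp: u_def restr_fun_def)
    then show "has_val (u i) (P j) (if i = j then 1 else 0)"
      using has_val_regular[OF W PW[OF j] u[OF i]] by simp
  qed
qed

end

section \<open>Finite fibres and the cofinite topology\<close>

context covering
begin

lemma has_val_t: "P \<in> X - inf_fibre \<Longrightarrow> has_val t P (t P)"
proof -
  assume P: "P \<in> X - inf_fibre"
  have "\<forall>\<^sub>F p in gen. restr_fun (X - inf_fibre) t p = t p"
    using ev_finite_part by eventually_elim (simp add: restr_fun_def)
  moreover have "has_val (restr_fun (X - inf_fibre) t) P (t P)"
    using has_val_regular[OF openin_finite_part P regular_t] P by (simp add: restr_fun_def)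
  ultimately show ?thesis by (rule has_val_cong[rotated])
qed

lemma has_val_t_inf: "P \<in> inf_fibre \<Longrightarrow> has_val (\<lambda>p. inverse (t p)) P 0"
proof -
  assume P: "P \<in> inf_fibre"
  define h where "h = (\<lambda>x :: 2 \<Rightarrow> 'k. x 1)"
  have h: "form 1 h" unfolding h_def by (rule form_coord)
  have Ph: "P \<in> pre h" using P y_nonzero[of P] by (auto simp: inf_fibre_def pre_def h_def)
  have r: "restr_fun (pre h) (\<lambda>p. y p 0 / h (y p)) \<in> regular X (pre h)" by (rule regular_pull[OF form_coord h])
  have "has_val (restr_fun (pre h) (\<lambda>p. y p 0 / h (y p))) P 0"
    using has_val_regular[OF openin_pre[OF h] Ph r] Ph P by (simp add: restr_fun_def inf_fibre_def)
  moreover have "\<forall>\<^sub>F p in gen. restr_fun (pre h) (\<lambda>p. y p 0 / h (y p)) p = inverse (t p)"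
  proof -
    have "\<forall>\<^sub>F p in gen. p \<in> pre h" by (rule eventually_open[OF openin_pre[OF h]]) (use Ph in auto)
    then show ?thesis by eventually_elim (simp add: restr_fun_def h_def t_def)
  qed
  ultimately show ?thesis by (rule has_val_cong)
qed

text \<open>More than \<open>n\<close> points in one fibre would carry more than \<open>n\<close>
  functions independent over k(t), exceeding the degree. The assumption \<open>conv\<close> passes
  from \<open>\<tau>\<close>, which vanishes on the fibre, to \<open>t\<close>.\<close>

lemma finite_fibre_aux:
  assumes S: "S \<subseteq> X" and \<tau>: "\<And>P. P \<in> S \<Longrightarrow> has_val \<tau> P 0" "\<forall>\<^sub>F p in gen. \<tau> p \<noteq> 0"
    and conv: "\<And>u m. poly_indep gen \<tau> u m \<Longrightarrow> poly_indep gen t u m"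
  shows "finite S"
proof (rule ccontr)
  assume "infinite S"
  then obtain T where T: "T \<subseteq> S" "card T = Suc n" "finite T" using infinite_arbitrarily_large by blast
  obtain P where P: "bij_betw P {..<Suc n} T" using ex_bij_betw_nat_finite[OF T(3)] T(2) by (auto simp: atLeast0LessThan)
  have PS: "P i \<in> S" if "i < Suc n" for i using P T(1) that by (auto simp: bij_betw_def)
  obtain u where u: "\<forall>i<Suc n. u i \<in> rat" "\<forall>i<Suc n. \<forall>j<Suc n. has_val (u i) (P j) (if i = j then 1 else 0)"
    using interpolation[of "Suc n" P] PS S P by (auto simp: bij_betw_def)
  have "poly_indep gen \<tau> u (Suc n)"
    by (rule fibre_indep[of "Suc n" P]) (use PS S \<tau> u in auto)
  then have "Suc n \<le> n" by (intro indep_le[OF _ conv]) (use u in auto)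
  then show False by simp
qed

lemma finite_fibre: "finite {P \<in> X - inf_fibre. t P = c}"
proof (rule finite_fibre_aux[of _ "\<lambda>p. t p + (- c)"])
  fix P assume P: "P \<in> {P \<in> X - inf_fibre. t P = c}"
  have "has_val (\<lambda>p. t p + (- c)) P (t P + (- c))"
    by (rule has_val_add[OF has_val_t has_val_const]) (use P in auto)
  then show "has_val (\<lambda>p. t p + - c) P 0" using P by simp
next
  show "\<forall>\<^sub>F p in gen. t p + - c \<noteq> 0" using t_neq[of c] by eventually_elim simp
next
  fix u :: "nat \<Rightarrow> ('n, 'k) pt \<Rightarrow> 'k" and m assume ind: "poly_indep gen (\<lambda>p. t p + - c) u m"
  show "poly_indep gen t u m"
    unfolding poly_indep_def
  proof (intro allI impI)
    fix q j assume ev: "\<forall>\<^sub>F p in gen. (\<Sum>j<m. poly (q j) (t p) * u j p) = 0" and j: "j < m"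
    have "\<forall>\<^sub>F p in gen. (\<Sum>j<m. poly (pcompose (q j) [:c, 1:]) (t p + - c) * u j p) = 0"
      using ev by eventually_elim (simp add: poly_pcompose)
    from poly_indepD[OF ind this j] show "q j = 0" by (simp add: pcompose_eq_0_iff)
  qed
qed auto

lemma finite_inf_fibre: "finite inf_fibre"
proof (rule finite_fibre_aux[of _ "\<lambda>p. inverse (t p)"])
  show "inf_fibre \<subseteq> X" by (auto simp: inf_fibre_def)
  show "\<forall>\<^sub>F p in gen. inverse (t p) \<noteq> 0" using t_neq[of 0] by eventually_elim simp
next
  fix u :: "nat \<Rightarrow> ('n, 'k) pt \<Rightarrow> 'k" and m assume ind: "poly_indep gen (\<lambda>p. inverse (t p)) u m"
  show "poly_indep gen t u m"
    unfolding poly_indep_def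
  proof (intro allI impI)
    fix q :: "nat \<Rightarrow> 'k poly" and j assume ev: "\<forall>\<^sub>F p in gen. (\<Sum>j<m. poly (q j) (t p) * u j p) = 0" and j: "j < m"
    define M where "M = (\<Sum>j<m. Polynomial.degree (q j))"
    have M: "Polynomial.degree (q j) \<le> M" if "j < m" for j unfolding M_def using that by (intro member_le_sum) auto
    \<comment> \<open>Reversed coefficients, padded to the common degree \<open>M\<close>, rewrite a
      relation in \<open>t\<close> as one in \<open>inverse t\<close>.\<close>
    define r where "r = (\<lambda>j. monom 1 (M - Polynomial.degree (q j)) * reflect_poly (q j))"
    have r: "poly (r j) (inverse x) = inverse x ^ M * poly (q j) x" if "j < m" "x \<noteq> 0" for j x
      using M[OF that(1)] poly_reflect_poly_nz[of "inverse x" "q j"] that(2)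
      by (simp add: r_def poly_monom flip: power_add mult.assoc)
    have "\<forall>\<^sub>F p in gen. (\<Sum>j<m. poly (r j) (inverse (t p)) * u j p) = 0"
      using ev t_neq[of 0]
    proof eventually_elim
      case (elim p)
      have "(\<Sum>j<m. poly (r j) (inverse (t p)) * u j p) = inverse (t p) ^ M * (\<Sum>j<m. poly (q j) (t p) * u j p)"
        unfolding sum_distrib_left by (rule sum.cong) (use r elim(2) in auto)
      then show ?case using elim(1) by simp
    qed
    from poly_indepD[OF ind this j] show "q j = 0" by (simp add: r_def)
  qed
qed (rule has_val_t_inf)

text \<open>The powers of \<open>u\<close> up to exponent \<open>n\<close> are dependent over k(t).
  Cancelling the lowest power that occurs leaves a nonzero constant term, which is then a multiple
  of \<open>u\<close> by a polynomial in \<open>t\<close> and \<open>u\<close>.\<close>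

lemma algebraic:
  assumes u: "u \<in> rat" "\<forall>\<^sub>F p in gen. u p \<noteq> 0"
  shows "\<exists>q m r. q \<noteq> 0 \<and> (\<forall>\<^sub>F p in gen. poly q (t p) = u p * (\<Sum>j<m. poly (r j) (t p) * u p ^ j))"
proof -
  have "\<not> poly_indep gen t (\<lambda>j p. u p ^ j) (Suc n)"
  proof
    have pw: "(\<lambda>p. u p ^ j) \<in> rat" for j
      by (induction j) (auto intro: rat_const rat_mult u)
    assume "poly_indep gen t (\<lambda>j p. u p ^ j) (Suc n)"
    then have "Suc n \<le> n" by (rule indep_le[rotated]) (rule pw)
    then show False by simp
  qed
  then obtain q j where q: "\<forall>\<^sub>F p in gen. (\<Sum>j<Suc n. poly (q j) (t p) * u p ^ j) = 0"
    and j: "j < Suc n" "q j \<noteq> 0" unfolding poly_indep_def by blast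
  define k where "k = (LEAST k. q k \<noteq> 0)"
  have k: "q k \<noteq> 0" unfolding k_def by (rule LeastI[of "\<lambda>k. q k \<noteq> 0", OF j(2)])
  have "k \<le> j" unfolding k_def by (rule Least_le[of "\<lambda>k. q k \<noteq> 0", OF j(2)])
  then have kn: "k \<le> n" using j(1) by simp
  have kz: "q i = 0" if "i < k" for i using not_less_Least[of i "\<lambda>k. q k \<noteq> 0"] that by (auto simp: k_def)
  have "\<forall>\<^sub>F p in gen. poly (q k) (t p) = u p * (\<Sum>j<n - k. poly (- q (j + Suc k)) (t p) * u p ^ j)"
    using q u(2)
  proof eventually_elim
    case (elim p)
    have "(\<Sum>j<Suc n. poly (q j) (t p) * u p ^ j) = (\<Sum>j\<in>{k..<Suc n}. poly (q j) (t p) * u p ^ j)"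
      by (rule sum.mono_neutral_right) (use kz in \<open>auto simp: not_le\<close>)
    also have "\<dots> = poly (q k) (t p) * u p ^ k + (\<Sum>j\<in>{Suc k..<Suc n}. poly (q j) (t p) * u p ^ j)"
      using kn by (subst sum.atLeast_Suc_lessThan) auto
    also have "(\<Sum>j\<in>{Suc k..<Suc n}. poly (q j) (t p) * u p ^ j) = (\<Sum>j<n - k. poly (q (j + Suc k)) (t p) * u p ^ (j + Suc k))"
      by (rule sum.reindex_bij_witness[of _ "\<lambda>j. j + Suc k" "\<lambda>j. j - Suc k"]) (use kn in auto)
    also have "\<dots> = u p ^ k * (u p * (\<Sum>j<n - k. poly (q (j + Suc k)) (t p) * u p ^ j))"
      by (simp add: sum_distrib_left power_add mult_ac)
    finally have "u p ^ k * (poly (q k) (t p) + u p * (\<Sum>j<n - k. poly (q (j + Suc k)) (t p) * u p ^ j)) = 0"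
      using elim(1) by (simp add: algebra_simps)
    then have "poly (q k) (t p) + u p * (\<Sum>j<n - k. poly (q (j + Suc k)) (t p) * u p ^ j) = 0" using elim(2) by simp
    then show ?case by (simp add: sum_negf eq_neg_iff_add_eq_0)
  qed
  with k show ?thesis by (intro exI conjI)
qed

text \<open>By \<open>algebraic\<close> some nonzero \<open>q(t)\<close> is a multiple of
  \<open>w\<close>, so at every zero of \<open>w\<close> outside infinity \<open>t\<close> is a root
  of \<open>q\<close>. The zeros thus lie in finitely many fibres, each of which is finite.\<close>

lemma finite_zeros:
  assumes W: "openin (zar X) W" and w: "w \<in> regular X W" "\<forall>\<^sub>F p in gen. w p \<noteq> 0"
  shows "finite {P \<in> W. w P = 0}"
proof (cases "W = {}")
  case False
  have "w \<in> rat" by (rule ratI[OF W False w(1)]) simp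
  from algebraic[OF this w(2)] obtain q m r where q: "q \<noteq> 0"
    "\<forall>\<^sub>F p in gen. poly q (t p) = w p * (\<Sum>j<m. poly (r j) (t p) * w p ^ j)" by (elim exE conjE) (rule that)
  have root: "poly q (t P) = 0" if P: "P \<in> W" "w P = 0" "P \<notin> inf_fibre" for P
  proof -
    have PX: "P \<in> X" "P \<in> X - inf_fibre" using P openin_sub[OF W] by auto
    have hw: "has_val w P 0" using has_val_regular[OF W P(1) w(1)] P(2) by simp
    have "has_val (\<lambda>p. w p * (\<Sum>j<m. poly (r j) (t p) * w p ^ j)) P (0 * (\<Sum>j<m. poly (r j) (t P) * 0 ^ j))"
      by (intro has_val_mult has_val_sum has_val_poly has_val_power has_val_t hw PX)
    then have "has_val (\<lambda>p. w p * (\<Sum>j<m. poly (r j) (t p) * w p ^ j)) P 0" by simp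
    moreover have "\<forall>\<^sub>F p in gen. w p * (\<Sum>j<m. poly (r j) (t p) * w p ^ j) = poly q (t p)"
      using q(2) by eventually_elim simp
    ultimately have "has_val (\<lambda>p. poly q (t p)) P 0" by (rule has_val_cong)
    then show ?thesis using has_val_unique[OF has_val_poly[OF PX(1) has_val_t[OF PX(2)]]] by blast
  qed
  have "{P \<in> W. w P = 0} \<subseteq> inf_fibre \<union> (\<Union>c\<in>{c. poly q c = 0}. {P \<in> X - inf_fibre. t P = c})"
    using root openin_sub[OF W] by auto
  moreover have "finite \<dots>" using finite_inf_fibre finite_fibre poly_roots_finite[OF q(1)] by auto
  ultimately show ?thesis by (rule finite_subset)
qed simp

text \<open>A nonempty open set contains the nonvanishing locus of a form. On each coordinate chart,
  the quotient of this form by a power of the coordinate has finitely many zeros.\<close>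

lemma finite_complement:
  assumes U: "openin (zar X) U" "U \<noteq> {}" shows "finite (X - U)"
proof -
  obtain P where P: "P \<in> U" using U by auto
  obtain U' where U': "openin zariski U'" "U = U' \<inter> X" using U(1) by (auto simp: openin_subtopology)
  from zariski_basis[OF U'(1), of P] obtain e \<phi> where \<phi>: "form e \<phi>" "\<forall>x\<in>P. \<phi> x \<noteq> 0"
    "{q \<in> proj_space. \<forall>x\<in>q. \<phi> x \<noteq> 0} \<subseteq> U'" using P U'(2) by auto
  have PX: "P \<in> X" using P U'(2) by auto
  define D where "D = (\<lambda>i. {p \<in> X. \<forall>x\<in>p. x i \<noteq> 0})"
  have D: "openin (zar X) (D i)" for i unfolding D_def by (rule openin_form[OF form_coord X_sub])
  define w where "w = (\<lambda>i. restr_fun (D i) (\<lambda>p. \<phi> (rep p) / (rep p i) ^ e))"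
  have w: "w i \<in> regular X (D i)" for i
  proof -
    have "form e (\<lambda>x :: 'n \<Rightarrow> 'k. x i ^ e)" using form_power[OF form_coord[of i], of e] by simp
    then show ?thesis unfolding w_def by (rule regular_quotient[OF D X_sub \<phi>(1)]) (auto simp: D_def)
  qed
  have fin: "finite {p \<in> D i. w i p = 0}" for i
  proof (cases "D i = {}")
    case False
    have o: "openin (zar X) {p \<in> X. \<forall>x\<in>p. \<phi> x \<noteq> 0}" by (rule openin_form[OF \<phi>(1) X_sub])
    have ne: "{p \<in> X. \<forall>x\<in>p. \<phi> x \<noteq> 0} \<noteq> {}" using PX \<phi>(2) by auto
    have "\<forall>\<^sub>F p in gen. w i p \<noteq> 0"
      using eventually_open[OF o ne] eventually_open[OF D False]
    proof eventually_elim
      case (elim p)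
      then have "rep p \<in> p" using X_sub rep_mem by auto
      then show ?case using elim by (auto simp: w_def restr_fun_def D_def)
    qed
    then show ?thesis by (rule finite_zeros[OF D w])
  qed simp
  have "X - U \<subseteq> (\<Union>i. {p \<in> D i. w i p = 0})"
  proof
    fix p assume p: "p \<in> X - U"
    then have pp: "p \<in> proj_space" "rep p \<in> p" using X_sub rep_mem by auto
    obtain i where i: "rep p i \<noteq> 0" using proj_point_mem(1)[OF pp] by auto
    then have pD: "p \<in> D i" using form_nonzero_iff[OF form_coord pp, of i] p by (auto simp: D_def)
    have "\<phi> (rep p) = 0" using \<phi>(3) p U'(2) form_nonzero_iff[OF \<phi>(1) pp] pp by auto
    then show "p \<in> (\<Union>i. {p \<in> D i. w i p = 0})" using pD by (auto simp: w_def restr_fun_def)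
  qed
  moreover have "finite (\<Union>i. {p \<in> D i. w i p = 0})" using fin by auto
  ultimately show ?thesis by (rule finite_subset)
qed

text \<open>Points are closed because linear forms separate them.\<close>

lemma openin_cofinite:
  assumes U: "openin (zar X) U" and "finite S" shows "openin (zar X) (U - S)"
  using assms(2)
proof (induction S rule: finite_induct)
  case (insert q S)
  show ?case
  proof (cases "q \<in> X")
    case False
    then have "U - insert q S = U - S" using openin_sub[OF U] by auto
    then show ?thesis using insert.IH by simp
  next
    case True
    have "openin (zar X) (X - {q})"
    proof (subst openin_subopen, intro ballI)
      fix p assume p: "p \<in> X - {q}"
      obtain \<phi> where \<phi>: "form 1 \<phi>" "\<phi> (rep p) \<noteq> 0" "\<phi> (rep q) = 0" using separating_form[of p q] p True by auto
      have "p \<in> {p \<in> X. \<forall>x\<in>p. \<phi> x \<noteq> 0}"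
        using form_nonzero_iff[OF \<phi>(1), of p "rep p"] \<phi>(2) p X_sub rep_mem by auto
      moreover have "q \<notin> {p \<in> X. \<forall>x\<in>p. \<phi> x \<noteq> 0}" using \<phi>(3) rep_mem True X_sub by auto
      ultimately show "\<exists>T. openin (zar X) T \<and> p \<in> T \<and> T \<subseteq> X - {q}"
        using openin_form[OF \<phi>(1) X_sub] by (intro exI[of _ "{p \<in> X. \<forall>x\<in>p. \<phi> x \<noteq> 0}"]) auto
    qed
    then have "openin (zar X) ((U - S) \<inter> (X - {q}))" using insert.IH by auto
    moreover have "(U - S) \<inter> (X - {q}) = U - insert q S" using openin_sub[OF U] by auto
    ultimately show ?thesis by simp
  qed
qed (use U in simp)

lemma rat_reg_cofinite:
  assumes "u \<in> rat" shows "finite {P \<in> X. u \<notin> reg P}"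
proof -
  from ratD[OF assms] obtain W w where w: "openin (zar X) W" "W \<noteq> {}" "w \<in> regular X W"
    "\<forall>\<^sub>F p in gen. u p = w p" by (elim exE conjE) (rule that)
  have "{P \<in> X. u \<notin> reg P} \<subseteq> X - W" using regI[OF w(1) _ w(3,4)] by auto
  then show ?thesis using finite_complement[OF w(1,2)] finite_subset by blast
qed

end

section \<open>Poles\<close>

context covering
begin

text \<open>Numerator and denominator of a quotient of forms become regular at \<open>P\<close>
  after division by a power of a coordinate that does not vanish at \<open>P\<close>.\<close>

lemma fraction_at:
  assumes u: "u \<in> rat" and P: "P \<in> X"
  shows "\<exists>a b. a \<in> reg P \<and> b \<in> reg P \<and> (\<forall>\<^sub>F p in gen. b p \<noteq> 0) \<and> (\<forall>\<^sub>F p in gen. u p * b p = a p)"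
proof -
  from ratD[OF u] obtain W w where w: "openin (zar X) W" "W \<noteq> {}" "w \<in> regular X W"
    "\<forall>\<^sub>F p in gen. u p = w p" by (elim exE conjE) (rule that)
  obtain Q where Q: "Q \<in> W" using w(2) by auto
  from regularD[OF w(3) Q] obtain V e g h where V: "openin (zar X) V" "Q \<in> V" "V \<subseteq> W" "form e g" "form e h"
    "\<forall>q\<in>V. \<forall>x\<in>q. h x \<noteq> 0" "\<forall>q\<in>V. \<forall>x\<in>q. w q = g x / h x" by (elim exE conjE) (rule that)
  have PP: "P \<in> proj_space" "rep P \<in> P" using P X_sub rep_mem by auto
  obtain i where i: "rep P i \<noteq> 0" using proj_point_mem(1)[OF PP] by auto
  define D where "D = {p \<in> X. \<forall>x\<in>p. x i \<noteq> 0}"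
  have D: "openin (zar X) D" unfolding D_def by (rule openin_form[OF form_coord X_sub])
  have PD: "P \<in> D" using form_nonzero_iff[OF form_coord PP, of i] i P by (auto simp: D_def)
  have fi: "form e (\<lambda>x :: 'n \<Rightarrow> 'k. x i ^ e)" using form_power[OF form_coord[of i], of e] by simp
  define a b where "a = restr_fun D (\<lambda>p. g (rep p) / rep p i ^ e)" and "b = restr_fun D (\<lambda>p. h (rep p) / rep p i ^ e)"
  have ab: "a \<in> regular X D" "b \<in> regular X D"
    unfolding a_def b_def by (rule regular_quotient[OF D X_sub _ fi]; use V in \<open>auto simp: D_def\<close>)+
  have "\<forall>\<^sub>F p in gen. p \<in> V" "\<forall>\<^sub>F p in gen. p \<in> D"
    by (rule eventually_open[OF V(1)], use V in auto, rule eventually_open[OF D], use PD in auto)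
  then have "\<forall>\<^sub>F p in gen. b p \<noteq> 0 \<and> u p * b p = a p"
    using w(4)
  proof eventually_elim
    case (elim p)
    then have r: "rep p \<in> p" using openin_sub[OF V(1)] X_sub rep_mem by auto
    then have "h (rep p) \<noteq> 0" "rep p i \<noteq> 0" "w p = g (rep p) / h (rep p)" using V elim by (auto simp: D_def)
    then show ?case using elim by (simp add: a_def b_def restr_fun_def)
  qed
  then have "\<forall>\<^sub>F p in gen. b p \<noteq> 0" "\<forall>\<^sub>F p in gen. u p * b p = a p" by (auto elim: eventually_mono)
  with regI'[OF D PD ab(1)] regI'[OF D PD ab(2)] show ?thesis by (intro exI conjI)
qed

lemma reg_sum: "P \<in> X \<Longrightarrow> (\<And>j. j \<in> A \<Longrightarrow> u j \<in> reg P) \<Longrightarrow> (\<lambda>p. \<Sum>j\<in>A. u j p) \<in> reg P"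
  by (induction A rule: infinite_finite_induct) (auto intro: reg_const reg_add)

lemma reg_power: "P \<in> X \<Longrightarrow> u \<in> reg P \<Longrightarrow> (\<lambda>p. u p ^ j) \<in> reg P"
  by (induction j) (auto intro: reg_const reg_mult)

lemma reg_poly: "P \<in> X \<Longrightarrow> u \<in> reg P \<Longrightarrow> (\<lambda>p. poly q (u p)) \<in> reg P"
  by (induction q) (auto intro: reg_const reg_add reg_mult)

lemma inf_poly_reg:
  assumes P: "P \<in> inf_fibre" and "Polynomial.degree q \<le> M"
  shows "(\<lambda>p. inverse (t p) ^ M * poly q (t p)) \<in> reg P"
proof -
  have PX: "P \<in> X" using P by (simp add: inf_fibre_def)
  have "(\<lambda>p. poly (monom 1 (M - Polynomial.degree q) * reflect_poly q) (inverse (t p))) \<in> reg P"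
    by (rule reg_poly[OF PX t_inverse_reg_inf[OF P]])
  moreover have "\<forall>\<^sub>F p in gen. poly (monom 1 (M - Polynomial.degree q) * reflect_poly q) (inverse (t p))
      = inverse (t p) ^ M * poly q (t p)"
    using t_neq[of 0]
  proof eventually_elim
    case (elim p)
    then show ?case using assms(2) poly_reflect_poly_nz[of "inverse (t p)" q]
      by (simp add: poly_monom flip: power_add mult.assoc)
  qed
  ultimately show ?thesis by (rule reg_cong)
qed

text \<open>Write \<open>u = a / b\<close> with \<open>a\<close> and \<open>b\<close> regular at
  \<open>P\<close>. By \<open>algebraic\<close> the function \<open>b\<close> divides some
  \<open>q(t)\<close>, with a quotient polynomial in \<open>t\<close> and \<open>b\<close>, so
  \<open>q(t) u\<close> is regular where \<open>t\<close> is. Over infinity a power of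
  \<open>inverse t\<close> makes the polynomial coefficients regular.\<close>

lemma pole:
  assumes u: "u \<in> rat" and P: "P \<in> X"
  shows "\<exists>q. q \<noteq> 0 \<and> (P \<notin> inf_fibre \<longrightarrow> (\<lambda>p. poly q (t p) * u p) \<in> reg P) \<and>
    (P \<in> inf_fibre \<longrightarrow> (\<exists>M. (\<lambda>p. inverse (t p) ^ M * poly q (t p) * u p) \<in> reg P))"
proof -
  from fraction_at[OF assms] obtain a b where a: "a \<in> reg P" and b: "b \<in> reg P"
    and nz: "\<forall>\<^sub>F p in gen. b p \<noteq> 0" and ub: "\<forall>\<^sub>F p in gen. u p * b p = a p" by (elim exE conjE) (rule that)
  from algebraic[OF reg_rat[OF b] nz] obtain q m r where q: "q \<noteq> 0"
    "\<forall>\<^sub>F p in gen. poly q (t p) = b p * (\<Sum>j<m. poly (r j) (t p) * b p ^ j)" by (elim exE conjE) (rule that)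
  have 1: "\<forall>\<^sub>F p in gen. a p * (\<Sum>j<m. poly (r j) (t p) * b p ^ j) = poly q (t p) * u p"
    using ub q(2)
  proof eventually_elim
    case (elim p)
    then show ?case unfolding elim(1)[symmetric] elim(2) by (simp add: mult_ac)
  qed
  show ?thesis
  proof (intro exI[of _ q] conjI impI q)
    assume "P \<notin> inf_fibre"
    then have "t \<in> reg P" using t_reg P by simp
    then have "(\<lambda>p. a p * (\<Sum>j<m. poly (r j) (t p) * b p ^ j)) \<in> reg P"
      by (intro reg_mult[OF a] reg_sum[OF P] reg_mult[OF reg_poly[OF P] reg_power[OF P b]])
    then show "(\<lambda>p. poly q (t p) * u p) \<in> reg P" by (rule reg_cong[OF _ 1])
  next
    assume I: "P \<in> inf_fibre"
    define M where "M = (\<Sum>j<m. Polynomial.degree (r j))"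
    have "(\<lambda>p. a p * (\<Sum>j<m. (inverse (t p) ^ M * poly (r j) (t p)) * b p ^ j)) \<in> reg P"
      by (intro reg_mult[OF a] reg_sum[OF P] reg_mult[OF inf_poly_reg[OF I] reg_power[OF P b]])
        (auto simp: M_def intro: member_le_sum)
    moreover have "\<forall>\<^sub>F p in gen. a p * (\<Sum>j<m. (inverse (t p) ^ M * poly (r j) (t p)) * b p ^ j)
        = inverse (t p) ^ M * poly q (t p) * u p"
      using 1
    proof eventually_elim
      case (elim p)
      show ?case unfolding mult.assoc elim[symmetric] by (simp add: sum_distrib_left mult_ac)
    qed
    ultimately have "(\<lambda>p. inverse (t p) ^ M * poly q (t p) * u p) \<in> reg P" by (rule reg_cong)
    then show "\<exists>M. (\<lambda>p. inverse (t p) ^ M * poly q (t p) * u p) \<in> reg P" by (rule exI)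
  qed
qed

section \<open>Cech cocycles\<close>

lemma regular_module:
  assumes "\<phi> \<in> regular X X" "s \<in> regular X V" "openin (zar X) V"
  shows "(\<lambda>p. \<phi> p * s p) \<in> regular X V"
proof -
  have "(\<lambda>p. restr_fun V \<phi> p * s p) \<in> regular X V"
    by (rule regular_mult[OF regular_restr[OF assms(1) openin_sub[OF assms(3)] assms(3)] assms(2,3)])
  moreover have "(\<lambda>p. restr_fun V \<phi> p * s p) = (\<lambda>p. \<phi> p * s p)"
    using regular_zero_outside[OF assms(2)] by (auto simp: restr_fun_def)
  ultimately show ?thesis by simp
qed

lemma regular_poly:
  assumes "\<phi> \<in> regular X U" "openin (zar X) U" shows "restr_fun U (\<lambda>p. poly q (\<phi> p)) \<in> regular X U"
proof (induction q)
  case 0 show ?case using regular_const[OF assms(2), of 0] by simp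
next
  case (pCons a q)
  have "(\<lambda>p. restr_fun U (\<lambda>_. a) p + \<phi> p * restr_fun U (\<lambda>p. poly q (\<phi> p)) p) \<in> regular X U"
    by (intro regular_add regular_mult regular_const pCons assms)
  moreover have "(\<lambda>p. restr_fun U (\<lambda>_. a) p + \<phi> p * restr_fun U (\<lambda>p. poly q (\<phi> p)) p) = restr_fun U (\<lambda>p. poly (pCons a q) (\<phi> p))"
    by (auto simp: restr_fun_def)
  ultimately show ?case by simp
qed

lemma cover_sub: "point_cover X C \<Longrightarrow> P \<in> X \<Longrightarrow> C P \<subseteq> X"
  using openin_sub by (simp add: point_cover_def)

lemma cech_trivialI:
  assumes "point_cover X D" "\<And>P. P \<in> X \<Longrightarrow> D P \<subseteq> C P" "\<And>P. P \<in> X \<Longrightarrow> h P \<in> regular X (D P)"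
    "\<And>P Q p. P \<in> X \<Longrightarrow> Q \<in> X \<Longrightarrow> p \<in> D P \<Longrightarrow> p \<in> D Q \<Longrightarrow> c P Q p = h Q p - h P p"
  shows "cech_trivial X C c"
  unfolding cech_trivial_def using assms by (intro exI[of _ D] exI[of _ h] conjI ballI) auto

lemma cech_trivialD: "cech_trivial X C c \<Longrightarrow> \<exists>D h. point_cover X D \<and> (\<forall>P\<in>X. D P \<subseteq> C P) \<and>
    (\<forall>P\<in>X. h P \<in> regular X (D P)) \<and> (\<forall>P\<in>X. \<forall>Q\<in>X. \<forall>p \<in> D P \<inter> D Q. c P Q p = h Q p - h P p)"
  unfolding cech_trivial_def by (simp add: ball_conj_distrib)

text \<open>Classes live in a limit over covers: triviality may be shown on a finer family, where
  the two cochains have to agree only on the smaller overlaps.\<close>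

lemma cech_trivial_refine:
  assumes "cech_trivial X D c'" "\<And>P. P \<in> X \<Longrightarrow> D P \<subseteq> C P"
    "\<And>P Q p. P \<in> X \<Longrightarrow> Q \<in> X \<Longrightarrow> p \<in> D P \<Longrightarrow> p \<in> D Q \<Longrightarrow> c P Q p = c' P Q p"
  shows "cech_trivial X C c"
proof -
  from cech_trivialD[OF assms(1)] obtain E h where E: "point_cover X E" "\<forall>P\<in>X. E P \<subseteq> D P"
    "\<forall>P\<in>X. h P \<in> regular X (E P)" "\<forall>P\<in>X. \<forall>Q\<in>X. \<forall>p \<in> E P \<inter> E Q. c' P Q p = h Q p - h P p"
    by (elim exE conjE) (rule that)
  show ?thesis
  proof (rule cech_trivialI[OF E(1)])
    fix P Q p assume *: "P \<in> X" "Q \<in> X" "p \<in> E P" "p \<in> E Q"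
    then have "p \<in> D P" "p \<in> D Q" using E(2) by auto
    then show "c P Q p = h Q p - h P p" using assms(3)[of P Q p] E(4) * by simp
  next
    fix P assume "P \<in> X" then show "E P \<subseteq> C P" using E(2) assms(2) by (meson subset_trans)
  qed (use E in auto)
qed

lemma cech_trivial_mult:
  assumes "cech_trivial X C c" "\<phi> \<in> regular X X"
  shows "cech_trivial X C (\<lambda>P Q p. \<phi> p * c P Q p)"
proof -
  from cech_trivialD[OF assms(1)] obtain D h where D: "point_cover X D" "\<forall>P\<in>X. D P \<subseteq> C P"
    "\<forall>P\<in>X. h P \<in> regular X (D P)" "\<forall>P\<in>X. \<forall>Q\<in>X. \<forall>p \<in> D P \<inter> D Q. c P Q p = h Q p - h P p"
    by (elim exE conjE) (rule that)
  show ?thesis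
  proof (rule cech_trivialI[OF D(1), of _ "\<lambda>P p. \<phi> p * h P p"])
    fix P assume P: "P \<in> X"
    show "(\<lambda>p. \<phi> p * h P p) \<in> regular X (D P)"
      using regular_module[OF assms(2)] D(1,3) P by (auto simp: point_cover_def)
  qed (use D in \<open>auto simp: right_diff_distrib\<close>)
qed

lemma cech_trivial_add:
  assumes "cech_trivial X C c" "cech_trivial X C c'"
  shows "cech_trivial X C (\<lambda>P Q p. c P Q p + c' P Q p)"
proof -
  from cech_trivialD[OF assms(1)] obtain D h where D: "point_cover X D" "\<forall>P\<in>X. D P \<subseteq> C P"
    "\<forall>P\<in>X. h P \<in> regular X (D P)" "\<forall>P\<in>X. \<forall>Q\<in>X. \<forall>p \<in> D P \<inter> D Q. c P Q p = h Q p - h P p"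
    by (elim exE conjE) (rule that)
  from cech_trivialD[OF assms(2)] obtain D' h' where D': "point_cover X D'" "\<forall>P\<in>X. D' P \<subseteq> C P"
    "\<forall>P\<in>X. h' P \<in> regular X (D' P)" "\<forall>P\<in>X. \<forall>Q\<in>X. \<forall>p \<in> D' P \<inter> D' Q. c' P Q p = h' Q p - h' P p"
    by (elim exE conjE) (rule that)
  have o: "openin (zar X) (D P \<inter> D' P)" if "P \<in> X" for P using D(1) D'(1) that by (auto simp: point_cover_def)
  show ?thesis
  proof (rule cech_trivialI[of "\<lambda>P. D P \<inter> D' P" _ "\<lambda>P p. restr_fun (D P \<inter> D' P) (h P) p + restr_fun (D P \<inter> D' P) (h' P) p"])
    show "point_cover X (\<lambda>P. D P \<inter> D' P)" using D(1) D'(1) by (auto simp: point_cover_def)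
    fix P assume P: "P \<in> X"
    show "D P \<inter> D' P \<subseteq> C P" using D(2) P by auto
    show "(\<lambda>p. restr_fun (D P \<inter> D' P) (h P) p + restr_fun (D P \<inter> D' P) (h' P) p) \<in> regular X (D P \<inter> D' P)"
      by (intro regular_add regular_restr[OF bspec[OF D(3) P]] regular_restr[OF bspec[OF D'(3) P]] o P) auto
  qed (use D D' in \<open>auto simp: restr_fun_def\<close>)
qed

lemma cech_trivial_smult: "point_cover X C \<Longrightarrow> cech_trivial X C c \<Longrightarrow> cech_trivial X C (\<lambda>P Q p. a * c P Q p)"
  by (rule cech_trivial_refine[OF cech_trivial_mult[OF _ regular_const[OF openin_X, of a]]])
    (auto simp: restr_fun_def dest: cover_sub)

lemma cech_trivial_sum:
  assumes C: "point_cover X C" and "\<And>i. i \<in> A \<Longrightarrow> cech_trivial X C (c i)"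
  shows "cech_trivial X C (\<lambda>P Q p. \<Sum>i\<in>A. c i P Q p)"
  using assms(2)
proof (induction A rule: infinite_finite_induct)
  case (insert x A)
  then have "cech_trivial X C (\<lambda>P Q p. c x P Q p + (\<Sum>i\<in>A. c i P Q p))" by (intro cech_trivial_add) auto
  then show ?case using insert by simp
qed (rule cech_trivialI[OF C, of _ "\<lambda>_ _. 0"]; use C in \<open>auto simp: point_cover_def intro: regular_zero\<close>)+

end

section \<open>Consequences of the finiteness of the genus\<close>

locale curve_setup = covering X f n for X :: "('n::finite, 'k::alg_closed_field) pt set" and f n +
  fixes g :: nat
  assumes genus: "has_genus X g" and g_pos: "g > 0"
begin

lemma cech_dependent:
  assumes C: "point_cover X C" and c: "\<And>i. i < Suc g \<Longrightarrow> cech_cocycle X C (c i)"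
  shows "\<exists>a. cech_trivial X C (\<lambda>P Q p. \<Sum>i<Suc g. a i * c i P Q p) \<and> (\<exists>i<Suc g. a i \<noteq> 0)"
proof (rule ccontr)
  assume *: "\<not> ?thesis"
  have "h1_independent_classes X (Suc g)"
    unfolding h1_independent_classes_def
  proof (intro exI[of _ C] exI[of _ c] conjI allI impI)
    fix a i assume "cech_trivial X C (\<lambda>P Q p. \<Sum>i<Suc g. a i * c i P Q p)" "i < Suc g"
    then show "a i = 0" using * by blast
  qed (use C c in auto)
  then show False using genus by (simp add: has_genus_def)
qed

lemma cocycle_mult:
  assumes "cech_cocycle X C c" "point_cover X C" "\<phi> \<in> regular X X"
  shows "cech_cocycle X C (\<lambda>P Q p. \<phi> p * c P Q p)"
  unfolding cech_cocycle_def
proof (intro conjI ballI)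
  fix P Q assume "P \<in> X" "Q \<in> X"
  then show "(\<lambda>p. \<phi> p * c P Q p) \<in> regular X (C P \<inter> C Q)"
    using assms by (intro regular_module) (auto simp: cech_cocycle_def point_cover_def)
next
  fix P Q R p assume "P \<in> X" "Q \<in> X" "R \<in> X" "p \<in> C P \<inter> C Q \<inter> C R"
  then have "c P Q p + c Q R p = c P R p" using assms(1) by (simp add: cech_cocycle_def)
  then show "\<phi> p * c P Q p + \<phi> p * c Q R p = \<phi> p * c P R p" by (metis distrib_left)
qed

text \<open>
  A nonconstant global function \<open>\<psi>\<close> cannot exist: since \<open>H\<^sup>1\<close> is finite-dimensional, some
  \<open>p(\<psi>) \<noteq> 0\<close> annihilates it; but multiplication by \<open>p(\<psi>)\<close> is surjective on \<open>H\<^sup>1\<close>, because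
  the finitely many zeros can be removed from all overlaps of a cover. As \<open>g > 0\<close>, this is absurd.
\<close>

lemma global_regular_const:
  assumes \<psi>: "\<psi> \<in> regular X X"
  shows "\<exists>c. \<forall>\<^sub>F p in gen. \<psi> p = c"
proof (rule ccontr)
  assume nc: "\<nexists>c. \<forall>\<^sub>F p in gen. \<psi> p = c"
  have \<psi>rat: "\<psi> \<in> rat" by (rule ratI[OF openin_X X_nonempty \<psi>]) simp
  have neq: "\<forall>\<^sub>F p in gen. \<psi> p \<noteq> c" for c
  proof -
    have "(\<lambda>p. \<psi> p + (- c)) \<in> rat" by (intro rat_add \<psi>rat rat_const)
    from rat_cases[OF this] show ?thesis
    proof
      assume "\<forall>\<^sub>F p in gen. \<psi> p + - c = 0"
      then have "\<forall>\<^sub>F p in gen. \<psi> p = c" by eventually_elim simp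
      then show ?thesis using nc by blast
    next
      assume "\<forall>\<^sub>F p in gen. \<psi> p + - c \<noteq> 0"
      then show ?thesis by eventually_elim simp
    qed
  qed
  have poly_neq: "\<forall>\<^sub>F p in gen. poly q (\<psi> p) \<noteq> 0" if "q \<noteq> 0" for q
  proof -
    have "finite {x. poly q x = 0}" using that by (rule poly_roots_finite)
    then have "\<forall>\<^sub>F p in gen. \<forall>x\<in>{x. poly q x = 0}. \<psi> p \<noteq> x"
      by (rule eventually_ball_finite) (auto intro: neq)
    then show ?thesis by eventually_elim auto
  qed
  define pw where "pw = (\<lambda>q. restr_fun X (\<lambda>p. poly q (\<psi> p)))"
  have pw: "pw q \<in> regular X X" for q unfolding pw_def by (rule regular_poly[OF \<psi> openin_X])
  have pwX: "p \<in> X \<Longrightarrow> pw q p = poly q (\<psi> p)" for q p by (simp add: pw_def restr_fun_def)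
  have "h1_independent_classes X g" using genus by (simp add: has_genus_def)
  then obtain C c where C: "point_cover X C" and c: "\<forall>i<g. cech_cocycle X C (c i)"
    and ind: "\<forall>a. cech_trivial X C (\<lambda>P Q p. \<Sum>i<g. a i * c i P Q p) \<longrightarrow> (\<forall>i<g. a i = 0)"
    unfolding h1_independent_classes_def by (elim exE conjE) (rule that)
  have CX: "p \<in> X" if "P \<in> X" "p \<in> C P" for p P using cover_sub[OF C] that by auto
  \<comment> \<open>The products of \<open>c i\<close> with the powers of \<open>\<psi>\<close> up
    to exponent \<open>g\<close> are \<open>g + 1\<close> classes, hence dependent; this yields a
    polynomial in \<open>\<psi>\<close> that annihilates the class of \<open>c i\<close>.\<close>
  have "\<forall>i. \<exists>q. i < g \<longrightarrow> q \<noteq> 0 \<and> cech_trivial X C (\<lambda>P Q p. pw q p * c i P Q p)"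
  proof
    fix i show "\<exists>q. i < g \<longrightarrow> q \<noteq> 0 \<and> cech_trivial X C (\<lambda>P Q p. pw q p * c i P Q p)"
    proof (cases "i < g")
      case True
      have "cech_cocycle X C (\<lambda>P Q p. pw (monom 1 j) p * c i P Q p)" for j
        using cocycle_mult[OF _ C pw] c True by blast
      then have "\<exists>a. cech_trivial X C (\<lambda>P Q p. \<Sum>j<Suc g. a j * (pw (monom 1 j) p * c i P Q p)) \<and>
          (\<exists>j<Suc g. a j \<noteq> 0)"
        by (intro cech_dependent[OF C])
      then obtain a j where
        a: "cech_trivial X C (\<lambda>P Q p. \<Sum>j<Suc g. a j * (pw (monom 1 j) p * c i P Q p))" and j: "j < Suc g" "a j \<noteq> 0"
        by blast
      define q where "q = (\<Sum>j<Suc g. monom (a j) j)"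
      have "coeff q j = (\<Sum>k<Suc g. if k = j then a k else 0)" unfolding q_def coeff_sum by (rule sum.cong) auto
      then have "coeff q j = a j" using j(1) by simp
      then have "q \<noteq> 0" using j by auto
      moreover have "cech_trivial X C (\<lambda>P Q p. pw q p * c i P Q p)"
        by (rule cech_trivial_refine[OF a])
          (auto simp: pwX[OF CX] q_def poly_sum poly_monom sum_distrib_right mult.assoc simp del: sum.lessThan_Suc)
      ultimately show ?thesis by blast
    qed simp
  qed
  from choice[OF this] obtain q where q: "\<forall>i. i < g \<longrightarrow> q i \<noteq> 0 \<and> cech_trivial X C (\<lambda>P Q p. pw (q i) p * c i P Q p)"
    by (rule exE)
  define \<chi> where "\<chi> = pw (\<Prod>i<g. q i)"
  have \<chi>: "\<chi> \<in> regular X X" by (simp add: \<chi>_def pw)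
  have \<chi>c: "cech_trivial X C (\<lambda>P Q p. \<chi> p * c i P Q p)" if i: "i < g" for i
  proof (rule cech_trivial_refine[OF cech_trivial_mult[OF _ pw[of "\<Prod>j\<in>{..<g} - {i}. q j"]]])
    show "cech_trivial X C (\<lambda>P Q p. pw (q i) p * c i P Q p)" using q i by simp
    fix P Q p assume "P \<in> X" "Q \<in> X" "p \<in> C P" "p \<in> C Q"
    moreover have "(\<Prod>i<g. q i) = q i * (\<Prod>j\<in>{..<g} - {i}. q j)" using i by (subst prod.remove[of _ i]) auto
    ultimately show "\<chi> p * c i P Q p = pw (\<Prod>j\<in>{..<g} - {i}. q j) p * (pw (q i) p * c i P Q p)"
      by (simp add: \<chi>_def pwX[OF CX])
  qed simp
  have "\<forall>\<^sub>F p in gen. \<chi> p \<noteq> 0"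
  proof -
    have "(\<Prod>i<g. q i) \<noteq> 0" using q by simp
    from poly_neq[OF this] eventually_open[OF openin_X X_nonempty] show ?thesis
      by eventually_elim (simp add: \<chi>_def pwX)
  qed
  from finite_zeros[OF openin_X \<chi> this] have Z: "finite {p \<in> X. \<chi> p = 0}" .
  define Z where "Z = {p \<in> X. \<chi> p = 0}"
  \<comment> \<open>The member at \<open>P\<close> loses all zeros of \<open>\<chi>\<close> except
    \<open>P\<close> itself: the family still covers, while overlaps of members with distinct
    indices avoid the zeros.\<close>
  define D where "D = (\<lambda>P. C P - (Z - {P}))"
  have oC: "openin (zar X) (C P)" "P \<in> C P" if "P \<in> X" for P using C that by (auto simp: point_cover_def)
  have oD: "openin (zar X) (D P)" if "P \<in> X" for P
    unfolding D_def by (rule openin_cofinite[OF oC(1)[OF that]]) (use Z in \<open>simp add: Z_def\<close>)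
  have D: "point_cover X D" using oD oC by (auto simp: point_cover_def D_def)
  have diag: "c i P P p = 0" if "i < g" "P \<in> X" "p \<in> C P" for i P p
  proof -
    have "c i P P p + c i P P p = c i P P p" using c that by (auto simp: cech_cocycle_def)
    then show ?thesis by (metis add_cancel_right_right)
  qed
  have creg: "restr_fun (D P \<inter> D Q) (c i P Q) \<in> regular X (D P \<inter> D Q)" if "i < g" "P \<in> X" "Q \<in> X" for i P Q
  proof (rule regular_restr[of _ _ "C P \<inter> C Q"])
    show "c i P Q \<in> regular X (C P \<inter> C Q)" using c that by (simp add: cech_cocycle_def)
    show "openin (zar X) (D P \<inter> D Q)" using oD that by auto
  qed (auto simp: D_def)
  \<comment> \<open>The entry with index \<open>g\<close> is \<open>c 0 / \<chi>\<close>, a preimage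
    of the class of \<open>c 0\<close> under multiplication by \<open>\<chi>\<close>.\<close>
  define c' where "c' = (\<lambda>i P Q. restr_fun (D P \<inter> D Q) (\<lambda>p. if i < g then c i P Q p else c 0 P Q p / \<chi> p))"
  have c': "cech_cocycle X D (c' i)" for i
    unfolding cech_cocycle_def
  proof (intro conjI ballI)
    fix P Q assume PQ: "P \<in> X" "Q \<in> X"
    have o: "openin (zar X) (D P \<inter> D Q)" using oD PQ by auto
    show "c' i P Q \<in> regular X (D P \<inter> D Q)"
    proof (cases "i < g")
      case True then show ?thesis using creg[OF True PQ] by (simp add: c'_def)
    next
      case False
      show ?thesis
      proof (cases "P = Q")
        case True
        \<comment> \<open>On the diagonal a zero of \<open>\<chi>\<close> may remain, but there the
          cocycle vanishes.\<close>
        have "c' i P Q = (\<lambda>_. 0)"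
          using False True diag[OF g_pos PQ(1)] by (auto simp: c'_def restr_fun_def D_def fun_eq_iff)
        then show ?thesis using regular_zero[OF o] by simp
      next
        case neq: False
        have "restr_fun (D P \<inter> D Q) \<chi> \<in> regular X (D P \<inter> D Q)" by (rule regular_restr[OF \<chi> openin_sub[OF o] o])
        moreover have "restr_fun (D P \<inter> D Q) \<chi> p \<noteq> 0" if p: "p \<in> D P \<inter> D Q" for p
        proof
          assume "restr_fun (D P \<inter> D Q) \<chi> p = 0"
          then have "p \<in> Z" using p CX[OF PQ(1), of p] by (simp add: restr_fun_def Z_def D_def)
          then have "p = P" "p = Q" using p by (auto simp: D_def)
          then show False using neq by simp
        qed
        ultimately have "(\<lambda>p. inverse (restr_fun (D P \<inter> D Q) \<chi> p)) \<in> regular X (D P \<inter> D Q)"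
          by (rule regular_inverse)
        from regular_mult[OF creg[OF g_pos PQ] this o]
        have "(\<lambda>p. restr_fun (D P \<inter> D Q) (c 0 P Q) p * inverse (restr_fun (D P \<inter> D Q) \<chi> p))
          \<in> regular X (D P \<inter> D Q)" .
        moreover have "(\<lambda>p. restr_fun (D P \<inter> D Q) (c 0 P Q) p * inverse (restr_fun (D P \<inter> D Q) \<chi> p)) = c' i P Q"
          by (rule ext) (simp add: c'_def restr_fun_def divide_inverse False)
        ultimately show ?thesis by simp
      qed
    qed
  next
    fix P Q R p assume *: "P \<in> X" "Q \<in> X" "R \<in> X" and p: "p \<in> D P \<inter> D Q \<inter> D R"
    then have "p \<in> C P \<inter> C Q \<inter> C R" by (auto simp: D_def)
    then have "c j P Q p + c j Q R p = c j P R p" if "j < g" for j using c * that by (simp add: cech_cocycle_def)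
    then show "c' i P Q p + c' i Q R p = c' i P R p"
      using p g_pos by (auto simp: c'_def restr_fun_def simp flip: add_divide_distrib)
  qed
  have "\<exists>a. cech_trivial X D (\<lambda>P Q p. \<Sum>i<Suc g. a i * c' i P Q p) \<and> (\<exists>i<Suc g. a i \<noteq> 0)"
    by (rule cech_dependent[OF D]) (rule c')
  then obtain b i where
    b: "cech_trivial X D (\<lambda>P Q p. \<Sum>i<Suc g. b i * c' i P Q p)" and i: "i < Suc g" "b i \<noteq> 0"
    by (elim exE conjE) (rule that)
  have \<chi>c0: "\<chi> p * c' g P Q p = c 0 P Q p" if "P \<in> X" "Q \<in> X" "p \<in> D P" "p \<in> D Q" for P Q p
  proof (cases "\<chi> p = 0")
    case True
    have pZ: "p \<in> Z" "p \<in> C P" using that(3) CX[OF that(1), of p] True by (auto simp: D_def Z_def)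
    then have "p = P" "p = Q" using that(3,4) by (auto simp: D_def)
    then show ?thesis using diag[OF g_pos that(1), of p] pZ(2) True by simp
  qed (use that in \<open>simp add: c'_def restr_fun_def\<close>)
  \<comment> \<open>Multiplication by \<open>\<chi>\<close> makes the first \<open>g\<close> classes
    trivial and leaves \<open>b g\<close> times the class of \<open>c 0\<close>. Hence
    \<open>b g = 0\<close>, and the original relation involves only the independent classes
    \<open>c i\<close>.\<close>
  have t1: "cech_trivial X C (\<lambda>P Q p. (\<Sum>i<g. b i * (\<chi> p * c i P Q p)) + b g * c 0 P Q p)"
  proof (rule cech_trivial_refine[OF cech_trivial_mult[OF b \<chi>]])
    fix P Q p assume *: "P \<in> X" "Q \<in> X" "p \<in> D P" "p \<in> D Q"
    have "(\<Sum>i<g. b i * (\<chi> p * c i P Q p)) = \<chi> p * (\<Sum>i<g. b i * c' i P Q p)"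
      unfolding sum_distrib_left by (rule sum.cong) (use * in \<open>auto simp: c'_def restr_fun_def\<close>)
    then show "(\<Sum>i<g. b i * (\<chi> p * c i P Q p)) + b g * c 0 P Q p = \<chi> p * (\<Sum>i<Suc g. b i * c' i P Q p)"
      using \<chi>c0[OF *] by (simp add: distrib_left mult.left_commute)
  qed (auto simp: D_def)
  have t2: "cech_trivial X C (\<lambda>P Q p. \<Sum>i<g. b i * (\<chi> p * c i P Q p))"
    by (rule cech_trivial_sum[OF C]) (auto intro: cech_trivial_smult[OF C] \<chi>c)
  have "cech_trivial X C (\<lambda>P Q p. \<Sum>i<g. (if i = 0 then b g else 0) * c i P Q p)"
  proof (rule cech_trivial_refine[OF cech_trivial_add[OF t1 cech_trivial_smult[OF C t2, of "- 1"]]])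
    fix P Q p
    have "(\<Sum>i<g. (if i = 0 then b g else 0) * c i P Q p) = (\<Sum>i<g. if i = 0 then b g * c i P Q p else 0)"
      by (rule sum.cong) auto
    then show "(\<Sum>i<g. (if i = 0 then b g else 0) * c i P Q p) =
       (\<Sum>i<g. b i * (\<chi> p * c i P Q p)) + b g * c 0 P Q p + - 1 * (\<Sum>i<g. b i * (\<chi> p * c i P Q p))"
      using g_pos by simp
  qed simp
  from mp[OF spec[OF ind, of "\<lambda>i. if i = 0 then b g else 0"] this] have bg: "b g = 0" using g_pos by auto
  have "cech_trivial X C (\<lambda>P Q p. \<Sum>i<g. b i * c i P Q p)"
  proof (rule cech_trivial_refine[OF b])
    fix P Q p assume *: "P \<in> X" "Q \<in> X" "p \<in> D P" "p \<in> D Q"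
    have "(\<Sum>i<g. b i * c i P Q p) = (\<Sum>i<g. b i * c' i P Q p)"
      by (rule sum.cong) (use * in \<open>auto simp: c'_def restr_fun_def\<close>)
    then show "(\<Sum>i<g. b i * c i P Q p) = (\<Sum>i<Suc g. b i * c' i P Q p)" by (simp add: bg)
  qed (auto simp: D_def)
  from mp[OF spec[OF ind, of b] this] have "\<forall>i<g. b i = 0" .
  then show False using i bg by (auto simp: less_Suc_eq)
qed

lemma global_const:
  assumes "\<And>P. P \<in> X \<Longrightarrow> u \<in> reg P" shows "\<exists>c. \<forall>\<^sub>F p in gen. u p = c"
proof -
  obtain \<psi> where \<psi>: "\<psi> \<in> regular X X" "\<forall>\<^sub>F p in gen. u p = \<psi> p" using glue[OF openin_X assms] X_nonempty by auto
  obtain c where "\<forall>\<^sub>F p in gen. \<psi> p = c" using global_regular_const[OF \<psi>(1)] by blast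
  with \<psi>(2) have "\<forall>\<^sub>F p in gen. u p = c" by eventually_elim simp
  then show ?thesis by blast
qed

text \<open>With more than \<open>g\<close> functions on the overlap of the two charts, some
  combination \<open>w0\<close> has trivial class. A trivializing cochain, corrected by the jump
  between the charts, glues to one function \<open>t0\<close> that is regular on the finite chart
  while \<open>t0 + w0\<close> is regular on the other. This splits \<open>w0\<close> and
  contradicts the independence assumed.\<close>

lemma genus_bound:
  assumes w: "\<And>i P. i < N \<Longrightarrow> P \<in> X - inf_fibre \<Longrightarrow> t P \<noteq> 0 \<Longrightarrow> w i \<in> reg P"
    and ind: "\<And>a u v. (\<And>P. P \<in> X - inf_fibre \<Longrightarrow> u \<in> reg P) \<Longrightarrow>
      (\<And>P. P \<in> X \<Longrightarrow> P \<in> inf_fibre \<or> t P \<noteq> 0 \<Longrightarrow> v \<in> reg P) \<Longrightarrow>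
      \<forall>\<^sub>F p in gen. (\<Sum>i<N. a i * w i p) = u p + v p \<Longrightarrow> (\<forall>i<N. a i = 0)"
  shows "N \<le> g"
proof (rule ccontr)
  assume "\<not> N \<le> g"
  then have N: "Suc g \<le> N" by simp
  define U0 U1 where "U0 = X - inf_fibre" and "U1 = {p \<in> X. p \<in> inf_fibre \<or> t p \<noteq> 0}"
  have U0: "openin (zar X) U0" unfolding U0_def by (rule openin_finite_part)
  have "U1 = pre (\<lambda>x. x 1)" using y_nonzero by (auto simp: U1_def pre_def inf_fibre_def t_def)
  then have U1: "openin (zar X) U1" using openin_pre[OF form_coord[of 1]] by simp
  have o: "openin (zar X) (U0 \<inter> U1)" using U0 U1 by auto
  have ne: "U0 \<inter> U1 \<noteq> {}"
  proof
    assume e: "U0 \<inter> U1 = {}"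
    have "\<forall>\<^sub>F p in gen. False" using ev_finite_part t_neq[of 0] by eventually_elim (use e in \<open>auto simp: U0_def U1_def\<close>)
    then show False using gen_neq_bot by (simp add: trivial_limit_def)
  qed
  have "\<forall>i. \<exists>v. i < N \<longrightarrow> v \<in> regular X (U0 \<inter> U1) \<and> (\<forall>\<^sub>F p in gen. w i p = v p)"
    using glue[OF o, of "w _"] w ne by (auto simp: U0_def U1_def)
  from choice[OF this] obtain w' where w': "\<And>i. i < N \<Longrightarrow> w' i \<in> regular X (U0 \<inter> U1)"
    "\<And>i. i < N \<Longrightarrow> (\<forall>\<^sub>F p in gen. w i p = w' i p)" by blast
  \<comment> \<open>The two-chart cover in the form indexed by points: each point gets one chart,
    and \<open>\<sigma>\<close> records which. A cocycle is then \<open>w' i\<close> times the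
    difference of two choices.\<close>
  define C where "C = (\<lambda>P. if P \<in> inf_fibre then U1 else U0)"
  define \<sigma> :: "('n, 'k) pt \<Rightarrow> 'k" where "\<sigma> = (\<lambda>P. if P \<in> inf_fibre then 1 else 0)"
  define c where "c = (\<lambda>i P Q p. (\<sigma> Q - \<sigma> P) * w' i p)"
  have C: "point_cover X C" using U0 U1 by (auto simp: point_cover_def C_def U0_def U1_def)
  have cc: "cech_cocycle X C (c i)" if "i < Suc g" for i
    unfolding cech_cocycle_def
  proof (intro conjI ballI)
    fix P Q assume PQ: "P \<in> X" "Q \<in> X"
    have i: "i < N" using that N by simp
    have oC: "openin (zar X) (C P \<inter> C Q)" using C PQ by (auto simp: point_cover_def)
    show "c i P Q \<in> regular X (C P \<inter> C Q)"
    proof (cases "(P \<in> inf_fibre) = (Q \<in> inf_fibre)")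
      case True then show ?thesis using regular_zero[OF oC] by (simp add: c_def \<sigma>_def)
    next
      case False
      then have "C P \<inter> C Q = U0 \<inter> U1" by (auto simp: C_def)
      then show ?thesis using regular_smult[OF o w'(1)[OF i]] by (simp add: c_def)
    qed
  qed (simp add: c_def algebra_simps)
  have "\<exists>a. cech_trivial X C (\<lambda>P Q p. \<Sum>i<Suc g. a i * c i P Q p) \<and> (\<exists>i<Suc g. a i \<noteq> 0)"
    by (rule cech_dependent[OF C]) (rule cc)
  then obtain a j where
    a: "cech_trivial X C (\<lambda>P Q p. \<Sum>i<Suc g. a i * c i P Q p)" and j: "j < Suc g" "a j \<noteq> 0" by (elim exE conjE) (rule that)
  from cech_trivialD[OF a] obtain D h where D: "point_cover X D" "\<forall>P\<in>X. D P \<subseteq> C P"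
    "\<forall>P\<in>X. h P \<in> regular X (D P)" "\<forall>P\<in>X. \<forall>Q\<in>X. \<forall>p \<in> D P \<inter> D Q. (\<Sum>i<Suc g. a i * c i P Q p) = h Q p - h P p"
    by (elim exE conjE) (rule that)
  define w0 where "w0 = (\<lambda>p. \<Sum>i<Suc g. a i * w' i p)"
  \<comment> \<open>At \<open>p\<close> the cochain with index \<open>p\<close> itself is used;
    subtracting \<open>\<sigma> p * w0 p\<close> makes the result agree near every \<open>P\<close>
    with \<open>h P - \<sigma> P * w0\<close>.\<close>
  define t0 where "t0 = (\<lambda>p. h p p - \<sigma> p * w0 p)"
  have oD: "openin (zar X) (D P)" "P \<in> D P" if "P \<in> X" for P using D(1) that by (auto simp: point_cover_def)
  have t0: "\<forall>\<^sub>F p in gen. t0 p = h P p - \<sigma> P * w0 p" if P: "P \<in> X" for P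
  proof (rule eventually_genI[OF oD(1)[OF P]])
    fix p assume p: "p \<in> D P"
    then have pX: "p \<in> X" using openin_sub[OF oD(1)[OF P]] by auto
    have 1: "(\<Sum>i<Suc g. a i * c i P p p) = h p p - h P p" using D(4) P pX p oD(2)[OF pX] by blast
    have 2: "(\<Sum>i<Suc g. a i * c i P p p) = (\<sigma> p - \<sigma> P) * w0 p"
      unfolding w0_def sum_distrib_left by (rule sum.cong) (auto simp: c_def)
    show "t0 p = h P p - \<sigma> P * w0 p" using 1 unfolding 2 by (simp add: t0_def algebra_simps)
  qed (use oD[OF P] in auto)
  have hreg: "h P \<in> reg P" if "P \<in> X" for P by (rule regI'[OF oD[OF that]]) (use D(3) that in simp)
  have t0_fin: "t0 \<in> reg P" if P: "P \<in> X - inf_fibre" for P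
  proof (rule reg_cong[OF hreg])
    show "\<forall>\<^sub>F p in gen. h P p = t0 p" using t0[of P] P by (auto simp: \<sigma>_def elim: eventually_mono)
  qed (use P in auto)
  have w0: "w0 \<in> reg P" if "P \<in> U0 \<inter> U1" for P
    unfolding w0_def by (intro reg_sum reg_mult reg_const regI'[OF o that] w'(1)) (use that N in \<open>auto simp: U0_def\<close>)
  have "\<forall>i<N. (if i < Suc g then a i else 0) = 0"
  proof (rule ind)
    show "(\<lambda>p. - 1 * t0 p) \<in> reg P" if "P \<in> X - inf_fibre" for P
      by (intro reg_mult reg_const t0_fin) (use that in auto)
    show "(\<lambda>p. t0 p + w0 p) \<in> reg P" if P: "P \<in> X" "P \<in> inf_fibre \<or> t P \<noteq> 0" for P
    proof (cases "P \<in> inf_fibre")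
      case True
      show ?thesis
      proof (rule reg_cong[OF hreg[OF P(1)]])
        show "\<forall>\<^sub>F p in gen. h P p = t0 p + w0 p" using t0[OF P(1)] True by (auto simp: \<sigma>_def elim: eventually_mono)
      qed
    next
      case False then show ?thesis using P by (intro reg_add t0_fin w0) (auto simp: U0_def U1_def)
    qed
    have "\<forall>\<^sub>F p in gen. \<forall>i\<in>{..<Suc g}. w i p = w' i p" by (intro eventually_ball_finite ballI w'(2)) (use N in auto)
    then show "\<forall>\<^sub>F p in gen. (\<Sum>i<N. (if i < Suc g then a i else 0) * w i p) = - 1 * t0 p + (t0 p + w0 p)"
    proof eventually_elim
      case (elim p)
      have "(\<Sum>i<N. (if i < Suc g then a i else 0) * w i p) = (\<Sum>i<Suc g. a i * w i p)"
        by (rule sum.mono_neutral_cong_right) (use N in auto)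
      also have "\<dots> = w0 p" unfolding w0_def by (rule sum.cong) (use elim in auto)
      finally show ?case by simp
    qed
  qed
  then show False using j N by (auto dest!: spec[of _ j])
qed

sublocale curve_over_line gen X inf_fibre rat reg t n g
proof (unfold_locales, goal_cases)
  case 1 show ?case by (rule gen_neq_bot)
next
  case 2 show ?case by (auto simp: inf_fibre_def)
next
  case 3 show ?case by (rule rat_const)
next
  case 4 then show ?case by (rule rat_add)
next
  case 5 then show ?case by (rule rat_mult)
next
  case 6 then show ?case by (rule rat_inverse)
next
  case 7 then show ?case by (rule rat_cong)
next
  case 8 then show ?case by (rule rat_cases)
next
  case 9 show ?case by (rule reg_rat[OF 9(2)])
next
  case 10 then show ?case by (rule reg_const)
next
  case 11 show ?case by (rule reg_add[OF 11(2,3)])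
next
  case 12 show ?case by (rule reg_mult[OF 12(2,3)])
next
  case 13 then show ?case by (rule reg_cong)
next
  case 14 then show ?case by (rule rat_reg_cofinite)
next
  case 15 show ?case by (rule t_rat)
next
  case 16 show ?case by (rule t_neq)
next
  case 17 then show ?case by (rule t_reg)
next
  case 18 show ?case by (rule t_inverse_reg) (use 18 in auto)
next
  case 19 then show ?case by (rule t_inverse_reg_inf)
next
  case 20 show ?case by (rule t_quot_reg) (use 20 in \<open>auto simp: inf_fibre_def\<close>)
next
  case (21 u P)
  then have "P \<in> X" by simp
  from pole[OF 21(1) this] show ?case
    by (elim exE conjE) (rule exI, rule conjI, assumption, erule mp, use 21 in simp)
next
  case (22 u P)
  then have "P \<in> X" by (simp add: inf_fibre_def)
  from pole[OF 22(1) this] obtain q where q: "q \<noteq> 0"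
    "P \<in> inf_fibre \<longrightarrow> (\<exists>M. (\<lambda>p. inverse (t p) ^ M * poly q (t p) * u p) \<in> reg P)"
    by (elim exE conjE) (rule that)
  from mp[OF q(2) 22(2)] show ?case by (elim exE) (rule exI, rule exI, rule conjI, rule q(1))
next
  case 23 then show ?case by (rule indep_le)
next
  case 24 then show ?case by (rule indep_extend)
next
  case 25 then show ?case by (rule global_const)
next
  case 26 then show ?case by (rule genus_bound)
qed

end

section \<open>Line bundles as divisors\<close>

context variety
begin

text \<open>An isomorphism with the structure sheaf over \<open>W\<close>, its record operations
  unfolded to pointwise ones.\<close>

definition triv :: "('n, 'k, 's) sheaf \<Rightarrow> ('n, 'k) pt set \<Rightarrow> (('n, 'k) pt set \<Rightarrow> 's \<Rightarrow> ('n, 'k) pt \<Rightarrow> 'k) \<Rightarrow> bool"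
  where "triv L W \<theta> \<longleftrightarrow> (\<forall>U. openin (zar X) U \<and> U \<subseteq> W \<longrightarrow>
    bij_betw (\<theta> U) (carrier (sections L U)) (regular X U) \<and>
    (\<forall>s\<in>carrier (sections L U). \<forall>s'\<in>carrier (sections L U).
       \<theta> U (s \<oplus>\<^bsub>sections L U\<^esub> s') = (\<lambda>p. \<theta> U s p + \<theta> U s' p)) \<and>
    (\<forall>a\<in>regular X U. \<forall>s\<in>carrier (sections L U). \<theta> U (a \<odot>\<^bsub>sections L U\<^esub> s) = (\<lambda>p. a p * \<theta> U s p)) \<and>
    (\<forall>V. openin (zar X) V \<and> V \<subseteq> U \<longrightarrow>
       (\<forall>s\<in>carrier (sections L U). \<theta> V (restr L U V s) = restr_fun V (\<theta> U s))))"

lemma triv_iff: "sheaf_iso_on X W L (structure_sheaf X) \<longleftrightarrow> (\<exists>\<theta>. triv L W \<theta>)"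
  by (simp add: sheaf_iso_on_def structure_sheaf_def triv_def)

end

text \<open>
  The trivialization \<open>T0\<close> over \<open>W0\<close> identifies the rational sections of \<open>L\<close> with the rational
  functions, and the transition functions from it to the trivializations \<open>T P\<close> near the points
  \<open>P\<close> are the local equations \<open>gd P\<close> of a divisor.
\<close>

locale trivialized = curve_setup X f n g
  for X :: "('n::finite, 'k::alg_closed_field) pt set" and f n g +
  fixes L :: "('n, 'k, 's) sheaf" and W T and W0 :: "('n, 'k) pt set" and T0
  assumes sheaf: "sheaf_of_modules X L"
    and W: "P \<in> X \<Longrightarrow> openin (zar X) (W P) \<and> P \<in> W P \<and> triv L (W P) (T P)"
    and W0: "openin (zar X) W0" "W0 \<noteq> {}" "triv L W0 T0"
    and W_W0: "P \<in> W0 \<Longrightarrow> W P = W0 \<and> T P = T0"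
begin

abbreviation "sect U \<equiv> carrier (sections L U)"

lemmas sheaf_restr = conjunct1[OF conjunct2[OF sheaf[unfolded sheaf_of_modules_def]]]

lemma restr_sect: "openin (zar X) U \<Longrightarrow> openin (zar X) V \<Longrightarrow> V \<subseteq> U \<Longrightarrow> s \<in> sect U \<Longrightarrow> restr L U V s \<in> sect V"
  using sheaf_restr by simp

lemma restr_add: "openin (zar X) U \<Longrightarrow> openin (zar X) V \<Longrightarrow> V \<subseteq> U \<Longrightarrow> s \<in> sect U \<Longrightarrow> s' \<in> sect U \<Longrightarrow>
    restr L U V (s \<oplus>\<^bsub>sections L U\<^esub> s') = restr L U V s \<oplus>\<^bsub>sections L V\<^esub> restr L U V s'"
  using sheaf_restr by simp

lemma restr_smult: "openin (zar X) U \<Longrightarrow> openin (zar X) V \<Longrightarrow> V \<subseteq> U \<Longrightarrow> a \<in> regular X U \<Longrightarrow> s \<in> sect U \<Longrightarrow>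
    restr L U V (a \<odot>\<^bsub>sections L U\<^esub> s) = restr_fun V a \<odot>\<^bsub>sections L V\<^esub> restr L U V s"
  using sheaf_restr by simp

lemma restr_restr: "openin (zar X) U \<Longrightarrow> openin (zar X) V \<Longrightarrow> openin (zar X) Y \<Longrightarrow> Y \<subseteq> V \<Longrightarrow> V \<subseteq> U \<Longrightarrow> s \<in> sect U \<Longrightarrow>
    restr L V Y (restr L U V s) = restr L U Y s"
  using conjunct1[OF conjunct2[OF conjunct2[OF conjunct2[OF sheaf[unfolded sheaf_of_modules_def]]]]] by simp

lemma sheaf_glue:
  assumes "\<And>V. V \<in> \<U> \<Longrightarrow> openin (zar X) V \<and> s V \<in> sect V"
    and "\<And>V V'. V \<in> \<U> \<Longrightarrow> V' \<in> \<U> \<Longrightarrow> restr L V (V \<inter> V') (s V) = restr L V' (V \<inter> V') (s V')"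
  shows "\<exists>!t. t \<in> sect (\<Union>\<U>) \<and> (\<forall>V\<in>\<U>. restr L (\<Union>\<U>) V t = s V)"
proof (rule mp[OF spec[OF spec[OF conjunct2[OF conjunct2[OF conjunct2[OF conjunct2[OF sheaf[unfolded sheaf_of_modules_def]]]]]]]])
  show "(\<forall>V\<in>\<U>. openin (zar X) V \<and> s V \<in> sect V) \<and>
      (\<forall>V\<in>\<U>. \<forall>V'\<in>\<U>. restr L V (V \<inter> V') (s V) = restr L V' (V \<inter> V') (s V'))"
    by (intro conjI ballI assms(1)[THEN conjunct1] assms(1)[THEN conjunct2] assms(2))
qed

lemma trivD:
  assumes "triv L Y \<theta>" "openin (zar X) U" "U \<subseteq> Y"
  shows "bij_betw (\<theta> U) (sect U) (regular X U)"
    and "s \<in> sect U \<Longrightarrow> s' \<in> sect U \<Longrightarrow> \<theta> U (s \<oplus>\<^bsub>sections L U\<^esub> s') = (\<lambda>p. \<theta> U s p + \<theta> U s' p)"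
    and "a \<in> regular X U \<Longrightarrow> s \<in> sect U \<Longrightarrow> \<theta> U (a \<odot>\<^bsub>sections L U\<^esub> s) = (\<lambda>p. a p * \<theta> U s p)"
    and "openin (zar X) V \<Longrightarrow> V \<subseteq> U \<Longrightarrow> s \<in> sect U \<Longrightarrow> \<theta> V (restr L U V s) = restr_fun V (\<theta> U s)"
  using assms unfolding triv_def by simp_all

lemma triv_regular: "triv L Y \<theta> \<Longrightarrow> openin (zar X) U \<Longrightarrow> U \<subseteq> Y \<Longrightarrow> s \<in> sect U \<Longrightarrow> \<theta> U s \<in> regular X U"
  using trivD(1) bij_betwE by blast

lemma triv_inj: "triv L Y \<theta> \<Longrightarrow> openin (zar X) U \<Longrightarrow> U \<subseteq> Y \<Longrightarrow> s \<in> sect U \<Longrightarrow> s' \<in> sect U \<Longrightarrow> \<theta> U s = \<theta> U s' \<Longrightarrow> s = s'"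
  using trivD(1) unfolding bij_betw_def inj_on_def by blast

lemma triv_surj:
  assumes "triv L Y \<theta>" "openin (zar X) U" "U \<subseteq> Y" "\<phi> \<in> regular X U"
  shows "\<exists>s\<in>sect U. \<theta> U s = \<phi>"
proof -
  have "\<phi> \<in> \<theta> U ` sect U" using assms(4) bij_betw_imp_surj_on[OF trivD(1)[OF assms(1-3)]] by simp
  then show ?thesis by auto
qed

lemma smult_sect: "openin (zar X) U \<Longrightarrow> a \<in> regular X U \<Longrightarrow> s \<in> sect U \<Longrightarrow> a \<odot>\<^bsub>sections L U\<^esub> s \<in> sect U"
proof -
  assume U: "openin (zar X) U" and a: "a \<in> regular X U" and s: "s \<in> sect U"
  have "Module.module (regular_ring X U) (sections L U)"
    using conjunct1[OF sheaf[unfolded sheaf_of_modules_def]] U by simp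
  from module.smult_closed[OF this, of a s] a s show ?thesis by (simp add: regular_ring_def)
qed

definition overlap :: "('n, 'k) pt \<Rightarrow> ('n, 'k) pt set" where "overlap P = W P \<inter> W0"

lemma openin_overlap: "P \<in> X \<Longrightarrow> openin (zar X) (overlap P)"
  using W W0 by (auto simp: overlap_def)

lemma overlap_nonempty: "P \<in> X \<Longrightarrow> overlap P \<noteq> {}"
  using open_meet[of "W P" W0] W W0 by (auto simp: overlap_def)

definition unit_section :: "('n, 'k) pt \<Rightarrow> 's" where
  "unit_section P = (SOME s. s \<in> sect (overlap P) \<and> T0 (overlap P) s = restr_fun (overlap P) (\<lambda>_. 1))"

lemma unit_section:
  assumes "P \<in> X"
  shows "unit_section P \<in> sect (overlap P)" "T0 (overlap P) (unit_section P) = restr_fun (overlap P) (\<lambda>_. 1)"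
proof -
  have "\<exists>s. s \<in> sect (overlap P) \<and> T0 (overlap P) s = restr_fun (overlap P) (\<lambda>_. 1)"
    using triv_surj[OF W0(3) openin_overlap[OF assms] _ regular_const[OF openin_overlap[OF assms], of 1]]
    by (auto simp: overlap_def)
  then have "unit_section P \<in> sect (overlap P) \<and> T0 (overlap P) (unit_section P) = restr_fun (overlap P) (\<lambda>_. 1)"
    unfolding unit_section_def by (rule someI_ex)
  then show "unit_section P \<in> sect (overlap P)" "T0 (overlap P) (unit_section P) = restr_fun (overlap P) (\<lambda>_. 1)" by auto
qed

text \<open>The transition function from \<open>T0\<close> to \<open>T P\<close>, obtained as the
  image under \<open>T P\<close> of the section that \<open>T0\<close> sends to 1.\<close>

definition gd :: "('n, 'k) pt \<Rightarrow> ('n, 'k) pt \<Rightarrow> 'k" where "gd P = T P (overlap P) (unit_section P)"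

lemma gd_regular: "P \<in> X \<Longrightarrow> gd P \<in> regular X (overlap P)"
  unfolding gd_def by (rule triv_regular[OF _ openin_overlap _ unit_section(1)]) (use W in \<open>auto simp: overlap_def\<close>)

text \<open>Inside the overlap every section is its \<open>T0\<close> coordinate times the unit
  section, and both trivializations are linear over regular functions.\<close>

lemma transition:
  assumes P: "P \<in> X" and U: "openin (zar X) U" "U \<subseteq> overlap P" and s: "s \<in> sect U"
  shows "T P U s = (\<lambda>p. T0 U s p * gd P p)"
proof -
  have sub: "U \<subseteq> W0" "U \<subseteq> W P" "overlap P \<subseteq> W0" "overlap P \<subseteq> W P" using U(2) by (auto simp: overlap_def)
  have TP: "triv L (W P) (T P)" using W[OF P] by simp
  define a where "a = T0 U s"
  have a: "a \<in> regular X U" unfolding a_def by (rule triv_regular[OF W0(3) U(1) sub(1) s])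
  define \<sigma> where "\<sigma> = restr L (overlap P) U (unit_section P)"
  have \<sigma>: "\<sigma> \<in> sect U" unfolding \<sigma>_def by (rule restr_sect[OF openin_overlap[OF P] U unit_section(1)[OF P]])
  have "T0 U \<sigma> = restr_fun U (restr_fun (overlap P) (\<lambda>_. 1))"
    unfolding \<sigma>_def unit_section(2)[OF P, symmetric]
    by (rule trivD(4)[OF W0(3) openin_overlap[OF P] sub(3) U unit_section(1)[OF P]])
  then have "T0 U (a \<odot>\<^bsub>sections L U\<^esub> \<sigma>) = a"
    unfolding trivD(3)[OF W0(3) U(1) sub(1) a \<sigma>] using regular_zero_outside[OF a] U(2) by (auto simp: restr_fun_def fun_eq_iff)
  then have s_eq: "s = a \<odot>\<^bsub>sections L U\<^esub> \<sigma>"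
    by (intro triv_inj[OF W0(3) U(1) sub(1) s smult_sect[OF U(1) a \<sigma>]]) (simp add: a_def)
  have "T P U \<sigma> = restr_fun U (gd P)"
    unfolding \<sigma>_def gd_def by (rule trivD(4)[OF TP openin_overlap[OF P] sub(4) U unit_section(1)[OF P]])
  then have "T P U s = (\<lambda>p. a p * restr_fun U (gd P) p)"
    using trivD(3)[OF TP U(1) sub(2) a \<sigma>] s_eq by simp
  also have "\<dots> = (\<lambda>p. a p * gd P p)" using regular_zero_outside[OF a] by (auto simp: restr_fun_def fun_eq_iff)
  finally show ?thesis by (simp add: a_def)
qed

text \<open>The section that \<open>T P\<close> sends to 1 provides an inverse of
  \<open>gd P\<close> on the overlap.\<close>

lemma gd_nonzero: assumes P: "P \<in> X" shows "\<forall>\<^sub>F p in gen. gd P p \<noteq> 0"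
proof (rule eventually_mono[OF eventually_open[OF openin_overlap[OF P] overlap_nonempty[OF P]]])
  have TP: "triv L (W P) (T P)" using W[OF P] by simp
  obtain \<tau> where \<tau>: "\<tau> \<in> sect (overlap P)" "T P (overlap P) \<tau> = restr_fun (overlap P) (\<lambda>_. 1)"
    using triv_surj[OF TP openin_overlap[OF P] _ regular_const[OF openin_overlap[OF P], of 1]] by (auto simp: overlap_def)
  fix p assume "p \<in> overlap P"
  then have "T0 (overlap P) \<tau> p * gd P p = 1"
    using fun_cong[OF transition[OF P openin_overlap[OF P] order_refl \<tau>(1)], of p] \<tau>(2) by (simp add: restr_fun_def)
  then show "gd P p \<noteq> 0" by auto
qed

lemma divisor_gd: "divisor gd"
  unfolding divisor_def
proof (intro conjI ballI)
  fix P assume P: "P \<in> X"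
  show "gd P \<in> rat" by (rule ratI[OF openin_overlap[OF P] overlap_nonempty[OF P] gd_regular[OF P]]) simp
  show "\<forall>\<^sub>F p in gen. gd P p \<noteq> 0" by (rule gd_nonzero[OF P])
next
  have "\<forall>\<^sub>F p in gen. gd P p = 1" if P: "P \<in> W0" for P
  proof -
    have "P \<in> X" using openin_sub[OF W0(1)] P by auto
    then have "gd P = restr_fun W0 (\<lambda>_. 1)"
      using unit_section(2)[of P] W_W0[OF P] by (simp add: gd_def overlap_def)
    then show ?thesis using restr_ev[OF W0(1,2), of "\<lambda>_. 1"] by simp
  qed
  then have "{P \<in> X. \<not> (\<forall>\<^sub>F p in gen. gd P p = 1)} \<subseteq> X - W0" by auto
  then show "finite {P \<in> X. \<not> (\<forall>\<^sub>F p in gen. gd P p = 1)}"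
    using finite_complement[OF W0(1,2)] finite_subset by blast
qed

text \<open>The rational function that represents a section in the generic trivialization
  \<open>T0\<close>. Over a nonempty open \<open>U\<close> it identifies sections with the rational
  functions that lie in \<open>sec gd P\<close> for all \<open>P\<close> in \<open>U\<close>, up to
  generic equality.\<close>

definition rho :: "('n, 'k) pt set \<Rightarrow> 's \<Rightarrow> ('n, 'k) pt \<Rightarrow> 'k" where
  "rho U s = T0 (U \<inter> W0) (restr L U (U \<inter> W0) s)"

lemma rho_regular:
  assumes "openin (zar X) U" "s \<in> sect U" shows "rho U s \<in> regular X (U \<inter> W0)"
  unfolding rho_def using assms W0 by (intro triv_regular[OF W0(3)] restr_sect) auto

lemma rho_restr:
  assumes U: "openin (zar X) U" and V: "openin (zar X) V" "V \<subseteq> U" and s: "s \<in> sect U"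
  shows "rho V (restr L U V s) = restr_fun (V \<inter> W0) (rho U s)"
proof -
  have o: "openin (zar X) (U \<inter> W0)" "openin (zar X) (V \<inter> W0)" using U V W0 by auto
  have sub: "V \<inter> W0 \<subseteq> U" using V(2) by auto
  have "restr L V (V \<inter> W0) (restr L U V s) = restr L (U \<inter> W0) (V \<inter> W0) (restr L U (U \<inter> W0) s)"
    using restr_restr[OF U V(1) o(2) _ V(2) s] restr_restr[OF U o(1) o(2) _ _ s] V(2) sub by auto
  then show ?thesis
    unfolding rho_def using V(2) by (subst trivD(4)[OF W0(3) o(1) _ o(2) _ restr_sect[OF U o(1) _ s], symmetric]) auto
qed

lemma rho_restr_ev:
  assumes U: "openin (zar X) U" and V: "openin (zar X) V" "V \<subseteq> U" "V \<noteq> {}" and s: "s \<in> sect U"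
  shows "\<forall>\<^sub>F p in gen. rho V (restr L U V s) p = rho U s p"
  unfolding rho_restr[OF U V(1,2) s] using open_meet[OF V(1,3) W0(1,2)] V(1) W0(1) by (intro restr_ev) auto

lemma rho_local:
  assumes U: "openin (zar X) U" "U \<subseteq> W P" "U \<noteq> {}" and P: "P \<in> X" and s: "s \<in> sect U"
  shows "\<forall>\<^sub>F p in gen. T P U s p = gd P p * rho U s p"
proof -
  have TP: "triv L (W P) (T P)" using W[OF P] by simp
  have o: "openin (zar X) (U \<inter> W0)" "U \<inter> W0 \<noteq> {}" using U W0 open_meet by auto
  have sub: "U \<inter> W0 \<subseteq> overlap P" using U(2) by (auto simp: overlap_def)
  have "T P (U \<inter> W0) (restr L U (U \<inter> W0) s) = restr_fun (U \<inter> W0) (T P U s)"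
    by (rule trivD(4)[OF TP U(1,2) o(1) _ s]) simp
  moreover have "T P (U \<inter> W0) (restr L U (U \<inter> W0) s) = (\<lambda>p. rho U s p * gd P p)"
    using transition[OF P o(1) sub restr_sect[OF U(1) o(1) _ s]] by (simp add: rho_def)
  ultimately have e: "restr_fun (U \<inter> W0) (T P U s) = (\<lambda>p. rho U s p * gd P p)" by simp
  show ?thesis using restr_ev[OF o, of "T P U s"]
    by eventually_elim (use fun_cong[OF e] in \<open>simp add: mult.commute\<close>)
qed

lemma rho_sec:
  assumes U: "openin (zar X) U" and s: "s \<in> sect U" and P: "P \<in> U"
  shows "rho U s \<in> sec gd P"
proof -
  have PX: "P \<in> X" using openin_sub[OF U] P by auto
  note WP = W[OF PX]
  define V where "V = U \<inter> W P"
  have V: "openin (zar X) V" "P \<in> V" "V \<subseteq> U" "V \<subseteq> W P" using U WP P by (auto simp: V_def)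
  have r: "restr L U V s \<in> sect V" by (rule restr_sect[OF U V(1,3) s])
  have o: "openin (zar X) (U \<inter> W0)" "U \<inter> W0 \<noteq> {}" using U W0 open_meet[of U W0] P by auto
  have "rho U s \<in> rat" by (rule ratI[OF o rho_regular[OF U s]]) simp
  moreover have "(\<lambda>p. gd P p * rho U s p) \<in> reg P"
  proof (rule regI[OF V(1,2) triv_regular[OF conjunct2[OF conjunct2[OF WP]] V(1,4) r]])
    have "V \<noteq> {}" using V by auto
    show "\<forall>\<^sub>F p in gen. gd P p * rho U s p = T P V (restr L U V s) p"
      using rho_local[OF V(1,4) \<open>V \<noteq> {}\<close> PX r] rho_restr_ev[OF U V(1,3) \<open>V \<noteq> {}\<close> s]
      by eventually_elim simp
  qed
  ultimately show ?thesis by (simp add: sec_def)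
qed

text \<open>Near each point the trivialization is injective and regular functions are determined
  generically; the uniqueness in the gluing axiom extends the equality to all of
  \<open>U\<close>.\<close>

lemma rho_inj:
  assumes U: "openin (zar X) U" and s: "s \<in> sect U" "s' \<in> sect U"
    and ev: "U \<noteq> {} \<Longrightarrow> \<forall>\<^sub>F p in gen. rho U s p = rho U s' p"
  shows "s = s'"
proof -
  define \<U> where "\<U> = (\<lambda>P. U \<inter> W P) ` U"
  have WU: "openin (zar X) (W P)" "P \<in> W P" "triv L (W P) (T P)" "P \<in> X" if "P \<in> U" for P
    using W[of P] openin_sub[OF U] that by auto
  have Un: "\<Union>\<U> = U" using WU by (auto simp: \<U>_def)
  have V: "openin (zar X) V" "V \<subseteq> U" if "V \<in> \<U>" for V using that WU U by (auto simp: \<U>_def)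
  have eq: "restr L U V s = restr L U V s'" if "V \<in> \<U>" for V
  proof -
    obtain P where P: "P \<in> U" "V = U \<inter> W P" using \<open>V \<in> \<U>\<close> by (auto simp: \<U>_def)
    have ne: "V \<noteq> {}" "U \<noteq> {}" "V \<subseteq> W P" using P WU by auto
    note r = restr_sect[OF U V[OF that]]
    have "T P V (restr L U V s) = T P V (restr L U V s')"
    proof (rule regular_identity[OF V(1)[OF that]])
      show "\<forall>\<^sub>F p in gen. T P V (restr L U V s) p = T P V (restr L U V s') p"
        using rho_local[OF V(1)[OF that] ne(3,1) WU(4)[OF P(1)] r[OF s(1)]] rho_restr_ev[OF U V[OF that] ne(1) s(1)]
          rho_local[OF V(1)[OF that] ne(3,1) WU(4)[OF P(1)] r[OF s(2)]] rho_restr_ev[OF U V[OF that] ne(1) s(2)] ev[OF ne(2)]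
        by eventually_elim simp
    qed (rule triv_regular[OF WU(3)[OF P(1)] V(1)[OF that] ne(3) r]; rule s)+
    then show ?thesis by (rule triv_inj[OF WU(3)[OF P(1)] V(1)[OF that] ne(3) r[OF s(1)] r[OF s(2)]])
  qed
  have "\<exists>!t. t \<in> sect (\<Union>\<U>) \<and> (\<forall>V\<in>\<U>. restr L (\<Union>\<U>) V t = restr L U V s)"
  proof (rule sheaf_glue)
    fix V V' assume VV: "V \<in> \<U>" "V' \<in> \<U>"
    have o: "openin (zar X) (V \<inter> V')" using V VV by auto
    show "restr L V (V \<inter> V') (restr L U V s) = restr L V' (V \<inter> V') (restr L U V' s)"
      using restr_restr[OF U V(1)[OF VV(1)] o _ V(2)[OF VV(1)] s(1)] restr_restr[OF U V(1)[OF VV(2)] o _ V(2)[OF VV(2)] s(1)]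
      by simp
  qed (use V restr_sect[OF U _ _ s(1)] in auto)
  then have ex1: "\<exists>!t. t \<in> sect U \<and> (\<forall>V\<in>\<U>. restr L U V t = restr L U V s)" unfolding Un .
  show ?thesis by (rule ex1E[OF ex1]) (metis s eq)
qed

text \<open>Locally \<open>gd P * u\<close> is regular and comes from a section; these local
  sections agree on overlaps by \<open>rho_inj\<close>, so they glue.\<close>

lemma rho_surj:
  assumes U: "openin (zar X) U" "U \<noteq> {}" and u: "\<And>P. P \<in> U \<Longrightarrow> u \<in> sec gd P"
  shows "\<exists>s\<in>sect U. \<forall>\<^sub>F p in gen. rho U s p = u p"
proof -
  have UX: "P \<in> X" if "P \<in> U" for P using openin_sub[OF U(1)] that by auto
  have "\<exists>V s. openin (zar X) V \<and> P \<in> V \<and> V \<subseteq> U \<and> s \<in> sect V \<and> (\<forall>\<^sub>F p in gen. rho V s p = u p)"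
    if P: "P \<in> U" for P
  proof -
    note WP = W[OF UX[OF P]]
    have "(\<lambda>p. gd P p * u p) \<in> reg P" using u[OF P] by (simp add: sec_def)
    from regD[OF this] obtain N v where N: "openin (zar X) N" "P \<in> N" "v \<in> regular X N"
      "\<forall>\<^sub>F p in gen. gd P p * u p = v p" by (elim exE conjE) (rule that)
    define V where "V = N \<inter> U \<inter> W P"
    have V: "openin (zar X) V" "P \<in> V" "V \<subseteq> U" "V \<subseteq> W P" "V \<subseteq> N" using N U WP P by (auto simp: V_def)
    have ne: "V \<noteq> {}" using V by auto
    obtain s where s: "s \<in> sect V" "T P V s = restr_fun V v"
      using triv_surj[OF conjunct2[OF conjunct2[OF WP]] V(1,4) regular_restr[OF N(3) V(5,1)]] by auto
    have "\<forall>\<^sub>F p in gen. rho V s p = u p"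
      using rho_local[OF V(1,4) ne UX[OF P] s(1)] N(4) restr_ev[OF V(1) ne, of v] gd_nonzero[OF UX[OF P]]
      by eventually_elim (simp add: s(2))
    then show ?thesis using V s by blast
  qed
  then have "\<forall>P\<in>U. \<exists>Vs. openin (zar X) (fst Vs) \<and> P \<in> fst Vs \<and> fst Vs \<subseteq> U \<and> snd Vs \<in> sect (fst Vs) \<and>
      (\<forall>\<^sub>F p in gen. rho (fst Vs) (snd Vs) p = u p)" by simp
  from bchoice[OF this] obtain Vs where Vs: "\<forall>P\<in>U. openin (zar X) (fst (Vs P)) \<and> P \<in> fst (Vs P) \<and>
      fst (Vs P) \<subseteq> U \<and> snd (Vs P) \<in> sect (fst (Vs P)) \<and> (\<forall>\<^sub>F p in gen. rho (fst (Vs P)) (snd (Vs P)) p = u p)"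
    by (rule exE)
  define \<U> where "\<U> = (\<lambda>P. fst (Vs P)) ` U"
  \<comment> \<open>The gluing axiom takes sections indexed by open sets, so one point is selected
    for each member of the cover.\<close>
  define s where "s = (\<lambda>V. snd (Vs (inv_into U (\<lambda>P. fst (Vs P)) V)))"
  have V: "openin (zar X) V" "V \<subseteq> U" "V \<noteq> {}" "s V \<in> sect V" "\<forall>\<^sub>F p in gen. rho V (s V) p = u p" if "V \<in> \<U>" for V
  proof -
    define P where "P = inv_into U (\<lambda>P. fst (Vs P)) V"
    have P: "P \<in> U" "fst (Vs P) = V"
      using inv_into_into[OF that[unfolded \<U>_def]] f_inv_into_f[OF that[unfolded \<U>_def]] by (simp_all add: P_def)
    show "openin (zar X) V" "V \<subseteq> U" "V \<noteq> {}" "s V \<in> sect V" "\<forall>\<^sub>F p in gen. rho V (s V) p = u p"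
      using bspec[OF Vs P(1)] P(2) unfolding s_def P_def[symmetric] by auto
  qed
  have Un: "\<Union>\<U> = U" using Vs V(2) by (fastforce simp: \<U>_def)
  have "\<exists>!t. t \<in> sect (\<Union>\<U>) \<and> (\<forall>V\<in>\<U>. restr L (\<Union>\<U>) V t = s V)"
  proof (rule sheaf_glue)
    fix V V' assume VV: "V \<in> \<U>" "V' \<in> \<U>"
    have o: "openin (zar X) (V \<inter> V')" using V VV by auto
    show "restr L V (V \<inter> V') (s V) = restr L V' (V \<inter> V') (s V')"
    proof (rule rho_inj[OF o])
      assume ne: "V \<inter> V' \<noteq> {}"
      show "\<forall>\<^sub>F p in gen. rho (V \<inter> V') (restr L V (V \<inter> V') (s V)) p = rho (V \<inter> V') (restr L V' (V \<inter> V') (s V')) p"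
        using rho_restr_ev[OF V(1)[OF VV(1)] o _ ne V(4)[OF VV(1)]] rho_restr_ev[OF V(1)[OF VV(2)] o _ ne V(4)[OF VV(2)]]
          V(5)[OF VV(1)] V(5)[OF VV(2)] by (auto elim!: eventually_rev_mp)
    qed (rule restr_sect[OF V(1)[OF VV(1)] o _ V(4)[OF VV(1)]] restr_sect[OF V(1)[OF VV(2)] o _ V(4)[OF VV(2)]]; simp)+
  qed (use V in auto)
  then obtain t where t: "t \<in> sect U" "\<forall>V\<in>\<U>. restr L U V t = s V" unfolding Un by blast
  obtain V0 where V0: "V0 \<in> \<U>" using U(2) by (auto simp: \<U>_def)
  have "\<forall>\<^sub>F p in gen. rho U t p = u p"
    using rho_restr_ev[OF U(1) V(1-3)[OF V0] t(1)] V(5)[OF V0]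
    by eventually_elim (use t(2) V0 in simp)
  then show ?thesis using t(1) by blast
qed

lemma rho_add:
  assumes "openin (zar X) U" "s \<in> sect U" "s' \<in> sect U"
  shows "rho U (s \<oplus>\<^bsub>sections L U\<^esub> s') = (\<lambda>p. rho U s p + rho U s' p)"
proof -
  have o: "openin (zar X) (U \<inter> W0)" "U \<inter> W0 \<subseteq> U" "U \<inter> W0 \<subseteq> W0" using assms(1) W0 by auto
  show ?thesis unfolding rho_def restr_add[OF assms(1) o(1,2) assms(2,3)]
    by (rule trivD(2)[OF W0(3) o(1,3) restr_sect[OF assms(1) o(1,2) assms(2)] restr_sect[OF assms(1) o(1,2) assms(3)]])
qed

lemma rho_smult:
  assumes U: "openin (zar X) U" and a: "a \<in> regular X U" and s: "s \<in> sect U"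
  shows "rho U (a \<odot>\<^bsub>sections L U\<^esub> s) = (\<lambda>p. a p * rho U s p)"
proof -
  have o: "openin (zar X) (U \<inter> W0)" "U \<inter> W0 \<subseteq> U" "U \<inter> W0 \<subseteq> W0" using U W0 by auto
  have "rho U (a \<odot>\<^bsub>sections L U\<^esub> s) = (\<lambda>p. restr_fun (U \<inter> W0) a p * rho U s p)"
    unfolding rho_def restr_smult[OF U o(1,2) a s]
    by (rule trivD(3)[OF W0(3) o(1,3) regular_restr[OF a o(2,1)] restr_sect[OF U o(1,2) s]])
  also have "\<dots> = (\<lambda>p. a p * rho U s p)"
    using regular_zero_outside[OF rho_regular[OF U s]] by (auto simp: restr_fun_def fun_eq_iff)
  finally show ?thesis .
qed

end

lemma (in curve_setup) line_bundle_trivialized: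
  assumes "line_bundle X L"
  shows "\<exists>W T W0 T0. trivialized X f n g L W T W0 T0"
proof -
  have "\<forall>P\<in>X. \<exists>WT. openin (zar X) (fst WT) \<and> P \<in> fst WT \<and> triv L (fst WT) (snd WT)"
    using assms unfolding line_bundle_def triv_iff by force
  from bchoice[OF this] obtain WT where WT: "\<forall>P\<in>X. openin (zar X) (fst (WT P)) \<and> P \<in> fst (WT P) \<and> triv L (fst (WT P)) (snd (WT P))"
    by (rule exE)
  obtain P0 where P0: "P0 \<in> X" using X_nonempty by auto
  \<comment> \<open>All points of the reference open set share its trivialization. There
    \<open>gd\<close> is generically 1, which leaves only finitely many exceptional points.\<close>
  define WT' where "WT' = (\<lambda>P. if P \<in> fst (WT P0) then WT P0 else WT P)"
  have "trivialized X f n g L (\<lambda>P. fst (WT' P)) (\<lambda>P. snd (WT' P)) (fst (WT P0)) (snd (WT P0))"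
    using assms WT P0 by unfold_locales (auto simp: line_bundle_def WT'_def)
  then show ?thesis by blast
qed

section \<open>Sections of the twisting sheaves\<close>

lemma twisted_iff:
  "s \<in> twisted_sections Y d U \<longleftrightarrow> (\<forall>x. x \<notin> \<Union>U \<longrightarrow> s x = 0) \<and>
     (\<forall>p\<in>U. \<exists>V e e' g h. openin (zar Y) V \<and> p \<in> V \<and> V \<subseteq> U \<and> form e g \<and> form e' h \<and> int e - int e' = d \<and>
        (\<forall>x\<in>\<Union>V. h x \<noteq> 0 \<and> s x = g x / h x))"
proof -
  have "(\<exists>V e e' G H. openin (zar Y) V \<and> p \<in> V \<and> V \<subseteq> U \<and> homogeneous e G \<and> homogeneous e' H \<and> int e - int e' = d \<and>
        (\<forall>x\<in>\<Union>V. poly_eval H x \<noteq> 0 \<and> s x = poly_eval G x / poly_eval H x))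
      \<longleftrightarrow> (\<exists>V e e' g h. openin (zar Y) V \<and> p \<in> V \<and> V \<subseteq> U \<and> form e g \<and> form e' h \<and> int e - int e' = d \<and>
        (\<forall>x\<in>\<Union>V. h x \<noteq> 0 \<and> s x = g x / h x))" (is "?A \<longleftrightarrow> ?B") for p
  proof
    assume ?A then show ?B
      by (elim exE conjE) (intro exI conjI; (assumption | rule formI))
  next
    assume ?B
    then obtain V e e' g h where V: "openin (zar Y) V" "p \<in> V" "V \<subseteq> U" "form e g" "form e' h" "int e - int e' = d"
      "\<forall>x\<in>\<Union>V. h x \<noteq> 0 \<and> s x = g x / h x" by (elim exE conjE) (rule that)
    obtain F F' where "homogeneous e F" "g = poly_eval F" "homogeneous e' F'" "h = poly_eval F'"
      using V(4,5) by (auto simp: form_def)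
    with V show ?A by (intro exI[of _ V] exI[of _ e] exI[of _ e'] exI[of _ F] exI[of _ F'] conjI) auto
  qed
  then show ?thesis unfolding twisted_sections_def by simp
qed

lemma twistedI:
  assumes "\<And>x. x \<notin> \<Union>U \<Longrightarrow> s x = 0"
    and "\<And>p. p \<in> U \<Longrightarrow> \<exists>V e e' g h. openin (zar Y) V \<and> p \<in> V \<and> V \<subseteq> U \<and> form e g \<and> form e' h \<and> int e - int e' = d \<and>
        (\<forall>x\<in>\<Union>V. h x \<noteq> 0 \<and> s x = g x / h x)"
  shows "s \<in> twisted_sections Y d U"
  unfolding twisted_iff using assms by (intro conjI allI ballI impI)

lemma twistedD:
  assumes "s \<in> twisted_sections Y d U" "p \<in> U"
  shows "\<exists>V e e' g h. openin (zar Y) V \<and> p \<in> V \<and> V \<subseteq> U \<and> form e g \<and> form e' h \<and> int e - int e' = d \<and>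
        (\<forall>x\<in>\<Union>V. h x \<noteq> 0) \<and> (\<forall>x\<in>\<Union>V. s x = g x / h x)"
  using bspec[OF conjunct2[OF assms(1)[unfolded twisted_iff]] assms(2)] by (simp only: ball_conj_distrib)

lemma twisted_outside: "s \<in> twisted_sections Y d U \<Longrightarrow> x \<notin> \<Union>U \<Longrightarrow> s x = 0"
  unfolding twisted_iff by simp

lemma twisted_quotient:
  assumes "openin (zar Y) U" "form e g" "form e' h" "int e - int e' = d" "\<And>x. x \<in> \<Union>U \<Longrightarrow> h x \<noteq> 0"
  shows "restr_fun (\<Union>U) (\<lambda>x. g x / h x) \<in> twisted_sections Y d U"
proof (rule twistedI)
  fix p assume "p \<in> U"
  then show "\<exists>V e e' g' h'. openin (zar Y) V \<and> p \<in> V \<and> V \<subseteq> U \<and> form e g' \<and> form e' h' \<and> int e - int e' = d \<and>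
        (\<forall>x\<in>\<Union>V. h' x \<noteq> 0 \<and> restr_fun (\<Union>U) (\<lambda>x. g x / h x) x = g' x / h' x)"
    using assms by (intro exI[of _ U] exI[of _ e] exI[of _ e'] exI[of _ g] exI[of _ h]) (simp add: restr_fun_def)
qed (simp add: restr_fun_def)

lemma twisted_restr:
  assumes s: "s \<in> twisted_sections Y d U" and V: "openin (zar Y) V" "V \<subseteq> U"
  shows "restr_fun (\<Union>V) s \<in> twisted_sections Y d V"
proof (rule twistedI)
  fix p assume p: "p \<in> V"
  from twistedD[OF s subsetD[OF V(2) p]]
  obtain W e e' g h where W: "openin (zar Y) W" "p \<in> W" "W \<subseteq> U" "form e g" "form e' h" "int e - int e' = d"
    "\<forall>x\<in>\<Union>W. h x \<noteq> 0" "\<forall>x\<in>\<Union>W. s x = g x / h x" by (elim exE conjE) (rule that)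
  show "\<exists>W e e' g h. openin (zar Y) W \<and> p \<in> W \<and> W \<subseteq> V \<and> form e g \<and> form e' h \<and> int e - int e' = d \<and>
        (\<forall>x\<in>\<Union>W. h x \<noteq> 0 \<and> restr_fun (\<Union>V) s x = g x / h x)"
    by (rule exI[of _ "W \<inter> V"], rule exI[of _ e], rule exI[of _ e'], rule exI[of _ g], rule exI[of _ h])
      (use W V p in \<open>auto simp: restr_fun_def\<close>)
qed (simp add: restr_fun_def)

lemma twisted_combine:
  assumes s: "s \<in> twisted_sections Y d U" and s': "s' \<in> twisted_sections Y d' U"
    and z: "\<And>x. x \<notin> \<Union>U \<Longrightarrow> r x = 0"
    and comb: "\<And>e g e1 h e' g' e1' h'. form e g \<Longrightarrow> form e1 h \<Longrightarrow> form e' g' \<Longrightarrow> form e1' h' \<Longrightarrow>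
      int e - int e1 = d \<Longrightarrow> int e' - int e1' = d' \<Longrightarrow>
      \<exists>k k' G H. form k G \<and> form k' H \<and> int k - int k' = d'' \<and> (\<forall>x\<in>\<Union>U. h x \<noteq> 0 \<longrightarrow> h' x \<noteq> 0 \<longrightarrow>
         s x = g x / h x \<longrightarrow> s' x = g' x / h' x \<longrightarrow> H x \<noteq> 0 \<and> r x = G x / H x)"
  shows "r \<in> twisted_sections Y d'' U"
proof (rule twistedI[OF z])
  fix p assume p: "p \<in> U"
  from twistedD[OF s p]
  obtain W e e1 g h where W: "openin (zar Y) W" "p \<in> W" "W \<subseteq> U" "form e g" "form e1 h" "int e - int e1 = d"
    "\<forall>x\<in>\<Union>W. h x \<noteq> 0" "\<forall>x\<in>\<Union>W. s x = g x / h x" by (elim exE conjE) (rule that)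
  from twistedD[OF s' p]
  obtain W' e' e1' g' h' where W': "openin (zar Y) W'" "p \<in> W'" "W' \<subseteq> U" "form e' g'" "form e1' h'" "int e' - int e1' = d'"
    "\<forall>x\<in>\<Union>W'. h' x \<noteq> 0" "\<forall>x\<in>\<Union>W'. s' x = g' x / h' x" by (elim exE conjE) (rule that)
  from comb[OF W(4,5) W'(4,5) W(6) W'(6)] obtain k k' G H where G: "form k G" "form k' H" "int k - int k' = d''"
    "\<forall>x\<in>\<Union>U. h x \<noteq> 0 \<longrightarrow> h' x \<noteq> 0 \<longrightarrow> s x = g x / h x \<longrightarrow> s' x = g' x / h' x \<longrightarrow> H x \<noteq> 0 \<and> r x = G x / H x"
    by (elim exE conjE) (rule that)
  have "H x \<noteq> 0 \<and> r x = G x / H x" if "x \<in> \<Union>(W \<inter> W')" for x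
  proof -
    have x: "x \<in> \<Union>W" "x \<in> \<Union>W'" "x \<in> \<Union>U" using that W(3) by auto
    show ?thesis using bspec[OF G(4) x(3)] bspec[OF W(7) x(1)] bspec[OF W(8) x(1)] bspec[OF W'(7) x(2)] bspec[OF W'(8) x(2)] by blast
  qed
  then show "\<exists>V e e' g h. openin (zar Y) V \<and> p \<in> V \<and> V \<subseteq> U \<and> form e g \<and> form e' h \<and> int e - int e' = d'' \<and>
        (\<forall>x\<in>\<Union>V. h x \<noteq> 0 \<and> r x = g x / h x)"
    by (intro exI[of _ "W \<inter> W'"] exI[of _ k] exI[of _ k'] exI[of _ G] exI[of _ H] conjI ballI
        openin_Int W(1) W'(1) IntI W(2) W'(2) G(1-3) le_infI1[OF W(3)]) blast+
qed

lemma twisted_add: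
  fixes s s' :: "('m::finite \<Rightarrow> 'k::field) \<Rightarrow> 'k"
  assumes "s \<in> twisted_sections Y d U" "s' \<in> twisted_sections Y d U"
  shows "(\<lambda>x. s x + s' x) \<in> twisted_sections Y d U"
proof (rule twisted_combine[OF assms])
  fix e e1 e' e1' and g h g' h' :: "('m \<Rightarrow> 'k) \<Rightarrow> 'k"
  assume f: "form e g" "form e1 h" "form e' g'" "form e1' h'" "int e - int e1 = d" "int e' - int e1' = d"
  have "e1 + e' = e + e1'" using f by linarith
  then have "form (e + e1') (\<lambda>x. g x * h' x + h x * g' x)"
    using form_add[OF form_mult[OF f(1,4)]] form_mult[OF f(2,3)] by simp
  then show "\<exists>k k' G H. form k G \<and> form k' H \<and> int k - int k' = d \<and> (\<forall>x\<in>\<Union>U. h x \<noteq> 0 \<longrightarrow> h' x \<noteq> 0 \<longrightarrow>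
         s x = g x / h x \<longrightarrow> s' x = g' x / h' x \<longrightarrow> H x \<noteq> 0 \<and> s x + s' x = G x / H x)"
    by (intro exI[of _ "e + e1'"] exI[of _ "e1 + e1'"] exI[of _ "\<lambda>x. g x * h' x + h x * g' x"]
        exI[of _ "\<lambda>x. h x * h' x"] conjI form_mult[OF f(2,4)]) (use f in \<open>auto simp: field_simps\<close>)
next
  fix x assume "x \<notin> \<Union>U"
  then show "s x + s' x = 0" using twisted_outside[OF assms(1)] twisted_outside[OF assms(2)] by simp
qed

text \<open>Zero has to be written as a quotient of the prescribed degree, so for negative
  \<open>d\<close> a power of a nonvanishing coordinate serves as denominator.\<close>

lemma twisted_zero:
  assumes U: "openin (zar proj_space) U"
  shows "(\<lambda>_. 0) \<in> twisted_sections proj_space d U"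
proof (rule twistedI)
  fix p assume p: "p \<in> U"
  then have pp: "p \<in> proj_space" "rep p \<in> p"
    using openin_subset[OF U] rep_mem by (auto simp: topspace_subtopology)
  obtain i where i: "rep p i \<noteq> 0" using proj_point_mem(1)[OF pp] by auto
  define V where "V = U \<inter> {p \<in> proj_space. \<forall>x\<in>p. x i \<noteq> 0}"
  have "openin (zar proj_space) V" unfolding V_def by (intro openin_Int U openin_form[OF form_coord]) simp
  moreover have "p \<in> V" using form_nonzero_iff[OF form_coord pp, of i] i p pp by (simp add: V_def)
  moreover have "form (nat (- d)) (\<lambda>x. x i ^ nat (- d))" using form_power[OF form_coord[of i], of "nat (- d)"] by simp
  ultimately show "\<exists>V e e' g h. openin (zar proj_space) V \<and> p \<in> V \<and> V \<subseteq> U \<and> form e g \<and> form e' h \<and> int e - int e' = d \<and>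
        (\<forall>x\<in>\<Union>V. h x \<noteq> 0 \<and> 0 = g x / h x)"
    by (intro exI[of _ V] exI[of _ "nat d"] exI[of _ "nat (- d)"] exI[of _ "\<lambda>_. 0"] exI[of _ "\<lambda>x. x i ^ nat (- d)"] conjI form_zero)
      (auto simp: V_def)
qed simp

text \<open>A regular function, viewed on the cone, is a twisted section of degree 0.\<close>

lemma twisted_smult:
  fixes s :: "('m::finite \<Rightarrow> 'k::field) \<Rightarrow> 'k"
  assumes U: "openin (zar Y) U" "Y \<subseteq> proj_space" and a: "a \<in> regular Y U" and s: "s \<in> twisted_sections Y d U"
  shows "(\<lambda>x. a (proj_point x) * s x) \<in> twisted_sections Y d U"
proof -
  have UP: "U \<subseteq> proj_space" using openin_subset[OF U(1)] U(2) by (auto simp: topspace_subtopology)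
  have "restr_fun (\<Union>U) (\<lambda>x. a (proj_point x)) \<in> twisted_sections Y 0 U"
  proof (rule twistedI)
    fix p assume p: "p \<in> U"
    from regularD[OF a p] obtain V e g h where V: "openin (zar Y) V" "p \<in> V" "V \<subseteq> U" "form e g" "form e h"
      "\<forall>q\<in>V. \<forall>x\<in>q. h x \<noteq> 0" "\<forall>q\<in>V. \<forall>x\<in>q. a q = g x / h x" by (elim exE conjE) (rule that)
    have "restr_fun (\<Union>U) (\<lambda>x. a (proj_point x)) x = g x / h x" if x: "x \<in> \<Union>V" for x
    proof -
      obtain q where q: "q \<in> V" "x \<in> q" using x by auto
      then have "q = proj_point x" using proj_point_mem(2)[of q x] UP V(3) by auto
      then show ?thesis using V(3,7) q by (auto simp: restr_fun_def)
    qed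
    then show "\<exists>V e e' g h. openin (zar Y) V \<and> p \<in> V \<and> V \<subseteq> U \<and> form e g \<and> form e' h \<and> int e - int e' = 0 \<and>
        (\<forall>x\<in>\<Union>V. h x \<noteq> 0 \<and> restr_fun (\<Union>U) (\<lambda>x. a (proj_point x)) x = g x / h x)"
      by (intro exI[of _ V] exI[of _ e] exI[of _ e] exI[of _ g] exI[of _ h]) (use V in auto)
  qed (simp add: restr_fun_def)
  from this s show ?thesis
  proof (rule twisted_combine)
    fix e e1 e' e1' and g h g' h' :: "('m \<Rightarrow> 'k) \<Rightarrow> 'k"
    assume f: "form e g" "form e1 h" "form e' g'" "form e1' h'" "int e - int e1 = 0" "int e' - int e1' = d"
    show "\<exists>k k' G H. form k G \<and> form k' H \<and> int k - int k' = d \<and> (\<forall>x\<in>\<Union>U. h x \<noteq> 0 \<longrightarrow> h' x \<noteq> 0 \<longrightarrow>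
         restr_fun (\<Union>U) (\<lambda>x. a (proj_point x)) x = g x / h x \<longrightarrow> s x = g' x / h' x \<longrightarrow> H x \<noteq> 0 \<and>
         a (proj_point x) * s x = G x / H x)"
      by (intro exI[of _ "e + e'"] exI[of _ "e1 + e1'"] exI[of _ "\<lambda>x. g x * g' x"]
        exI[of _ "\<lambda>x. h x * h' x"] conjI form_mult f) (use f in \<open>auto simp: restr_fun_def\<close>)
  next
    fix x assume "x \<notin> \<Union>U" then show "a (proj_point x) * s x = 0" using twisted_outside[OF s, of x] by simp
  qed
qed

text \<open>Homogeneity extends the zeros to all vectors with \<open>x 0 \<noteq> 0\<close>. On the
  other affine chart the form is a polynomial vanishing at all nonzero arguments, hence zero, which
  covers the point at infinity.\<close>

lemma form2_zero:
  assumes \<phi>: "form e (\<phi> :: (2 \<Rightarrow> 'k::alg_closed_field) \<Rightarrow> 'k)" and z: "\<And>c. \<phi> (vec2 1 c) = 0"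
  shows "\<phi> x = 0"
proof -
  have nz: "\<phi> (vec2 a b) = 0" if "a \<noteq> 0" for a b
    using form_scale[OF \<phi>, of a "vec2 1 (b / a)"] z[of "b / a"] that by (simp add: vec2_scale)
  obtain Q where Q: "\<And>c. \<phi> (vec2 c 1) = poly Q c" using form_dehom(2)[OF \<phi>] by blast
  have "Q = 0"
  proof (rule ccontr)
    assume "Q \<noteq> 0"
    \<comment> \<open>The linear factor forces the nonroot to be nonzero; nothing is known yet about
      the value at 0.\<close>
    then have "[:0, 1:] * Q \<noteq> 0" by simp
    then obtain c where "poly ([:0, 1:] * Q) c \<noteq> 0" using poly_nonroot by blast
    then show False using nz[of c 1] Q[of c] by auto
  qed
  then have 0: "\<phi> (vec2 0 1) = 0" using Q[of 0] by simp
  show ?thesis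
  proof (cases "x 0 = 0")
    case True
    then have "x = (\<lambda>i. x 1 * vec2 0 1 i)" using vec2_eta[of x] by (simp add: vec2_scale)
    then show ?thesis using form_scale[OF \<phi>, of "x 1" "vec2 0 1"] 0 by simp
  next
    case False then show ?thesis using nz[of "x 0" "x 1"] vec2_eta[of x] by simp
  qed
qed

section \<open>From a basis to a splitting\<close>

context trivialized
begin

abbreviation "pull V \<equiv> X \<inter> f -` V"

definition split_sections :: "(nat \<Rightarrow> int) \<Rightarrow> (2, 'k) pt set \<Rightarrow> (nat \<Rightarrow> (2 \<Rightarrow> 'k) \<Rightarrow> 'k) set" where
  "split_sections d V = (\<Pi>\<^sub>E j\<in>{..<n}. twisted_sections proj_line (d j) V)"

lemma f_affine: "p \<in> X - inf_fibre \<Longrightarrow> f p = proj_point (vec2 1 (t p))"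
  using proj_point_mem(2)[OF f_mem affine_mem] by auto

lemma f_inf: "p \<in> inf_fibre \<Longrightarrow> f p = proj_point (vec2 0 1)"
  using proj_point_mem(2)[OF f_mem infinite_mem] I_X by auto

lemma pull_nonempty: "openin (zar proj_line) V \<Longrightarrow> V \<noteq> {} \<Longrightarrow> pull V \<noteq> {}"
  using f_surj openin_subset[of "zar proj_line" V] by (fastforce simp: topspace_subtopology)

lemma ev_pull: "openin (zar proj_line) V \<Longrightarrow> V \<noteq> {} \<Longrightarrow> \<forall>\<^sub>F p in gen. p \<in> pull V - inf_fibre \<and> vec2 1 (t p) \<in> \<Union>V"
proof -
  assume V: "openin (zar proj_line) V" "V \<noteq> {}"
  show ?thesis
    using eventually_open[OF open_preimage[OF V(1)] pull_nonempty[OF V]] ev_finite_part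
    by eventually_elim (use affine_mem in auto)
qed

text \<open>Evaluated at \<open>vec2 1 (t p)\<close>, a section of O(d) becomes a quotient of
  polynomials in \<open>t\<close>. Near infinity the representative is
  \<open>vec2 (inverse (t p)) 1\<close> instead, and homogeneity turns this rescaling into the
  factor \<open>t powi (- d)\<close>.\<close>

lemma twisted_local:
  assumes \<tau>: "\<tau> \<in> twisted_sections proj_line d V" and V: "openin (zar proj_line) V" and P: "P \<in> pull V"
  shows "P \<notin> inf_fibre \<Longrightarrow> (\<lambda>p. \<tau> (vec2 1 (t p))) \<in> reg P"
    and "P \<in> inf_fibre \<Longrightarrow> (\<lambda>p. t p powi (- d) * \<tau> (vec2 1 (t p))) \<in> reg P"
proof -
  have "f P \<in> V" using P by simp
  from twistedD[OF \<tau> this]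
  obtain W e e' g h where W: "openin (zar proj_line) W" "f P \<in> W" "W \<subseteq> V" "form e g" "form e' h" "int e - int e' = d"
    "\<forall>x\<in>\<Union>W. h x \<noteq> 0" "\<forall>x\<in>\<Union>W. \<tau> x = g x / h x" by (elim exE conjE) (rule that)
  have PX: "P \<in> X" using P by auto
  have ev: "\<forall>\<^sub>F p in gen. vec2 1 (t p) \<in> \<Union>W \<and> t p \<noteq> 0"
  proof -
    have "W \<noteq> {}" using W(2) by auto
    from ev_pull[OF W(1) this] t_neq[of 0] show ?thesis by eventually_elim (intro conjI; elim conjE; assumption)
  qed
  show "(\<lambda>p. \<tau> (vec2 1 (t p))) \<in> reg P" if P: "P \<notin> inf_fibre"
  proof -
    obtain A where A: "\<And>c. g (vec2 1 c) = poly A c" using form_dehom(1)[OF W(4)] by blast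
    obtain B where B: "\<And>c. h (vec2 1 c) = poly B c" using form_dehom(1)[OF W(5)] by blast
    have hv: "has_val t P (t P)" by (rule has_val_t) (use P PX in auto)
    have "poly B (t P) \<noteq> 0" using W(2,7) affine_mem[of P] P PX by (auto simp flip: B)
    then have "(\<lambda>p. poly A (t p) * inverse (poly B (t p))) \<in> reg P"
      using PX P by (intro reg_mult reg_poly t_reg has_val_inverse[OF has_val_poly[OF PX hv]]) auto
    moreover have "\<forall>\<^sub>F p in gen. poly A (t p) * inverse (poly B (t p)) = \<tau> (vec2 1 (t p))"
      using ev
    proof eventually_elim
      case (elim p)
      show ?case unfolding bspec[OF W(8) conjunct1[OF elim]] by (simp add: A B divide_inverse)
    qed
    ultimately show ?thesis by (rule reg_cong)
  qed
  show "(\<lambda>p. t p powi (- d) * \<tau> (vec2 1 (t p))) \<in> reg P" if P: "P \<in> inf_fibre"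
  proof -
    obtain A where A: "\<And>c. g (vec2 c 1) = poly A c" using form_dehom(2)[OF W(4)] by blast
    obtain B where B: "\<And>c. h (vec2 c 1) = poly B c" using form_dehom(2)[OF W(5)] by blast
    have "poly B 0 \<noteq> 0" using W(2,7) infinite_mem[OF P] by (auto simp flip: B)
    then have "(\<lambda>p. poly A (inverse (t p)) * inverse (poly B (inverse (t p)))) \<in> reg P"
      by (intro reg_mult reg_poly[OF PX] t_inverse_reg_inf[OF P] has_val_inverse[OF has_val_poly[OF PX has_val_t_inf[OF P]]])
    moreover have "\<forall>\<^sub>F p in gen. poly A (inverse (t p)) * inverse (poly B (inverse (t p))) = t p powi (- d) * \<tau> (vec2 1 (t p))"
      using ev
    proof eventually_elim
      case (elim p)
      have v: "vec2 1 (t p) = (\<lambda>i. t p * vec2 (inverse (t p)) 1 i)" using elim by (simp add: vec2_scale)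
      have "\<tau> (vec2 1 (t p)) = t p ^ e * poly A (inverse (t p)) / (t p ^ e' * poly B (inverse (t p)))"
        unfolding bspec[OF W(8) conjunct1[OF elim]] unfolding v form_scale[OF W(4)] form_scale[OF W(5)] A B ..
      moreover have "t p powi (- d) = t p ^ e' / t p ^ e"
        using elim power_int_diff[of "t p" "int e'" "int e"] by (simp flip: W(6))
      moreover have "a * inverse c = y / z * (z * a / (y * c))" if "y \<noteq> 0" "z \<noteq> 0" for a c y z :: 'k
        using that by (cases "c = 0") (simp_all add: field_simps)
      ultimately show ?case using conjunct2[OF elim] by simp
    qed
    ultimately show ?thesis by (rule reg_cong)
  qed
qed

lemma combination_sec:
  assumes sb: "sbasis gd b d" and V: "openin (zar proj_line) V" and \<tau>: "\<tau> \<in> split_sections d V" and P: "P \<in> pull V"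
  shows "(\<lambda>p. \<Sum>j<n. \<tau> j (vec2 1 (t p)) * b j p) \<in> sec gd P"
proof (rule sec_sum)
  show PX: "P \<in> X" using P by auto
  fix j assume "j \<in> {..<n}"
  then have j: "j < n" and \<tau>j: "\<tau> j \<in> twisted_sections proj_line (d j) V" using \<tau> by (auto simp: split_sections_def)
  show "(\<lambda>p. \<tau> j (vec2 1 (t p)) * b j p) \<in> sec gd P"
  proof (cases "P \<in> inf_fibre")
    case False
    then show ?thesis using PX j by (intro sec_smult twisted_local[OF \<tau>j V P] sbasis_sec(2)[OF sb]) auto
  next
    case True
    have "(\<lambda>p. (t p powi (- d j) * \<tau> j (vec2 1 (t p))) * (t p powi d j * b j p)) \<in> sec gd P"
      by (intro sec_smult PX twisted_local(2)[OF \<tau>j V P True] sbasis_sec(3)[OF sb j True])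
    moreover have "\<forall>\<^sub>F p in gen. (t p powi (- d j) * \<tau> j (vec2 1 (t p))) * (t p powi d j * b j p) = \<tau> j (vec2 1 (t p)) * b j p"
      using t_neq_0 by eventually_elim (simp add: power_int_minus field_simps)
    ultimately show ?thesis by (rule sec_cong)
  qed
qed

definition related :: "(nat \<Rightarrow> ('n, 'k) pt \<Rightarrow> 'k) \<Rightarrow> (2, 'k) pt set \<Rightarrow> 's \<Rightarrow> (nat \<Rightarrow> (2 \<Rightarrow> 'k) \<Rightarrow> 'k) \<Rightarrow> bool" where
  "related b V s \<tau> \<longleftrightarrow> V = {} \<or> (\<forall>\<^sub>F p in gen. rho (pull V) s p = (\<Sum>j<n. \<tau> j (vec2 1 (t p)) * b j p))"

lemma sect_empty: "\<exists>s. s \<in> sect {}"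
  using sheaf_glue[of "{}"] by auto

lemma related_surj:
  assumes sb: "sbasis gd b d" and V: "openin (zar proj_line) V" and \<tau>: "\<tau> \<in> split_sections d V"
  shows "\<exists>s\<in>sect (pull V). related b V s \<tau>"
proof (cases "V = {}")
  case True then show ?thesis using sect_empty by (auto simp: related_def)
next
  case False
  from rho_surj[OF open_preimage[OF V] pull_nonempty[OF V False] combination_sec[OF sb V \<tau>]]
  show ?thesis by (auto simp: related_def)
qed

lemma related_inj_left:
  assumes V: "openin (zar proj_line) V" and s: "s \<in> sect (pull V)" "s' \<in> sect (pull V)" "related b V s \<tau>" "related b V s' \<tau>"
  shows "s = s'"
proof (rule rho_inj[OF open_preimage[OF V] s(1,2)])
  assume "pull V \<noteq> {}"
  then have "V \<noteq> {}" by auto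
  then have "\<forall>\<^sub>F p in gen. rho (pull V) s p = (\<Sum>j<n. \<tau> j (vec2 1 (t p)) * b j p)"
    "\<forall>\<^sub>F p in gen. rho (pull V) s' p = (\<Sum>j<n. \<tau> j (vec2 1 (t p)) * b j p)" using s by (auto simp: related_def)
  then show "\<forall>\<^sub>F p in gen. rho (pull V) s p = rho (pull V) s' p" by eventually_elim simp
qed

lemma split_sections_empty: "\<tau> \<in> split_sections d {} \<Longrightarrow> \<tau> = (\<lambda>j\<in>{..<n}. \<lambda>_. 0)"
  by (rule PiE_ext[of _ "{..<n}" "\<lambda>_. UNIV"])
    (auto simp: split_sections_def PiE_def fun_eq_iff intro: twisted_outside)

end

section \<open>Existence and uniqueness of coordinates, and the isomorphism with the direct
  sum\<close>

context trivialized
begin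

lemma point_cases:
  assumes V: "openin (zar proj_line) V" and x: "x \<in> \<Union>V"
  shows "x 0 \<noteq> 0 \<Longrightarrow> proj_point (vec2 1 (x 1 / x 0)) \<in> V"
    and "x 0 = 0 \<Longrightarrow> proj_point (vec2 0 1) \<in> V \<and> x 1 \<noteq> 0"
proof -
  obtain z where z: "z \<in> V" "x \<in> z" using x by auto
  have zP: "z \<in> proj_space" using openin_subset[OF V] z by (auto simp: topspace_subtopology)
  have scale: "(\<lambda>i. c * x i) \<in> z" if "c \<noteq> 0" for c
    using proj_point_mem(2)[OF zP z(2)] that by (auto simp: proj_point_def)
  show "proj_point (vec2 1 (x 1 / x 0)) \<in> V" if "x 0 \<noteq> 0"
  proof -
    have "vec2 1 (x 1 / x 0) = (\<lambda>i. inverse (x 0) * x i)"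
      using vec2_scale[of "inverse (x 0)" "x 0" "x 1"] vec2_eta[of x] that by (simp add: divide_inverse mult.commute)
    then have "vec2 1 (x 1 / x 0) \<in> z" using scale[of "inverse (x 0)"] that by simp
    then show ?thesis using proj_point_mem(2)[OF zP] z(1) by blast
  qed
  show "proj_point (vec2 0 1) \<in> V \<and> x 1 \<noteq> 0" if "x 0 = 0"
  proof -
    have x1: "x 1 \<noteq> 0" using proj_point_mem(1)[OF zP z(2)] vec2_eta[of x] vec2_zero_iff[of "x 0" "x 1"] that by metis
    have "vec2 0 1 = (\<lambda>i. inverse (x 1) * x i)"
      using vec2_scale[of "inverse (x 1)" "x 0" "x 1"] vec2_eta[of x] that x1 by simp
    then have "vec2 0 1 \<in> z" using scale[of "inverse (x 1)"] x1 by simp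
    then have "proj_point (vec2 0 1) \<in> V" using proj_point_mem(2)[OF zP] z(1) by blast
    then show ?thesis using x1 by simp
  qed
qed

text \<open>The coordinates \<open>r j / q\<close> from \<open>sbasis_generates\<close> are
  homogenized, \<open>q\<close> to degree \<open>E\<close> and \<open>r j\<close> to degree
  \<open>E + d j\<close>. Since the section is defined over all of \<open>V\<close>, the homogenized
  denominator has no zero there, and the quotient is a section of O(d j).\<close>

lemma related_exists:
  assumes sb: "sbasis gd b d" and V: "openin (zar proj_line) V" and s: "s \<in> sect (pull V)"
  shows "\<exists>\<tau>\<in>split_sections d V. related b V s \<tau>"
proof (cases "V = {}")
  case True
  have "(\<lambda>j\<in>{..<n}. \<lambda>_. 0) \<in> split_sections d V" using twisted_zero[OF V] by (auto simp: split_sections_def)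
  then show ?thesis using True by (auto simp: related_def)
next
  case False
  define u where "u = rho (pull V) s"
  have usec: "u \<in> sec gd P" if "P \<in> pull V" for P
    unfolding u_def by (rule rho_sec[OF open_preimage[OF V] s that])
  have uK: "u \<in> rat" using pull_nonempty[OF V False] usec sec_K by blast
  from sbasis_generates[OF sb uK]
  obtain q r where q: "q \<noteq> 0" "\<forall>\<^sub>F p in gen. poly q (t p) * u p = (\<Sum>j<n. poly (r j) (t p) * b j p)"
    "\<forall>c. (\<forall>P\<in>X - inf_fibre. t P = c \<longrightarrow> u \<in> sec gd P) \<longrightarrow> poly q c \<noteq> 0"
    "\<forall>e. (\<forall>P\<in>inf_fibre. (\<lambda>p. t p powi (- e) * u p) \<in> sec gd P) \<longrightarrow>
       (\<forall>j<n. r j \<noteq> 0 \<longrightarrow> int (Polynomial.degree (r j)) \<le> int (Polynomial.degree q) + d j + e)"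
    by (elim exE conjE) (rule that)
  \<comment> \<open>If infinity lies in \<open>V\<close>, the denominator must not vanish there, so
    its degree is exactly that of \<open>q\<close>. Otherwise \<open>E\<close> is enlarged until
    every \<open>E + d j\<close> bounds the degree of \<open>r j\<close>.\<close>
  define E where "E = Polynomial.degree q +
    (if proj_point (vec2 0 1) \<in> V then 0 else \<Sum>j<n. nat (int (Polynomial.degree (r j)) - d j))"
  have deg: "int (Polynomial.degree (r j)) \<le> int E + d j" if j: "j < n" "r j \<noteq> 0" for j
  proof (cases "proj_point (vec2 0 1) \<in> V")
    case True
    have "\<forall>P\<in>inf_fibre. (\<lambda>p. t p powi (- 0) * u p) \<in> sec gd P"
    proof
      fix P assume P: "P \<in> inf_fibre"
      then have "P \<in> pull V" using f_inf[OF P] True I_X by auto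
      from usec[OF this] show "(\<lambda>p. t p powi (- 0) * u p) \<in> sec gd P" by simp
    qed
    note q4 = mp[OF spec[OF q(4)] this]
    have "int (Polynomial.degree (r j)) \<le> int (Polynomial.degree q) + d j + 0"
      by (rule mp[OF mp[OF spec[OF q4] j(1)] j(2)])
    then show ?thesis using True by (simp add: E_def)
  next
    case False
    have "nat (int (Polynomial.degree (r j)) - d j) \<le> (\<Sum>j<n. nat (int (Polynomial.degree (r j)) - d j))"
      using j by (intro member_le_sum) auto
    then have "nat (int (Polynomial.degree (r j)) - d j) \<le> E" using False by (simp add: E_def)
    then show ?thesis by linarith
  qed
  define H where "H = homogenize E q"
  have qE: "Polynomial.degree q \<le> E" by (simp add: E_def)
  have H: "form E H" unfolding H_def by (rule form_homogenize)
  have Hnz: "H x \<noteq> 0" if x: "x \<in> \<Union>V" for x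
  proof (cases "x 0 = 0")
    case True
    note pc = point_cases(2)[OF V x True]
    have "x = (\<lambda>i. x 1 * vec2 0 1 i)" using vec2_eta[of x] True by (simp add: vec2_scale)
    then have "H x = x 1 ^ E * coeff q E"
      using form_scale[OF H, of "x 1" "vec2 0 1"] by (simp add: H_def homogenize_infinity)
    moreover have "E = Polynomial.degree q" using pc by (simp add: E_def)
    ultimately show ?thesis using pc q(1) by simp
  next
    case False
    define c where "c = x 1 / x 0"
    have cV: "proj_point (vec2 1 c) \<in> V" unfolding c_def by (rule point_cases(1)[OF V x False])
    have "\<forall>P\<in>X - inf_fibre. t P = c \<longrightarrow> u \<in> sec gd P"
    proof (intro ballI impI usec)
      fix P assume P: "P \<in> X - inf_fibre" "t P = c"
      then show "P \<in> pull V" using f_affine[OF P(1)] cV by simp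
    qed
    from mp[OF spec[OF q(3)] this] have qc: "poly q c \<noteq> 0" .
    have "x = (\<lambda>i. x 0 * vec2 1 c i)" using vec2_eta[of x] False by (simp add: vec2_scale c_def)
    then have "H x = x 0 ^ E * poly q c"
      using form_scale[OF H, of "x 0" "vec2 1 c"] homogenize_affine[OF qE] by (simp add: H_def)
    then show ?thesis using qc False by simp
  qed
  define \<tau> where "\<tau> = (\<lambda>j\<in>{..<n}. if r j = 0 then (\<lambda>_. 0)
     else restr_fun (\<Union>V) (\<lambda>x. homogenize (nat (int E + d j)) (r j) x / H x))"
  have "\<tau> \<in> split_sections d V"
    unfolding split_sections_def
  proof (rule PiE_I)
    fix j assume j: "j \<in> {..<n}"
    show "\<tau> j \<in> twisted_sections proj_line (d j) V"
    proof (cases "r j = 0")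
      case True then show ?thesis using j twisted_zero[OF V] by (simp add: \<tau>_def)
    next
      case False
      have "0 \<le> int E + d j" using deg[of j] j False by auto
      then have "restr_fun (\<Union>V) (\<lambda>x. homogenize (nat (int E + d j)) (r j) x / H x) \<in> twisted_sections proj_line (d j) V"
        by (intro twisted_quotient[OF V form_homogenize H _ Hnz]) auto
      then show ?thesis using j False by (simp add: \<tau>_def)
    qed
  qed (simp add: \<tau>_def)
  moreover have "\<forall>\<^sub>F p in gen. u p = (\<Sum>j<n. \<tau> j (vec2 1 (t p)) * b j p)"
    using ev_pull[OF V False] q(2) poly_t_neq_0[OF q(1)]
  proof eventually_elim
    case (elim p)
    have "\<tau> j (vec2 1 (t p)) = poly (r j) (t p) / poly q (t p)" if "j < n" for j
      using that elim(1) homogenize_affine[OF qE] homogenize_affine[of "r j" "nat (int E + d j)"] deg[OF that]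
      by (auto simp: \<tau>_def restr_fun_def H_def)
    then have "(\<Sum>j<n. \<tau> j (vec2 1 (t p)) * b j p) = (\<Sum>j<n. poly (r j) (t p) * b j p) / poly q (t p)"
      unfolding sum_divide_distrib by (intro sum.cong) auto
    then show ?case unfolding elim(2)[symmetric] using elim(3) by simp
  qed
  ultimately show ?thesis by (auto simp: related_def u_def)
qed

lemma twisted_ratio:
  assumes \<tau>: "\<tau> \<in> twisted_sections proj_line d V" and z: "z \<in> V"
  shows "\<exists>e e' g h A B. form e g \<and> form e' h \<and> int e - int e' = d \<and> (\<forall>c. g (vec2 1 c) = poly A c) \<and>
    (\<forall>c. h (vec2 1 c) = poly B c) \<and> B \<noteq> 0 \<and> (\<forall>x\<in>z. h x \<noteq> 0 \<and> \<tau> x = g x / h x) \<and>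
    (\<forall>\<^sub>F p in gen. \<tau> (vec2 1 (t p)) = ratio A B p)"
proof -
  from twistedD[OF \<tau> z]
  obtain W e e' g h where W: "openin (zar proj_line) W" "z \<in> W" "W \<subseteq> V" "form e g" "form e' h" "int e - int e' = d"
    "\<forall>x\<in>\<Union>W. h x \<noteq> 0" "\<forall>x\<in>\<Union>W. \<tau> x = g x / h x" by (elim exE conjE) (rule that)
  obtain A where A: "\<forall>c. g (vec2 1 c) = poly A c" using form_dehom(1)[OF W(4)] by blast
  obtain B where B: "\<forall>c. h (vec2 1 c) = poly B c" using form_dehom(1)[OF W(5)] by blast
  have "W \<noteq> {}" using W(2) by auto
  note ev = ev_pull[OF W(1) this]
  have "B \<noteq> 0"
  proof
    assume "B = 0"
    have "\<forall>\<^sub>F p in gen. False" using ev by eventually_elim (use W(7) B \<open>B = 0\<close> in auto)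
    then show False using ev_False by simp
  qed
  moreover have "\<forall>\<^sub>F p in gen. \<tau> (vec2 1 (t p)) = ratio A B p"
    using ev by eventually_elim (use W(8) A B in \<open>auto simp: ratio_def\<close>)
  moreover have "\<forall>x\<in>z. h x \<noteq> 0 \<and> \<tau> x = g x / h x" using W(2,7,8) by auto
  ultimately show ?thesis using W(4-6) A B by (intro exI conjI)
qed

text \<open>Independence over k(t) makes the entries agree as rational functions of
  \<open>t\<close>. After cross multiplication the difference of the representing forms vanishes at
  every \<open>vec2 1 c\<close> and hence identically, which also settles the values over
  infinity.\<close>

lemma related_inj_right:
  assumes sb: "sbasis gd b d" and V: "openin (zar proj_line) V"
    and \<tau>: "\<tau> \<in> split_sections d V" "\<tau>' \<in> split_sections d V" "related b V s \<tau>" "related b V s \<tau>'"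
  shows "\<tau> = \<tau>'"
proof (cases "V = {}")
  case True then show ?thesis using \<tau>(1,2) split_sections_empty by blast
next
  case False
  have mem: "\<tau> j \<in> twisted_sections proj_line (d j) V" "\<tau>' j \<in> twisted_sections proj_line (d j) V" if "j < n" for j
    using \<tau> that by (auto simp: split_sections_def)
  have eq: "\<tau> j x = \<tau>' j x" if j: "j < n" and z: "z \<in> V" "x \<in> z" for j x z
  proof -
    \<comment> \<open>Representatives at \<open>z\<close> are needed for all entries at once,
      because independence concerns the whole family.\<close>
    have "\<forall>i. \<exists>g h A B g' h' A' B'. i < n \<longrightarrow>
       (\<exists>k. form k (\<lambda>x. g x * h' x) \<and> form k (\<lambda>x. g' x * h x)) \<and>
       (\<forall>c. g (vec2 1 c) = poly A c) \<and> (\<forall>c. h (vec2 1 c) = poly B c) \<and>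
       (\<forall>c. g' (vec2 1 c) = poly A' c) \<and> (\<forall>c. h' (vec2 1 c) = poly B' c) \<and> B \<noteq> 0 \<and> B' \<noteq> 0 \<and>
       (\<forall>x\<in>z. h x \<noteq> 0 \<and> \<tau> i x = g x / h x) \<and> (\<forall>x\<in>z. h' x \<noteq> 0 \<and> \<tau>' i x = g' x / h' x) \<and>
       (\<forall>\<^sub>F p in gen. \<tau> i (vec2 1 (t p)) = ratio A B p) \<and> (\<forall>\<^sub>F p in gen. \<tau>' i (vec2 1 (t p)) = ratio A' B' p)"
      (is "\<forall>i. \<exists>g h A B g' h' A' B'. i < n \<longrightarrow> ?P i g h A B g' h' A' B'")
    proof
      fix i show "\<exists>g h A B g' h' A' B'. i < n \<longrightarrow> ?P i g h A B g' h' A' B'"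
      proof (cases "i < n")
        case True
        from twisted_ratio[OF mem(1)[OF True] z(1)] obtain e e' g h A B where
          1: "form e g" "form e' h" "int e - int e' = d i" "\<forall>c. g (vec2 1 c) = poly A c" "\<forall>c. h (vec2 1 c) = poly B c"
          "B \<noteq> 0" "\<forall>x\<in>z. h x \<noteq> 0 \<and> \<tau> i x = g x / h x" "\<forall>\<^sub>F p in gen. \<tau> i (vec2 1 (t p)) = ratio A B p"
          by (elim exE conjE) (rule that)
        from twisted_ratio[OF mem(2)[OF True] z(1)] obtain e1 e1' g' h' A' B' where
          2: "form e1 g'" "form e1' h'" "int e1 - int e1' = d i" "\<forall>c. g' (vec2 1 c) = poly A' c" "\<forall>c. h' (vec2 1 c) = poly B' c"
          "B' \<noteq> 0" "\<forall>x\<in>z. h' x \<noteq> 0 \<and> \<tau>' i x = g' x / h' x" "\<forall>\<^sub>F p in gen. \<tau>' i (vec2 1 (t p)) = ratio A' B' p"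
          by (elim exE conjE) (rule that)
        have "e1 + e' = e + e1'" using 1(3) 2(3) by linarith
        then have "form (e + e1') (\<lambda>x. g' x * h x)" using form_mult[OF 2(1) 1(2)] by simp
        then have k: "\<exists>k. form k (\<lambda>x. g x * h' x) \<and> form k (\<lambda>x. g' x * h x)" using form_mult[OF 1(1) 2(2)] by blast
        show ?thesis
          by (rule exI[of _ g], rule exI[of _ h], rule exI[of _ A], rule exI[of _ B],
              rule exI[of _ g'], rule exI[of _ h'], rule exI[of _ A'], rule exI[of _ B'], intro impI conjI k 1(4-8) 2(4-8))
      qed simp
    qed
    from this[unfolded choice_iff] obtain g h A B g' h' A' B' where
      R: "\<forall>i. i < n \<longrightarrow> ?P i (g i) (h i) (A i) (B i) (g' i) (h' i) (A' i) (B' i)" by (elim exE) (rule that)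
    have ev: "\<forall>\<^sub>F p in gen. (\<Sum>j<n. \<tau> j (vec2 1 (t p)) * b j p) = (\<Sum>j<n. \<tau>' j (vec2 1 (t p)) * b j p)"
    proof -
      have "\<forall>\<^sub>F p in gen. rho (pull V) s p = (\<Sum>j<n. \<tau> j (vec2 1 (t p)) * b j p)"
        "\<forall>\<^sub>F p in gen. rho (pull V) s p = (\<Sum>j<n. \<tau>' j (vec2 1 (t p)) * b j p)" using \<tau>(3,4) False by (auto simp: related_def)
      then show ?thesis by eventually_elim simp
    qed
    have ev2: "\<forall>\<^sub>F p in gen. \<forall>i\<in>{..<n}. \<tau> i (vec2 1 (t p)) = ratio (A i) (B i) p \<and> \<tau>' i (vec2 1 (t p)) = ratio (A' i) (B' i) p
        \<and> poly (B i) (t p) \<noteq> 0 \<and> poly (B' i) (t p) \<noteq> 0"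
      by (intro eventually_ball_finite ballI eventually_conj poly_t_neq_0) (use R in auto)
    define D where "D = (\<lambda>i. A i * B' i - A' i * B i)"
    have "D j = 0"
    proof (rule poly_indep_ratio[OF sbasis_indep[OF sb] _ _ j])
      show "\<forall>\<^sub>F p in gen. (\<Sum>j<n. ratio (D j) (B j * B' j) p * b j p) = 0"
        using ev ev2
      proof eventually_elim
        case (elim p)
        have "(\<Sum>j<n. ratio (D j) (B j * B' j) p * b j p) = (\<Sum>j<n. \<tau> j (vec2 1 (t p)) * b j p - \<tau>' j (vec2 1 (t p)) * b j p)"
        proof (rule sum.cong[OF refl])
          fix i assume "i \<in> {..<n}"
          with elim(2) have *: "\<tau> i (vec2 1 (t p)) = ratio (A i) (B i) p" "\<tau>' i (vec2 1 (t p)) = ratio (A' i) (B' i) p"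
            "poly (B i) (t p) \<noteq> 0" "poly (B' i) (t p) \<noteq> 0" by auto
          then have "ratio (D i) (B i * B' i) p = \<tau> i (vec2 1 (t p)) - \<tau>' i (vec2 1 (t p))"
            by (simp add: D_def ratio_def field_simps)
          then show "ratio (D i) (B i * B' i) p * b i p = \<tau> i (vec2 1 (t p)) * b i p - \<tau>' i (vec2 1 (t p)) * b i p"
            by (simp add: left_diff_distrib)
        qed
        then show ?case using elim(1) by (simp add: sum_subtractf)
      qed
      show "B i * B' i \<noteq> 0" if "i < n" for i using R that by auto
    qed
    have Rj: "?P j (g j) (h j) (A j) (B j) (g' j) (h' j) (A' j) (B' j)" using R j by blast
    obtain k where k: "form k (\<lambda>x. g j x * h' j x)" "form k (\<lambda>x. g' j x * h j x)" using conjunct1[OF Rj] by blast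
    have "form k (\<lambda>x. g j x * h' j x + (- 1) * (g' j x * h j x))" by (intro form_add form_smult k)
    then have "g j x * h' j x + (- 1) * (g' j x * h j x) = 0"
    proof (rule form2_zero)
      fix c
      have "poly (A j) c * poly (B' j) c - poly (A' j) c * poly (B j) c = poly (D j) c" by (simp add: D_def)
      then show "g j (vec2 1 c) * h' j (vec2 1 c) + (- 1) * (g' j (vec2 1 c) * h j (vec2 1 c)) = 0"
        using Rj \<open>D j = 0\<close> by simp
    qed
    moreover have "h j x \<noteq> 0" "\<tau> j x = g j x / h j x" "h' j x \<noteq> 0" "\<tau>' j x = g' j x / h' j x" using Rj z(2) by auto
    ultimately show ?thesis by (simp add: frac_eq_eq)
  qed
  show ?thesis
  proof (rule PiE_ext[OF \<tau>(1)[unfolded split_sections_def] \<tau>(2)[unfolded split_sections_def]])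
    fix j assume "j \<in> {..<n}"
    then have j: "j < n" by simp
    show "\<tau> j = \<tau>' j"
    proof
      fix x show "\<tau> j x = \<tau>' j x"
      proof (cases "x \<in> \<Union>V")
        case True then show ?thesis using eq[OF j] by auto
      next
        case False then show ?thesis using twisted_outside[OF mem(1)[OF j] False] twisted_outside[OF mem(2)[OF j] False] by simp
      qed
    qed
  qed
qed

lemma direct_image_simps:
  "carrier (sections (direct_image X f L) V) = sect (pull V)"
  "s \<oplus>\<^bsub>sections (direct_image X f L) V\<^esub> s' = s \<oplus>\<^bsub>sections L (pull V)\<^esub> s'"
  "a \<odot>\<^bsub>sections (direct_image X f L) V\<^esub> s = pullback_fun X f V a \<odot>\<^bsub>sections L (pull V)\<^esub> s"
  "restr (direct_image X f L) U V = restr L (pull U) (pull V)"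
  by (simp_all add: direct_image_def Let_def)

lemma direct_sum_simps:
  "carrier (sections (direct_sum n (\<lambda>j. twisting_sheaf proj_line (d j))) V) = split_sections d V"
  "\<tau> \<oplus>\<^bsub>sections (direct_sum n (\<lambda>j. twisting_sheaf proj_line (d j))) V\<^esub> \<tau>' = (\<lambda>j\<in>{..<n}. \<lambda>x. \<tau> j x + \<tau>' j x)"
  "a \<odot>\<^bsub>sections (direct_sum n (\<lambda>j. twisting_sheaf proj_line (d j))) V\<^esub> \<tau> = (\<lambda>j\<in>{..<n}. \<lambda>x. a (proj_point x) * \<tau> j x)"
  "restr (direct_sum n (\<lambda>j. twisting_sheaf proj_line (d j))) U V \<tau> = (\<lambda>j\<in>{..<n}. restr_fun (\<Union>V) (\<tau> j))"
  by (simp_all add: direct_sum_def twisting_sheaf_def split_sections_def)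

lemma add_sect: "openin (zar X) U \<Longrightarrow> s \<in> sect U \<Longrightarrow> s' \<in> sect U \<Longrightarrow> s \<oplus>\<^bsub>sections L U\<^esub> s' \<in> sect U"
proof -
  assume U: "openin (zar X) U" and s: "s \<in> sect U" "s' \<in> sect U"
  have "Module.module (regular_ring X U) (sections L U)"
    using conjunct1[OF sheaf[unfolded sheaf_of_modules_def]] U by simp
  then have "abelian_group (sections L U)" by (simp add: module_def)
  then show ?thesis using s by (intro abelian_groupE(1))
qed

lemma pullback_at: "p \<in> pull V \<Longrightarrow> p \<notin> inf_fibre \<Longrightarrow> pullback_fun X f V a p = a (proj_point (vec2 1 (t p)))"
  using f_affine[of p] by (simp add: pullback_fun_def restr_fun_def)

text \<open>The map sends a section to its unique related tuple. Each compatibility follows by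
  checking that the expected tuple is related as well.\<close>

theorem splitting_from_basis:
  assumes sb: "sbasis gd b d"
  shows "splitting_type X f L n d"
proof -
  define \<theta> where "\<theta> = (\<lambda>V s. SOME \<tau>. \<tau> \<in> split_sections d V \<and> related b V s \<tau>)"
  have \<theta>: "\<theta> V s \<in> split_sections d V" "related b V s (\<theta> V s)" if "openin (zar proj_line) V" "s \<in> sect (pull V)" for V s
  proof -
    have "\<exists>\<tau>. \<tau> \<in> split_sections d V \<and> related b V s \<tau>" using related_exists[OF sb that] by blast
    then have "\<theta> V s \<in> split_sections d V \<and> related b V s (\<theta> V s)" unfolding \<theta>_def by (rule someI_ex)
    then show "\<theta> V s \<in> split_sections d V" "related b V s (\<theta> V s)" by auto
  qed
  have \<theta>_eq: "\<theta> V s = \<tau>" if "openin (zar proj_line) V" "s \<in> sect (pull V)" "\<tau> \<in> split_sections d V" "related b V s \<tau>" for V s \<tau>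
    by (rule related_inj_right[OF sb that(1) \<theta>(1)[OF that(1,2)] that(3) \<theta>(2)[OF that(1,2)] that(4)])
  have comp: "\<theta> V s j \<in> twisted_sections proj_line (d j) V" if "openin (zar proj_line) V" "s \<in> sect (pull V)" "j < n" for V s j
    using \<theta>(1)[OF that(1,2)] that(3) by (auto simp: split_sections_def)
  have rel: "\<forall>\<^sub>F p in gen. rho (pull V) s p = (\<Sum>j<n. \<theta> V s j (vec2 1 (t p)) * b j p)"
    if "openin (zar proj_line) V" "s \<in> sect (pull V)" "V \<noteq> {}" for V s
    using \<theta>(2)[OF that(1,2)] that(3) by (simp add: related_def)
  show ?thesis
    unfolding splitting_type_def sheaf_iso_def sheaf_iso_on_def direct_image_simps direct_sum_simps
  proof (intro exI[of _ \<theta>] allI impI, elim conjE, intro conjI ballI allI impI)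
    fix U :: "(2, 'k) pt set" assume U: "openin (zar proj_line) U"
    note oU = open_preimage[OF U]
    show "bij_betw (\<theta> U) (sect (pull U)) (split_sections d U)"
    proof (rule bij_betw_imageI)
      show "inj_on (\<theta> U) (sect (pull U))"
      proof (rule inj_onI)
        fix s s' assume *: "s \<in> sect (pull U)" "s' \<in> sect (pull U)" "\<theta> U s = \<theta> U s'"
        show "s = s'" by (rule related_inj_left[OF U *(1,2) \<theta>(2)[OF U *(1)]]) (use \<theta>(2)[OF U *(2)] *(3) in simp)
      qed
      show "\<theta> U ` sect (pull U) = split_sections d U"
      proof
        show "\<theta> U ` sect (pull U) \<subseteq> split_sections d U" using \<theta>(1)[OF U] by auto
        show "split_sections d U \<subseteq> \<theta> U ` sect (pull U)"
        proof
          fix \<tau> assume \<tau>: "\<tau> \<in> split_sections d U"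
          from related_surj[OF sb U this] obtain s where "s \<in> sect (pull U)" "related b U s \<tau>" by (rule bexE)
          then show "\<tau> \<in> \<theta> U ` sect (pull U)" using \<theta>_eq[OF U _ \<tau>] by (intro image_eqI[of _ _ s]) auto
        qed
      qed
    qed
    fix s assume s: "s \<in> sect (pull U)"
    show "\<theta> U (s \<oplus>\<^bsub>sections L (pull U)\<^esub> s') = (\<lambda>j\<in>{..<n}. \<lambda>x. \<theta> U s j x + \<theta> U s' j x)" if s': "s' \<in> sect (pull U)" for s'
    proof (rule \<theta>_eq[OF U add_sect[OF oU s s']])
      show "(\<lambda>j\<in>{..<n}. \<lambda>x. \<theta> U s j x + \<theta> U s' j x) \<in> split_sections d U"
        unfolding split_sections_def by (rule restrict_PiE_iff[THEN iffD2]) (use comp[OF U s] comp[OF U s'] in \<open>auto intro: twisted_add\<close>)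
      show "related b U (s \<oplus>\<^bsub>sections L (pull U)\<^esub> s') (\<lambda>j\<in>{..<n}. \<lambda>x. \<theta> U s j x + \<theta> U s' j x)"
        unfolding related_def
      proof (rule disj_imp[THEN iffD2], rule impI)
        assume ne: "U \<noteq> {}"
        show "\<forall>\<^sub>F p in gen. rho (pull U) (s \<oplus>\<^bsub>sections L (pull U)\<^esub> s') p =
            (\<Sum>j<n. (\<lambda>j\<in>{..<n}. \<lambda>x. \<theta> U s j x + \<theta> U s' j x) j (vec2 1 (t p)) * b j p)"
          unfolding rho_add[OF oU s s'] using rel[OF U s ne] rel[OF U s' ne]
          by eventually_elim (simp add: distrib_right sum.distrib)
      qed
    qed
    show "\<theta> U (pullback_fun X f U a \<odot>\<^bsub>sections L (pull U)\<^esub> s) = (\<lambda>j\<in>{..<n}. \<lambda>x. a (proj_point x) * \<theta> U s j x)"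
      if a: "a \<in> regular proj_line U" for a
    proof (rule \<theta>_eq[OF U smult_sect[OF oU pullback_regular[OF U a] s]])
      show "(\<lambda>j\<in>{..<n}. \<lambda>x. a (proj_point x) * \<theta> U s j x) \<in> split_sections d U"
        unfolding split_sections_def
        by (rule restrict_PiE_iff[THEN iffD2]) (use comp[OF U s] in \<open>auto intro!: twisted_smult[OF U _ a]\<close>)
      show "related b U (pullback_fun X f U a \<odot>\<^bsub>sections L (pull U)\<^esub> s) (\<lambda>j\<in>{..<n}. \<lambda>x. a (proj_point x) * \<theta> U s j x)"
        unfolding related_def
      proof (rule disj_imp[THEN iffD2], rule impI)
        assume ne: "U \<noteq> {}"
        show "\<forall>\<^sub>F p in gen. rho (pull U) (pullback_fun X f U a \<odot>\<^bsub>sections L (pull U)\<^esub> s) p =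
            (\<Sum>j<n. (\<lambda>j\<in>{..<n}. \<lambda>x. a (proj_point x) * \<theta> U s j x) j (vec2 1 (t p)) * b j p)"
          unfolding rho_smult[OF oU pullback_regular[OF U a] s]
          using rel[OF U s ne] ev_pull[OF U ne]
          by eventually_elim (simp add: pullback_at sum_distrib_left mult.assoc)
      qed
    qed
    show "\<theta> V (restr L (pull U) (pull V) s) = (\<lambda>j\<in>{..<n}. restr_fun (\<Union>V) (\<theta> U s j))"
      if V: "openin (zar proj_line) V \<and> V \<subseteq> U" for V
    proof -
      have oV: "openin (zar proj_line) V" "V \<subseteq> U" "pull V \<subseteq> pull U" "openin (zar X) (pull V)" using V open_preimage by auto
      show ?thesis
      proof (rule \<theta>_eq[OF oV(1) restr_sect[OF oU oV(4,3) s]])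
        show "(\<lambda>j\<in>{..<n}. restr_fun (\<Union>V) (\<theta> U s j)) \<in> split_sections d V"
          unfolding split_sections_def
          by (rule restrict_PiE_iff[THEN iffD2]) (use comp[OF U s] in \<open>auto intro!: twisted_restr[OF _ oV(1,2)]\<close>)
        show "related b V (restr L (pull U) (pull V) s) (\<lambda>j\<in>{..<n}. restr_fun (\<Union>V) (\<theta> U s j))"
          unfolding related_def
        proof (rule disj_imp[THEN iffD2], rule impI)
          assume ne: "V \<noteq> {}"
          then have neU: "U \<noteq> {}" using oV by auto
          show "\<forall>\<^sub>F p in gen. rho (pull V) (restr L (pull U) (pull V) s) p =
              (\<Sum>j<n. (\<lambda>j\<in>{..<n}. restr_fun (\<Union>V) (\<theta> U s j)) j (vec2 1 (t p)) * b j p)"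
            using rel[OF U s neU] rho_restr_ev[OF oU oV(4,3) pull_nonempty[OF oV(1) ne] s] ev_pull[OF oV(1) ne]
            by eventually_elim (simp add: restr_fun_def)
        qed
      qed
    qed
  qed
qed

end

section \<open>From a splitting to a basis\<close>

definition chart :: "2 \<Rightarrow> (2, 'k::field) pt set" where
  "chart i = {z \<in> proj_space. \<forall>x\<in>z. x i \<noteq> 0}"

lemma openin_chart: "openin (zar proj_line) (chart i)"
  unfolding chart_def by (rule openin_form[OF form_coord]) simp

lemma proj_point_self: "x \<in> proj_point x"
  unfolding proj_point_def by (auto intro!: exI[of _ 1])

lemma chart_Union: "x \<in> \<Union>(chart i) \<longleftrightarrow> x i \<noteq> 0"
proof
  assume "x i \<noteq> 0"
  then have "proj_point x \<in> chart i" by (auto simp: chart_def proj_space_def proj_point_def)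
  then show "x \<in> \<Union>(chart i)" using proj_point_self by blast
qed (auto simp: chart_def)

lemma quotient_value:
  assumes "form e g" "form e h" "V \<subseteq> proj_space" "z \<in> V" "x \<in> z"
  shows "restr_fun V (\<lambda>q. g (rep q) / h (rep q)) z = g x / h x"
  using form_quotient_const[OF assms(1,2) _ rep_mem assms(5)] assms(3,4) by (auto simp: restr_fun_def)

lemma powi_quotient: "x \<noteq> 0 \<Longrightarrow> (x :: 'k::field) powi m = x ^ nat m / x ^ nat (- m)"
  by (auto simp: power_int_def divide_inverse power_inverse)

text \<open>An isomorphism between the direct image and the direct sum of twisting sheaves, with the
  operations of both sheaves unfolded.\<close>

locale split_image = trivialized X f n g L W T W0 T0
  for X :: "('n::finite, 'k::alg_closed_field) pt set" and f n g
    and L :: "('n, 'k, 's) sheaf" and W T W0 T0 +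
  fixes d :: "nat \<Rightarrow> int" and \<theta> :: "(2, 'k) pt set \<Rightarrow> 's \<Rightarrow> nat \<Rightarrow> (2 \<Rightarrow> 'k) \<Rightarrow> 'k"
  assumes iso: "\<forall>U. openin (zar proj_line) U \<and> U \<subseteq> proj_line \<longrightarrow>
     bij_betw (\<theta> U) (sect (pull U)) (split_sections d U) \<and>
     (\<forall>s\<in>sect (pull U). \<forall>s'\<in>sect (pull U).
        \<theta> U (s \<oplus>\<^bsub>sections L (pull U)\<^esub> s') = (\<lambda>j\<in>{..<n}. \<lambda>x. \<theta> U s j x + \<theta> U s' j x)) \<and>
     (\<forall>a\<in>regular proj_line U. \<forall>s\<in>sect (pull U).
        \<theta> U (pullback_fun X f U a \<odot>\<^bsub>sections L (pull U)\<^esub> s) = (\<lambda>j\<in>{..<n}. \<lambda>x. a (proj_point x) * \<theta> U s j x)) \<and>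
     (\<forall>V. openin (zar proj_line) V \<and> V \<subseteq> U \<longrightarrow>
        (\<forall>s\<in>sect (pull U). \<theta> V (restr L (pull U) (pull V) s) = (\<lambda>j\<in>{..<n}. restr_fun (\<Union>V) (\<theta> U s j))))"
begin

lemma open_proj_line: "openin (zar proj_line) U \<Longrightarrow> U \<subseteq> proj_line"
  using openin_subset[of "zar proj_line" U] by (auto simp: topspace_subtopology)

lemma iso_at:
  assumes "openin (zar proj_line) U"
  shows "bij_betw (\<theta> U) (sect (pull U)) (split_sections d U)"
    and "s \<in> sect (pull U) \<Longrightarrow> s' \<in> sect (pull U) \<Longrightarrow>
      \<theta> U (s \<oplus>\<^bsub>sections L (pull U)\<^esub> s') = (\<lambda>j\<in>{..<n}. \<lambda>x. \<theta> U s j x + \<theta> U s' j x)"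
    and "a \<in> regular proj_line U \<Longrightarrow> s \<in> sect (pull U) \<Longrightarrow>
      \<theta> U (pullback_fun X f U a \<odot>\<^bsub>sections L (pull U)\<^esub> s) = (\<lambda>j\<in>{..<n}. \<lambda>x. a (proj_point x) * \<theta> U s j x)"
    and "openin (zar proj_line) V \<Longrightarrow> V \<subseteq> U \<Longrightarrow> s \<in> sect (pull U) \<Longrightarrow>
      \<theta> V (restr L (pull U) (pull V) s) = (\<lambda>j\<in>{..<n}. restr_fun (\<Union>V) (\<theta> U s j))"
  using mp[OF spec[OF iso] conjI[OF assms open_proj_line[OF assms]]] by simp_all

lemma iso_inj: "openin (zar proj_line) U \<Longrightarrow> s \<in> sect (pull U) \<Longrightarrow> s' \<in> sect (pull U) \<Longrightarrow> \<theta> U s = \<theta> U s' \<Longrightarrow> s = s'"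
  using iso_at(1) by (auto simp: bij_betw_def dest: inj_onD)

lemma iso_outside:
  assumes U: "openin (zar proj_line) U" and s: "s \<in> sect (pull U)" and "j < n" "x \<notin> \<Union>U"
  shows "\<theta> U s j x = 0"
proof -
  have "\<theta> U s \<in> split_sections d U" using bij_betw_imp_surj_on[OF iso_at(1)[OF U]] s by blast
  then have "\<theta> U s j \<in> twisted_sections proj_line (d j) U" using assms(3) by (auto simp: split_sections_def)
  then show ?thesis using assms(4) by (rule twisted_outside)
qed

text \<open>A constant acts as a regular function pulled back from the line; its effects on
  \<open>\<theta>\<close> and on \<open>rho\<close> are tracked together.\<close>

lemma scale_section:
  assumes U: "openin (zar proj_line) U" "U \<noteq> {}" and s: "s \<in> sect (pull U)"
  shows "\<exists>s'\<in>sect (pull U). \<theta> U s' = (\<lambda>j\<in>{..<n}. \<lambda>x. c * \<theta> U s j x) \<and>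
     (\<forall>\<^sub>F p in gen. rho (pull U) s' p = c * rho (pull U) s p)"
proof -
  define a where "a = restr_fun U (\<lambda>_ :: (2, 'k) pt. c)"
  have a: "a \<in> regular proj_line U"
    unfolding a_def using regular_quotient[OF U(1) subset_refl form_const[of c] form_const[of 1]] by simp
  note oU = open_preimage[OF U(1)] and pa = pullback_regular[OF U(1) a]
  have "a (proj_point x) * \<theta> U s j x = c * \<theta> U s j x" if "j < n" for j x
  proof (cases "x \<in> \<Union>U")
    case True
    then obtain z where z: "z \<in> U" "x \<in> z" by auto
    then have "z = proj_point x" using proj_point_mem(2)[of z x] open_proj_line[OF U(1)] by auto
    then show ?thesis using z(1) by (simp add: a_def restr_fun_def)
  next
    case False then show ?thesis using iso_outside[OF U(1) s that] by simp
  qed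
  then have "\<theta> U (pullback_fun X f U a \<odot>\<^bsub>sections L (pull U)\<^esub> s) = (\<lambda>j\<in>{..<n}. \<lambda>x. c * \<theta> U s j x)"
    unfolding iso_at(3)[OF U(1) a s] by (intro restrict_ext ext) simp
  moreover have "\<forall>\<^sub>F p in gen. rho (pull U) (pullback_fun X f U a \<odot>\<^bsub>sections L (pull U)\<^esub> s) p = c * rho (pull U) s p"
    unfolding rho_smult[OF oU pa s] using ev_pull[OF U]
    by eventually_elim (simp add: pullback_fun_def restr_fun_def a_def)
  ultimately show ?thesis using smult_sect[OF oU pa s] by (intro bexI[of _ "pullback_fun X f U a \<odot>\<^bsub>sections L (pull U)\<^esub> s"] conjI)
qed

lemma combine_sections:
  assumes U: "openin (zar proj_line) U" "U \<noteq> {}" and s: "\<And>j :: nat. s j \<in> sect (pull U)"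
  shows "\<exists>s'\<in>sect (pull U). \<theta> U s' = (\<lambda>k\<in>{..<n}. \<lambda>x. \<Sum>j<m. c j * \<theta> U (s j) k x) \<and>
     (\<forall>\<^sub>F p in gen. rho (pull U) s' p = (\<Sum>j<m. c j * rho (pull U) (s j) p))"
proof (induction m)
  case 0
  from scale_section[OF U s[of 0], of 0] show ?case by (simp only: mult_zero_left lessThan_0 sum.empty)
next
  case (Suc m)
  from Suc.IH obtain s1 where s1: "s1 \<in> sect (pull U)" "\<theta> U s1 = (\<lambda>k\<in>{..<n}. \<lambda>x. \<Sum>j<m. c j * \<theta> U (s j) k x)"
    "\<forall>\<^sub>F p in gen. rho (pull U) s1 p = (\<Sum>j<m. c j * rho (pull U) (s j) p)" by (elim bexE conjE) (rule that)
  from scale_section[OF U s, of "c m" m] obtain s2 where s2: "s2 \<in> sect (pull U)" "\<theta> U s2 = (\<lambda>k\<in>{..<n}. \<lambda>x. c m * \<theta> U (s m) k x)"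
    "\<forall>\<^sub>F p in gen. rho (pull U) s2 p = c m * rho (pull U) (s m) p" by (elim bexE conjE) (rule that)
  note oU = open_preimage[OF U(1)]
  have "\<theta> U (s1 \<oplus>\<^bsub>sections L (pull U)\<^esub> s2) = (\<lambda>k\<in>{..<n}. \<lambda>x. \<Sum>j<Suc m. c j * \<theta> U (s j) k x)"
    unfolding iso_at(2)[OF U(1) s1(1) s2(1)] s1(2) s2(2) by (intro restrict_ext ext) simp
  moreover have "\<forall>\<^sub>F p in gen. rho (pull U) (s1 \<oplus>\<^bsub>sections L (pull U)\<^esub> s2) p = (\<Sum>j<Suc m. c j * rho (pull U) (s j) p)"
    unfolding rho_add[OF oU s1(1) s2(1)] using s1(3) s2(3) by eventually_elim simp
  ultimately show ?case using add_sect[OF oU s1(1) s2(1)] by (intro bexI[of _ "s1 \<oplus>\<^bsub>sections L (pull U)\<^esub> s2"] conjI)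
qed

text \<open>If the combination is \<open>a\<close> times a section, linearity of
  \<open>\<theta>\<close> over regular functions makes its image divisible by \<open>a\<close>,
  hence zero where \<open>a\<close> vanishes. Divisibility along a fibre of \<open>f\<close> thus
  becomes a statement about one point of the line.\<close>

lemma combination_vanishes:
  assumes U: "openin (zar proj_line) U" "x \<in> \<Union>U" and s: "\<And>j :: nat. s j \<in> sect (pull U)"
    and a: "a \<in> regular proj_line U" "a (proj_point x) = 0"
    and v: "\<And>P. P \<in> pull U \<Longrightarrow> v \<in> sec gd P"
    and ev: "\<forall>\<^sub>F p in gen. a (f p) * v p = (\<Sum>j<n. c j * rho (pull U) (s j) p)" and k: "k < n"
  shows "(\<Sum>j<n. c j * \<theta> U (s j) k x) = 0"
proof -
  have ne: "U \<noteq> {}" using U(2) by auto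
  note oU = open_preimage[OF U(1)] and pa = pullback_regular[OF U(1) a(1)]
  from combine_sections[where s = s and c = c and m = n, OF U(1) ne s] obtain s1 where s1: "s1 \<in> sect (pull U)"
    "\<theta> U s1 = (\<lambda>k\<in>{..<n}. \<lambda>x. \<Sum>j<n. c j * \<theta> U (s j) k x)"
    "\<forall>\<^sub>F p in gen. rho (pull U) s1 p = (\<Sum>j<n. c j * rho (pull U) (s j) p)" by (elim bexE conjE) (rule that)
  have "\<exists>s2\<in>sect (pull U). \<forall>\<^sub>F p in gen. rho (pull U) s2 p = v p"
    by (rule rho_surj[OF oU pull_nonempty[OF U(1) ne] v])
  then obtain s2 where s2: "s2 \<in> sect (pull U)"
    "\<forall>\<^sub>F p in gen. rho (pull U) s2 p = v p" by (elim bexE) (rule that)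
  have "\<forall>\<^sub>F p in gen. rho (pull U) s1 p = rho (pull U) (pullback_fun X f U a \<odot>\<^bsub>sections L (pull U)\<^esub> s2) p"
    unfolding rho_smult[OF oU pa s2(1)] using s1(3) s2(2) ev ev_pull[OF U(1) ne]
    by eventually_elim (simp add: pullback_fun_def restr_fun_def)
  then have "s1 = pullback_fun X f U a \<odot>\<^bsub>sections L (pull U)\<^esub> s2"
    by (rule rho_inj[OF oU s1(1) smult_sect[OF oU pa s2(1)]])
  then have "\<theta> U s1 k x = a (proj_point x) * \<theta> U s2 k x" using iso_at(3)[OF U(1) a(1) s2(1)] k by simp
  then show ?thesis using s1(2) k a(2) by simp
qed

text \<open>The standard generators over a chart: \<open>x i powi d j\<close> generates O(d j) where
  the coordinate \<open>x i\<close> does not vanish.\<close>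

definition frame :: "2 \<Rightarrow> nat \<Rightarrow> nat \<Rightarrow> (2 \<Rightarrow> 'k) \<Rightarrow> 'k" where
  "frame i j = (\<lambda>k\<in>{..<n}. if k = j then restr_fun (\<Union>(chart i)) (\<lambda>x. x i powi d j) else (\<lambda>_. 0))"

lemma frame_split: "frame i j \<in> split_sections d (chart i)"
  unfolding split_sections_def
proof (rule PiE_I)
  fix k assume k: "k \<in> {..<n}"
  show "frame i j k \<in> twisted_sections proj_line (d k) (chart i)"
  proof (cases "k = j")
    case False then show ?thesis using k twisted_zero[OF openin_chart] by (simp add: frame_def)
  next
    case True
    have "restr_fun (\<Union>(chart i)) (\<lambda>x :: 2 \<Rightarrow> 'k. x i ^ nat (d j) / x i ^ nat (- d j)) \<in> twisted_sections proj_line (d j) (chart i)"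
    proof (rule twisted_quotient[OF openin_chart])
      show "form (nat m) (\<lambda>x :: 2 \<Rightarrow> 'k. x i ^ nat m)" for m using form_power[OF form_coord[of i], of "nat m"] by simp
      show "form (nat m) (\<lambda>x :: 2 \<Rightarrow> 'k. x i ^ nat m)" for m using form_power[OF form_coord[of i], of "nat m"] by simp
      show "x i ^ nat (- d j) \<noteq> 0" if "x \<in> \<Union>(chart i)" for x :: "2 \<Rightarrow> 'k"
        using that chart_Union[of x i] by simp
    qed simp
    moreover have "restr_fun (\<Union>(chart i)) (\<lambda>x :: 2 \<Rightarrow> 'k. x i ^ nat (d j) / x i ^ nat (- d j)) =
        restr_fun (\<Union>(chart i)) (\<lambda>x. x i powi d j)"
      by (rule ext) (simp add: restr_fun_def chart_Union powi_quotient del: Union_iff)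
    ultimately show ?thesis using True k by (simp add: frame_def)
  qed
qed (simp add: frame_def)

definition frame_section :: "2 \<Rightarrow> nat \<Rightarrow> 's" where
  "frame_section i j = inv_into (sect (pull (chart i))) (\<theta> (chart i)) (frame i j)"

lemma frame_section: "frame_section i j \<in> sect (pull (chart i))" "\<theta> (chart i) (frame_section i j) = frame i j"
proof -
  have "frame i j \<in> \<theta> (chart i) ` sect (pull (chart i))"
    unfolding bij_betw_imp_surj_on[OF iso_at(1)[OF openin_chart]] by (rule frame_split)
  then show "frame_section i j \<in> sect (pull (chart i))" "\<theta> (chart i) (frame_section i j) = frame i j"
    unfolding frame_section_def by (auto intro: inv_into_into f_inv_into_f)
qed

definition frame_fun :: "2 \<Rightarrow> nat \<Rightarrow> ('n, 'k) pt \<Rightarrow> 'k" where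
  "frame_fun i j = rho (pull (chart i)) (frame_section i j)"

lemma frame_fun_sec: "P \<in> pull (chart i) \<Longrightarrow> frame_fun i j \<in> sec gd P"
  unfolding frame_fun_def by (rule rho_sec[OF open_preimage[OF openin_chart] frame_section(1)])

text \<open>At \<open>x\<close> the frame is diagonal with nonzero entries
  \<open>x i powi d k\<close>, so a combination that vanishes there has zero coefficients.\<close>

lemma frame_independent:
  assumes x: "x i \<noteq> 0" and a: "a \<in> regular proj_line (chart i)" "a (proj_point x) = 0"
    and v: "\<And>P. P \<in> pull (chart i) \<Longrightarrow> v \<in> sec gd P"
    and ev: "\<forall>\<^sub>F p in gen. a (f p) * v p = (\<Sum>j<n. c j * frame_fun i j p)" and k: "k < n"
  shows "c k = 0"
proof -
  have xU: "x \<in> \<Union>(chart i)" using x chart_Union[of x i] by blast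
  have "(\<Sum>j<n. c j * \<theta> (chart i) (frame_section i j) k x) = 0"
    by (rule combination_vanishes[OF openin_chart xU frame_section(1) a v ev[unfolded frame_fun_def] k])
  moreover have "\<theta> (chart i) (frame_section i j) k x = (if j = k then x i powi d k else 0)" for j
    using k xU by (auto simp: frame_section(2) frame_def restr_fun_def simp del: Union_iff)
  ultimately have "(\<Sum>j<n. if j = k then c k * x i powi d k else 0) = 0" by (simp add: if_distrib cong: if_cong)
  then show ?thesis using k x by (simp add: sum.delta)
qed

lemma finite_chart: "pull (chart 0) = X - inf_fibre"
  using pre_eq[OF form_coord[of 0]] finite_part by (simp add: chart_def)

lemma infinite_chart: "P \<in> X \<Longrightarrow> P \<in> inf_fibre \<or> t P \<noteq> 0 \<longleftrightarrow> P \<in> pull (chart 1)"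
  using pre_eq[OF form_coord[of 1]] y_nonzero[of P] by (auto simp: chart_def pre_def inf_fibre_def t_def set_eq_iff)

text \<open>The generators over the two charts differ by \<open>(x 1 / x 0) powi d j\<close>, which
  pulls back to \<open>t powi d j\<close>.\<close>

lemma frame_change: "\<forall>\<^sub>F p in gen. t p powi d j * frame_fun 0 j p = frame_fun 1 j p"
proof -
  define V :: "(2, 'k) pt set" where "V = chart 0 \<inter> chart 1"
  have V: "openin (zar proj_line) V" unfolding V_def by (intro openin_Int openin_chart)
  have sub: "V \<subseteq> chart 0" "V \<subseteq> chart 1" "V \<subseteq> proj_space" by (auto simp: V_def chart_def)
  have nz: "x 0 \<noteq> 0" "x 1 \<noteq> 0" if "x \<in> \<Union>V" for x
    using that by (auto simp: V_def chart_def)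
  have ne: "V \<noteq> {}"
  proof -
    have "proj_point (vec2 1 (1 :: 'k)) \<in> V"
      using vec2_point[of 1 "1 :: 'k"] by (auto simp: V_def chart_def proj_point_def)
    then show ?thesis by auto
  qed
  \<comment> \<open>The positive and negative parts of \<open>d j\<close> are separated so that
    numerator and denominator are forms of the same degree.\<close>
  define e where "e = nat (d j) + nat (- d j)"
  define num den where "num = (\<lambda>x :: 2 \<Rightarrow> 'k. x 1 ^ nat (d j) * x 0 ^ nat (- d j))"
    and "den = (\<lambda>x :: 2 \<Rightarrow> 'k. x 0 ^ nat (d j) * x 1 ^ nat (- d j))"
  have fp: "form (nat m) (\<lambda>x :: 2 \<Rightarrow> 'k. x i ^ nat m)" for m i using form_power[OF form_coord[of i], of "nat m"] by simp
  have forms: "form e num" "form e den" unfolding e_def num_def den_def by (intro form_mult fp)+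
  define a where "a = restr_fun V (\<lambda>z. num (rep z) / den (rep z))"
  have a: "a \<in> regular proj_line V"
    unfolding a_def by (rule regular_quotient[OF V _ forms]) (use nz in \<open>auto simp: den_def\<close>)
  have a_val: "a z = x 1 powi d j / x 0 powi d j" if "z \<in> V" "x \<in> z" for x z
  proof -
    have "x \<in> \<Union>V" using that by auto
    note nz[OF this]
    then show ?thesis unfolding a_def quotient_value[OF forms sub(3) that]
      by (simp add: num_def den_def powi_quotient)
  qed
  define s where "s i = restr L (pull (chart i)) (pull V) (frame_section i j)" for i
  have s: "s 0 \<in> sect (pull V)" "s 1 \<in> sect (pull V)"
    "\<theta> V (s 0) = (\<lambda>k\<in>{..<n}. restr_fun (\<Union>V) (frame 0 j k))" "\<theta> V (s 1) = (\<lambda>k\<in>{..<n}. restr_fun (\<Union>V) (frame 1 j k))"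
    unfolding s_def frame_section(2)[symmetric]
    by (intro restr_sect open_preimage openin_chart V frame_section(1) iso_at(4) sub Int_mono vimage_mono order_refl)+
  have rs: "\<forall>\<^sub>F p in gen. rho (pull V) (s 0) p = frame_fun 0 j p" "\<forall>\<^sub>F p in gen. rho (pull V) (s 1) p = frame_fun 1 j p"
    unfolding s_def frame_fun_def
    by (intro rho_restr_ev open_preimage openin_chart V frame_section(1) pull_nonempty[OF V ne] sub Int_mono vimage_mono order_refl)+
  note oV = open_preimage[OF V] and pa = pullback_regular[OF V a]
  have "a (proj_point x) * restr_fun (\<Union>V) (frame 0 j k) x = restr_fun (\<Union>V) (frame 1 j k) x" if k: "k < n" for k x
  proof (cases "x \<in> \<Union>V")
    case True
    then obtain z where z: "z \<in> V" "x \<in> z" by auto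
    then have "z = proj_point x" using proj_point_mem(2)[of z x] sub(3) by auto
    then have "a (proj_point x) = x 1 powi d j / x 0 powi d j" using a_val z by simp
    moreover have "x \<in> \<Union>(chart 0)" "x \<in> \<Union>(chart 1)" using z sub by auto
    ultimately show ?thesis using True k nz[OF True] by (simp add: restr_fun_def frame_def del: Union_iff)
  next
    case False then show ?thesis by (simp add: restr_fun_def del: Union_iff)
  qed
  then have "\<theta> V (pullback_fun X f V a \<odot>\<^bsub>sections L (pull V)\<^esub> s 0) = \<theta> V (s 1)"
    unfolding iso_at(3)[OF V a s(1)] s(3,4) by (intro restrict_ext ext) simp
  then have eq: "pullback_fun X f V a \<odot>\<^bsub>sections L (pull V)\<^esub> s 0 = s 1"
    by (rule iso_inj[OF V smult_sect[OF oV pa s(1)] s(2)])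
  have "rho (pull V) (s 1) = (\<lambda>p. pullback_fun X f V a p * rho (pull V) (s 0) p)"
    unfolding eq[symmetric] by (rule rho_smult[OF oV pa s(1)])
  then have "\<forall>\<^sub>F p in gen. rho (pull V) (s 1) p = pullback_fun X f V a p * rho (pull V) (s 0) p" by simp
  with rs ev_pull[OF V ne] show ?thesis
  proof eventually_elim
    case (elim p)
    then have p: "p \<in> pull V" "p \<in> X - inf_fibre" by auto
    then have "pullback_fun X f V a p = t p powi d j"
      using a_val[OF _ affine_mem[OF p(2)]] by (simp add: pullback_fun_def restr_fun_def)
    then show ?case using elim by simp
  qed
qed

text \<open>Fibre independence is \<open>frame_independent\<close> for the local equation of the
  point below: \<open>t - c\<close> on the finite chart and \<open>1 / t\<close> on the chart at
  infinity. The degrees over infinity come from \<open>frame_change\<close>.\<close>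

lemma frame_basis: "sbasis gd (frame_fun 0) d"
  unfolding sbasis_def
proof (intro conjI allI impI)
  note pc0 = finite_chart
  have fin: "frame_fun 0 j \<in> sec gd P" if "P \<in> X - inf_fibre" for P j using frame_fun_sec[of P 0] that finite_chart by simp
  have inf: "frame_fun 1 j \<in> sec gd P" if "P \<in> X" "P \<in> inf_fibre \<or> t P \<noteq> 0" for P j
    using frame_fun_sec[of P 1] infinite_chart that by simp
  fix j assume "j < n"
  show "frame_fun 0 j \<in> graded_sec gd (- d j)"
    unfolding graded_sec_def
  proof (intro CollectI conjI ballI)
    from finite_part_nonempty obtain P where "P \<in> X - inf_fibre" by blast
    then show "frame_fun 0 j \<in> rat" by (rule sec_K[OF fin])
    show "frame_fun 0 j \<in> sec gd P" if "P \<in> X - inf_fibre" for P using that by (rule fin)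
    show "(\<lambda>p. t p powi (- (- d j)) * frame_fun 0 j p) \<in> sec gd P" if "P \<in> inf_fibre" for P
    proof (rule sec_cong[OF inf[of P j]])
      show "\<forall>\<^sub>F p in gen. frame_fun 1 j p = t p powi (- (- d j)) * frame_fun 0 j p"
        using frame_change[of j] by eventually_elim simp
    qed (use that I_X in auto)
  qed
next
  fix c b k
  assume H: "\<forall>P\<in>X - inf_fibre. t P = c \<longrightarrow> (\<lambda>p. inverse (t p - c) * (\<Sum>j<n. b j * frame_fun 0 j p)) \<in> sec gd P" and k: "k < n"
  define a :: "(2, 'k) pt \<Rightarrow> 'k" where "a = restr_fun (chart 0) (\<lambda>z. (rep z 1 - c * rep z 0) / rep z 0)"
  have a: "a \<in> regular proj_line (chart 0)"
    unfolding a_def by (rule regular_quotient[OF openin_chart _ form_coord_lin form_coord]) (auto simp: chart_def)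
  have a_val: "a z = x 1 / x 0 - c" if "z \<in> chart 0" "x \<in> z" for x z
    using quotient_value[OF form_coord_lin[of c] form_coord[of 0] _ that] that
    by (auto simp: a_def chart_def diff_divide_distrib)
  show "b k = 0"
  proof (rule frame_independent[OF _ a _ _ _ k])
    show "vec2 1 c 0 \<noteq> 0" by simp
    have "proj_point (vec2 1 c) \<in> chart 0" using vec2_point[of 1 c] by (auto simp: chart_def proj_point_def)
    from a_val[OF this, of "vec2 1 c"] show "a (proj_point (vec2 1 c)) = 0" by (simp add: proj_point_self)
  next
    fix P assume "P \<in> pull (chart 0)"
    then have P: "P \<in> X" "P \<notin> inf_fibre" "P \<in> X - inf_fibre" "P \<in> pull (chart 0)" using finite_chart by auto
    show "(\<lambda>p. inverse (t p - c) * (\<Sum>j<n. b j * frame_fun 0 j p)) \<in> sec gd P"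
    proof (cases "t P = c")
      case True then show ?thesis using H P(3) by simp
    next
      case False
      then show ?thesis
        by (intro sec_smult P(1) t_inverse_reg sec_sum reg_const frame_fun_sec P(4) disjI2)
    qed
  next
    show "\<forall>\<^sub>F p in gen. a (f p) * (inverse (t p - c) * (\<Sum>j<n. b j * frame_fun 0 j p)) = (\<Sum>j<n. b j * frame_fun 0 j p)"
      using t_neq[of c] ev_finite_part
    proof eventually_elim
      case (elim p)
      have "p \<in> pull (chart 0)" using elim(2) finite_chart by simp
      then have "a (f p) = t p - c" using a_val[OF _ affine_mem[OF elim(2)]] by simp
      then show ?case using elim(1) by simp
    qed
  qed
next
  fix b k
  assume H: "\<forall>P\<in>inf_fibre. (\<lambda>p. t p * (\<Sum>j<n. b j * (t p powi d j * frame_fun 0 j p))) \<in> sec gd P" and k: "k < n"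
  define a :: "(2, 'k) pt \<Rightarrow> 'k" where "a = restr_fun (chart 1) (\<lambda>z. rep z 0 / rep z 1)"
  have a: "a \<in> regular proj_line (chart 1)"
    unfolding a_def by (rule regular_quotient[OF openin_chart _ form_coord form_coord]) (auto simp: chart_def)
  have a_val: "a z = x 0 / x 1" if "z \<in> chart 1" "x \<in> z" for x z
    using quotient_value[OF form_coord[of 0] form_coord[of 1] _ that] by (auto simp: a_def chart_def)
  have ev: "\<forall>\<^sub>F p in gen. (\<Sum>j<n. b j * (t p powi d j * frame_fun 0 j p)) = (\<Sum>j<n. b j * frame_fun 1 j p)"
  proof -
    have "\<forall>\<^sub>F p in gen. \<forall>j\<in>{..<n}. t p powi d j * frame_fun 0 j p = frame_fun 1 j p"
      by (intro eventually_ball_finite ballI frame_change) simp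
    then show ?thesis by eventually_elim simp
  qed
  show "b k = 0"
  proof (rule frame_independent[OF _ a _ _ _ k])
    show "vec2 0 1 1 \<noteq> (0 :: 'k)" by simp
    have "proj_point (vec2 0 (1 :: 'k)) \<in> chart 1" using vec2_point[of 0 "1 :: 'k"] by (auto simp: chart_def proj_point_def)
    from a_val[OF this, of "vec2 0 1"] show "a (proj_point (vec2 0 1)) = 0" by (simp add: proj_point_self)
  next
    fix P assume P: "P \<in> pull (chart 1)"
    show "(\<lambda>p. t p * (\<Sum>j<n. b j * frame_fun 1 j p)) \<in> sec gd P"
    proof (cases "P \<in> inf_fibre")
      case True
      show ?thesis by (rule sec_cong[OF bspec[OF H True]]) (use ev in eventually_elim, simp)
    next
      case False
      have "P \<in> X" using P by simp
      then show ?thesis using False by (intro sec_smult t_reg sec_sum reg_const frame_fun_sec P) auto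
    qed
  next
    show "\<forall>\<^sub>F p in gen. a (f p) * (t p * (\<Sum>j<n. b j * frame_fun 1 j p)) = (\<Sum>j<n. b j * frame_fun 1 j p)"
      using t_neq[of 0] ev_finite_part
    proof eventually_elim
      case (elim p)
      have "p \<in> pull (chart 1)" using elim infinite_chart[of p] by blast
      then have "a (f p) = 1 / t p" using a_val[OF _ affine_mem[OF elim(2)]] by simp
      then show ?case using elim(1) by simp
    qed
  qed
qed

end

theorem (in trivialized) basis_from_splitting:
  assumes "splitting_type X f L n d"
  shows "\<exists>b. sbasis gd b d"
proof -
  from assms[unfolded splitting_type_def sheaf_iso_def sheaf_iso_on_def direct_image_simps direct_sum_simps]
  obtain \<theta> where "split_image X f n g L W T W0 T0 d \<theta>"
    by (elim exE) (rule that, unfold_locales)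
  from split_image.frame_basis[OF this] show ?thesis by blast
qed

section \<open>The bound on the spread\<close>

text \<open>Grothendieck's splitting theorem for the direct image, with the greedy basis providing
  the summands.\<close>

lemma (in curve_setup) splitting_type_exists:
  assumes "line_bundle X L" shows "\<exists>d. splitting_type X f L n d"
proof -
  from line_bundle_trivialized[OF assms] obtain W T W0 T0 where tr: "trivialized X f n g L W T W0 T0"
    by (elim exE) (rule that)
  interpret trivialized X f n g L W T W0 T0 by (rule tr)
  from sbasis_exists[OF divisor_gd] obtain b d where "sbasis gd b d" by (elim exE) (rule that)
  then show ?thesis by (intro exI splitting_from_basis)
qed

lemma (in curve_setup) splitting_spread:
  assumes L: "line_bundle X L" and d: "splitting_type X f L n d" and "i < n" "j < n"
  shows "int n * (d i - d j) \<le> 2 * int g - 2 + 2 * int n"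
proof -
  from line_bundle_trivialized[OF L] obtain W T W0 T0 where tr: "trivialized X f n g L W T W0 T0"
    by (elim exE) (rule that)
  interpret trivialized X f n g L W T W0 T0 by (rule tr)
  from basis_from_splitting[OF d] obtain b where "sbasis gd b d" by (elim exE) (rule that)
  from spread_bound[OF divisor_gd this assms(3,4)] show ?thesis .
qed

text \<open>The bound holds for every splitting, hence for the one selected in the definition. For
  \<open>n = 1\<close> it would still allow a positive value, so that case is read off from the
  single index.\<close>

lemma (in curve_setup) s_invariant_bound:
  assumes L: "line_bundle X L"
  shows "int n * s_invariant X f L n \<le> 2 * int g - 2 + 2 * int n" and "n = 1 \<Longrightarrow> s_invariant X f L n = 0"
proof -
  define d where "d = (SOME d. splitting_type X f L n d)"
  have d: "splitting_type X f L n d" unfolding d_def by (rule someI_ex[OF splitting_type_exists[OF L]])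
  define A where "A = {\<bar>d i - d j\<bar> | i j. i < n \<and> j < n}"
  have s: "s_invariant X f L n = Max A" unfolding s_invariant_def Let_def d_def A_def ..
  have "A = (\<lambda>(i, j). \<bar>d i - d j\<bar>) ` ({..<n} \<times> {..<n})" by (auto simp: A_def)
  then have "Max A \<in> A" using degree_pos by (intro Max_in) auto
  then obtain i j where ij: "Max A = \<bar>d i - d j\<bar>" "i < n" "j < n" by (auto simp: A_def)
  show "int n * s_invariant X f L n \<le> 2 * int g - 2 + 2 * int n"
    using splitting_spread[OF L d ij(2,3)] splitting_spread[OF L d ij(3,2)] unfolding s ij(1) by (cases "d i \<ge> d j") auto
  show "s_invariant X f L n = 0" if "n = 1" unfolding s using ij that by simp
qed

theorem mainTheorem8:
  fixes X :: "('n::finite, 'k::alg_closed_field) pt set"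
    and f :: "('n, 'k) pt \<Rightarrow> (2, 'k) pt"
    and L :: "('n, 'k, 's) sheaf"
    and g n :: nat
  assumes curve: "smooth_projective_curve X"
    and genus: "has_genus X g" "g > 1"
    and morphism: "surjective_morphism X proj_line f"
    and degree: "has_degree X proj_line f n"
    and line_bundle: "line_bundle X L"
  shows "let s = real_of_int (s_invariant X f L n) in
         (odd n \<longrightarrow>
            s \<le> (2 * real g - 5/2) / real n + 5/2 \<and>
            s \<le> 2/3 * real g + 5/3) \<and>
         (even n \<longrightarrow>
            s \<le> (2 * real g - 2) / real n + 5/2 \<and>
            (n = 2 \<longrightarrow> s \<le> real g + 1) \<and>
            (n \<noteq> 2 \<longrightarrow> s \<le> 1/2 * real g + 2)) \<and>
         (\<not> hyperelliptic X \<or> \<not> hyperelliptic_map X f \<longrightarrow>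
            s \<le> 2/3 * real g + 5/3)"
proof -
  have X: "X \<subseteq> proj_space"
    using curve closedin_subset[of zariski X] by (simp add: smooth_projective_curve_def topspace_zariski)
  have g: "real g \<ge> 2" using genus(2) by simp
  interpret curve_setup X f n g
    by unfold_locales (use X curve genus morphism degree in \<open>simp_all add: smooth_projective_curve_def\<close>)
  define s where "s = real_of_int (s_invariant X f L n)"
  have "real_of_int (int n * s_invariant X f L n) \<le> real_of_int (2 * int g - 2 + 2 * int n)"
    using s_invariant_bound(1)[OF line_bundle] by (simp only: of_int_le_iff)
  then have ns: "real n * s \<le> 2 * real g - 2 + 2 * real n" by (simp add: s_def)
  have n: "real n > 0" using degree_pos by simp
  \<comment> \<open>Sharper than what is asked for: the last summand is 2 instead of 5/2.\<close>
  have bound: "s \<le> (2 * real g - 2) / real n + 2" using ns n by (simp add: field_simps)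
  have bound_ge: "s \<le> (2 * real g - 2) / real m + 2" if "m \<le> n" "m > 0" for m
  proof -
    have "(2 * real g - 2) / real n \<le> (2 * real g - 2) / real m"
      using that g n by (intro divide_left_mono mult_pos_pos) auto
    then show ?thesis using bound by simp
  qed
  have odd1: "s \<le> (2 * real g - 5/2) / real n + 5/2" and odd2: "s \<le> 2/3 * real g + 5/3" if "odd n"
  proof -
    have "s \<le> (2 * real g - 5/2) / real n + 5/2 \<and> s \<le> 2/3 * real g + 5/3"
    proof (cases "n = 1")
      \<comment> \<open>Here \<open>bound\<close> only gives \<open>2 * g\<close>, too weak for the
        second inequality.\<close>
      case True
      then have "s = 0" using s_invariant_bound(2)[OF line_bundle] by (simp add: s_def)
      then show ?thesis using True g by simp
    next
      case False
      with that degree_pos have "n \<ge> 3" by presburger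
      \<comment> \<open>The required bound exceeds the proved one by \<open>1/2 - 1/(2 n)\<close>,
        which is nonnegative.\<close>
      have "(2 * real g - 5/2) / real n + 5/2 = (2 * real g - 2) / real n + 2 + (1 / 2 - 1 / (2 * real n))"
        using n by (simp add: field_simps)
      moreover have "1 / (2 * real n) \<le> 1 / 2" using n degree_pos by (simp add: field_simps)
      moreover have "s \<le> (2 * real g - 2) / 3 + 2" using bound_ge[of 3] \<open>n \<ge> 3\<close> by simp
      then have "s \<le> 2/3 * real g + 5/3" using g by (simp add: field_simps)
      ultimately show ?thesis using bound by linarith
    qed
    then show "s \<le> (2 * real g - 5/2) / real n + 5/2" "s \<le> 2/3 * real g + 5/3" by auto
  qed
  \<comment> \<open>The bound decreases with \<open>n\<close> and equals \<open>g/2 + 3/2\<close> at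
    \<open>n = 4\<close>, which also lies below \<open>2/3 * g + 5/3\<close>.\<close>
  have even4: "s \<le> 1/2 * real g + 3/2" if "even n" "n \<noteq> 2"
  proof -
    from that degree_pos have "n \<ge> 4" by presburger
    then show ?thesis using bound_ge[of 4] by (simp add: field_simps)
  qed
  have two: "s \<le> real g + 1" if "n = 2" using ns that by simp
  have "s \<le> 2/3 * real g + 5/3" if "\<not> hyperelliptic X \<or> \<not> hyperelliptic_map X f"
  proof -
    \<comment> \<open>With \<open>n = 2\<close> the given \<open>f\<close> would itself be a
      hyperelliptic map, which refutes both alternatives.\<close>
    have "n \<noteq> 2" using that morphism degree by (auto simp: hyperelliptic_def hyperelliptic_map_def)
    then show ?thesis using odd2 even4 g by (cases "odd n") auto
  qed
  then show ?thesis
    unfolding Let_def s_def[symmetric] using bound odd1 odd2 even4 two by auto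
qed

end
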